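(* Assume $\underline\theta<0$. Let $-\lambda'(0)<a<\bar a_-:=\lim_{\theta\to\theta_*+}(-\lambda'(\theta))$, let $\theta\in(\theta_*,0)$ satisfy $a=-\lambda'(\theta)$, let $b\in\mathbb R$, and let $(j_n)_{n\in\mathbb N}$ be positive integers with $\lim_{n\to\infty}(\log n-aj_n)/(\log n)^{1/2}=b$. For $j\in\mathbb N$ let $Z_j=\#\{u:|u|=j,\ P(u)\ne0\}$ and $L_n^{(j)}=Z_j-K_n^{(j)}$ (the number of empty level-$j$ boxes). Then almost surely, as $n\to\infty$, $L_n^{(j_n)}=\dfrac{\Gamma(-\theta)}{(2\pi\lambda''(\theta))^{1/2}}\,e^{-ab^2/(2\lambda''(\theta))}\,W(\theta)\,\dfrac{n^\theta e^{\lambda(\theta)j_n}}{j_n^{1/2}}(1+o(1)).$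
   Context: Standing setup. Let $(P_k)_{k\in\mathbb N}$ be nonnegative random variables with an arbitrary joint law such that $\sum_{k\ge1}P_k=1$ a.s. and $\mathbb E\,\#\{k:P_k>0\}>1$. Let $\mathbb V=\bigcup_{n\ge0}\mathbb N^n$ be the set of finite words (root $\varnothing$; $|u|$ is the length of $u$; $uk$ is the word $u$ followed by $k$), and let $((P_k(u))_{k\in\mathbb N})_{u\in\mathbb V}$ be independent copies of $(P_k)_{k\in\mathbb N}$. Set $P(\varnothing)=1$ and $P(uk)=P(u)P_k(u)$. For $|u|=j$ let $I_u=[\sum_{|v|=j,\,v\prec u}P(v),\ \sum_{|v|=j,\,v\preceq u}P(v))$, where $\prec$ is the lexicographic order on $\mathbb N^j$. Let $U_1,U_2,\dots$ be i.i.d. uniform on $[0,1]$, independent of the weights (ball $i$ falls into every box $u$ with $U_i\in I_u$). For $j,n,k\in\mathbb N$ let $K_n^{(j)}(k)=\#\{u:|u|=j,\ \#\{i\le n:U_i\in I_u\}\ge k\}$ (number of level-$j$ boxes containing at least $k$ of the first $n$ balls), and $K_n^{(j)}=K_n^{(j)}(1)$. Branching random walk: $V(u)=-\log P(u)$ ($V(u)=\infty$ if $P(u)=0$; sums over $|u|=j$ ignore such $u$). Nonlattice assumption: for all $a>0$, $b\in\mathbb R$, $\mathbb P(V(u)\in a\mathbb Z+b\text{ for all }|u|=1)<1$. Let $\lambda(\theta)=\log\mathbb E\sum_{|u|=1}e^{-\theta V(u)}\in(-\infty,\infty]$ and $\underline\theta=\inf\{\theta:\lambda(\theta)<\infty\}$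 (so $\lambda(1)=0$, $\underline\theta\le 1$, and $\lambda$ is strictly convex and decreasing on its domain). It is assumed that there exists $\theta^*$ with $\theta^*\lambda'(\theta^* )-\lambda(\theta^* )=0$ (then $\theta^*>1$). Define $\theta_*$ as follows: if $\lambda(0)=\infty$, $\theta_*=\underline\theta$; if $\underline\theta<0$, $\theta_*=\inf\{\theta\in(\underline\theta,0):\theta\lambda'(\theta)-\lambda(\theta)<0\}$. For $\theta>\underline\theta$ let $W_j(\theta)=\sum_{|u|=j}e^{-\theta V(u)-\lambda(\theta)j}$ and $W(\theta)=\lim_{j\to\infty}W_j(\theta)$ a.s. (limit of a nonnegative martingale). *)

theory Defs
  imports "HOL-Probability.Probability" "HOL-Library.Landau_Symbols"
begin

text \<open>Words u in N^n are lists of naturals (children labelled 0,1,2,... instead of 1,2,3,...;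
  this is an order isomorphism, so lexicographic order is unaffected).
  The word uk is u @ [k].  X u w k is the weight P_k(u) at the sample point w.\<close>

definition wt :: "(nat list \<Rightarrow> 'a \<Rightarrow> nat \<Rightarrow> real) \<Rightarrow> nat list \<Rightarrow> 'a \<Rightarrow> real" where
  "wt X u w = (\<Prod>i<length u. X (take i u) w (u ! i))"

text \<open>Branching random walk V(u) = - log P(u) (only used where P(u) > 0).\<close>
definition brw :: "(nat list \<Rightarrow> 'a \<Rightarrow> nat \<Rightarrow> real) \<Rightarrow> nat list \<Rightarrow> 'a \<Rightarrow> real" where
  "brw X u w = - ln (wt X u w)"

definition box_lo :: "(nat list \<Rightarrow> 'a \<Rightarrow> nat \<Rightarrow> real) \<Rightarrow> nat list \<Rightarrow> 'a \<Rightarrow> real" where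
  "box_lo X u w = (\<Sum>\<^sub>\<infinity> v \<in> {v. length v = length u \<and> (v, u) \<in> lex less_than}. wt X v w)"

definition box_hi :: "(nat list \<Rightarrow> 'a \<Rightarrow> nat \<Rightarrow> real) \<Rightarrow> nat list \<Rightarrow> 'a \<Rightarrow> real" where
  "box_hi X u w = (\<Sum>\<^sub>\<infinity> v \<in> {v. length v = length u \<and> ((v, u) \<in> lex less_than \<or> v = u)}. wt X v w)"

definition box :: "(nat list \<Rightarrow> 'a \<Rightarrow> nat \<Rightarrow> real) \<Rightarrow> nat list \<Rightarrow> 'a \<Rightarrow> real set" where
  "box X u w = {box_lo X u w ..< box_hi X u w}"

definition Kcount :: "(nat list \<Rightarrow> 'a \<Rightarrow> nat \<Rightarrow> real) \<Rightarrow> (nat \<Rightarrow> 'a \<Rightarrow> real) \<Rightarrow> nat \<Rightarrow> nat \<Rightarrow> nat \<Rightarrow> 'a \<Rightarrow> nat" where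
  "Kcount X U n j k w = card {u. length u = j \<and> k \<le> card {i. i < n \<and> U i w \<in> box X u w}}"

definition Zcount :: "(nat list \<Rightarrow> 'a \<Rightarrow> nat \<Rightarrow> real) \<Rightarrow> nat \<Rightarrow> 'a \<Rightarrow> nat" where
  "Zcount X j w = card {u. length u = j \<and> wt X u w \<noteq> 0}"

definition Lempty :: "(nat list \<Rightarrow> 'a \<Rightarrow> nat \<Rightarrow> real) \<Rightarrow> (nat \<Rightarrow> 'a \<Rightarrow> real) \<Rightarrow> nat \<Rightarrow> nat \<Rightarrow> 'a \<Rightarrow> real" where
  "Lempty X U n j w = real (Zcount X j w) - real (Kcount X U n j 1 w)"

definition mgf :: "'a measure \<Rightarrow> (nat list \<Rightarrow> 'a \<Rightarrow> nat \<Rightarrow> real) \<Rightarrow> real \<Rightarrow> ennreal" where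
  "mgf M X \<theta> = (\<integral>\<^sup>+ w. (\<integral>\<^sup>+ u. ennreal (exp (- \<theta> * brw X u w))
       \<partial>count_space {u. length u = 1 \<and> wt X u w > 0}) \<partial>M)"

definition lam :: "'a measure \<Rightarrow> (nat list \<Rightarrow> 'a \<Rightarrow> nat \<Rightarrow> real) \<Rightarrow> real \<Rightarrow> real" where
  "lam M X \<theta> = ln (enn2real (mgf M X \<theta>))"

definition theta_low :: "'a measure \<Rightarrow> (nat list \<Rightarrow> 'a \<Rightarrow> nat \<Rightarrow> real) \<Rightarrow> ereal" where
  "theta_low M X = Inf {ereal t | t. mgf M X t < \<infinity>}"

definition theta_star :: "'a measure \<Rightarrow> (nat list \<Rightarrow> 'a \<Rightarrow> nat \<Rightarrow> real) \<Rightarrow> ereal" where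
  "theta_star M X = (if mgf M X 0 = \<infinity> then theta_low M X
     else Inf {ereal t | t. theta_low M X < ereal t \<and> t < 0 \<and>
                 t * deriv (lam M X) t - lam M X t < 0})"

definition abar :: "'a measure \<Rightarrow> (nat list \<Rightarrow> 'a \<Rightarrow> nat \<Rightarrow> real) \<Rightarrow> ereal" where
  "abar M X = Lim (if theta_star M X = -\<infinity> then at_bot else at_right (real_of_ereal (theta_star M X)))
                  (\<lambda>t. ereal (- deriv (lam M X) t))"

definition Wj :: "'a measure \<Rightarrow> (nat list \<Rightarrow> 'a \<Rightarrow> nat \<Rightarrow> real) \<Rightarrow> real \<Rightarrow> nat \<Rightarrow> 'a \<Rightarrow> real" where
  "Wj M X \<theta> j w = (\<Sum>\<^sub>\<infinity> u \<in> {u. length u = j \<and> wt X u w > 0}.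
        exp (- \<theta> * brw X u w - lam M X \<theta> * real j))"

definition Wlim :: "'a measure \<Rightarrow> (nat list \<Rightarrow> 'a \<Rightarrow> nat \<Rightarrow> real) \<Rightarrow> real \<Rightarrow> 'a \<Rightarrow> real" where
  "Wlim M X \<theta> w = lim (\<lambda>j. Wj M X \<theta> j w)"

end

theory Submission
  imports Defs "HOL-Probability.Probability" "HOL-Real_Asymp.Real_Asymp"
begin

text \<open>Given the weights, the mean number of empty boxes at level \<open>j\<close> is a sum of \<open>(1 - P(u))^n\<close>, close to the
  sum of \<open>exp (- n P(u))\<close>. Splitting the tree at a generation \<open>k\<close> of order \<open>j powr (1/8)\<close>, a von
  Bahr--Esseen estimate shows that this sum is close to its conditional expectation given the
  first \<open>k\<close> generations. By the many-to-one formula that expectation is an integral with respect to a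
  random walk with nonlattice centred steps, tilted by \<open>\<theta>\<close>; a local limit theorem, proved by Fejer
  smoothing and a Tauberian argument with the kernel \<open>exp (- s y - exp (- y))\<close>, whose integral is
  \<open>\<Gamma>(s)\<close>, gives the Gaussian factor, while the first \<open>k\<close> generations contribute the martingale limit.
  Chebyshev's inequality (the indicators of empty boxes are negatively correlated) and Borel--Cantelli
  give the asymptotics of the number of empty boxes along a geometric grid of values of \<open>n\<close>, uniformly
  in the level \<open>j\<close> in the relevant range; monotonicity in \<open>n\<close> fills the gaps of the grid.\<close>

section \<open>The local limit theorem\<close>

text \<open>The inequality \<open>\<theta> * deriv lamT \<theta> - lamT \<theta> < 0\<close>, which
  is what \<open>theta_star M X < ereal \<theta>\<close> provides, is used twice. Its left-hand side
  is the derivative at r = 1 of \<open>lamT (r * \<theta>) - r * lamT \<theta>\<close>, so some r >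
  1 makes r-th moments of the normalised weights contract by a factor \<open>\<beta> < 1\<close> per
  generation. Its negative is the growth rate \<open>gap\<close> of the typical number of empty
  boxes, which makes Chebyshev's bound summable. The estimates must work with moments of some order
  r in (1, 2], which is why a von Bahr--Esseen inequality replaces a variance computation in the
  tree. The obstacle that shapes the second half is uniformity in n: exponentially many n share a
  level j, while the fluctuation bound decays only like \<beta> to a small power of j. Hence a level
  is tested at no more than j^2 + 1 times. A geometric grid of any fixed mesh meets this, since its
  index is of order ln n, that is, linear in j.\<close>

definition gum :: "real \<Rightarrow> real \<Rightarrow> real" where
  "gum s y = exp (- (s * y) - exp (- y))"

lemma gum_measurable [measurable]: "gum s \<in> borel_measurable borel"
  unfolding gum_def by measurable

lemma gum_pos: "0 < gum s y"
  by (simp add: gum_def)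

text \<open>The substitution t = exp (- y) turns Euler's integral for \<open>Gamma s\<close> into
  this one; the Jacobian exp (- y) raises the exponent from s - 1 to s.\<close>

lemma has_bochner_integral_gum:
  assumes "0 < s"
  shows "has_bochner_integral lborel (gum s) (Gamma s)"
proof -
  define f where "f t = t powr (s - 1) / exp t" for t :: real
  have f: "f absolutely_integrable_on {0<..}" "integral {0<..} f = Gamma s"
  proof -
    have "(f has_integral Gamma s) {0..}"
      unfolding f_def using Gamma_integral_real[OF assms] .
    moreover have "negligible {x \<in> {0..} - {0<..}. f x \<noteq> 0}"
      by (rule negligible_subset[of "{0}"]) auto
    moreover have "negligible {x \<in> {0<..} - {0..}. f x \<noteq> 0}"
      by (rule negligible_subset[of "{}"]) auto
    ultimately have h: "(f has_integral Gamma s) {0<..}"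
      using has_integral_spike_set_eq by blast
    show "f absolutely_integrable_on {0<..}"
      using h by (intro nonnegative_absolutely_integrable_1) (auto simp: f_def has_integral_integrable)
    show "integral {0<..} f = Gamma s" using h by (rule integral_unique)
  qed
  have img: "(\<lambda>y::real. exp (- y)) ` UNIV = {0<..}"
  proof -
    have "x \<in> (\<lambda>y::real. exp (- y)) ` UNIV" if "x > 0" for x :: real
      using that by (intro image_eqI[of _ _ "- ln x"]) auto
    then show ?thesis by auto
  qed
  have "(\<lambda>y. \<bar>- exp (- y)\<bar> * f (exp (- y))) absolutely_integrable_on UNIV \<and>
        integral UNIV (\<lambda>y. \<bar>- exp (- y)\<bar> * f (exp (- y))) = Gamma s"
    by (subst has_absolute_integral_change_of_variables_1')
       (use f img in \<open>auto intro!: derivative_eq_intros injI\<close>)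
  moreover have "(\<lambda>y. \<bar>- exp (- y)\<bar> * f (exp (- y))) = gum s"
  proof
    fix y :: real
    have "exp (- y) * exp (- ((s - 1) * y)) = exp (- (s * y))"
      by (simp add: mult_exp_exp algebra_simps)
    then show "\<bar>- exp (- y)\<bar> * f (exp (- y)) = gum s y"
      by (simp add: f_def gum_def powr_def exp_diff)
  qed
  ultimately have g: "gum s absolutely_integrable_on UNIV" "integral UNIV (gum s) = Gamma s" by auto
  have i: "integrable lborel (gum s)"
    using g(1) by (simp add: set_integrable_def integrable_completion)
  have "integral\<^sup>L lborel (gum s) = Gamma s"
    using g(2) integral_lborel[OF i] by simp
  with i show ?thesis by (simp add: has_bochner_integral_iff)
qed

lemma gum_bounded:
  assumes "0 < s"
  obtains C where "0 < C" "\<And>y. gum s y \<le> C"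
proof -
  have l1: "(gum s \<longlongrightarrow> 0) at_top" unfolding gum_def using assms by real_asymp
  have l2: "(gum s \<longlongrightarrow> 0) at_bot" unfolding gum_def using assms by real_asymp
  obtain a where a: "\<And>y. y \<ge> a \<Longrightarrow> gum s y < 1"
    using order_tendstoD(2)[OF l1, of 1] by (auto simp: eventually_at_top_linorder)
  obtain b where b: "\<And>y. y \<le> b \<Longrightarrow> gum s y < 1"
    using order_tendstoD(2)[OF l2, of 1] by (auto simp: eventually_at_bot_linorder)
  have "bounded (gum s ` {b..a})"
    by (intro compact_imp_bounded compact_continuous_image) (auto simp: gum_def intro!: continuous_intros)
  then obtain B where B: "\<And>y. y \<in> {b..a} \<Longrightarrow> \<bar>gum s y\<bar> \<le> B"
    unfolding bounded_iff by (metis imageI real_norm_def)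
  show thesis
  proof (rule that[of "max 1 B"])
    show "gum s y \<le> max 1 B" for y
      using a[of y] b[of y] B[of y] by (cases "y \<ge> a"; cases "y \<le> b") (auto simp: max_def)
  qed auto
qed

section \<open>The Fejer kernel and Fourier transforms\<close>

definition fejer :: "real \<Rightarrow> real \<Rightarrow> real" where
  "fejer T z = (1 - cos (T * z)) / (pi * T * z\<^sup>2)"

definition tent :: "real \<Rightarrow> real \<Rightarrow> real" where
  "tent T t = indicator {-T..T} t * (1 - \<bar>t\<bar> / T)"

lemma fejer_measurable [measurable]: "fejer T \<in> borel_measurable borel"
  unfolding fejer_def by measurable

lemma tent_measurable [measurable]: "tent T \<in> borel_measurable borel"
  unfolding tent_def by measurable

lemma fejer_nonneg: "0 < T \<Longrightarrow> 0 \<le> fejer T z"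
  by (simp add: fejer_def)

lemma tent_bounds: "0 < T \<Longrightarrow> 0 \<le> tent T t \<and> tent T t \<le> indicator {-T..T} t"
  by (auto simp: tent_def indicator_def field_simps)

text \<open>Integration by parts reduces (1 - cos z) / z^2 to the sine integral, whose limit pi / 2
  at infinity fixes the normalisation. The negative half-line follows by reflection.\<close>

lemma has_bochner_integral_fejer1: "has_bochner_integral lborel (fejer 1) 1"
proof -
  define F where "F z = (Si z - (1 - cos z) / z) / pi" for z :: real
  have D: "DERIV F x :> fejer 1 x" if "0 < x" for x
  proof -
    have "DERIV F x :> (sinc x - (sin x * x - (1 - cos x)) / (x * x)) / pi"
      unfolding F_def using that by (auto intro!: derivative_eq_intros DERIV_Si)
    also have "(sinc x - (sin x * x - (1 - cos x)) / (x * x)) / pi = fejer 1 x"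
      using that by (simp add: fejer_def field_simps power2_eq_square)
    finally show ?thesis .
  qed
  have C: "isCont (fejer 1) x" if "0 < x" for x
    unfolding fejer_def using that by (intro continuous_intros) auto
  have A: "(F \<longlongrightarrow> 0) (at_right 0)"
  proof -
    have "(Si \<longlongrightarrow> Si 0) (at_right 0)"
      using isCont_Si[of 0] by (simp add: isCont_def filterlim_at_split)
    moreover have "((\<lambda>z::real. (1 - cos z) / z) \<longlongrightarrow> 0) (at_right 0)" by real_asymp
    ultimately have "(F \<longlongrightarrow> (Si 0 - 0) / pi) (at_right 0)"
      unfolding F_def by (intro tendsto_intros) auto
    moreover have "Si 0 = 0" using Si_neg[of 0] by simp
    ultimately show ?thesis by simp
  qed
  have B: "(F \<longlongrightarrow> 1/2) at_top"
  proof -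
    have "((\<lambda>z::real. (1 - cos z) / z) \<longlongrightarrow> 0) at_top"
    proof (rule tendsto_sandwich[of "\<lambda>_. 0" _ _ "\<lambda>z. 2 / z"])
      show "\<forall>\<^sub>F z::real in at_top. 0 \<le> (1 - cos z) / z"
        using eventually_gt_at_top[of 0] by eventually_elim auto
      show "\<forall>\<^sub>F z::real in at_top. (1 - cos z) / z \<le> 2 / z"
        using eventually_gt_at_top[of 0]
      proof eventually_elim
        case (elim z) show ?case using elim cos_ge_minus_one[of z] by (intro divide_right_mono) linarith+
      qed
      show "((\<lambda>z::real. 2 / z) \<longlongrightarrow> 0) at_top" by real_asymp
    qed simp
    then have "(F \<longlongrightarrow> (pi/2 - 0) / pi) at_top"
      unfolding F_def by (intro tendsto_intros Si_at_top) auto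
    then show ?thesis by simp
  qed
  have A': "((F \<circ> real_of_ereal) \<longlongrightarrow> 0) (at_right 0)"
    using A by (simp add: zero_ereal_def ereal_tendsto_simps)
  have B': "((F \<circ> real_of_ereal) \<longlongrightarrow> 1/2) (at_left \<infinity>)"
    using B by (simp add: ereal_tendsto_simps)
  have N: "AE x in lborel. (0::ereal) < ereal x \<longrightarrow> ereal x < \<infinity> \<longrightarrow> 0 \<le> fejer 1 x"
    by (auto simp: fejer_nonneg)
  have ab: "(0::ereal) < \<infinity>" by simp
  note FTC = interval_integral_FTC_nonneg[OF ab, of F "fejer 1", OF _ _ N A' B']
  have I: "set_integrable lborel (einterval 0 \<infinity>) (fejer 1)" "(LBINT x=0..\<infinity>. fejer 1 x) = 1/2"
    using FTC D C by auto
  have e: "einterval 0 \<infinity> = {0::real<..}" by (auto simp: einterval_def)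
  have h1: "has_bochner_integral lborel (\<lambda>x. indicator {0<..} x *\<^sub>R fejer 1 x) (1/2)"
    using I by (simp add: has_bochner_integral_iff set_integrable_def interval_lebesgue_integral_def
        set_lebesgue_integral_def e)
  have h2: "has_bochner_integral lborel (\<lambda>x. indicator {0<..} (0 + (-1) * x) *\<^sub>R fejer 1 (0 + (-1)*x)) (1/2)"
    using lborel_has_bochner_integral_real_affine_iff[of "-1" "\<lambda>x. indicator {0<..} x *\<^sub>R fejer 1 x" "1/2" 0] h1
    by simp
  have h3: "has_bochner_integral lborel (\<lambda>x. indicator {0<..} x *\<^sub>R fejer 1 x
     + indicator {0<..} (0 + (-1) * x) *\<^sub>R fejer 1 (0 + (-1)*x)) 1"
    using has_bochner_integral_add[OF h1 h2] by simp
  \<comment> \<open>At 0 both indicators vanish and \<open>fejer 1 0 = 0\<close> by the convention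
    for division by zero, so this is an identity of functions.\<close>
  have "(\<lambda>x. indicator {0<..} x *\<^sub>R fejer 1 x
     + indicator {0<..} (0 + (-1) * x) *\<^sub>R fejer 1 (0 + (-1)*x)) = fejer 1"
    by (auto simp: fun_eq_iff indicator_def fejer_def)
  with h3 show ?thesis by simp
qed

lemma fejer_scale: "0 < T \<Longrightarrow> fejer T z = T * fejer 1 (T * z)"
  by (simp add: fejer_def power2_eq_square)

lemma has_bochner_integral_fejer:
  assumes "0 < T" shows "has_bochner_integral lborel (fejer T) 1"
proof -
  have "has_bochner_integral lborel (\<lambda>z. fejer 1 (0 + T * z)) (1 /\<^sub>R \<bar>T\<bar>)"
    using lborel_has_bochner_integral_real_affine_iff[of T "fejer 1" 1 0] has_bochner_integral_fejer1 assms by simp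
  then have "has_bochner_integral lborel (\<lambda>z. T * fejer 1 (0 + T * z)) (T * (1 /\<^sub>R \<bar>T\<bar>))"
    by (rule has_bochner_integral_mult_right)
  then show ?thesis using assms by (simp add: fejer_scale[OF assms, abs_def])
qed

text \<open>By \<open>fejer_scale\<close> the mass of \<open>fejer T\<close> outside [-d, d] is the
  mass of \<open>fejer 1\<close> outside [-d T, d T], the tail of a convergent integral.\<close>

lemma fejer_tail:
  assumes "0 < d" "0 < e"
  obtains T where "0 < T" "(LBINT z. indicator {z. \<bar>z\<bar> > d} z * fejer T z) \<le> e"
proof -
  have "(\<lambda>n. LBINT z. indicator {z. \<bar>z\<bar> > d * real (Suc n)} z * fejer 1 z) \<longlonglongrightarrow> (LBINT (z::real). (0 :: real))"
  proof (rule integral_dominated_convergence[where w = "fejer 1"])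
    show "integrable lborel (fejer 1)" using has_bochner_integral_fejer1 by (simp add: has_bochner_integral_iff)
    show "AE z in lborel. (\<lambda>n. indicator {z. \<bar>z\<bar> > d * real (Suc n)} z * fejer 1 z) \<longlonglongrightarrow> 0"
    proof (rule AE_I2)
      fix z :: real
      have "\<forall>\<^sub>F n in sequentially. d * real (Suc n) > \<bar>z\<bar>" using assms by real_asymp
      then have "\<forall>\<^sub>F n in sequentially. indicator {z. \<bar>z\<bar> > d * real (Suc n)} z * fejer 1 z = 0"
        by eventually_elim auto
      then show "(\<lambda>n. indicator {z. \<bar>z\<bar> > d * real (Suc n)} z * fejer 1 z) \<longlonglongrightarrow> 0"
        by (rule tendsto_eventually)
    qed
  qed (auto simp: indicator_def fejer_nonneg)
  then have "\<forall>\<^sub>F n in sequentially. (LBINT z. indicator {z. \<bar>z\<bar> > d * real (Suc n)} z * fejer 1 z) < e"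
    using assms by (intro order_tendstoD(2)) auto
  then obtain n where n: "(LBINT z. indicator {z. \<bar>z\<bar> > d * real (Suc n)} z * fejer 1 z) < e"
    by (auto simp: eventually_sequentially)
  define T where "T = real (Suc n)"
  have T: "0 < T" by (simp add: T_def)
  have "(LBINT z. indicator {z. \<bar>z\<bar> > d * T} z * fejer 1 z)
      = \<bar>T\<bar> *\<^sub>R (LBINT z. indicator {z. \<bar>z\<bar> > d * T} (0 + T * z) * fejer 1 (0 + T * z))"
    using T by (intro lborel_integral_real_affine) auto
  also have "\<dots> = (LBINT z. \<bar>T\<bar> *\<^sub>R (indicator {z. \<bar>z\<bar> > d * T} (0 + T * z) * fejer 1 (0 + T * z)))"
    by simp
  also have "\<dots> = (LBINT z. indicator {z. \<bar>z\<bar> > d} z * fejer T z)"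
    using T by (intro Bochner_Integration.integral_cong) (auto simp: fejer_scale[OF T] indicator_def abs_mult field_simps)
  finally show thesis using n T by (intro that[of T]) (auto simp: T_def)
qed

text \<open>The point z = 0 must be excluded: there the integral of the tent is T, while
  \<open>fejer T 0\<close> is 0 by the convention for division by zero. Elsewhere the
  antiderivatives F and G on the two linear pieces give the value.\<close>

lemma tent_fourier:
  assumes "0 < T" "z \<noteq> 0"
  shows "(CLBINT t. of_real (tent T t) * iexp (t * z)) = of_real (2 * pi * fejer T z)"
proof -
  define F where "F t = of_real (1 - t / T) * iexp (t * z) / (\<i> * z) + of_real (1/T) * iexp (t * z) / (\<i> * z)\<^sup>2" for t
  define G where "G t = of_real (1 + t / T) * iexp (t * z) / (\<i> * z) - of_real (1/T) * iexp (t * z) / (\<i> * z)\<^sup>2" for t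
  let ?f = "\<lambda>t. of_real (1 - \<bar>t\<bar> / T) * iexp (t * z)"
  have DF: "(F has_vector_derivative of_real (1 - t / T) * iexp (t * z)) (at t within S)" for t S
  proof -
    have "((\<lambda>t. (1 - t / of_real T) * exp (\<i> * (t * of_real z)) / (\<i> * z) + of_real (1/T) * exp (\<i> * (t * of_real z)) / (\<i> * z)\<^sup>2)
        has_field_derivative (1 - of_real t / of_real T) * exp (\<i> * (of_real t * of_real z))) (at (of_real t))"
      using assms by (auto intro!: derivative_eq_intros simp: field_simps power2_eq_square)
    from has_vector_derivative_real_field[OF this, of S] show ?thesis unfolding F_def[abs_def] by simp
  qed
  have DG: "(G has_vector_derivative of_real (1 + t / T) * iexp (t * z)) (at t within S)" for t S
  proof -
    have "((\<lambda>t. (1 + t / of_real T) * exp (\<i> * (t * of_real z)) / (\<i> * z) - of_real (1/T) * exp (\<i> * (t * of_real z)) / (\<i> * z)\<^sup>2)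
        has_field_derivative (1 + of_real t / of_real T) * exp (\<i> * (of_real t * of_real z))) (at (of_real t))"
      using assms by (auto intro!: derivative_eq_intros simp: field_simps power2_eq_square)
    from has_vector_derivative_real_field[OF this, of S] show ?thesis unfolding G_def[abs_def] by simp
  qed
  have i1: "(?f has_integral F T - F 0) {0..T}"
  proof (rule has_integral_eq)
    show "((\<lambda>t. of_real (1 - t / T) * iexp (t * z)) has_integral F T - F 0) {0..T}"
      using assms DF by (intro fundamental_theorem_of_calculus) auto
  qed auto
  have i2: "(?f has_integral G 0 - G (-T)) {-T..0}"
  proof (rule has_integral_eq)
    show "((\<lambda>t. of_real (1 + t / T) * iexp (t * z)) has_integral G 0 - G (-T)) {-T..0}"
      using assms DG by (intro fundamental_theorem_of_calculus) auto
  qed auto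
  have i: "(?f has_integral (G 0 - G (-T)) + (F T - F 0)) {-T..T}"
    using assms by (intro has_integral_combine[OF _ _ i2 i1]) auto
  have s: "(G 0 - G (-T)) + (F T - F 0) = of_real (2 * pi * fejer T z)"
  proof -
    have e: "iexp (T * z) + iexp (- T * z) = of_real (2 * cos (T * z))"
      by (simp add: complex_eq_iff Re_exp Im_exp)
    have p: "(\<i> * complex_of_real z)\<^sup>2 = - of_real (z\<^sup>2)" by (simp add: power_mult_distrib)
    have "(G 0 - G (-T)) + (F T - F 0) = of_real (1/T) * (iexp (T * z) + iexp (- T * z) - 2) / (\<i> * z)\<^sup>2"
      unfolding F_def G_def using assms(1) by (simp add: diff_divide_distrib add_divide_distrib right_diff_distrib distrib_left)
    also have "\<dots> = of_real (1/T * (2 * cos (T * z) - 2) / (- (z\<^sup>2)))"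
      unfolding e p by simp
    also have "1/T * (2 * cos (T * z) - 2) / (- (z\<^sup>2)) = 2 * pi * fejer T z"
      using assms by (simp add: fejer_def divide_simps) 
    finally show ?thesis .
  qed
  have int: "set_integrable lborel {-T..T} ?f"
    using assms by (intro borel_integrable_atLeastAtMost') (auto intro!: continuous_intros)
  have "(CLBINT t. of_real (tent T t) * iexp (t * z)) = (CLBINT t:{-T..T}. ?f t)"
    unfolding set_lebesgue_integral_def
    by (intro Bochner_Integration.integral_cong) (auto simp: tent_def indicator_def)
  also have "\<dots> = integral {-T..T} ?f"
    by (rule set_borel_integral_eq_integral[OF int])
  also have "\<dots> = of_real (2 * pi * fejer T z)"
    using i s by (simp add: integral_unique)
  finally show ?thesis .
qed

text \<open>A product of two integrable functions as majorant makes f integrable on the product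
  space. The exchanges of integrals in \<open>fejer_gum\<close> and \<open>H_fourier\<close> all
  have such a majorant.\<close>

lemma (in pair_sigma_finite) Fubini_dominated:
  fixes f :: "'a \<Rightarrow> 'b \<Rightarrow> 'c::{banach, second_countable_topology}"
  assumes [measurable]: "case_prod f \<in> borel_measurable (M1 \<Otimes>\<^sub>M M2)"
    and u: "integrable M1 u" and v: "integrable M2 v"
    and le: "\<And>x y. x \<in> space M1 \<Longrightarrow> y \<in> space M2 \<Longrightarrow> norm (f x y) \<le> u x * v y"
  shows "(LINT y|M2. LINT x|M1. f x y) = (LINT x|M1. LINT y|M2. f x y)"
proof (rule Fubini_integral, rule Fubini_integrable)
  have [measurable]: "u \<in> borel_measurable M1" "v \<in> borel_measurable M2" using u v by auto
  have int: "integrable M2 (\<lambda>y. f x y)" if "x \<in> space M1" for x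
    using that le by (intro Bochner_Integration.integrable_bound[OF integrable_mult_right[OF v, of "u x"]])
      (auto intro!: AE_I2 order_trans[OF le])
  show "AE x in M1. integrable M2 (\<lambda>y. case (x, y) of (x, y) \<Rightarrow> f x y)"
    using int by (auto intro!: AE_I2)
  show "integrable M1 (\<lambda>x. LINT y|M2. norm (case (x, y) of (x, y) \<Rightarrow> f x y))"
  proof (rule Bochner_Integration.integrable_bound[OF integrable_mult_left[OF u, of "LINT y|M2. v y"]])
    show "AE x in M1. norm (LINT y|M2. norm (case (x, y) of (x, y) \<Rightarrow> f x y)) \<le> norm (u x * (LINT y|M2. v y))"
    proof (rule AE_I2)
      fix x assume x: "x \<in> space M1"
      have "(LINT y|M2. norm (f x y)) \<le> (LINT y|M2. u x * v y)"
        using x int[OF x] v le by (intro integral_mono) auto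
      moreover have "0 \<le> (LINT y|M2. norm (f x y))" by simp
      ultimately show "norm (LINT y|M2. norm (case (x, y) of (x, y) \<Rightarrow> f x y)) \<le> norm (u x * (LINT y|M2. v y))"
        by simp
    qed
  qed measurable
qed measurable

lemma integrable_exp_square:
  assumes "0 < c" shows "integrable lborel (\<lambda>x::real. exp (- (c * x\<^sup>2)))"
proof -
  have "integrable lborel (\<lambda>x. sqrt (2 * pi * (1 / sqrt (2*c))\<^sup>2) * normal_density 0 (1 / sqrt (2*c)) x)"
    using assms by (intro integrable_mult_right integrable_normal_density) auto
  also have "(\<lambda>x. sqrt (2 * pi * (1 / sqrt (2*c))\<^sup>2) * normal_density 0 (1 / sqrt (2*c)) x) = (\<lambda>x. exp (- (c * x\<^sup>2)))"
    using assms by (auto simp: normal_density_def fun_eq_iff power_divide)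
  finally show ?thesis .
qed

text \<open>This is the characteristic function of the standard normal law after rescaling by
  \<sigma>.\<close>

lemma gauss_fourier:
  assumes "0 < \<sigma>"
  shows "(CLBINT x. of_real (exp (- (\<sigma>\<^sup>2 * x\<^sup>2 / 2))) * iexp (x * y))
    = of_real (sqrt (2 * pi) / \<sigma> * exp (- (y\<^sup>2 / (2 * \<sigma>\<^sup>2))))"
proof -
  have "of_real (exp (- ((y / \<sigma>)\<^sup>2 / 2))) = char std_normal_distribution (y / \<sigma>)"
    by (simp add: char_std_normal_distribution)
  also have "\<dots> = (CLBINT x. std_normal_density x *\<^sub>R iexp (y / \<sigma> * x))"
    unfolding char_def by (subst integral_density) (auto simp: normal_density_nonneg)
  also have "\<dots> = \<bar>\<sigma>\<bar> *\<^sub>R (CLBINT x. std_normal_density (0 + \<sigma> * x) *\<^sub>R iexp (y / \<sigma> * (0 + \<sigma> * x)))"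
    using assms by (intro lborel_integral_real_affine) auto
  also have "\<dots> = (CLBINT x. of_real (\<sigma> / sqrt (2 * pi)) * (of_real (exp (- (\<sigma>\<^sup>2 * x\<^sup>2 / 2))) * iexp (x * y)))"
    unfolding integral_scaleR_right[symmetric] using assms
    by (intro Bochner_Integration.integral_cong)
       (auto simp: std_normal_density_def scaleR_conv_of_real field_simps power_mult_distrib)
  also have "\<dots> = of_real (\<sigma> / sqrt (2 * pi)) * (CLBINT x. of_real (exp (- (\<sigma>\<^sup>2 * x\<^sup>2 / 2))) * iexp (x * y))"
    by (rule integral_mult_right_zero)
  finally have "of_real (sqrt (2*pi) / \<sigma>) * complex_of_real (exp (- ((y / \<sigma>)\<^sup>2 / 2))) =
     (of_real (sqrt (2*pi) / \<sigma>) * of_real (\<sigma> / sqrt (2 * pi))) * (CLBINT x. of_real (exp (- (\<sigma>\<^sup>2 * x\<^sup>2 / 2))) * iexp (x * y))"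
    by (simp add: mult.assoc)
  also have "of_real (sqrt (2*pi) / \<sigma>) * of_real (\<sigma> / sqrt (2 * pi)) = (1::complex)"
    using assms by (simp flip: of_real_mult)
  finally show ?thesis by (simp add: power_divide mult.commute)
qed

definition gum_hat :: "real \<Rightarrow> real \<Rightarrow> complex" where
  "gum_hat s t = (CLBINT y. of_real (gum s y) * iexp (- (t * y)))"

lemma gum_hat_measurable [measurable]: "gum_hat s \<in> borel_measurable borel"
  unfolding gum_hat_def by measurable

lemma integrable_gum: "0 < s \<Longrightarrow> integrable lborel (gum s)"
  and integral_gum: "0 < s \<Longrightarrow> integral\<^sup>L lborel (gum s) = Gamma s"
  using has_bochner_integral_gum by (auto simp: has_bochner_integral_iff)

lemma gum_hat_bound: 
  assumes "0 < s" shows "cmod (gum_hat s t) \<le> Gamma s"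
proof -
  have "cmod (gum_hat s t) \<le> (LBINT y. cmod (of_real (gum s y) * iexp (- (t * y))))"
    unfolding gum_hat_def by (rule integral_norm_bound)
  also have "\<dots> = (LBINT y. gum s y)"
    by (intro Bochner_Integration.integral_cong) (auto simp: norm_mult gum_pos less_imp_le)
  finally show ?thesis using integral_gum[OF assms] by simp
qed

lemma gum_hat_tendsto:
  assumes "0 < s" "t \<longlonglongrightarrow> 0" shows "(\<lambda>n. gum_hat s (t n)) \<longlonglongrightarrow> of_real (Gamma s)"
proof -
  have "(\<lambda>n. gum_hat s (t n)) \<longlonglongrightarrow> (CLBINT y. complex_of_real (gum s y))"
    unfolding gum_hat_def
  proof (rule integral_dominated_convergence[where w = "gum s"])
    show "AE y in lborel. (\<lambda>n. of_real (gum s y) * iexp (- (t n * y))) \<longlonglongrightarrow> complex_of_real (gum s y)"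
    proof (rule AE_I2)
      fix y
      have "(\<lambda>n. of_real (gum s y) * iexp (- (t n * y))) \<longlonglongrightarrow> of_real (gum s y) * iexp (- (0 * y))"
        by (intro tendsto_intros assms)
      then show "(\<lambda>n. of_real (gum s y) * iexp (- (t n * y))) \<longlonglongrightarrow> complex_of_real (gum s y)" by simp
    qed
  qed (use integrable_gum[OF assms(1)] in \<open>auto simp: norm_mult gum_pos less_imp_le\<close>)
  also have "(CLBINT y. complex_of_real (gum s y)) = of_real (Gamma s)"
    using integral_gum[OF assms(1)] by simp
  finally show ?thesis .
qed

text \<open>The measure \<open>\<nu>m m\<close> stands for the law of a sum of m independent steps,
  but it enters only as a probability measure with the right characteristic function, which is what
  the Fourier argument works with. The third moment yields an expansion of the characteristic
  function at 0 with cubic error; \<open>nonlattice\<close> has the form of a strict bound away from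
  0.\<close>

locale llt = real_distribution \<nu> for \<nu> :: "real measure" +
  fixes \<nu>m :: "nat \<Rightarrow> real measure" and s a \<sigma> :: real
  assumes s_pos: "0 < s" and \<sigma>_pos: "0 < \<sigma>"
    and distm: "\<And>m. real_distribution (\<nu>m m)"
    and charm: "\<And>m t. char (\<nu>m m) t = char \<nu> t ^ m"
    and int3: "integrable \<nu> (\<lambda>x. \<bar>x - a\<bar> ^ 3)"
    and int2: "integrable \<nu> (\<lambda>x. (x - a)\<^sup>2)"
    and int1: "integrable \<nu> (\<lambda>x. x)"
    and mean: "expectation (\<lambda>x. x) = a"
    and var: "expectation (\<lambda>x. (x - a)\<^sup>2) = \<sigma>\<^sup>2"
    and nonlattice: "\<And>t. t \<noteq> 0 \<Longrightarrow> cmod (char \<nu> t) < 1"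
begin

definition psi :: "real \<Rightarrow> complex" where "psi t = char \<nu> t * iexp (- (a * t))"

lemma psi_measurable [measurable]: "psi \<in> borel_measurable borel"
  unfolding psi_def by measurable

lemma isCont_psi: "isCont psi t"
  unfolding psi_def by (intro continuous_intros isCont_char)

lemma cmod_psi: "cmod (psi t) = cmod (char \<nu> t)"
  by (simp add: psi_def norm_mult)

lemma cmod_psi_le_1: "cmod (psi t) \<le> 1"
  by (simp add: cmod_psi cmod_char_le_1)

lemma psi_eq_char: "psi t = char (distr \<nu> borel (\<lambda>x. x - a)) t"
proof -
  have "char (distr \<nu> borel (\<lambda>x. x - a)) t = (CLINT x|\<nu>. iexp (t * (x - a)))"
    unfolding char_def by (subst integral_distr) auto
  also have "\<dots> = (CLINT x|\<nu>. iexp (t * x) * iexp (- (a * t)))"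
    by (intro Bochner_Integration.integral_cong) (auto simp: algebra_simps simp flip: exp_add)
  also have "\<dots> = psi t" by (simp add: psi_def char_def)
  finally show ?thesis ..
qed

definition qd :: "real \<Rightarrow> real" where "qd t = 1 - t\<^sup>2 * \<sigma>\<^sup>2 / 2"

lemma psi_approx:
  obtains C where "0 \<le> C" "\<And>t. cmod (psi t - complex_of_real (qd t)) \<le> C * \<bar>t\<bar> ^ 3"
proof
  let ?C = "expectation (\<lambda>x. \<bar>x - a\<bar> ^ 3) / 6"
  show "0 \<le> ?C" by simp
  fix t
  have v: "variance (\<lambda>x. x - a) = \<sigma>\<^sup>2" "expectation (\<lambda>x. x - a) = 0" "integrable \<nu> (\<lambda>x. x - a)"
    using int1 mean var prob_space by auto
  let ?E = "expectation (\<lambda>x. \<bar>x - a\<bar> ^ 3)"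
  have "cmod (psi t - (1 - t\<^sup>2 * \<sigma>\<^sup>2 / 2)) \<le> (t\<^sup>2 / 6) * expectation (\<lambda>x. min (6 * (x - a)\<^sup>2) (\<bar>t\<bar> * \<bar>x - a\<bar> ^ 3))"
    unfolding psi_eq_char by (rule char_approx3') (use v int2 in auto)
  also have "expectation (\<lambda>x. min (6 * (x - a)\<^sup>2) (\<bar>t\<bar> * \<bar>x - a\<bar> ^ 3)) \<le> expectation (\<lambda>x. \<bar>t\<bar> * \<bar>x - a\<bar> ^ 3)"
    using int2 int3 by (intro integral_mono) (auto intro!: integrable_min)
  also have "expectation (\<lambda>x. \<bar>t\<bar> * \<bar>x - a\<bar> ^ 3) = \<bar>t\<bar> * ?E" by simp
  also have "t\<^sup>2 / 6 * (\<bar>t\<bar> * ?E) = ?C * \<bar>t\<bar> ^ 3"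
    unfolding power3_eq_cube[of "\<bar>t\<bar>"] power2_eq_square by (simp only: abs_mult_self_eq[symmetric, of t]) (simp add: mult_ac)
  finally show "cmod (psi t - complex_of_real (qd t)) \<le> ?C * \<bar>t\<bar> ^ 3"
    by (simp add: mult_left_mono qd_def)
qed

lemma psi_gauss_bound:
  obtains e where "0 < e" "\<And>t. \<bar>t\<bar> \<le> e \<Longrightarrow> cmod (psi t) \<le> exp (- (\<sigma>\<^sup>2 * t\<^sup>2 / 4))"
proof -
  obtain C where C: "0 \<le> C" "\<And>t. cmod (psi t - complex_of_real (qd t)) \<le> C * \<bar>t\<bar> ^ 3"
    by (rule psi_approx) blast
  \<comment> \<open>The first bound keeps the quadratic approximation \<open>qd t\<close>
    nonnegative, so that its modulus is itself; the second makes the cubic error at most half of the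
    quadratic term.\<close>
  define e where "e = min (1 / \<sigma>) (\<sigma>\<^sup>2 / (4 * (C + 1)))"
  show thesis
  proof
    show "0 < e" using \<sigma>_pos C by (auto simp: e_def)
    fix t :: real assume t: "\<bar>t\<bar> \<le> e"
    have "\<bar>t\<bar> * \<sigma> \<le> 1" using t \<sigma>_pos by (auto simp: e_def field_simps)
    then have "(\<bar>t\<bar> * \<sigma>)\<^sup>2 \<le> 1" using \<sigma>_pos by (simp add: power_le_one_iff)
    then have t1: "t\<^sup>2 * \<sigma>\<^sup>2 \<le> 1" by (simp add: power_mult_distrib)
    have "(C + 1) * \<bar>t\<bar> \<le> \<sigma>\<^sup>2 / 4" using t C by (auto simp: e_def field_simps)
    then have "C * \<bar>t\<bar> \<le> \<sigma>\<^sup>2 / 4" using abs_ge_zero[of t] by (simp add: algebra_simps)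
    then have "C * \<bar>t\<bar> * t\<^sup>2 \<le> \<sigma>\<^sup>2 / 4 * t\<^sup>2" by (rule mult_right_mono) simp
    then have t2: "C * \<bar>t\<bar> ^ 3 \<le> \<sigma>\<^sup>2 * t\<^sup>2 / 4"
      by (simp add: power3_eq_cube power2_eq_square mult.assoc)
    have "cmod (psi t) \<le> cmod (of_real (qd t)) + cmod (psi t - of_real (qd t))"
      by (rule norm_triangle_sub)
    also have "cmod (of_real (qd t)) = 1 - t\<^sup>2 * \<sigma>\<^sup>2 / 2" unfolding norm_of_real using t1 by (simp add: qd_def)
    finally have "cmod (psi t) \<le> 1 + (- (\<sigma>\<^sup>2 * t\<^sup>2 / 4))" using C(2)[of t] t2 by (simp add: field_simps)
    also have "\<dots> \<le> exp (- (\<sigma>\<^sup>2 * t\<^sup>2 / 4))" by (rule exp_ge_add_one_self)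
    finally show "cmod (psi t) \<le> exp (- (\<sigma>\<^sup>2 * t\<^sup>2 / 4))" .
  qed
qed

text \<open>Once both bases lie in the unit disc, their m-th powers differ by at most m times the
  difference of the bases. At t = x / sqrt m the cubic error contributes a term of order 1 / sqrt
  m.\<close>

lemma psi_pow_tendsto:
  "(\<lambda>m. psi (x / sqrt (real m)) ^ m) \<longlonglongrightarrow> of_real (exp (- (\<sigma>\<^sup>2 * x\<^sup>2 / 2)))"
proof -
  obtain C where C: "0 \<le> C" "\<And>t. cmod (psi t - complex_of_real (qd t)) \<le> C * \<bar>t\<bar> ^ 3"
    by (rule psi_approx) blast
  let ?w = "\<lambda>m. complex_of_real (1 + (- (\<sigma>\<^sup>2 * x\<^sup>2 / 2)) / real m)"
  have "(\<lambda>m. of_real ((1 + (- (\<sigma>\<^sup>2 * x\<^sup>2 / 2)) / real m) ^ m)) \<longlonglongrightarrow> complex_of_real (exp (- (\<sigma>\<^sup>2 * x\<^sup>2 / 2)))"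
    by (intro tendsto_of_real tendsto_exp_limit_sequentially)
  then have l: "(\<lambda>m. ?w m ^ m) \<longlonglongrightarrow> complex_of_real (exp (- (\<sigma>\<^sup>2 * x\<^sup>2 / 2)))" by simp
  have ev: "\<forall>\<^sub>F m in sequentially. real m \<ge> \<sigma>\<^sup>2 * x\<^sup>2 \<and> m > 0"
    by (intro eventually_conj eventually_gt_at_top) 
       (use filterlim_real_sequentially in \<open>auto simp: filterlim_at_top\<close>)
  have bd: "\<forall>\<^sub>F m in sequentially. cmod (psi (x / sqrt (real m)) ^ m - ?w m ^ m) \<le> C * \<bar>x\<bar> ^ 3 / sqrt (real m)"
    using ev
  proof eventually_elim
    case (elim m)
    let ?t = "x / sqrt (real m)"
    have m: "real m > 0" using elim by simp
    have t2: "?t\<^sup>2 = x\<^sup>2 / real m" using m by (simp add: power_divide)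
    have w: "?w m = of_real (qd ?t)" unfolding qd_def t2 by (simp add: mult.commute)
    have q: "0 \<le> \<sigma>\<^sup>2 * x\<^sup>2 / real m" "\<sigma>\<^sup>2 * x\<^sup>2 / real m \<le> 1" using elim m by (auto simp: field_simps)
    have w1: "cmod (?w m) \<le> 1" unfolding norm_of_real using q by (auto simp: abs_le_iff)
    have "cmod (psi ?t ^ m - ?w m ^ m) \<le> m * cmod (psi ?t - ?w m)"
      by (rule norm_power_diff[OF cmod_psi_le_1 w1])
    also have "\<dots> \<le> m * (C * \<bar>?t\<bar> ^ 3)" using C(2)[of ?t] unfolding w by (rule mult_left_mono) simp
    also have "\<dots> = C * \<bar>x\<bar> ^ 3 / sqrt (real m)"
      using m by (simp add: power_divide power3_eq_cube)
    finally show ?case .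
  qed
  have "(\<lambda>m. C * \<bar>x\<bar> ^ 3 / sqrt (real m)) \<longlonglongrightarrow> 0" by real_asymp
  then have "(\<lambda>m. psi (x / sqrt (real m)) ^ m - ?w m ^ m) \<longlonglongrightarrow> 0"
    by (rule Lim_null_comparison[OF bd])
  from tendsto_add[OF this l] show ?thesis by simp
qed

text \<open>This is what the Fejer kernel buys: only frequencies up to T occur, so compactness turns
  the pointwise bound \<open>nonlattice\<close> into a uniform one, although the modulus may come
  back close to 1 at infinity.\<close>

lemma psi_away:
  assumes "0 < e"
  obtains q where "0 \<le> q" "q < 1" "\<And>t. e \<le> \<bar>t\<bar> \<Longrightarrow> \<bar>t\<bar> \<le> T \<Longrightarrow> cmod (psi t) \<le> q"
proof (cases "e \<le> T")
  case True
  let ?S = "{t. e \<le> \<bar>t\<bar> \<and> \<bar>t\<bar> \<le> T}"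
  have S: "?S = {-T..-e} \<union> {e..T}" using assms True by auto
  have "compact ?S" unfolding S by (intro compact_Un compact_Icc)
  moreover have "?S \<noteq> {}" using True assms by (auto intro!: exI[of _ e])
  moreover have "continuous_on ?S (\<lambda>t. cmod (psi t))"
    by (intro continuous_on_norm continuous_at_imp_continuous_on ballI isCont_psi)
  ultimately obtain t0 where t0: "t0 \<in> ?S" "\<And>t. t \<in> ?S \<Longrightarrow> cmod (psi t) \<le> cmod (psi t0)"
    using continuous_attains_sup[of ?S "\<lambda>t. cmod (psi t)"] by blast
  have "t0 \<noteq> 0" using t0 assms by auto
  then show thesis using t0 nonlattice[of t0] by (intro that[of "cmod (psi t0)"]) (auto simp: cmod_psi)
next
  case False
  then show thesis by (intro that[of 0]) auto
qed

end

section \<open>The Fourier error of the smoothed problem\<close>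

context llt
begin

text \<open>The Fourier integrand of the smoothed problem after t = x / sqrt m, minus its Gaussian
  limit. The oscillating factor is left out, because only absolute values will be
  integrated.\<close>

definition ferr :: "real \<Rightarrow> nat \<Rightarrow> real \<Rightarrow> complex" where
  "ferr T m x = of_real (tent T (x / sqrt (real m))) * gum_hat s (x / sqrt (real m)) * psi (x / sqrt (real m)) ^ m
      - of_real (Gamma s * exp (- (\<sigma>\<^sup>2 * x\<^sup>2 / 2)))"

lemma ferr_measurable [measurable]: "ferr T m \<in> borel_measurable borel"
  unfolding ferr_def by measurable

lemma Gamma_s_pos: "0 < Gamma s"
  using s_pos by (rule Gamma_real_pos)

lemma ferr_tendsto: 
  assumes "0 < T" shows "(\<lambda>m. ferr T m x) \<longlonglongrightarrow> 0"
proof -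
  have t0: "(\<lambda>m. x / sqrt (real m)) \<longlonglongrightarrow> 0" by real_asymp
  have "isCont (\<lambda>t. 1 - \<bar>t\<bar> / T) 0" using assms by (intro continuous_intros) auto
  from isCont_tendsto_compose[OF this t0]
  have "(\<lambda>m. 1 - \<bar>x / sqrt (real m)\<bar> / T) \<longlonglongrightarrow> 1" by simp
  moreover have "\<forall>\<^sub>F m in sequentially. \<bar>x / sqrt (real m)\<bar> < T"
    using tendsto_rabs[OF t0] assms by (intro order_tendstoD(2)) auto
  then have "\<forall>\<^sub>F m in sequentially. 1 - \<bar>x / sqrt (real m)\<bar> / T = tent T (x / sqrt (real m))"
    
  proof eventually_elim
    case (elim m)
    then have "x / sqrt (real m) \<in> {-T..T}" unfolding atLeastAtMost_iff by linarith
    then show ?case by (simp add: tent_def)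
  qed
  ultimately have "(\<lambda>m. tent T (x / sqrt (real m))) \<longlonglongrightarrow> 1"
    by (rule Lim_transform_eventually)
  then have "(\<lambda>m. ferr T m x) \<longlonglongrightarrow> complex_of_real 1 * of_real (Gamma s) * of_real (exp (- (\<sigma>\<^sup>2 * x\<^sup>2 / 2)))
     - of_real (Gamma s * exp (- (\<sigma>\<^sup>2 * x\<^sup>2 / 2)))"
    unfolding ferr_def by (intro tendsto_intros gum_hat_tendsto s_pos psi_pow_tendsto t0)
  then show ?thesis by simp
qed

text \<open>For frequencies below e the bound of \<open>psi_gauss_bound\<close> provides the fixed
  majorant \<open>w\<close>. On the remaining frequencies up to T the factor q^m beats the length of
  the range, of order sqrt m; this part is \<open>h m\<close>.\<close>

lemma ferr_integral_tendsto:
  assumes T: "0 < T" shows "(\<lambda>m. LBINT x. cmod (ferr T m x)) \<longlonglongrightarrow> 0"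
    and "m > 0 \<Longrightarrow> integrable lborel (ferr T m)"
proof -
  obtain e where e: "0 < e" "\<And>t. \<bar>t\<bar> \<le> e \<Longrightarrow> cmod (psi t) \<le> exp (- (\<sigma>\<^sup>2 * t\<^sup>2 / 4))"
    by (rule psi_gauss_bound) blast
  obtain q where q: "0 \<le> q" "q < 1" "\<And>t. e \<le> \<bar>t\<bar> \<Longrightarrow> \<bar>t\<bar> \<le> T \<Longrightarrow> cmod (psi t) \<le> q"
    using psi_away[OF e(1), of T] by blast
  define w where "w x = 2 * Gamma s * exp (- (\<sigma>\<^sup>2 * x\<^sup>2 / 4))" for x
  define h where "h m x = indicator {- (T * sqrt (real m)) .. T * sqrt (real m)} x * (Gamma s * q ^ m)" for m :: nat and x :: real
  have [measurable]: "w \<in> borel_measurable borel" "h m \<in> borel_measurable borel" for m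
    unfolding w_def h_def by measurable
  have Gp: "0 < Gamma s" by (rule Gamma_s_pos)
  have wi: "integrable lborel w"
    unfolding w_def using integrable_exp_square[of "\<sigma>\<^sup>2 / 4"] \<sigma>_pos
    by (intro integrable_mult_right) (simp add: field_simps)
  have hb: "has_bochner_integral lborel (h m) (2 * T * sqrt (real m) * (Gamma s * q ^ m))" for m
  proof -
    have "has_bochner_integral lborel (\<lambda>x. indicator {- (T * sqrt (real m)) .. T * sqrt (real m)} x * (Gamma s * q ^ m))
      (measure lborel {- (T * sqrt (real m)) .. T * sqrt (real m)} * (Gamma s * q ^ m))"
      by (intro has_bochner_integral_mult_left has_bochner_integral_real_indicator emeasure_bounded_finite) auto
    then show ?thesis using T by (simp add: h_def[abs_def] mult_ac)
  qed
  have bound: "cmod (ferr T m x) \<le> w x + h m x" if m: "m > 0" for m x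
  proof -
    let ?t = "x / sqrt (real m)"
    have g: "Gamma s * exp (- (\<sigma>\<^sup>2 * x\<^sup>2 / 2)) \<le> Gamma s * exp (- (\<sigma>\<^sup>2 * x\<^sup>2 / 4))"
      using Gp by (intro mult_left_mono) auto
    have "cmod (ferr T m x) \<le> cmod (of_real (tent T ?t) * gum_hat s ?t * psi ?t ^ m) + cmod (of_real (Gamma s * exp (- (\<sigma>\<^sup>2 * x\<^sup>2 / 2))))"
      unfolding ferr_def by (rule norm_triangle_ineq4)
    also have "cmod (of_real (Gamma s * exp (- (\<sigma>\<^sup>2 * x\<^sup>2 / 2)))) = Gamma s * exp (- (\<sigma>\<^sup>2 * x\<^sup>2 / 2))"
      unfolding norm_of_real using Gp by simp
    finally have 1: "cmod (ferr T m x) \<le> cmod (of_real (tent T ?t) * gum_hat s ?t * psi ?t ^ m) + Gamma s * exp (- (\<sigma>\<^sup>2 * x\<^sup>2 / 4))"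
      using g by simp
    have tl: "\<bar>tent T ?t\<bar> \<le> indicator {-T..T} ?t" using tent_bounds[OF T, of ?t] by auto
    have 2: "cmod (of_real (tent T ?t) * gum_hat s ?t * psi ?t ^ m) \<le> indicator {-T..T} ?t * Gamma s * cmod (psi ?t) ^ m"
      unfolding norm_mult norm_power norm_of_real using tl gum_hat_bound[OF s_pos, of ?t] Gp
      by (intro mult_mono) auto
    have h0: "0 \<le> h m x" using q Gp by (auto simp: h_def)
    show ?thesis
    proof (cases "\<bar>?t\<bar> \<le> e")
      case True
      have "cmod (psi ?t) ^ m \<le> exp (- (\<sigma>\<^sup>2 * ?t\<^sup>2 / 4)) ^ m"
        using e(2)[OF True] by (intro power_mono) auto
      also have "\<dots> = exp (- (\<sigma>\<^sup>2 * x\<^sup>2 / 4))"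
        using m by (simp add: power_divide field_simps flip: exp_of_nat_mult)
      finally have "indicator {-T..T} ?t * Gamma s * cmod (psi ?t) ^ m \<le> 1 * Gamma s * exp (- (\<sigma>\<^sup>2 * x\<^sup>2 / 4))"
        using Gp by (intro mult_mono) (auto simp: indicator_def)
      then show ?thesis using 1 2 h0 unfolding w_def by linarith
    next
      case False
      have "indicator {-T..T} ?t * Gamma s * cmod (psi ?t) ^ m \<le> h m x"
      proof (cases "\<bar>?t\<bar> \<le> T")
        case True
        have "cmod (psi ?t) ^ m \<le> q ^ m" using q(3)[of ?t] True False by (intro power_mono) auto
        moreover have "x \<in> {- (T * sqrt (real m)) .. T * sqrt (real m)}"
          using True m by (auto simp: abs_le_iff field_simps)
        ultimately show ?thesis using Gp q(1) by (auto simp: h_def indicator_def intro!: mult_left_mono)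
      next
        case False
        then have "?t \<notin> {-T..T}" by auto
        then show ?thesis using h0 by simp
      qed
      moreover have "0 \<le> Gamma s * exp (- (\<sigma>\<^sup>2 * x\<^sup>2 / 4))" using Gp by simp
      ultimately show ?thesis using 1 2 unfolding w_def by linarith
    qed
  qed
  have hi: "integrable lborel (h m)" for m using hb[of m] by (simp add: has_bochner_integral_iff)
  have fi: "integrable lborel (ferr T m)" if "m > 0" for m
    by (rule Bochner_Integration.integrable_bound[OF Bochner_Integration.integrable_add[OF wi hi[of m]]])
       (use bound[OF that] in \<open>auto intro!: AE_I2 order_trans[OF bound[OF that]]\<close>)
  then show "m > 0 \<Longrightarrow> integrable lborel (ferr T m)" .
  \<comment> \<open>Cutting at \<open>w\<close> leaves a sequence with a fixed integrable majorant,
    and what is cut off lies below \<open>h m\<close>.\<close>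
  define g where "g m x = min (cmod (ferr T m x)) (w x)" for m x
  have [measurable]: "g m \<in> borel_measurable borel" for m unfolding g_def by measurable
  have w0: "0 \<le> w x" for x using Gp by (simp add: w_def)
  have gl: "(\<lambda>m. LBINT x. g m x) \<longlonglongrightarrow> (LBINT (x::real). 0)"
  proof (rule integral_dominated_convergence[where w = w])
    show "AE x in lborel. (\<lambda>m. g m x) \<longlonglongrightarrow> 0"
    proof (rule AE_I2)
      fix x
      have "(\<lambda>m. min (cmod (ferr T m x)) (w x)) \<longlonglongrightarrow> min (cmod 0) (w x)"
        by (intro tendsto_intros ferr_tendsto T)
      then show "(\<lambda>m. g m x) \<longlonglongrightarrow> 0" using w0[of x] by (simp add: g_def min_def)
    qed
    show "AE x in lborel. norm (g m x) \<le> w x" for m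
      using w0 by (auto simp: g_def intro!: AE_I2)
  qed (use wi in \<open>auto simp: g_def\<close>)
  \<comment> \<open>The case q = 0 occurs, for instance when e exceeds T.\<close>
  have hl: "(\<lambda>m. 2 * T * sqrt (real m) * (Gamma s * q ^ m)) \<longlonglongrightarrow> 0"
  proof (cases "q = 0")
    case True
    have "\<forall>\<^sub>F m in sequentially. 2 * T * sqrt (real m) * (Gamma s * q ^ m) = 0"
      using eventually_gt_at_top[of 0] by eventually_elim (simp add: True)
    then show ?thesis by (rule tendsto_eventually)
  next
    case False
    then have "q > 0" using q by simp
    then show ?thesis using q(2) by real_asymp
  qed
  have sl: "(\<lambda>m. (LBINT x. g m x) + 2 * T * sqrt (real m) * (Gamma s * q ^ m)) \<longlonglongrightarrow> 0"
    using tendsto_add[OF gl hl] by simp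
  show "(\<lambda>m. LBINT x. cmod (ferr T m x)) \<longlonglongrightarrow> 0"
  proof (rule Lim_null_comparison[OF _ sl])
    show "\<forall>\<^sub>F m in sequentially. norm (LBINT x. cmod (ferr T m x)) \<le> (LBINT x. g m x) + 2 * T * sqrt (real m) * (Gamma s * q ^ m)"
      using eventually_gt_at_top[of 0]
    proof eventually_elim
      case (elim m)
      have gi: "integrable lborel (g m)"
        by (rule Bochner_Integration.integrable_bound[OF wi]) (use w0 in \<open>auto simp: g_def intro!: AE_I2\<close>)
      have "(LBINT x. cmod (ferr T m x)) \<le> (LBINT x. g m x + h m x)"
      proof (rule integral_mono)
        fix x
        have h0: "0 \<le> h m x" using q Gp by (auto simp: h_def)
        show "cmod (ferr T m x) \<le> g m x + h m x" using bound[OF elim, of x] h0 unfolding g_def by linarith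
      qed (use fi[OF elim] gi hi[of m] in auto)
      also have "\<dots> = (LBINT x. g m x) + (LBINT x. h m x)" using gi hi[of m] by simp
      also have "(LBINT x. h m x) = 2 * T * sqrt (real m) * (Gamma s * q ^ m)"
        using hb[of m] by (simp add: has_bochner_integral_iff)
      finally show ?case by simp
    qed
  qed
qed

section \<open>Tauberian passage from smoothed to pointwise estimates\<close>

definition G :: "nat \<Rightarrow> real \<Rightarrow> real" where "G m x = (LINT y|\<nu>m m. gum s (y - x))"

text \<open>The expected limit of \<open>sqrt m * G m x\<close>: on the scale sqrt m the kernel acts
  like a point mass of weight \<open>Gamma s\<close>, its integral.\<close>

definition N :: "nat \<Rightarrow> real \<Rightarrow> real" where
  "N m x = Gamma s / (\<sigma> * sqrt (2 * pi)) * exp (- (x - a * real m)\<^sup>2 / (2 * \<sigma>\<^sup>2 * real m))"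

definition H :: "real \<Rightarrow> nat \<Rightarrow> real \<Rightarrow> real" where "H T m x = (LBINT z. fejer T z * G m (x + z))"

lemma sets_\<nu>m [measurable_cong, simp]: "sets (\<nu>m m) = sets borel" and space_\<nu>m [simp]: "space (\<nu>m m) = UNIV"
  using distm[of m] by (auto simp: real_distribution_def real_distribution_axioms_def dest: sets_eq_imp_space_eq)

lemma G_measurable [measurable]: "G m \<in> borel_measurable borel"
proof -
  interpret m: real_distribution "\<nu>m m" by (rule distm)
  have "(\<lambda>x. LINT y|\<nu>m m. gum s (y - x)) \<in> borel_measurable borel" by measurable
  then show ?thesis unfolding G_def[abs_def] .
qed

lemma G_int: "integrable (\<nu>m m) (\<lambda>y. gum s (y - x))"
proof -
  interpret m: real_distribution "\<nu>m m" by (rule distm)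
  obtain C where C: "0 < C" "\<And>y. gum s y \<le> C" by (rule gum_bounded[OF s_pos]) blast
  show ?thesis by (rule m.integrable_const_bound[of _ C]) (use C gum_pos in \<open>auto simp: less_imp_le\<close>)
qed

lemma G_nonneg: "0 \<le> G m x"
  unfolding G_def by (intro integral_nonneg_AE AE_I2) (simp add: gum_pos less_imp_le)

lemma G_bounded: obtains C where "0 < C" "\<And>m x. G m x \<le> C"
proof -
  obtain C where C: "0 < C" "\<And>y. gum s y \<le> C" by (rule gum_bounded[OF s_pos]) blast
  show thesis
  proof
    show "0 < C" by fact
    fix m x
    interpret m: real_distribution "\<nu>m m" by (rule distm)
    have "G m x \<le> (LINT y|\<nu>m m. C)" unfolding G_def by (intro integral_mono G_int) (use C in auto)
    then show "G m x \<le> C" using m.prob_space by simp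
  qed
qed

text \<open>Moving x to the right only makes the double exponential factor of the kernel smaller, so
  the growth comes from exp (s x) alone. This one-sided control is the Tauberian condition.\<close>

lemma G_slowly:
  assumes "0 \<le> z" shows "G m (x + z) \<le> exp (s * z) * G m x"
proof -
  have "gum s (y - (x + z)) \<le> exp (s * z) * gum s (y - x)" for y
  proof -
    have "exp (x - y) \<le> exp (x + z - y)" using assms by simp
    then show ?thesis
      by (simp add: gum_def algebra_simps flip: exp_add)
  qed
  then have "G m (x + z) \<le> (LINT y|\<nu>m m. exp (s * z) * gum s (y - x))"
    unfolding G_def by (intro integral_mono G_int integrable_mult_right) auto
  then show ?thesis by (simp add: G_def)
qed

lemma fejer_G_int: "0 < T \<Longrightarrow> integrable lborel (\<lambda>z. fejer T z * G m (x + z))"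
proof -
  assume T: "0 < T"
  obtain C where C: "0 < C" "\<And>m x. G m x \<le> C" by (rule G_bounded) blast
  have fi: "integrable lborel (\<lambda>z. fejer T z * C)"
    using has_bochner_integral_fejer[OF T] by (intro integrable_mult_left) (simp add: has_bochner_integral_iff)
  show ?thesis
    by (rule Bochner_Integration.integrable_bound[OF fi])
       (use C G_nonneg fejer_nonneg[OF T] in \<open>auto simp: abs_mult intro!: AE_I2 mult_left_mono\<close>)
qed

text \<open>The Fejer kernel may be replaced by the Fourier integral of the tent off the null set z
  = 0; after Fubini the inner integral is the transform of the kernel \<open>gum s\<close>.\<close>

lemma fejer_gum:
  assumes T: "0 < T"
  shows "complex_of_real (LBINT z. fejer T z * gum s (w - z))
    = 1 / (2 * pi) * (CLBINT t. of_real (tent T t) * gum_hat s t * iexp (t * w))"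
proof -
  have gi: "integrable lborel (\<lambda>z. gum s (w - z))"
    using lborel_integrable_real_affine[of "gum s" "-1" w] integrable_gum[OF s_pos] by simp
  have "complex_of_real (LBINT z. fejer T z * gum s (w - z)) = (CLBINT z. of_real (fejer T z) * of_real (gum s (w - z)))"
    by (simp flip: integral_of_real of_real_mult)
  also have "\<dots> = (CLBINT z. 1 / (2 * pi) * (CLBINT t. of_real (tent T t) * iexp (t * z) * of_real (gum s (w - z))))"
  proof (rule integral_cong_AE)
    show "AE z in lborel. complex_of_real (fejer T z) * of_real (gum s (w - z)) =
      1 / (2 * pi) * (CLBINT t. of_real (tent T t) * iexp (t * z) * of_real (gum s (w - z)))"
      using AE_lborel_singleton[of 0]
    proof eventually_elim
      case (elim z)
      show ?case using tent_fourier[OF T elim] by simp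
    qed
  qed measurable
  also have "\<dots> = 1 / (2 * pi) * (CLBINT z. CLBINT t. of_real (tent T t) * iexp (t * z) * of_real (gum s (w - z)))"
    by (rule integral_mult_right_zero)
  also have "(CLBINT z. CLBINT t. of_real (tent T t) * iexp (t * z) * of_real (gum s (w - z)))
    = (CLBINT t. CLBINT z. of_real (tent T t) * iexp (t * z) * of_real (gum s (w - z)))"
  proof (rule lborel_pair.Fubini_dominated)
    show "integrable lborel (indicator {-T..T} :: real \<Rightarrow> real)" using T by simp
    show "integrable lborel (\<lambda>z. gum s (w - z))" by (rule gi)
    show "cmod (of_real (tent T t) * iexp (t * z) * of_real (gum s (w - z))) \<le> indicator {-T..T} t * gum s (w - z)" for t z
      using tent_bounds[OF T, of t] gum_pos[of s "w - z"] by (auto simp: norm_mult abs_mult intro!: mult_right_mono)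
  qed measurable
  also have "\<dots> = (CLBINT t. of_real (tent T t) * gum_hat s t * iexp (t * w))"
  proof (rule Bochner_Integration.integral_cong)
    fix t :: real
    show "(CLBINT z. of_real (tent T t) * iexp (t * z) * of_real (gum s (w - z)))
      = of_real (tent T t) * gum_hat s t * iexp (t * w)"
  proof -
    have "(CLBINT z. of_real (tent T t) * iexp (t * z) * of_real (gum s (w - z)))
      = of_real (tent T t) * (CLBINT z. iexp (t * z) * of_real (gum s (w - z)))"
      by (simp add: mult.assoc)
    also have "(CLBINT z. iexp (t * z) * of_real (gum s (w - z))) = \<bar>-1\<bar> *\<^sub>R (CLBINT z. iexp (t * (w + (-1) * z)) * of_real (gum s (w - (w + (-1) * z))))"
      by (rule lborel_integral_real_affine) auto
    also have "\<dots> = (CLBINT z. iexp (t * w) * (of_real (gum s z) * iexp (- (t * z))))"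
      by (auto intro!: Bochner_Integration.integral_cong simp: algebra_simps simp flip: exp_add)
    also have "\<dots> = iexp (t * w) * gum_hat s t" unfolding gum_hat_def by (rule integral_mult_right_zero)
    finally show ?thesis by (simp add: mult_ac)
  qed
  qed simp
  finally show ?thesis .
qed

text \<open>Smoothing confines the frequencies to [-T, T], so every integral converges absolutely;
  integrating over \<open>\<nu>m m\<close> first brings in the m-th power of the characteristic
  function through \<open>charm\<close>.\<close>

lemma H_fourier:
  assumes T: "0 < T"
  shows "complex_of_real (H T m x) = 1 / (2 * pi) * (CLBINT t. of_real (tent T t) * gum_hat s t * psi t ^ m * iexp (t * (a * m - x)))"
proof -
  interpret m: real_distribution "\<nu>m m" by (rule distm)
  interpret p: pair_sigma_finite lborel "\<nu>m m" ..
  interpret p': pair_sigma_finite "\<nu>m m" lborel ..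
  obtain C where C: "0 < C" "\<And>y. gum s y \<le> C" by (rule gum_bounded[OF s_pos]) blast
  have "H T m x = (LBINT z. LINT y|\<nu>m m. fejer T z * gum s (y - x - z))"
    unfolding H_def G_def by (simp add: algebra_simps)
  also have "\<dots> = (LINT y|\<nu>m m. LINT z|lborel. fejer T z * gum s (y - x - z))"
  proof (rule p.Fubini_dominated[symmetric])
    show "integrable lborel (fejer T)" using has_bochner_integral_fejer[OF T] by (simp add: has_bochner_integral_iff)
    show "integrable (\<nu>m m) (\<lambda>_. C)" by simp
    show "norm (fejer T z * gum s (y - x - z)) \<le> fejer T z * C" for z y
      using fejer_nonneg[OF T] C gum_pos[of s "y - x - z"] by (auto simp: abs_mult intro!: mult_left_mono)
  qed measurable
  finally have "complex_of_real (H T m x) = (CLINT y|\<nu>m m. complex_of_real (LBINT z. fejer T z * gum s (y - x - z)))"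
    by simp
  also have "\<dots> = 1 / (2 * pi) * (LINT y|\<nu>m m. (CLBINT t. of_real (tent T t) * gum_hat s t * iexp (t * (y - x))))"
    unfolding fejer_gum[OF T] by (rule integral_mult_right_zero)
  also have "(LINT y|\<nu>m m. (CLBINT t. of_real (tent T t) * gum_hat s t * iexp (t * (y - x))))
    = (LINT t|lborel. (CLINT y|\<nu>m m. of_real (tent T t) * gum_hat s t * iexp (t * (y - x))))"
  proof (rule p'.Fubini_dominated[symmetric])
    show "integrable (\<nu>m m) (\<lambda>_. Gamma s)" by simp
    show "integrable lborel (indicator {-T..T} :: real \<Rightarrow> real)" using T by simp
    show "cmod (of_real (tent T t) * gum_hat s t * iexp (t * (y - x))) \<le> Gamma s * indicator {-T..T} t" for t y
    proof -
      have "\<bar>tent T t\<bar> * cmod (gum_hat s t) \<le> indicator {-T..T} t * Gamma s"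
        using tent_bounds[OF T, of t] gum_hat_bound[OF s_pos, of t] by (intro mult_mono) auto
      then show ?thesis by (simp add: norm_mult mult.commute)
    qed
  qed measurable
  also have "\<dots> = (CLBINT t. of_real (tent T t) * gum_hat s t * psi t ^ m * iexp (t * (a * m - x)))"
  proof (rule Bochner_Integration.integral_cong)
    fix t :: real
    show "(CLINT y|\<nu>m m. of_real (tent T t) * gum_hat s t * iexp (t * (y - x)))
    = of_real (tent T t) * gum_hat s t * psi t ^ m * iexp (t * (a * m - x))"
  proof -
    have "(CLINT y|\<nu>m m. of_real (tent T t) * gum_hat s t * iexp (t * (y - x)))
       = of_real (tent T t) * gum_hat s t * (CLINT y|\<nu>m m. iexp (t * y) * iexp (- (t * x)))"
      by (simp only: integral_mult_right_zero[symmetric])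
        (auto intro!: Bochner_Integration.integral_cong simp: algebra_simps exp_diff exp_minus field_simps)
    also have "(CLINT y|\<nu>m m. iexp (t * y) * iexp (- (t * x))) = char \<nu> t ^ m * iexp (- (t * x))"
      unfolding charm[symmetric] unfolding char_def[of "\<nu>m m"] by (rule integral_mult_left_zero)
    also have "char \<nu> t ^ m = psi t ^ m * iexp (t * (a * m))"
      by (simp add: psi_def power_mult_distrib mult_ac flip: exp_of_nat_mult exp_add)
    also have "psi t ^ m * iexp (t * (a * m)) * iexp (- (t * x)) = psi t ^ m * iexp (t * (a * m - x))"
      by (simp add: algebra_simps flip: exp_add)
    finally show ?thesis by (simp add: mult.assoc)
  qed
  qed simp
  finally show ?thesis .
qed

text \<open>The position x enters the Fourier integrals only through a phase of modulus 1, hence a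
  bound that does not depend on x.\<close>

lemma H_error:
  assumes T: "0 < T" and m: "m > 0"
  shows "\<bar>sqrt m * H T m x - N m x\<bar> \<le> 1 / (2 * pi) * (LBINT x. cmod (ferr T m x))"
proof -
  have r: "sqrt (real m) > 0" using m by simp
  define y where "y = (a * m - x) / sqrt m"
  let ?A = "\<lambda>u. of_real (tent T (u / sqrt m)) * gum_hat s (u / sqrt m) * psi (u / sqrt m) ^ m"
  let ?B = "\<lambda>u. complex_of_real (Gamma s * exp (- (\<sigma>\<^sup>2 * u\<^sup>2 / 2)))"
  have "(CLBINT t. of_real (tent T t) * gum_hat s t * psi t ^ m * iexp (t * (a * m - x)))
     = \<bar>1 / sqrt m\<bar> *\<^sub>R (CLBINT u. of_real (tent T (0 + 1 / sqrt m * u)) * gum_hat s (0 + 1 / sqrt m * u) * psi (0 + 1 / sqrt m * u) ^ m * iexp ((0 + 1 / sqrt m * u) * (a * m - x)))"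
    using r by (intro lborel_integral_real_affine) auto
  also have "\<dots> = of_real (1 / sqrt m) * (CLBINT u. ?A u * iexp (u * y))"
    using r by (simp add: scaleR_conv_of_real y_def)
  finally have 1: "of_real (sqrt m * H T m x) = 1 / (2 * pi) * (CLBINT u. ?A u * iexp (u * y))"
    using r H_fourier[OF T, of m x] by simp
  have bi: "integrable lborel ?B"
    using integrable_exp_square[of "\<sigma>\<^sup>2 / 2"] \<sigma>_pos
    by (intro integrable_of_real integrable_mult_right) (simp add: field_simps)
  have "(CLBINT u. ?B u * iexp (u * y)) = of_real (Gamma s) * (CLBINT x. of_real (exp (- (\<sigma>\<^sup>2 * x\<^sup>2 / 2))) * iexp (x * y))"
    by (simp add: mult.assoc)
  also have "\<dots> = of_real (Gamma s * (sqrt (2 * pi) / \<sigma> * exp (- (y\<^sup>2 / (2 * \<sigma>\<^sup>2)))))"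
    unfolding gauss_fourier[OF \<sigma>_pos] by simp
  finally have "1 / (2 * pi) * (CLBINT u. ?B u * iexp (u * y)) = of_real (1 / (2 * pi) * (Gamma s * (sqrt (2 * pi) / \<sigma> * exp (- (y\<^sup>2 / (2 * \<sigma>\<^sup>2))))))"
    by simp
  also have "1 / (2 * pi) * (Gamma s * (sqrt (2 * pi) / \<sigma> * exp (- (y\<^sup>2 / (2 * \<sigma>\<^sup>2))))) = N m x"
  proof -
    have "y\<^sup>2 / (2 * \<sigma>\<^sup>2) = (x - a * m)\<^sup>2 / (2 * \<sigma>\<^sup>2 * m)"
      using r by (simp add: y_def power_divide power2_commute)
    moreover have "1 / (2 * pi) * (Gamma s * (sqrt (2 * pi) / \<sigma> * E)) = Gamma s / (\<sigma> * sqrt (2 * pi)) * E" for E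
    proof -
      have "sqrt (2 * pi) / (2 * pi) = 1 / sqrt (2 * pi)"
        by (subst frac_eq_eq) auto
      then have "Gamma s / \<sigma> * E * (sqrt (2 * pi) / (2 * pi)) = Gamma s / \<sigma> * E * (1 / sqrt (2 * pi))" by simp
      then show ?thesis by (simp add: field_simps)
    qed
    ultimately show ?thesis unfolding N_def by (simp only: minus_divide_left)
  qed
  finally have 2: "of_real (N m x) = 1 / (2 * pi) * (CLBINT u. ?B u * iexp (u * y))" ..
  have fi: "integrable lborel (ferr T m)" using ferr_integral_tendsto(2)[OF T m] .
  have cm: "integrable lborel (\<lambda>u. f u * iexp (u * y))" if "integrable lborel f" for f :: "real \<Rightarrow> complex"
    by (rule Bochner_Integration.integrable_bound[OF that]) (use that in \<open>auto simp: norm_mult\<close>)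
  have ai: "integrable lborel ?A"
    using Bochner_Integration.integrable_add[OF fi bi] by (simp add: ferr_def)
  have "of_real (sqrt m * H T m x - N m x) = 1 / (2 * pi) * ((CLBINT u. ?A u * iexp (u * y)) - (CLBINT u. ?B u * iexp (u * y)))"
    unfolding of_real_diff 1 2 by (simp add: right_diff_distrib)
  also have "(CLBINT u. ?A u * iexp (u * y)) - (CLBINT u. ?B u * iexp (u * y)) = (CLBINT u. ?A u * iexp (u * y) - ?B u * iexp (u * y))"
    by (rule Bochner_Integration.integral_diff[symmetric, OF cm[OF ai] cm[OF bi]])
  also have "\<dots> = (CLBINT u. ferr T m u * iexp (u * y))"
    by (intro Bochner_Integration.integral_cong) (auto simp: ferr_def algebra_simps)
  finally have eq: "of_real (sqrt m * H T m x - N m x) = 1 / (2 * pi) * (CLBINT u. ferr T m u * iexp (u * y))" .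
  have "\<bar>sqrt m * H T m x - N m x\<bar> = 1 / (2 * pi) * cmod (CLBINT u. ferr T m u * iexp (u * y))"
    using arg_cong[OF eq, of cmod] by (simp only: norm_mult norm_of_real) simp
  moreover have "cmod (CLBINT u. ferr T m u * iexp (u * y)) \<le> (LBINT u. cmod (ferr T m u))"
    using integral_norm_bound[of lborel "\<lambda>u. ferr T m u * iexp (u * y)"]
    by (simp only: norm_mult norm_exp_i_times mult_1_right)
  from mult_left_mono[OF this, of "1 / (2 * pi)"]
  have "1 / (2 * pi) * cmod (CLBINT u. ferr T m u * iexp (u * y)) \<le> 1 / (2 * pi) * (LBINT u. cmod (ferr T m u))" by simp
  ultimately show ?thesis by (simp only:)
qed

lemma N_nonneg: "0 \<le> N m x"
  unfolding N_def using Gamma_s_pos \<sigma>_pos by simp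

lemma N_le: "N m x \<le> Gamma s / (\<sigma> * sqrt (2 * pi))"
proof -
  have "exp (- (x - a * real m)\<^sup>2 / (2 * \<sigma>\<^sup>2 * real m)) \<le> 1" by simp
  then have "Gamma s / (\<sigma> * sqrt (2 * pi)) * exp (- (x - a * real m)\<^sup>2 / (2 * \<sigma>\<^sup>2 * real m)) \<le> Gamma s / (\<sigma> * sqrt (2 * pi)) * 1"
    using Gamma_s_pos \<sigma>_pos by (intro mult_left_mono) auto
  then show ?thesis by (simp add: N_def)
qed

lemma N_lipschitz:
  obtains L where "0 \<le> L" "\<And>m x y. m > 0 \<Longrightarrow> \<bar>N m x - N m y\<bar> \<le> L * \<bar>x - y\<bar> / sqrt (real m)"
proof -
  let ?c = "Gamma s / (\<sigma> * sqrt (2 * pi))"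
  define \<kappa> where "\<kappa> = 1 / (2 * \<sigma>\<^sup>2)"
  define f where "f u = ?c * exp (- u\<^sup>2 * \<kappa>)" for u
  define f' where "f' u = ?c * (exp (- u\<^sup>2 * \<kappa>) * (- (2 * u) * \<kappa>))" for u
  have c: "0 \<le> ?c" using Gamma_s_pos \<sigma>_pos by simp
  have D: "(f has_field_derivative f' u) (at u within S)" for u S
    unfolding f_def f'_def using \<sigma>_pos by (auto intro!: derivative_eq_intros)
  let ?L = "?c * (1 / \<sigma>)"
  have B: "norm (f' u) \<le> ?L" for u
  proof -
    define v where "v = \<bar>u\<bar> / \<sigma>"
    have v0: "0 \<le> v" using \<sigma>_pos by (simp add: v_def)
    \<comment> \<open>The bound v <= exp (v^2 / 2) limits the slope of the Gaussian profile to its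
      height divided by \<sigma>.\<close>
    have "v \<le> 1 + v\<^sup>2 / 2" using zero_le_power2[of "v - 1"] by (simp add: power2_eq_square algebra_simps)
    also have "\<dots> \<le> exp (v\<^sup>2 / 2)" by (rule exp_ge_add_one_self)
    finally have "exp (- (v\<^sup>2 / 2)) * v \<le> 1" by (simp add: exp_minus field_simps)
    moreover have "norm (f' u) = ?c * (1 / \<sigma>) * (exp (- (v\<^sup>2 / 2)) * v)"
      using \<sigma>_pos Gamma_s_pos by (simp add: f'_def v_def \<kappa>_def abs_mult power_divide power2_eq_square mult_ac)
    moreover have "0 \<le> ?c * (1 / \<sigma>)" using c \<sigma>_pos by (intro mult_nonneg_nonneg) auto
    ultimately show ?thesis using mult_left_mono[of "exp (- (v\<^sup>2 / 2)) * v" 1 "?c * (1 / \<sigma>)"] by (simp only: mult_1_right)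
  qed
  have lip: "norm (f u - f v) \<le> ?L * norm (u - v)" for u v
    by (rule field_differentiable_bound[of UNIV f f']) (use D B in auto)
  show thesis
  proof
    show "0 \<le> ?L" using c \<sigma>_pos by (intro mult_nonneg_nonneg) auto
    fix m :: nat and x y :: real assume m: "m > 0"
    have r: "N m x = f ((x - a * m) / sqrt m)" for x
      using m by (simp add: N_def f_def \<kappa>_def power_divide mult.commute)
    have "(x - a * m) / sqrt m - (y - a * m) / sqrt m = (x - y) / sqrt m"
      by (simp add: diff_divide_distrib[symmetric])
    then show "\<bar>N m x - N m y\<bar> \<le> ?L * \<bar>x - y\<bar> / sqrt (real m)"
      using lip[of "(x - a * m) / sqrt m" "(y - a * m) / sqrt m"] by (simp add: r abs_mult)
  qed
qed

text \<open>Since \<open>exp (- s * x) * G m x\<close> is decreasing in \<open>x\<close>, two-sided bounds for \<open>G\<close> follow from the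
  smoothed quantity \<open>H\<close> at nearby points.\<close>

lemma G_upper:
  assumes T: "0 < T" and d: "0 \<le> d" and k: "(LBINT z. indicator {z. \<bar>z\<bar> > d} z * fejer T z) \<le> k"
  shows "G m x * (1 - k) \<le> exp (2 * s * d) * H T m (x - d)"
proof -
  let ?I = "\<lambda>z. indicator {z. \<bar>z\<bar> > d} z * fejer T z"
  have fi: "integrable lborel (fejer T)" "(LBINT z. fejer T z) = 1"
    using has_bochner_integral_fejer[OF T] by (auto simp: has_bochner_integral_iff)
  have Ii: "integrable lborel ?I"
    using fi(1) by (rule Bochner_Integration.integrable_bound) (auto simp: indicator_def)
  have le: "(fejer T z - ?I z) * G m x \<le> exp (2 * s * d) * (fejer T z * G m (x - d + z))" for z
  proof (cases "\<bar>z\<bar> > d")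
    case True then show ?thesis using fejer_nonneg[OF T, of z] G_nonneg by simp
  next
    case False
    have "G m x = G m ((x - d + z) + (d - z))" by simp
    also have "\<dots> \<le> exp (s * (d - z)) * G m (x - d + z)"
      by (rule G_slowly) (use False in auto)
    also have "\<dots> \<le> exp (2 * s * d) * G m (x - d + z)"
      using mult_left_mono[of "d - z" "2 * d" s] s_pos False by (intro mult_right_mono G_nonneg) (auto simp: mult_ac)
    finally show ?thesis using False fejer_nonneg[OF T, of z] by (auto dest: mult_left_mono[of _ _ "fejer T z"] simp: mult_ac)
  qed
  have "G m x * (1 - k) \<le> (1 - (LBINT z. ?I z)) * G m x"
    using mult_right_mono[of "1 - k" "1 - (LBINT z. ?I z)", OF _ G_nonneg[of m x]] k by (simp add: mult.commute)
  also have "\<dots> = (LBINT z. (fejer T z - ?I z) * G m x)"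
    using fi Ii by simp
  also have "\<dots> \<le> (LBINT z. exp (2 * s * d) * (fejer T z * G m (x - d + z)))"
    using fi Ii le by (intro integral_mono integrable_mult_right fejer_G_int T) auto
  also have "\<dots> = exp (2 * s * d) * H T m (x - d)" by (simp add: H_def)
  finally show ?thesis .
qed

text \<open>For the upper bound the kernel mass outside [-d, d] is simply dropped; here it has to be
  paid for with an a priori bound B on G, which \<open>local_limit\<close> obtains from the upper
  bound.\<close>

lemma G_lower:
  assumes T: "0 < T" and d: "0 \<le> d" and k: "(LBINT z. indicator {z. \<bar>z\<bar> > d} z * fejer T z) \<le> k"
    and B: "0 \<le> B" "\<And>y. G m y \<le> B"
  shows "H T m (x + d) \<le> exp (2 * s * d) * G m x + k * B"
proof -
  let ?I = "\<lambda>z. indicator {z. \<bar>z\<bar> > d} z * fejer T z"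
  have fi: "integrable lborel (fejer T)" "(LBINT z. fejer T z) = 1"
    using has_bochner_integral_fejer[OF T] by (auto simp: has_bochner_integral_iff)
  have Ii: "integrable lborel ?I"
    using fi(1) by (rule Bochner_Integration.integrable_bound) (auto simp: indicator_def)
  have le: "fejer T z * G m (x + d + z) \<le> fejer T z * (exp (2 * s * d) * G m x) + ?I z * B" for z
  proof (cases "\<bar>z\<bar> > d")
    case True
    have "fejer T z * G m (x + d + z) \<le> fejer T z * B" using B fejer_nonneg[OF T] by (intro mult_left_mono) auto
    moreover have "0 \<le> fejer T z * (exp (2 * s * d) * G m x)" using fejer_nonneg[OF T, of z] G_nonneg by simp
    ultimately show ?thesis using True by simp
  next
    case False
    have "G m (x + d + z) = G m (x + (d + z))" by (simp add: add.assoc)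
    also have "\<dots> \<le> exp (s * (d + z)) * G m x"
      by (rule G_slowly) (use False in auto)
    also have "\<dots> \<le> exp (2 * s * d) * G m x"
      using mult_left_mono[of "d + z" "2 * d" s] s_pos False by (intro mult_right_mono G_nonneg) (auto simp: mult_ac)
    finally show ?thesis using False fejer_nonneg[OF T, of z] by (auto intro: mult_left_mono)
  qed
  have "H T m (x + d) \<le> (LBINT z. fejer T z * (exp (2 * s * d) * G m x) + ?I z * B)"
    unfolding H_def using fi Ii le by (intro integral_mono fejer_G_int T) auto
  also have "\<dots> = exp (2 * s * d) * G m x + (LBINT z. ?I z) * B" using fi Ii by simp
  also have "\<dots> \<le> exp (2 * s * d) * G m x + k * B" using k B by (intro add_left_mono mult_right_mono)
  finally show ?thesis .
qed

theorem local_limit: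
  assumes "0 < \<epsilon>"
  shows "\<forall>\<^sub>F m in sequentially. \<forall>x. \<bar>sqrt (real m) * G m x - N m x\<bar> \<le> \<epsilon>"
proof -
  define B where "B = Gamma s / (\<sigma> * sqrt (2 * pi))"
  have B0: "0 < B" using Gamma_s_pos \<sigma>_pos by (simp add: B_def)
  obtain L where L: "0 \<le> L" "\<And>m x y. m > 0 \<Longrightarrow> \<bar>N m x - N m y\<bar> \<le> L * \<bar>x - y\<bar> / sqrt (real m)"
    by (rule N_lipschitz) blast
  \<comment> \<open>A single number d serves as width of the window, as bound on the kernel mass
    outside it, and as bound on the Fourier and Lipschitz errors. The loss factor in the upper bound
    is \<open>q d\<close>, the resulting bound on \<open>sqrt m * G\<close> is \<open>M d\<close>,
    and the two null functions below are the final errors from above and from below.\<close>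
  define q where "q d = exp (2 * s * d) / (1 - d)" for d
  define M where "M d = q d * (B + 2 * d)" for d
  have "((\<lambda>d. (q d - 1) * B + 2 * q d * d) \<longlongrightarrow> 0) (at_right 0)"
    unfolding q_def by real_asymp
  then have e1: "\<forall>\<^sub>F d in at_right 0. (q d - 1) * B + 2 * q d * d < \<epsilon>"
    using assms by (intro order_tendstoD(2)) auto
  have "((\<lambda>d. (1 - exp (- 2 * s * d)) * B + 2 * d + d * M d) \<longlongrightarrow> 0) (at_right 0)"
    unfolding M_def q_def by real_asymp
  then have e2: "\<forall>\<^sub>F d in at_right 0. (1 - exp (- 2 * s * d)) * B + 2 * d + d * M d < \<epsilon>"
    using assms by (intro order_tendstoD(2)) auto
  have e3: "\<forall>\<^sub>F d in at_right (0::real). 0 < d \<and> d < 1"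
    by (intro eventually_conj eventually_at_right_less) (auto simp: eventually_at_right_field intro!: exI[of _ 1])
  obtain d where d: "0 < d" "d < 1" "(q d - 1) * B + 2 * q d * d < \<epsilon>"
     "(1 - exp (- 2 * s * d)) * B + 2 * d + d * M d < \<epsilon>"
    using eventually_happens'[OF _ eventually_conj[OF e1 eventually_conj[OF e2 e3]]] by auto
  obtain T where T: "0 < T" "(LBINT z. indicator {z. \<bar>z\<bar> > d} z * fejer T z) \<le> d"
    using fejer_tail[OF d(1) d(1)] by blast
  have "(\<lambda>m. 1 / (2 * pi) * (LBINT x. cmod (ferr T m x))) \<longlonglongrightarrow> 1 / (2 * pi) * 0"
    by (intro tendsto_mult tendsto_const ferr_integral_tendsto T)
  then have ev1: "\<forall>\<^sub>F m in sequentially. 1 / (2 * pi) * (LBINT x. cmod (ferr T m x)) < d"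
    using d by (intro order_tendstoD(2)) auto
  have "(\<lambda>m. L * d / sqrt (real m)) \<longlonglongrightarrow> 0" by real_asymp
  then have ev2: "\<forall>\<^sub>F m in sequentially. L * d / sqrt (real m) < d"
    using d by (intro order_tendstoD(2)) auto
  show ?thesis
    using ev1 ev2 eventually_gt_at_top[of 0]
  proof eventually_elim
    case (elim m)
    let ?r = "sqrt (real m)"
    have r: "0 < ?r" using elim by simp
    have H: "\<bar>?r * H T m x - N m x\<bar> \<le> d" for x
      using H_error[OF T(1), of m x] elim by simp
    have NN: "\<bar>N m x - N m y\<bar> \<le> d" if "\<bar>x - y\<bar> = d" for x y
      using L(2)[of m x y] elim that by simp
    have q0: "0 \<le> q d" "1 \<le> q d" 
    proof -
      have "1 \<le> exp (2 * s * d)" using s_pos d by simp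
      then have "1 - d \<le> exp (2 * s * d)" using d by linarith
      then show "1 \<le> q d" using d by (simp add: q_def)
      then show "0 \<le> q d" by simp
    qed
    have up: "?r * G m x \<le> q d * (N m x + 2 * d)" for x
    proof -
      have "?r * G m x * (1 - d) \<le> exp (2 * s * d) * (?r * H T m (x - d))"
        using mult_left_mono[OF G_upper[OF T(1) less_imp_le[OF d(1)] T(2), of m x], of ?r] r by (simp add: mult_ac)
      also have "?r * H T m (x - d) \<le> N m x + 2 * d" 
        using H[of "x - d"] NN[of "x - d" x] d by auto
      finally show ?thesis using d by (simp add: q_def field_simps)
    qed
    \<comment> \<open>Divided by sqrt m this is the constant B for \<open>G_lower\<close>, so that
      after multiplication by sqrt m the tail costs only \<open>d * M d\<close>.\<close>
    have M: "?r * G m x \<le> M d" for x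
    proof -
      have "q d * (N m x + 2 * d) \<le> M d" unfolding M_def B_def using q0 N_le by (intro mult_left_mono add_mono) auto
      then show ?thesis using up[of x] by linarith
    qed
    have lo: "N m x - 2 * d - d * M d \<le> exp (2 * s * d) * (?r * G m x)" for x
    proof -
      have M0: "0 \<le> M d" using q0 B0 d by (simp add: M_def)
      have "H T m (x + d) \<le> exp (2 * s * d) * G m x + d * (M d / ?r)"
      proof (rule G_lower[OF T(1) less_imp_le[OF d(1)] T(2)])
        show "0 \<le> M d / ?r" using M0 by simp
        show "G m y \<le> M d / ?r" for y using M[of y] r by (simp add: field_simps)
      qed
      from mult_left_mono[OF this less_imp_le[OF r]] have "?r * H T m (x + d) \<le> exp (2 * s * d) * (?r * G m x) + d * M d"
        using r by (simp add: distrib_left mult_ac)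
      then show ?thesis using H[of "x + d"] NN[of "x + d" x] d by auto
    qed
    show ?case
    proof
      fix x
      have Nx: "0 \<le> N m x" "N m x \<le> B" using N_nonneg N_le by (auto simp: B_def)
      have "?r * G m x - N m x \<le> (q d - 1) * N m x + 2 * q d * d"
        using up[of x] by (simp add: algebra_simps)
      also have "(q d - 1) * N m x \<le> (q d - 1) * B" using q0 Nx by (intro mult_left_mono) auto
      finally have 1: "?r * G m x - N m x \<le> \<epsilon>" using d by simp
      have M0: "0 \<le> M d" using q0 B0 d by (simp add: M_def)
      have e: "exp (- 2 * s * d) \<le> 1" "0 < exp (- 2 * s * d)" using s_pos d by auto
      have "exp (- 2 * s * d) * (N m x - 2 * d - d * M d) \<le> exp (- 2 * s * d) * (exp (2 * s * d) * (?r * G m x))"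
        using lo[of x] by (intro mult_left_mono) auto
      also have "\<dots> = ?r * G m x" by (simp add: mult_exp_exp flip: mult.assoc)
      finally have "N m x - ?r * G m x \<le> (1 - exp (- 2 * s * d)) * N m x + exp (- 2 * s * d) * (2 * d + d * M d)"
        by (simp add: algebra_simps)
      also have "\<dots> \<le> (1 - exp (- 2 * s * d)) * B + 1 * (2 * d + d * M d)"
        using e Nx M0 d by (intro add_mono mult_left_mono mult_right_mono) auto
      also have "\<dots> < \<epsilon>" using d by simp
      finally show "\<bar>?r * G m x - N m x\<bar> \<le> \<epsilon>" using 1 by simp
    qed
  qed
qed

end

section \<open>Weighted trees\<close>

type_synonym env = "nat list \<Rightarrow> nat \<Rightarrow> real"

definition pw :: "env \<Rightarrow> nat list \<Rightarrow> real" where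
  "pw x u = (\<Prod>i<length u. x (take i u) (u ! i))"

definition lev :: "nat \<Rightarrow> nat list set" where "lev j = {u. length u = j}"

definition subenv :: "nat list \<Rightarrow> env \<Rightarrow> env" where "subenv v x = (\<lambda>u. x (v @ u))"

text \<open>A resampling device: the subtree at v is exchanged for another environment. Exchanging
  it for an independent one preserves the law (\<open>distr_graft\<close>), so independence of a
  subtree from the rest is expressed by iterated integrals in place of conditional
  expectations.\<close>

definition graft :: "nat list \<Rightarrow> env \<Rightarrow> env \<Rightarrow> env" where
  "graft v x' x = (\<lambda>u. if take (length v) u = v then x' (drop (length v) u) else x u)"

definition alive :: "nat \<Rightarrow> env \<Rightarrow> nat list set" where
  "alive j x = {u. length u = j \<and> 0 < pw x u}"

definition tsum :: "nat \<Rightarrow> (real \<Rightarrow> real) \<Rightarrow> env \<Rightarrow> real" where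
  "tsum j f x = (\<Sum>u\<in>alive j x. f (pw x u))"

text \<open>The extended nonnegative twin of \<open>tsum\<close>: it is measurable and obeys Tonelli
  without any finiteness, whereas \<open>tsum\<close> is 0 on an infinite generation. For good
  environments and nonnegative f the two agree (\<open>tsum_nn_eq_tsum\<close>).\<close>

definition tsum_nn :: "nat \<Rightarrow> (real \<Rightarrow> ennreal) \<Rightarrow> env \<Rightarrow> ennreal" where
  "tsum_nn j f x = (\<integral>\<^sup>+u. (if 0 < pw x u then f (pw x u) else 0) \<partial>count_space (lev j))"

text \<open>The basic almost sure properties of the weights as one deterministic predicate. It is
  inherited by subtrees (\<open>good_subenv\<close>), so path-wise arguments can recurse without
  collecting further null sets.\<close>

definition good :: "env \<Rightarrow> bool" where
  "good x \<longleftrightarrow> (\<forall>u. (\<forall>k. 0 \<le> x u k) \<and> x u sums 1) \<and> (\<forall>v j. finite (alive j (subenv v x)))"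

lemma lev_countable [simp]: "countable (lev j)"
  by (rule countableI_type)

lemma pw_Nil [simp]: "pw x [] = 1" by (simp add: pw_def)

lemma pw_append: "pw x (v @ u) = pw x v * pw (subenv v x) u"
proof -
  have "pw x (v @ u) = (\<Prod>i<length v. x (take i (v @ u)) ((v @ u) ! i)) *
     (\<Prod>i\<in>{length v..<length v + length u}. x (take i (v @ u)) ((v @ u) ! i))"
    unfolding pw_def by (subst prod.union_disjoint[symmetric]) (auto intro!: prod.cong)
  also have "(\<Prod>i<length v. x (take i (v @ u)) ((v @ u) ! i)) = pw x v"
    unfolding pw_def by (intro prod.cong) (auto simp: nth_append)
  also have "(\<Prod>i\<in>{length v..<length v + length u}. x (take i (v @ u)) ((v @ u) ! i)) = pw (subenv v x) u"
    unfolding pw_def subenv_def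
    by (rule prod.reindex_bij_witness[of _ "\<lambda>i. i + length v" "\<lambda>i. i - length v"]) (auto simp: nth_append)
  finally show ?thesis .
qed

lemma pw_single [simp]: "pw x [k] = x [] k" by (simp add: pw_def)

lemma subenv_Nil [simp]: "subenv [] x = x" by (simp add: subenv_def)

lemma subenv_subenv: "subenv u (subenv v x) = subenv (v @ u) x" by (simp add: subenv_def)

lemma subenv_graft [simp]: "subenv v (graft v x' x) = x'"
  by (simp add: subenv_def graft_def)

lemma pw_graft: "length u \<le> length v \<Longrightarrow> pw (graft v x' x) u = pw x u"
  unfolding pw_def graft_def by (intro prod.cong) (auto dest!: arg_cong[where f = length])

lemma subenv_graft_other: "length v' = length v \<Longrightarrow> v' \<noteq> v \<Longrightarrow> subenv v' (graft v x' x) = subenv v' x"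
  by (auto simp: subenv_def graft_def fun_eq_iff)

lemma good_subenv: "good x \<Longrightarrow> good (subenv v x)"
  unfolding good_def subenv_subenv by (auto simp only: subenv_def[of v x])

lemma good_finite: "good x \<Longrightarrow> finite (alive j x)"
  unfolding good_def by (metis subenv_Nil)

lemma good_pw_nonneg: "good x \<Longrightarrow> 0 \<le> pw x u"
  unfolding pw_def good_def by (intro prod_nonneg) auto

lemma good_label_nonneg: "good x \<Longrightarrow> 0 \<le> x u k"
  by (simp add: good_def)

lemma good_le_1: "good x \<Longrightarrow> x u k \<le> 1"
proof -
  assume g: "good x"
  then have s: "x u sums 1" "\<And>k. 0 \<le> x u k" by (auto simp: good_def)
  have "(\<Sum>i\<in>{k}. x u i) \<le> suminf (x u)" using s by (intro sum_le_suminf) (auto simp: sums_iff)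
  then show "x u k \<le> 1" using s by (simp add: sums_iff)
qed

lemma good_pw_le_1: "good x \<Longrightarrow> pw x u \<le> 1"
  unfolding pw_def by (intro prod_le_1) (auto simp: good_le_1 good_def)

text \<open>Only nonnegative labels are assumed, not \<open>good\<close>, because
  \<open>AE_good\<close> uses this split to prove that the generations are finite.\<close>

lemma alive_split:
  assumes nn: "\<And>u k. 0 \<le> x u k"
  shows "alive (k + m) x = (\<Union>v\<in>alive k x. (@) v ` alive m (subenv v x))"
proof (intro equalityI subsetI)
  fix w assume w: "w \<in> alive (k + m) x"
  define v u where "v = take k w" and "u = drop k w"
  have "w = v @ u" "length v = k" "length u = m" using w by (auto simp: v_def u_def alive_def)
  moreover from this have "0 < pw x v * pw (subenv v x) u" using w by (simp add: alive_def pw_append)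
  then have "0 < pw x v" "0 < pw (subenv v x) u"
    using prod_nonneg[of "{..<length v}" "\<lambda>i. x (take i v) (v ! i)"] nn
    by (auto simp: zero_less_mult_iff pw_def[of x v])
  ultimately show "w \<in> (\<Union>v\<in>alive k x. (@) v ` alive m (subenv v x))"
    by (auto simp: alive_def)
qed (auto simp: alive_def pw_append)

lemma tsum_split:
  assumes "good x"
  shows "tsum (k + m) f x = (\<Sum>v\<in>alive k x. tsum m (\<lambda>p. f (pw x v * p)) (subenv v x))"
proof -
  have "tsum (k + m) f x = (\<Sum>v\<in>alive k x. \<Sum>u\<in>(@) v ` alive m (subenv v x). f (pw x u))"
    unfolding tsum_def alive_split[OF good_label_nonneg[OF assms]]
    using good_finite[OF assms] good_finite[OF good_subenv[OF assms]]
    by (intro sum.UNION_disjoint) (auto simp: alive_def)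
  also have "\<dots> = (\<Sum>v\<in>alive k x. tsum m (\<lambda>p. f (pw x v * p)) (subenv v x))"
    unfolding tsum_def
  proof (rule sum.cong[OF refl])
    fix v
    show "(\<Sum>u\<in>(@) v ` alive m (subenv v x). f (pw x u)) = (\<Sum>u\<in>alive m (subenv v x). f (pw x v * pw (subenv v x) u))"
      by (subst sum.reindex) (auto simp: inj_on_def pw_append)
  qed
  finally show ?thesis .
qed

lemma tsum_nn_finite:
  assumes "finite (alive j x)"
  shows "tsum_nn j f x = (\<Sum>u\<in>alive j x. f (pw x u))"
  unfolding tsum_nn_def using assms
  by (subst nn_integral_count_space'[where A = "alive j x"]) (auto simp: lev_def alive_def)

lemma tsum_nn_eq_tsum:
  assumes "finite (alive j x)" "\<And>p. 0 < p \<Longrightarrow> 0 \<le> f p"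
  shows "tsum_nn j (\<lambda>p. ennreal (f p)) x = ennreal (tsum j f x)"
  unfolding tsum_nn_finite[OF assms(1)] tsum_def using assms(2) by (intro sum_ennreal) (auto simp: alive_def)

lemma tsum_nonneg: "(\<And>p. 0 < p \<Longrightarrow> 0 \<le> f p) \<Longrightarrow> 0 \<le> tsum j f x"
  unfolding tsum_def by (intro sum_nonneg) (auto simp: alive_def)

lemma tsum_mono: "(\<And>p. 0 < p \<Longrightarrow> f p \<le> g p) \<Longrightarrow> tsum j f x \<le> tsum j g x"
  unfolding tsum_def by (intro sum_mono) (auto simp: alive_def)

lemma tsum_nn_1: "tsum_nn j (\<lambda>_. 1) x = emeasure (count_space UNIV) (alive j x)"
proof -
  have "tsum_nn j (\<lambda>_. 1) x = (\<integral>\<^sup>+u. indicator (alive j x) u \<partial>count_space (lev j))"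
    unfolding tsum_nn_def by (intro nn_integral_cong) (auto simp: alive_def lev_def)
  also have "\<dots> = emeasure (count_space (lev j)) (alive j x)"
    by (rule nn_integral_indicator) (auto simp: alive_def lev_def)
  also have "\<dots> = emeasure (count_space UNIV) (alive j x)"
    by (simp add: emeasure_count_space alive_def lev_def subset_eq)
  finally show ?thesis .
qed

lemma finite_alive_iff: "finite (alive j x) \<longleftrightarrow> tsum_nn j (\<lambda>_. 1) x < \<infinity>"
  unfolding tsum_nn_1 by (cases "finite (alive j x)") (auto simp: of_nat_less_top)

lemma tsum_nn_0: "tsum_nn 0 f x = f 1"
proof -
  have "lev 0 = {[]}" by (auto simp: lev_def)
  then show ?thesis by (simp add: tsum_nn_def nn_integral_count_space_finite)
qed

lemma bij_lev_1: "bij_betw (\<lambda>k. [k]) UNIV (lev (Suc 0))"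
  by (rule bij_betwI[where g = hd]) (auto simp: lev_def length_Suc_conv)

lemma tsum_nn_1st: "tsum_nn (Suc 0) f x = (\<integral>\<^sup>+k. (if 0 < x [] k then f (x [] k) else 0) \<partial>count_space UNIV)"
  unfolding tsum_nn_def by (subst nn_integral_bij_count_space[OF bij_lev_1, symmetric]) (simp cong: if_cong)

lemma tsum_nn_split:
  assumes "good x"
  shows "tsum_nn (k + m) f x =
    (\<integral>\<^sup>+v. (if 0 < pw x v then tsum_nn m (\<lambda>p. f (pw x v * p)) (subenv v x) else 0) \<partial>count_space (lev k))"
proof -
  have "tsum_nn (k + m) f x = (\<Sum>v\<in>alive k x. \<Sum>u\<in>(@) v ` alive m (subenv v x). f (pw x u))"
    unfolding tsum_nn_finite[OF good_finite[OF assms]] alive_split[OF good_label_nonneg[OF assms]]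
    using good_finite[OF assms] good_finite[OF good_subenv[OF assms]]
    by (intro sum.UNION_disjoint) (auto simp: alive_def)
  also have "\<dots> = (\<Sum>v\<in>alive k x. \<Sum>u\<in>alive m (subenv v x). f (pw x v * pw (subenv v x) u))"
  proof (rule sum.cong[OF refl])
    fix v
    show "(\<Sum>u\<in>(@) v ` alive m (subenv v x). f (pw x u)) = (\<Sum>u\<in>alive m (subenv v x). f (pw x v * pw (subenv v x) u))"
      by (subst sum.reindex) (auto simp: inj_on_def pw_append)
  qed
  also have "\<dots> = (\<Sum>v\<in>alive k x. (if 0 < pw x v then tsum_nn m (\<lambda>p. f (pw x v * p)) (subenv v x) else 0))"
    by (intro sum.cong refl) (auto simp: alive_def tsum_nn_finite[OF good_finite[OF good_subenv[OF assms]]])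
  also have "\<dots> = (\<integral>\<^sup>+v. (if 0 < pw x v then tsum_nn m (\<lambda>p. f (pw x v * p)) (subenv v x) else 0) \<partial>count_space (lev k))"
    using good_finite[OF assms, of k]
    by (subst nn_integral_count_space'[where A = "alive k x"]) (auto simp: lev_def alive_def)
  finally show ?thesis .
qed

lemma borel_measurable_nn_integral_count_space:
  assumes "countable A" "\<And>u. u \<in> A \<Longrightarrow> (\<lambda>x. f x u) \<in> borel_measurable M"
  shows "(\<lambda>x. \<integral>\<^sup>+u. f x u \<partial>count_space A) \<in> borel_measurable M"
proof -
  interpret sigma_finite_measure "count_space A" by (rule sigma_finite_measure_count_space_countable) fact
  have "(\<lambda>z. f (snd z) (fst z)) \<in> borel_measurable (count_space A \<Otimes>\<^sub>M M)"
    by (rule measurable_pair_measure_countable1) (use assms in auto)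
  then have "(\<lambda>(x, u). f x u) \<in> borel_measurable (M \<Otimes>\<^sub>M count_space A)"
    by (subst measurable_pair_swap_iff) (simp add: split_beta')
  then show ?thesis by (rule borel_measurable_nn_integral)
qed

section \<open>The law of the environment and the branching property\<close>

locale tree = prob_space \<rho> for \<rho> :: "(nat \<Rightarrow> real) measure" +
  assumes sets_\<rho> [measurable_cong]: "sets \<rho> = sets (Pi\<^sub>M UNIV (\<lambda>_. borel))"
begin

definition E :: "env measure" where "E = Pi\<^sub>M UNIV (\<lambda>_. \<rho>)"

sublocale P: product_prob_space "\<lambda>_::nat list. \<rho>" UNIV ..

sublocale E: prob_space E unfolding E_def by (rule P.prob_space_axioms)

sublocale EE: pair_prob_space E E ..

lemma space_\<rho> [simp]: "space \<rho> = UNIV"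
  using sets_eq_imp_space_eq[OF sets_\<rho>] by (simp add: space_PiM)

lemma space_E [simp]: "space E = UNIV"
  by (simp add: E_def space_PiM)

lemma label_measurable [measurable]: "(\<lambda>y. y k) \<in> borel_measurable \<rho>"
  by measurable

lemma coord_measurable_\<rho> [measurable]: "(\<lambda>x. x u) \<in> measurable E \<rho>"
  unfolding E_def by (rule measurable_component_singleton) simp

lemma coord_measurable [measurable]: "(\<lambda>x. x u k) \<in> borel_measurable E"
  using measurable_compose[OF coord_measurable_\<rho> label_measurable] .

lemma into_E: "(\<And>u. (\<lambda>x. f x u) \<in> measurable M \<rho>) \<Longrightarrow> f \<in> measurable M E"
  unfolding E_def by (rule measurable_abs_UNIV)

lemma subenv_measurable [measurable]: "subenv v \<in> measurable E E"
  by (rule into_E) (simp add: subenv_def)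

lemma graft_measurable [measurable]: "(\<lambda>(x', x). graft v x' x) \<in> measurable (E \<Otimes>\<^sub>M E) E"
proof (rule into_E)
  fix u
  show "(\<lambda>z. (case z of (x', x) \<Rightarrow> graft v x' x) u) \<in> E \<Otimes>\<^sub>M E \<rightarrow>\<^sub>M \<rho>"
    by (cases "take (length v) u = v") (simp_all add: graft_def split_beta')
qed

lemma pw_measurable [measurable]: "(\<lambda>x. pw x u) \<in> borel_measurable E"
  unfolding pw_def by measurable

text \<open>It is enough to compare cylinder sets. The finite index set splits into the words
  extending v, which read the new environment after v is stripped off, and the others, which read
  the old one; the two probabilities multiply to the product over all indices.\<close>

lemma distr_graft: "distr (E \<Otimes>\<^sub>M E) E (\<lambda>(x', x). graft v x' x) = E" (is "?D = _")
proof -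
  have "?D = Pi\<^sub>M UNIV (\<lambda>_. \<rho>)"
  proof (rule P.PiM_eq)
    show "sets ?D = sets (Pi\<^sub>M UNIV (\<lambda>_. \<rho>))" by (simp add: E_def)
    fix J :: "nat list set" and F assume J: "finite J" and F: "\<And>j. j \<in> J \<Longrightarrow> F j \<in> sets \<rho>"
    define J1 where "J1 = {u\<in>J. take (length v) u = v}"
    define J2 where "J2 = {u\<in>J. take (length v) u \<noteq> v}"
    have J12: "finite J1" "finite J2" "J = J1 \<union> J2" "J1 \<inter> J2 = {}" using J by (auto simp: J1_def J2_def)
    have inj: "inj_on (drop (length v)) J1"
    proof (rule inj_onI)
      fix u w assume "u \<in> J1" "w \<in> J1" "drop (length v) u = drop (length v) w"
      then show "u = w" by (metis (mono_tags, lifting) J1_def append_take_drop_id mem_Collect_eq)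
    qed
    let ?J1 = "drop (length v) ` J1"
    let ?F = "\<lambda>w. F (v @ w)"
    have vJ: "v @ drop (length v) u = u" if "u \<in> J1" for u using that by (auto simp: J1_def) (metis append_take_drop_id)
    have cyl: "{x\<in>space E. \<forall>i\<in>K. x i \<in> F' i} \<in> sets E" if "finite K" "\<And>i. i \<in> K \<Longrightarrow> F' i \<in> sets \<rho>" for K F'
    proof (rule sets.sets_Collect_finite_All[OF _ that(1)])
      fix i assume "i \<in> K"
      then have [measurable]: "F' i \<in> sets \<rho>" by (rule that(2))
      show "{x\<in>space E. x i \<in> F' i} \<in> sets E" by measurable
    qed
    let ?A = "{x\<in>space E. \<forall>i\<in>?J1. x i \<in> ?F i}"
    let ?B = "{x\<in>space E. \<forall>i\<in>J2. x i \<in> F i}"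
    have A: "emeasure E ?A = (\<Prod>i\<in>?J1. emeasure \<rho> (?F i))"
      unfolding E_def by (rule P.emeasure_PiM_Collect) (use J12 F vJ in auto)
    have B: "emeasure E ?B = (\<Prod>i\<in>J2. emeasure \<rho> (F i))"
      unfolding E_def by (rule P.emeasure_PiM_Collect) (use J12 F in auto)
    have mA: "?A \<in> sets E" "?B \<in> sets E"
      by (rule cyl; use J12 F vJ in auto)+
    have "emeasure ?D (prod_emb UNIV (\<lambda>_. \<rho>) J (Pi\<^sub>E J F)) =
      emeasure (E \<Otimes>\<^sub>M E) ((\<lambda>(x', x). graft v x' x) -` prod_emb UNIV (\<lambda>_. \<rho>) J (Pi\<^sub>E J F) \<inter> space (E \<Otimes>\<^sub>M E))"
    proof (rule emeasure_distr[OF graft_measurable])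
      show "prod_emb UNIV (\<lambda>_. \<rho>) J (Pi\<^sub>E J F) \<in> sets E"
        unfolding E_def using J F by (intro sets_PiM_I) auto
    qed
    also have "(\<lambda>(x', x). graft v x' x) -` prod_emb UNIV (\<lambda>_. \<rho>) J (Pi\<^sub>E J F) \<inter> space (E \<Otimes>\<^sub>M E) = ?A \<times> ?B"
    proof -
      have "(\<forall>u\<in>J. graft v x' x u \<in> F u) \<longleftrightarrow> (\<forall>u\<in>J1. x' (drop (length v) u) \<in> F u) \<and> (\<forall>u\<in>J2. x u \<in> F u)" for x' x
        by (auto simp: graft_def J1_def J2_def)
      moreover have "(\<forall>u\<in>J1. x' (drop (length v) u) \<in> F u) \<longleftrightarrow> (\<forall>i\<in>?J1. x' i \<in> ?F i)" for x'
        using vJ by auto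
      ultimately show ?thesis
        by (auto simp: prod_emb_def space_pair_measure PiE_iff)
    qed
    also have "emeasure (E \<Otimes>\<^sub>M E) (?A \<times> ?B) = emeasure E ?A * emeasure E ?B"
      by (rule E.emeasure_pair_measure_Times) (use mA in auto)
    also have "(\<Prod>i\<in>?J1. emeasure \<rho> (?F i)) = (\<Prod>i\<in>J1. emeasure \<rho> (F i))"
      using vJ by (subst prod.reindex[OF inj]) (auto intro!: prod.cong)
    then have "emeasure E ?A * emeasure E ?B = (\<Prod>i\<in>J1. emeasure \<rho> (F i)) * (\<Prod>i\<in>J2. emeasure \<rho> (F i))"
      by (simp only: A B)
    also have "\<dots> = (\<Prod>j\<in>J. emeasure \<rho> (F j))"
      unfolding J12(3) by (rule prod.union_disjoint[symmetric]) (use J12 in auto)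
    finally show "emeasure ?D (prod_emb UNIV (\<lambda>_. \<rho>) J (Pi\<^sub>E J F)) = (\<Prod>j\<in>J. emeasure \<rho> (F j))" .
  qed
  then show ?thesis by (simp add: E_def)
qed

lemma nn_integral_graft:
  assumes [measurable]: "F \<in> borel_measurable E"
  shows "(\<integral>\<^sup>+x. F x \<partial>E) = (\<integral>\<^sup>+x. \<integral>\<^sup>+x'. F (graft v x' x) \<partial>E \<partial>E)"
proof -
  have "(\<integral>\<^sup>+x. F x \<partial>E) = (\<integral>\<^sup>+x. F x \<partial>distr (E \<Otimes>\<^sub>M E) E (\<lambda>(x', x). graft v x' x))"
    by (simp only: distr_graft)
  also have "\<dots> = (\<integral>\<^sup>+z. F (case z of (x', x) \<Rightarrow> graft v x' x) \<partial>(E \<Otimes>\<^sub>M E))"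
    by (rule nn_integral_distr) measurable
  also have "\<dots> = (\<integral>\<^sup>+x. \<integral>\<^sup>+x'. F (case (x', x) of (x', x) \<Rightarrow> graft v x' x) \<partial>E \<partial>E)"
    by (rule EE.nn_integral_snd[symmetric]) measurable
  finally show ?thesis by simp
qed

lemma distr_subenv: "distr E E (subenv v) = E"
proof (rule measure_eqI)
  fix A assume A: "A \<in> sets (distr E E (subenv v))"
  then have [measurable]: "A \<in> sets E" by simp
  have "emeasure (distr E E (subenv v)) A = (\<integral>\<^sup>+x. indicator A (subenv v x) \<partial>E)"
    by (subst nn_integral_indicator[symmetric], simp, subst nn_integral_distr) auto
  also have "\<dots> = (\<integral>\<^sup>+x. \<integral>\<^sup>+x'. indicator A (subenv v (graft v x' x)) \<partial>E \<partial>E)"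
    by (rule nn_integral_graft) measurable
  also have "\<dots> = emeasure E A" by (simp add: E.emeasure_space_1[simplified])
  finally show "emeasure (distr E E (subenv v)) A = emeasure E A" .
qed simp

lemma AE_subenv: "AE x in E. P x \<Longrightarrow> AE x in E. P (subenv v x)"
  using AE_distrD[OF subenv_measurable[of v], of P] unfolding distr_subenv .

lemma tsum_nn_measurable [measurable]:
  assumes [measurable]: "f \<in> borel_measurable borel"
  shows "tsum_nn j f \<in> borel_measurable E"
  unfolding tsum_nn_def[abs_def]
  by (rule borel_measurable_nn_integral_count_space) auto

text \<open>Each subtree hanging at generation k may be replaced by an independent copy, because
  \<open>pw x v\<close> is determined by labels strictly above v and is unaffected by grafting at
  v.\<close>

lemma branch_nn:
  assumes [measurable]: "case_prod \<Phi> \<in> borel_measurable (borel \<Otimes>\<^sub>M E)"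
  shows "(\<integral>\<^sup>+x. \<integral>\<^sup>+v. (if 0 < pw x v then \<Phi> (pw x v) (subenv v x) else 0) \<partial>count_space (lev k) \<partial>E)
    = (\<integral>\<^sup>+x. tsum_nn k (\<lambda>q. \<integral>\<^sup>+x'. \<Phi> q x' \<partial>E) x \<partial>E)"
proof -
  have "(\<integral>\<^sup>+x. \<integral>\<^sup>+v. (if 0 < pw x v then \<Phi> (pw x v) (subenv v x) else 0) \<partial>count_space (lev k) \<partial>E)
     = (\<integral>\<^sup>+v. \<integral>\<^sup>+x. (if 0 < pw x v then \<Phi> (pw x v) (subenv v x) else 0) \<partial>E \<partial>count_space (lev k))"
    by (rule nn_integral_count_space_nn_integral) auto
  also have "\<dots> = (\<integral>\<^sup>+v. \<integral>\<^sup>+x. (if 0 < pw x v then \<integral>\<^sup>+x'. \<Phi> (pw x v) x' \<partial>E else 0) \<partial>E \<partial>count_space (lev k))"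
  proof (rule nn_integral_cong)
    fix v
    have "(\<integral>\<^sup>+x. (if 0 < pw x v then \<Phi> (pw x v) (subenv v x) else 0) \<partial>E)
      = (\<integral>\<^sup>+x. \<integral>\<^sup>+x'. (if 0 < pw (graft v x' x) v then \<Phi> (pw (graft v x' x) v) (subenv v (graft v x' x)) else 0) \<partial>E \<partial>E)"
      by (rule nn_integral_graft) measurable
    also have "\<dots> = (\<integral>\<^sup>+x. (if 0 < pw x v then \<integral>\<^sup>+x'. \<Phi> (pw x v) x' \<partial>E else 0) \<partial>E)"
      by (intro nn_integral_cong) (auto simp: pw_graft)
    finally show "(\<integral>\<^sup>+x. (if 0 < pw x v then \<Phi> (pw x v) (subenv v x) else 0) \<partial>E)
      = (\<integral>\<^sup>+x. (if 0 < pw x v then \<integral>\<^sup>+x'. \<Phi> (pw x v) x' \<partial>E else 0) \<partial>E)" .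
  qed
  also have "\<dots> = (\<integral>\<^sup>+x. \<integral>\<^sup>+v. (if 0 < pw x v then \<integral>\<^sup>+x'. \<Phi> (pw x v) x' \<partial>E else 0) \<partial>count_space (lev k) \<partial>E)"
    by (rule nn_integral_count_space_nn_integral[symmetric]) auto
  finally show ?thesis by (simp add: tsum_nn_def)
qed

text \<open>Integration against the intensity measure of the positive first-generation
  weights.\<close>

definition Q :: "(real \<Rightarrow> ennreal) \<Rightarrow> ennreal" where
  "Q f = (\<integral>\<^sup>+y. \<integral>\<^sup>+k. (if 0 < y k then f (y k) else 0) \<partial>count_space UNIV \<partial>\<rho>)"

lemma expect_tsum_nn_1:
  assumes [measurable]: "f \<in> borel_measurable borel"
  shows "(\<integral>\<^sup>+x. tsum_nn (Suc 0) f x \<partial>E) = Q f"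
proof -
  have m: "(\<lambda>y. \<integral>\<^sup>+k. (if 0 < y k then f (y k) else 0) \<partial>count_space UNIV) \<in> borel_measurable \<rho>"
    by (rule borel_measurable_nn_integral_count_space) auto
  have "Q f = (\<integral>\<^sup>+y. \<integral>\<^sup>+k. (if 0 < y k then f (y k) else 0) \<partial>count_space UNIV \<partial>distr E \<rho> (\<lambda>x. x []))"
    unfolding Q_def E_def using P.PiM_component[of "[]"] by simp
  also have "\<dots> = (\<integral>\<^sup>+x. \<integral>\<^sup>+k. (if 0 < x [] k then f (x [] k) else 0) \<partial>count_space UNIV \<partial>E)"
    by (rule nn_integral_distr) (use m in auto)
  finally show ?thesis by (simp add: tsum_nn_1st)
qed

end

section \<open>A von Bahr--Esseen inequality on the tree\<close>

lemma powr_add_le_powr: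
  fixes a b \<alpha> :: real
  assumes "0 \<le> a" "0 \<le> b" "0 < \<alpha>" "\<alpha> \<le> 1"
  shows "(a + b) powr \<alpha> \<le> a powr \<alpha> + b powr \<alpha>"
proof (cases "a = 0 \<or> b = 0")
  case False
  then have ab: "0 < a" "0 < b" using assms by auto
  have "(a + b) powr \<alpha> = a * (a + b) powr (\<alpha> - 1) + b * (a + b) powr (\<alpha> - 1)"
    using ab powr_mult_base[of "a + b" "\<alpha> - 1"] by (simp add: distrib_right)
  also have "\<dots> \<le> a * a powr (\<alpha> - 1) + b * b powr (\<alpha> - 1)"
    using ab assms by (intro add_mono mult_left_mono powr_mono2') auto
  also have "\<dots> = a powr \<alpha> + b powr \<alpha>" using ab by (simp add: powr_diff)
  finally show ?thesis .
qed (use assms in auto)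

text \<open>On each of the ranges u >= 0, -1 <= u < 0 and u < -1 the difference of the two sides has
  a nonnegative derivative in |u|, by subadditivity or monotonicity of the power r - 1 <= 1. The
  linear term is kept explicit because it integrates to zero for centred variables.\<close>

lemma abs_powr_one_plus_le:
  fixes r u :: real
  assumes r: "1 < r" "r \<le> 2"
  shows "\<bar>1 + u\<bar> powr r \<le> 1 + r * u + 2 * \<bar>u\<bar> powr r"
proof -
  have mono: "h b \<ge> 0" if "h a \<ge> 0" "a \<le> b" "continuous_on {a..b} h"
      "\<And>x. a < x \<Longrightarrow> x < b \<Longrightarrow> \<exists>y. DERIV h x :> y \<and> y \<ge> 0" for h :: "real \<Rightarrow> real" and a b
    using DERIV_nonneg_imp_increasing_open[of a b h] that by (meson order_trans)
  have pos: "\<exists>y. DERIV h x :> y \<and> y \<ge> 0" if "DERIV h x :> d" "0 \<le> d" for h :: "real \<Rightarrow> real" and x d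
    using that by blast
  have sub: "(p + q) powr (r - 1) \<le> p powr (r - 1) + q powr (r - 1)" if "0 \<le> p" "0 \<le> q" for p q
    using powr_add_le_powr[of p q "r - 1"] that r by simp
  consider "0 \<le> u" | "-1 \<le> u" "u < 0" | "u < -1" by linarith
  then show ?thesis
  proof cases
    case 1
    define h where "h x = 1 + r * x + 2 * x powr r - (1 + x) powr r" for x
    have "h u \<ge> 0"
    proof (rule mono[of h 0])
      show "continuous_on {0..u} h" unfolding h_def using r by (intro continuous_on_diff continuous_on_add continuous_on_mult continuous_on_const continuous_on_id continuous_on_powr') auto
      fix x :: real assume x: "0 < x"
      have "DERIV h x :> r + 2 * (r * x powr (r - 1)) - r * (1 + x) powr (r - 1)"
        unfolding h_def using x by (auto intro!: derivative_eq_intros simp: mult_ac)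
      moreover have "r * (1 + x) powr (r - 1) \<le> r * (1 + x powr (r - 1))"
        using sub[of 1 x] x r by (intro mult_left_mono) auto
      moreover have "0 \<le> r * x powr (r - 1)" using r by simp
      ultimately show "\<exists>y. DERIV h x :> y \<and> y \<ge> 0" by - (erule pos, simp add: algebra_simps)
    qed (use 1 in \<open>auto simp: h_def\<close>)
    then show ?thesis using 1 by (simp add: h_def)
  next
    case 2
    define h where "h x = 1 - r * x + 2 * x powr r - (1 - x) powr r" for x
    have "h (- u) \<ge> 0"
    proof (rule mono[of h 0])
      show "continuous_on {0..-u} h" unfolding h_def using r 2 by (intro continuous_on_diff continuous_on_add continuous_on_mult continuous_on_const continuous_on_id continuous_on_powr') auto
      fix x :: real assume x: "0 < x" "x < - u"
      have "DERIV h x :> - r + 2 * (r * x powr (r - 1)) + r * (1 - x) powr (r - 1)"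
        unfolding h_def using x 2 by (auto intro!: derivative_eq_intros simp: mult_ac)
      moreover have "r * 1 \<le> r * (x powr (r - 1) + (1 - x) powr (r - 1))"
        using sub[of x "1 - x"] x r 2 by (intro mult_left_mono) auto
      moreover have "0 \<le> r * x powr (r - 1)" using r by simp
      ultimately show "\<exists>y. DERIV h x :> y \<and> y \<ge> 0" by - (erule pos, simp add: algebra_simps)
    qed (use 2 in \<open>auto simp: h_def\<close>)
    then show ?thesis using 2 by (simp add: h_def)
  next
    case 3
    define h where "h x = 1 - r * x + 2 * x powr r - (x - 1) powr r" for x
    have "h (- u) \<ge> 0"
    proof (rule mono[of h 1])
      show "continuous_on {1..-u} h" unfolding h_def using r 3 by (intro continuous_on_diff continuous_on_add continuous_on_mult continuous_on_const continuous_on_id continuous_on_powr') auto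
      fix x :: real assume x: "1 < x" "x < - u"
      have "DERIV h x :> - r + 2 * (r * x powr (r - 1)) - r * (x - 1) powr (r - 1)"
        unfolding h_def using x 3 by (auto intro!: derivative_eq_intros simp: mult_ac)
      moreover have "r * 1 \<le> r * x powr (r - 1)"
        using x r by (intro mult_left_mono ge_one_powr_ge_zero) auto
      moreover have "r * (x - 1) powr (r - 1) \<le> r * x powr (r - 1)"
        using x r by (intro mult_left_mono powr_mono2) auto
      ultimately show "\<exists>y. DERIV h x :> y \<and> y \<ge> 0" by - (erule pos, simp add: algebra_simps)
    qed (use 3 r in \<open>auto simp: h_def\<close>)
    moreover have "\<bar>1 + u\<bar> = - u - 1" "\<bar>u\<bar> = - u" using 3 by auto
    ultimately show ?thesis by (simp add: h_def)
  qed
qed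

lemma abs_powr_add_le:
  fixes r y z :: real
  assumes r: "1 < r" "r \<le> 2"
  shows "\<bar>y + z\<bar> powr r \<le> \<bar>y\<bar> powr r + r * sgn y * \<bar>y\<bar> powr (r - 1) * z + 2 * \<bar>z\<bar> powr r"
proof (cases "y = 0")
  case True then show ?thesis by simp
next
  case False
  have "\<bar>y + z\<bar> powr r = \<bar>y\<bar> powr r * \<bar>1 + z / y\<bar> powr r"
  proof -
    have "y + z = y * (1 + z / y)" using False by (simp add: field_simps)
    then have "\<bar>y + z\<bar> = \<bar>y\<bar> * \<bar>1 + z / y\<bar>" by (metis abs_mult)
    then show ?thesis by (simp add: powr_mult)
  qed
  also have "\<dots> \<le> \<bar>y\<bar> powr r * (1 + r * (z / y) + 2 * \<bar>z / y\<bar> powr r)"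
    by (intro mult_left_mono abs_powr_one_plus_le r) auto
  also have "\<dots> = \<bar>y\<bar> powr r + r * (\<bar>y\<bar> powr r / y) * z + 2 * \<bar>z\<bar> powr r"
    using False by (simp add: field_simps powr_divide)
  also have "\<bar>y\<bar> powr r / y = sgn y * \<bar>y\<bar> powr (r - 1)"
    using False by (cases "y > 0") (auto simp: powr_diff sgn_if field_simps)
  finally show ?thesis by (simp add: mult.assoc)
qed

lemma (in prob_space) centered_powr_le:
  fixes f :: "'a \<Rightarrow> real"
  assumes r: "1 < r" "r \<le> 2" and f: "integrable M f" "expectation f = 0"
  shows "(\<integral>\<^sup>+x. ennreal (\<bar>y + f x\<bar> powr r) \<partial>M) \<le> ennreal (\<bar>y\<bar> powr r) + 2 * (\<integral>\<^sup>+x. ennreal (\<bar>f x\<bar> powr r) \<partial>M)"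
proof (cases "(\<integral>\<^sup>+x. ennreal (\<bar>f x\<bar> powr r) \<partial>M) = \<infinity>")
  case True then show ?thesis by (simp add: ennreal_mult_top)
next
  case False
  have [measurable]: "f \<in> borel_measurable M" using f by auto
  have i: "integrable M (\<lambda>x. \<bar>f x\<bar> powr r)"
    using False by (intro integrableI_nonneg) (auto simp: less_top)
  let ?g = "\<lambda>x. \<bar>y\<bar> powr r + r * sgn y * \<bar>y\<bar> powr (r - 1) * f x + 2 * \<bar>f x\<bar> powr r"
  have gi: "integrable M ?g" using f i by simp
  have g0: "0 \<le> ?g x" for x using abs_powr_add_le[OF r, of y "f x"] powr_ge_zero order_trans by blast
  have "(\<integral>\<^sup>+x. ennreal (\<bar>y + f x\<bar> powr r) \<partial>M) \<le> (\<integral>\<^sup>+x. ennreal (?g x) \<partial>M)"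
    by (intro nn_integral_mono ennreal_leI abs_powr_add_le r)
  also have "\<dots> = ennreal (expectation ?g)"
    by (rule nn_integral_eq_integral[OF gi]) (use g0 in auto)
  also have "expectation ?g = \<bar>y\<bar> powr r + 2 * expectation (\<lambda>x. \<bar>f x\<bar> powr r)"
    using f i by (simp add: prob_space)
  also have "ennreal \<dots> = ennreal (\<bar>y\<bar> powr r) + 2 * ennreal (expectation (\<lambda>x. \<bar>f x\<bar> powr r))"
    by (simp add: ennreal_plus ennreal_mult)
  also have "ennreal (expectation (\<lambda>x. \<bar>f x\<bar> powr r)) = (\<integral>\<^sup>+x. ennreal (\<bar>f x\<bar> powr r) \<partial>M)"
    by (rule nn_integral_eq_integral[symmetric, OF i]) auto
  finally show ?thesis .
qed

context tree
begin

lemma tsum_measurable: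
  assumes [measurable]: "f \<in> borel_measurable borel" and "\<And>p. 0 < p \<Longrightarrow> 0 \<le> f p"
  shows "tsum j f \<in> borel_measurable E"
proof -
  have "tsum j f = (\<lambda>x. if tsum_nn j (\<lambda>_. 1) x < \<infinity> then enn2real (tsum_nn j (\<lambda>p. ennreal (f p)) x) else 0)"
  proof
    fix x
    show "tsum j f x = (if tsum_nn j (\<lambda>_. 1) x < \<infinity> then enn2real (tsum_nn j (\<lambda>p. ennreal (f p)) x) else 0)"
    proof (cases "finite (alive j x)")
      case True
      then show ?thesis using tsum_nn_eq_tsum[OF True, of f] tsum_nonneg[of f j x] assms(2)
        by (simp add: finite_alive_iff)
    next
      case False then show ?thesis using finite_alive_iff[of j x] by (simp add: tsum_def)
    qed
  qed
  then show ?thesis by simp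
qed

text \<open>Induction on the set of words. The contribution of the words treated so far does not
  change under grafting at the new word, so the inner integral over the grafted environment sees a
  constant plus a centred variable, and \<open>centered_powr_le\<close> applies.\<close>

lemma vbe_finite:
  fixes Y :: "env \<Rightarrow> real" and F :: "real \<Rightarrow> env \<Rightarrow> real"
  assumes r: "1 < r" "r \<le> 2" and [measurable]: "Y \<in> borel_measurable E" "B \<in> borel_measurable borel"
    and F [measurable]: "case_prod F \<in> borel_measurable (borel \<Otimes>\<^sub>M E)"
    and inv: "\<And>v x' x. length v = k \<Longrightarrow> Y (graft v x' x) = Y x"
    and int: "\<And>q. 0 < q \<Longrightarrow> integrable E (F q)" and cent: "\<And>q. 0 < q \<Longrightarrow> E.expectation (F q) = 0"
    and bd: "\<And>q. 0 < q \<Longrightarrow> (\<integral>\<^sup>+x. ennreal (\<bar>F q x\<bar> powr r) \<partial>E) \<le> B q"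
    and S: "finite S" "S \<subseteq> lev k"
  shows "(\<integral>\<^sup>+x. ennreal (\<bar>Y x + (\<Sum>v\<in>S. if 0 < pw x v then F (pw x v) (subenv v x) else 0)\<bar> powr r) \<partial>E)
    \<le> (\<integral>\<^sup>+x. ennreal (\<bar>Y x\<bar> powr r) \<partial>E) + 2 * (\<integral>\<^sup>+x. (\<Sum>v\<in>S. if 0 < pw x v then B (pw x v) else 0) \<partial>E)"
  using S
proof (induction S)
  case empty then show ?case by simp
next
  case (insert v S)
  define Z where "Z x = Y x + (\<Sum>v\<in>S. if 0 < pw x v then F (pw x v) (subenv v x) else 0)" for x
  have [measurable]: "Z \<in> borel_measurable E" unfolding Z_def by measurable
  have v: "length v = k" using insert by (auto simp: lev_def)
  have Zinv: "Z (graft v x' x) = Z x" for x' x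
    unfolding Z_def inv[OF v]
  proof (intro arg_cong2[where f = "(+)"] refl sum.cong)
    fix w assume "w \<in> S"
    then have w: "length w = length v" "w \<noteq> v" using insert v by (auto simp: lev_def)
    have "pw (graft v x' x) w = pw x w" using w by (intro pw_graft) simp
    moreover have "subenv w (graft v x' x) = subenv w x" by (rule subenv_graft_other) (use w in auto)
    ultimately show "(if 0 < pw (graft v x' x) w then F (pw (graft v x' x) w) (subenv w (graft v x' x)) else 0)
      = (if 0 < pw x w then F (pw x w) (subenv w x) else 0)" by (simp only:)
  qed
  have "(\<integral>\<^sup>+x. ennreal (\<bar>Y x + (\<Sum>v\<in>insert v S. if 0 < pw x v then F (pw x v) (subenv v x) else 0)\<bar> powr r) \<partial>E)
      = (\<integral>\<^sup>+x. ennreal (\<bar>Z x + (if 0 < pw x v then F (pw x v) (subenv v x) else 0)\<bar> powr r) \<partial>E)"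
    using insert by (simp add: Z_def algebra_simps)
  also have "\<dots> = (\<integral>\<^sup>+x. \<integral>\<^sup>+x'. ennreal (\<bar>Z x + (if 0 < pw x v then F (pw x v) x' else 0)\<bar> powr r) \<partial>E \<partial>E)"
    by (subst nn_integral_graft[where v = v]) (auto simp: Zinv pw_graft cong: if_cong)
  also have "\<dots> \<le> (\<integral>\<^sup>+x. ennreal (\<bar>Z x\<bar> powr r) + 2 * (if 0 < pw x v then B (pw x v) else 0) \<partial>E)"
  proof (rule nn_integral_mono)
    fix x
    show "(\<integral>\<^sup>+x'. ennreal (\<bar>Z x + (if 0 < pw x v then F (pw x v) x' else 0)\<bar> powr r) \<partial>E)
      \<le> ennreal (\<bar>Z x\<bar> powr r) + 2 * (if 0 < pw x v then B (pw x v) else 0)"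
    proof (cases "0 < pw x v")
      case True
      have "(\<integral>\<^sup>+x'. ennreal (\<bar>Z x + F (pw x v) x'\<bar> powr r) \<partial>E)
        \<le> ennreal (\<bar>Z x\<bar> powr r) + 2 * (\<integral>\<^sup>+x'. ennreal (\<bar>F (pw x v) x'\<bar> powr r) \<partial>E)"
        by (rule E.centered_powr_le[OF r int[OF True] cent[OF True]])
      also have "\<dots> \<le> ennreal (\<bar>Z x\<bar> powr r) + 2 * B (pw x v)"
        by (intro add_left_mono mult_left_mono bd True) auto
      finally show ?thesis using True by simp
    next
      case False then show ?thesis by (simp add: E.emeasure_space_1[simplified])
    qed
  qed
  also have "\<dots> = (\<integral>\<^sup>+x. ennreal (\<bar>Z x\<bar> powr r) \<partial>E) + 2 * (\<integral>\<^sup>+x. (if 0 < pw x v then B (pw x v) else 0) \<partial>E)"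
    by (simp add: nn_integral_add nn_integral_cmult)
  also have "\<dots> \<le> (\<integral>\<^sup>+x. ennreal (\<bar>Y x\<bar> powr r) \<partial>E) + 2 * (\<integral>\<^sup>+x. (\<Sum>v\<in>S. if 0 < pw x v then B (pw x v) else 0) \<partial>E)
      + 2 * (\<integral>\<^sup>+x. (if 0 < pw x v then B (pw x v) else 0) \<partial>E)"
    using insert.IH insert.prems unfolding Z_def by (intro add_right_mono) auto
  also have "\<dots> = (\<integral>\<^sup>+x. ennreal (\<bar>Y x\<bar> powr r) \<partial>E) + 2 * (\<integral>\<^sup>+x. (\<Sum>v\<in>insert v S. if 0 < pw x v then B (pw x v) else 0) \<partial>E)"
    using insert by (simp add: nn_integral_add distrib_left add_ac)
  finally show ?case .
qed

end

section \<open>Moments of the generations\<close>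

locale tree_pos = tree +
  assumes AE_\<rho>: "AE y in \<rho>. (\<forall>k. 0 \<le> y k) \<and> y sums 1"
begin

lemma label_pair_measurable [measurable]: "(\<lambda>z. fst z (snd z)) \<in> borel_measurable (\<rho> \<Otimes>\<^sub>M count_space UNIV)"
  by (rule measurable_compose_countable[where f = "\<lambda>i z. fst z i"]) measurable

lemma Q_cong: "(\<And>p. 0 < p \<Longrightarrow> f p = g p) \<Longrightarrow> Q f = Q g"
  unfolding Q_def by (intro nn_integral_cong) auto

lemma Q_mono: "(\<And>p. 0 < p \<Longrightarrow> p \<le> 1 \<Longrightarrow> f p \<le> g p) \<Longrightarrow> Q f \<le> Q g"
proof -
  assume le: "\<And>p. 0 < p \<Longrightarrow> p \<le> 1 \<Longrightarrow> f p \<le> g p"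
  show ?thesis
    unfolding Q_def
  proof (rule nn_integral_mono_AE)
    show "AE y in \<rho>. (\<integral>\<^sup>+ k. (if 0 < y k then f (y k) else 0) \<partial>count_space UNIV) \<le> (\<integral>\<^sup>+ k. (if 0 < y k then g (y k) else 0) \<partial>count_space UNIV)"
      using AE_\<rho>
    proof eventually_elim
      case (elim y)
      have "y k \<le> 1" for k
      proof -
        have "(\<Sum>i\<in>{k}. y i) \<le> suminf y" using elim by (intro sum_le_suminf) (auto simp: sums_iff)
        then show ?thesis using elim by (simp add: sums_iff)
      qed
      then show ?case by (intro nn_integral_mono) (auto intro: le)
    qed
  qed
qed

definition Mom :: "real \<Rightarrow> ennreal" where "Mom s = Q (\<lambda>p. ennreal (p powr s))"

lemma Mom_antimono: "s \<le> t \<Longrightarrow> Mom t \<le> Mom s"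
  unfolding Mom_def by (intro Q_mono ennreal_leI) (simp add: powr_mono')

end

locale tree_env = tree_pos +
  assumes Q1: "Q (\<lambda>_. 1) < \<infinity>"
begin

lemma AE_good: "AE x in E. good x"
proof -
  have "AE x in E. (\<forall>k. 0 \<le> x u k) \<and> x u sums 1" for u
    unfolding E_def by (rule P.AE_component[OF _ AE_\<rho>]) simp
  then have 1: "AE x in E. \<forall>u. (\<forall>k. 0 \<le> x u k) \<and> x u sums 1"
    by (subst AE_all_countable) auto
  have "(\<integral>\<^sup>+x. tsum_nn (Suc 0) (\<lambda>_. 1) x \<partial>E) \<noteq> \<infinity>"
    using expect_tsum_nn_1[of "\<lambda>_. 1"] Q1 by simp
  then have "AE x in E. tsum_nn (Suc 0) (\<lambda>_. 1) x \<noteq> \<infinity>"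
    by (intro nn_integral_PInf_AE) auto
  then have "AE x in E. finite (alive (Suc 0) x)"
    by eventually_elim (simp add: finite_alive_iff less_top)
  then have "AE x in E. finite (alive (Suc 0) (subenv v x))" for v by (rule AE_subenv)
  then have 2: "AE x in E. \<forall>v. finite (alive (Suc 0) (subenv v x))"
    by (subst AE_all_countable) auto
  show ?thesis using 1 2
  proof eventually_elim
    case (elim x)
    have "finite (alive j (subenv v x))" for v j
    proof (induction j arbitrary: v)
      case 0
      have "alive 0 (subenv v x) \<subseteq> {[]}" by (auto simp: alive_def)
      then show ?case using finite_subset by blast
    next
      case (Suc j)
      have "alive (Suc 0 + j) (subenv v x) = (\<Union>u\<in>alive (Suc 0) (subenv v x). (@) u ` alive j (subenv u (subenv v x)))"
        by (rule alive_split) (use elim in \<open>auto simp: subenv_def\<close>)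
      then show ?case using elim(2) Suc by (auto simp: subenv_subenv)
    qed
    then show ?case using elim by (auto simp: good_def)
  qed
qed

lemma expect_tsum_nn_split:
  assumes [measurable]: "f \<in> borel_measurable borel"
  shows "(\<integral>\<^sup>+x. tsum_nn (k + m) f x \<partial>E)
    = (\<integral>\<^sup>+x. tsum_nn k (\<lambda>q. \<integral>\<^sup>+x'. tsum_nn m (\<lambda>p. f (q * p)) x' \<partial>E) x \<partial>E)"
proof -
  define \<Phi> where "\<Phi> q x' = tsum_nn m (\<lambda>p. f (q * p)) x'" for q x'
  have "(\<lambda>z. \<integral>\<^sup>+u. (if 0 < pw (snd z) u then f (fst z * pw (snd z) u) else 0) \<partial>count_space (lev m))
      \<in> borel_measurable (borel \<Otimes>\<^sub>M E)"
    by (rule borel_measurable_nn_integral_count_space) auto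
  then have [measurable]: "case_prod \<Phi> \<in> borel_measurable (borel \<Otimes>\<^sub>M E)"
    by (simp add: \<Phi>_def tsum_nn_def split_beta')
  have "(\<integral>\<^sup>+x. tsum_nn (k + m) f x \<partial>E) =
    (\<integral>\<^sup>+x. \<integral>\<^sup>+v. (if 0 < pw x v then \<Phi> (pw x v) (subenv v x) else 0) \<partial>count_space (lev k) \<partial>E)"
  proof (rule nn_integral_cong_AE)
    show "AE x in E. tsum_nn (k + m) f x = (\<integral>\<^sup>+v. (if 0 < pw x v then \<Phi> (pw x v) (subenv v x) else 0) \<partial>count_space (lev k))"
      using AE_good unfolding \<Phi>_def by eventually_elim (rule tsum_nn_split)
  qed
  also have "\<dots> = (\<integral>\<^sup>+x. tsum_nn k (\<lambda>q. \<integral>\<^sup>+x'. \<Phi> q x' \<partial>E) x \<partial>E)"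
    by (rule branch_nn) measurable
  finally show ?thesis by (simp add: \<Phi>_def)
qed

lemma expect_tsum_nn_measurable:
  assumes [measurable]: "f \<in> borel_measurable borel"
  shows "(\<lambda>q. \<integral>\<^sup>+x'. tsum_nn m (\<lambda>p. f (q * p)) x' \<partial>E) \<in> borel_measurable borel"
proof -
  have "(\<lambda>z. \<integral>\<^sup>+u. (if 0 < pw (snd z) u then f (fst z * pw (snd z) u) else 0) \<partial>count_space (lev m))
      \<in> borel_measurable (borel \<Otimes>\<^sub>M E)"
    by (rule borel_measurable_nn_integral_count_space) auto
  then have "(\<lambda>(q, x'). tsum_nn m (\<lambda>p. f (q * p)) x') \<in> borel_measurable (borel \<Otimes>\<^sub>M E)"
    by (simp add: tsum_nn_def split_beta')
  then show ?thesis by (rule E.borel_measurable_nn_integral)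
qed

lemma Q_cmult:
  assumes [measurable]: "f \<in> borel_measurable borel" shows "Q (\<lambda>p. c * f p) = c * Q f"
proof -
  have m: "(\<lambda>y. \<integral>\<^sup>+k. (if 0 < y k then f (y k) else 0) \<partial>count_space UNIV) \<in> borel_measurable \<rho>"
    by (rule borel_measurable_nn_integral_count_space) auto
  have "Q (\<lambda>p. c * f p) = (\<integral>\<^sup>+y. \<integral>\<^sup>+k. c * (if 0 < y k then f (y k) else 0) \<partial>count_space UNIV \<partial>\<rho>)"
    unfolding Q_def by (intro nn_integral_cong) auto
  also have "\<dots> = (\<integral>\<^sup>+y. c * (\<integral>\<^sup>+k. (if 0 < y k then f (y k) else 0) \<partial>count_space UNIV) \<partial>\<rho>)"
    by (intro nn_integral_cong nn_integral_cmult) auto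
  also have "\<dots> = c * Q f" unfolding Q_def by (rule nn_integral_cmult[OF m])
  finally show ?thesis .
qed

lemma expect_tsum_nn_Suc:
  assumes [measurable]: "f \<in> borel_measurable borel"
  shows "(\<integral>\<^sup>+x. tsum_nn (Suc m) f x \<partial>E) = Q (\<lambda>q. \<integral>\<^sup>+x. tsum_nn m (\<lambda>p. f (q * p)) x \<partial>E)"
  using expect_tsum_nn_split[of f "Suc 0" m] expect_tsum_nn_1[OF expect_tsum_nn_measurable[OF assms]] by simp

lemma expect_powr: "(\<integral>\<^sup>+x. tsum_nn m (\<lambda>p. ennreal (p powr s)) x \<partial>E) = Mom s ^ m"
proof (induction m)
  case 0 then show ?case by (simp add: tsum_nn_0 E.emeasure_space_1[simplified])
next
  case (Suc m)
  have "tsum_nn m (\<lambda>p. ennreal ((q * p) powr s)) x = ennreal (q powr s) * tsum_nn m (\<lambda>p. ennreal (p powr s)) x" if "0 < q" for q x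
    unfolding tsum_nn_def using that
    by (subst nn_integral_cmult[symmetric]) (auto intro!: nn_integral_cong simp: powr_mult ennreal_mult)
  then have "(\<integral>\<^sup>+x. tsum_nn m (\<lambda>p. ennreal ((q * p) powr s)) x \<partial>E)
      = (\<integral>\<^sup>+x. ennreal (q powr s) * tsum_nn m (\<lambda>p. ennreal (p powr s)) x \<partial>E)" if "0 < q" for q
    using that by simp
  then have "(\<integral>\<^sup>+x. tsum_nn m (\<lambda>p. ennreal ((q * p) powr s)) x \<partial>E) = Mom s ^ m * ennreal (q powr s)" if "0 < q" for q
    using that by (simp add: nn_integral_cmult Suc mult.commute[of "ennreal (q powr s)"])
  then have "(\<integral>\<^sup>+x. tsum_nn (Suc m) (\<lambda>p. ennreal (p powr s)) x \<partial>E) = Q (\<lambda>q. Mom s ^ m * ennreal (q powr s))"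
    by (subst expect_tsum_nn_Suc) (auto intro!: Q_cong)
  also have "\<dots> = Mom s ^ m * Mom s" unfolding Mom_def by (rule Q_cmult) measurable
  also have "\<dots> = Mom s ^ Suc m" by (simp add: mult.commute)
  finally show ?case .
qed

text \<open>Fatou's lemma along an enumeration of all words. In a good environment generation k is
  finite, so the partial sums are eventually equal to the full sum.\<close>

lemma vbe:
  fixes Y :: "env \<Rightarrow> real" and F :: "real \<Rightarrow> env \<Rightarrow> real"
  assumes r: "1 < r" "r \<le> 2" and [measurable]: "Y \<in> borel_measurable E" "B \<in> borel_measurable borel"
    and F [measurable]: "case_prod F \<in> borel_measurable (borel \<Otimes>\<^sub>M E)"
    and inv: "\<And>v x' x. length v = k \<Longrightarrow> Y (graft v x' x) = Y x"
    and int: "\<And>q. 0 < q \<Longrightarrow> integrable E (F q)" and cent: "\<And>q. 0 < q \<Longrightarrow> E.expectation (F q) = 0"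
    and bd: "\<And>q. 0 < q \<Longrightarrow> (\<integral>\<^sup>+x. ennreal (\<bar>F q x\<bar> powr r) \<partial>E) \<le> B q"
  shows "(\<integral>\<^sup>+x. ennreal (\<bar>Y x + (\<Sum>v\<in>alive k x. F (pw x v) (subenv v x))\<bar> powr r) \<partial>E)
    \<le> (\<integral>\<^sup>+x. ennreal (\<bar>Y x\<bar> powr r) \<partial>E) + 2 * (\<integral>\<^sup>+x. tsum_nn k B x \<partial>E)" (is "_ \<le> ?R")
proof -
  define S where "S n = (from_nat :: nat \<Rightarrow> nat list) ` {..<n} \<inter> lev k" for n
  have S: "finite (S n)" "S n \<subseteq> lev k" for n by (auto simp: S_def)
  define f where "f n x = ennreal (\<bar>Y x + (\<Sum>v\<in>S n. if 0 < pw x v then F (pw x v) (subenv v x) else 0)\<bar> powr r)" for n x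
  have [measurable]: "f n \<in> borel_measurable E" for n unfolding f_def by measurable
  have le: "(\<integral>\<^sup>+x. f n x \<partial>E) \<le> ?R" for n
  proof -
    have "(\<integral>\<^sup>+x. f n x \<partial>E) \<le> (\<integral>\<^sup>+x. ennreal (\<bar>Y x\<bar> powr r) \<partial>E) + 2 * (\<integral>\<^sup>+x. (\<Sum>v\<in>S n. if 0 < pw x v then B (pw x v) else 0) \<partial>E)"
      unfolding f_def by (rule vbe_finite[OF r _ _ F inv int cent bd S]) auto
    also have "(\<integral>\<^sup>+x. (\<Sum>v\<in>S n. if 0 < pw x v then B (pw x v) else 0) \<partial>E) \<le> (\<integral>\<^sup>+x. tsum_nn k B x \<partial>E)"
    proof (rule nn_integral_mono)
      fix x
      have "(\<Sum>v\<in>S n. if 0 < pw x v then B (pw x v) else 0) = (\<integral>\<^sup>+v. (if 0 < pw x v then B (pw x v) else 0) * indicator (S n) v \<partial>count_space (lev k))"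
        using S[of n] by (subst nn_integral_count_space'[where A = "S n"]) (auto intro!: sum.cong)
      also have "\<dots> \<le> tsum_nn k B x"
        unfolding tsum_nn_def by (intro nn_integral_mono) (auto simp: indicator_def)
      finally show "(\<Sum>v\<in>S n. if 0 < pw x v then B (pw x v) else 0) \<le> tsum_nn k B x" .
    qed
    finally show ?thesis by (simp add: add_left_mono mult_left_mono)
  qed
  have "(\<integral>\<^sup>+x. ennreal (\<bar>Y x + (\<Sum>v\<in>alive k x. F (pw x v) (subenv v x))\<bar> powr r) \<partial>E) = (\<integral>\<^sup>+x. liminf (\<lambda>n. f n x) \<partial>E)"
  proof (rule nn_integral_cong_AE, rule AE_mp[OF AE_good], rule AE_I2, rule impI)
    fix x assume elim: "good x"
    have fin: "finite (alive k x)" using elim by (rule good_finite)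
    have "\<forall>\<^sub>F n in sequentially. f n x = ennreal (\<bar>Y x + (\<Sum>v\<in>alive k x. F (pw x v) (subenv v x))\<bar> powr r)"
    proof (rule eventually_sequentiallyI)
      fix n assume n: "Suc (Max (to_nat ` alive k x)) \<le> n"
      have "alive k x \<subseteq> S n"
      proof
        fix v assume v: "v \<in> alive k x"
        have "to_nat v \<le> Max (to_nat ` alive k x)" using fin v by simp
        then have "to_nat v < n" using n by simp
        then have "v \<in> from_nat ` {..<n}" by (intro image_eqI[of _ _ "to_nat v"]) auto
        then show "v \<in> S n" using v by (auto simp: S_def lev_def alive_def)
      qed
      then have "(\<Sum>v\<in>S n. if 0 < pw x v then F (pw x v) (subenv v x) else 0)
         = (\<Sum>v\<in>alive k x. if 0 < pw x v then F (pw x v) (subenv v x) else 0)"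
        using S[of n] by (intro sum.mono_neutral_right) (auto simp: lev_def alive_def)
      also have "\<dots> = (\<Sum>v\<in>alive k x. F (pw x v) (subenv v x))"
        by (intro sum.cong) (auto simp: alive_def)
      finally show "f n x = ennreal (\<bar>Y x + (\<Sum>v\<in>alive k x. F (pw x v) (subenv v x))\<bar> powr r)" by (simp add: f_def)
    qed
    then have "(\<lambda>n. f n x) \<longlonglongrightarrow> ennreal (\<bar>Y x + (\<Sum>v\<in>alive k x. F (pw x v) (subenv v x))\<bar> powr r)"
      by (rule tendsto_eventually)
    then show "ennreal (\<bar>Y x + (\<Sum>v\<in>alive k x. F (pw x v) (subenv v x))\<bar> powr r) = liminf (\<lambda>n. f n x)"
      by (simp add: lim_imp_Liminf)
  qed
  also have "\<dots> \<le> liminf (\<lambda>n. \<integral>\<^sup>+x. f n x \<partial>E)" by (rule nn_integral_liminf) measurable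
  also have "\<dots> \<le> limsup (\<lambda>n. \<integral>\<^sup>+x. f n x \<partial>E)" by (rule Liminf_le_Limsup) simp
  also have "\<dots> \<le> ?R" by (rule Limsup_bounded) (auto intro!: always_eventually le)
  finally show ?thesis .
qed

end

section \<open>The tilted martingale\<close>

lemma alive_1_sum:
  assumes "good x" shows "(\<Sum>u\<in>alive (Suc 0) x. pw x u) = 1" "alive (Suc 0) x \<noteq> {}"
proof -
  have fin: "finite (alive (Suc 0) x)" using assms by (rule good_finite)
  have im: "alive (Suc 0) x = (\<lambda>k. [k]) ` {k. 0 < x [] k}"
    by (auto simp: alive_def length_Suc_conv)
  have finK: "finite {k. 0 < x [] k}" using fin unfolding im by (rule finite_imageD) (simp add: inj_on_def)
  have s: "x [] sums 1" "\<And>k. 0 \<le> x [] k" using assms by (auto simp: good_def)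
  have "x [] sums (\<Sum>k\<in>{k. 0 < x [] k}. x [] k)"
    by (rule sums_finite[OF finK]) (use s(2) in \<open>auto simp: less_le\<close>)
  then have "(\<Sum>k\<in>{k. 0 < x [] k}. x [] k) = 1" using s(1) sums_unique2 by blast
  then show "(\<Sum>u\<in>alive (Suc 0) x. pw x u) = 1"
    unfolding im by (subst sum.reindex) (auto simp: inj_on_def)
  then show "alive (Suc 0) x \<noteq> {}" by auto
qed

text \<open>The two conditions on r provide an r-th moment of the additive martingale. Since the
  weights sum to 1, Jensen's inequality bounds the r-th moment of the first step by
  \<open>Mom (1 - (1 - \<theta>) * r)\<close>. The inequality \<open>Mom_r\<close> says that sums of
  r-th powers of normalised weights contract in the mean. Such an r comes from
  \<open>exists_exponent\<close>.\<close>

locale tilted_tree = tree_env +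
  fixes \<theta> r :: real
  assumes \<theta>_neg: "\<theta> < 0" and r: "1 < r" "r \<le> 2"
    and Q1_gt: "1 < Q (\<lambda>_. 1)"
    and Mom_finite: "Mom (1 - (1 - \<theta>) * r) < \<infinity>"
    and Mom_r: "enn2real (Mom (r * \<theta>)) < enn2real (Mom \<theta>) powr r"
begin

lemma Mom_0: "Mom 0 = Q (\<lambda>_. 1)"
  unfolding Mom_def by (intro Q_cong) simp

definition m\<theta> :: real where "m\<theta> = enn2real (Mom \<theta>)"

lemma Mom_ge: "s \<le> 0 \<Longrightarrow> 1 < Mom s"
  using Mom_antimono[of s 0] Q1_gt by (simp add: Mom_0)

lemma r\<theta>_le: "1 - (1 - \<theta>) * r \<le> r * \<theta>" "r * \<theta> \<le> \<theta>"
  using r \<theta>_neg by (auto simp: algebra_simps)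

lemma Mom_fin: "1 - (1 - \<theta>) * r \<le> s \<Longrightarrow> Mom s < \<infinity>"
  using Mom_antimono[of _ s] Mom_finite le_less_trans by blast

lemma Mom_\<theta>: "Mom \<theta> = ennreal m\<theta>" "1 < m\<theta>"
proof -
  have f: "Mom \<theta> < \<infinity>" by (rule Mom_fin) (use r\<theta>_le in linarith)
  then show e: "Mom \<theta> = ennreal m\<theta>" by (simp add: m\<theta>_def)
  show "1 < m\<theta>" using Mom_ge[of \<theta>] \<theta>_neg unfolding e
    by (metis ennreal_1 ennreal_less_iff less_imp_le zero_le_one)
qed

definition W :: "nat \<Rightarrow> env \<Rightarrow> real" where "W k x = tsum k (\<lambda>p. p powr \<theta>) x / m\<theta> ^ k"

lemma W_nonneg: "0 \<le> W k x"
  using Mom_\<theta>(2) by (auto simp: W_def intro!: divide_nonneg_nonneg tsum_nonneg)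

lemma W_measurable [measurable]: "W k \<in> borel_measurable E"
proof -
  have [measurable]: "tsum k (\<lambda>p. p powr \<theta>) \<in> borel_measurable E"
    by (rule tsum_measurable) auto
  show ?thesis unfolding W_def[abs_def] by measurable
qed

lemma nn_integral_tsum:
  assumes [measurable]: "f \<in> borel_measurable borel" and "\<And>p. 0 < p \<Longrightarrow> 0 \<le> f p"
  shows "(\<integral>\<^sup>+x. ennreal (tsum k f x) \<partial>E) = (\<integral>\<^sup>+x. tsum_nn k (\<lambda>p. ennreal (f p)) x \<partial>E)"
proof (rule nn_integral_cong_AE)
  show "AE x in E. ennreal (tsum k f x) = tsum_nn k (\<lambda>p. ennreal (f p)) x"
    using AE_good by eventually_elim (simp add: tsum_nn_eq_tsum good_finite assms)
qed

lemma nn_integral_W: "(\<integral>\<^sup>+x. ennreal (W k x) \<partial>E) = 1"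
proof -
  have m: "0 < m\<theta> ^ k" using Mom_\<theta>(2) by simp
  have [measurable]: "tsum k (\<lambda>p. p powr \<theta>) \<in> borel_measurable E"
    by (rule tsum_measurable) auto
  have "(\<integral>\<^sup>+x. ennreal (W k x) \<partial>E) = (\<integral>\<^sup>+x. ennreal (1 / m\<theta> ^ k) * ennreal (tsum k (\<lambda>p. p powr \<theta>) x) \<partial>E)"
    unfolding W_def using m by (subst ennreal_mult[symmetric]) (auto intro!: tsum_nonneg)
  also have "\<dots> = ennreal (1 / m\<theta> ^ k) * Mom \<theta> ^ k"
    by (subst nn_integral_cmult) (auto simp: nn_integral_tsum expect_powr)
  also have "\<dots> = 1" using m Mom_\<theta> by (simp add: ennreal_power flip: ennreal_mult)
  finally show ?thesis .
qed

lemma integrable_W: "integrable E (W k)"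
  by (rule integrableI_nonneg) (auto simp: W_nonneg nn_integral_W)

lemma integral_W: "E.expectation (W k) = 1"
  by (subst integral_eq_nn_integral) (auto simp: W_nonneg nn_integral_W)

text \<open>Jensen's inequality with the weights \<open>P\<^sub>k\<close> themselves.\<close>

lemma tsum_1_powr_le:
  assumes "good x"
  shows "tsum (Suc 0) (\<lambda>p. p powr \<theta>) x powr r \<le> tsum (Suc 0) (\<lambda>p. p powr (1 - (1 - \<theta>) * r)) x"
proof -
  let ?S = "alive (Suc 0) x"
  have p: "0 < pw x u" if "u \<in> ?S" for u using that by (simp add: alive_def)
  have "tsum (Suc 0) (\<lambda>p. p powr \<theta>) x = (\<Sum>u\<in>?S. pw x u *\<^sub>R pw x u powr (\<theta> - 1))"
    unfolding tsum_def
  proof (rule sum.cong[OF refl])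
    fix u assume "u \<in> ?S"
    then show "pw x u powr \<theta> = pw x u *\<^sub>R pw x u powr (\<theta> - 1)"
      using p[of u] powr_mult_base[of "pw x u" "\<theta> - 1"] by simp
  qed
  also have "(\<Sum>u\<in>?S. pw x u *\<^sub>R pw x u powr (\<theta> - 1)) powr r \<le> (\<Sum>u\<in>?S. pw x u * (pw x u powr (\<theta> - 1)) powr r)"
    by (rule convex_on_sum[where C = "{0<..}" and f = "\<lambda>x. x powr r"])
       (use assms alive_1_sum[OF assms] good_finite[OF assms] r p in \<open>auto intro!: powr_convex simp: less_imp_le dest: p\<close>)
  also have "\<dots> = tsum (Suc 0) (\<lambda>p. p powr (1 - (1 - \<theta>) * r)) x"
    unfolding tsum_def
  proof (rule sum.cong[OF refl])
    fix u assume "u \<in> ?S"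
    then have "pw x u * (pw x u powr (\<theta> - 1)) powr r = pw x u powr (1 + (\<theta> - 1) * r)"
      using p[of u] powr_mult_base[of "pw x u" "(\<theta> - 1) * r"] by (simp add: powr_powr)
    also have "1 + (\<theta> - 1) * r = 1 - (1 - \<theta>) * r" by (simp add: algebra_simps)
    finally show "pw x u * (pw x u powr (\<theta> - 1)) powr r = pw x u powr (1 - (1 - \<theta>) * r)" .
  qed
  finally show ?thesis .
qed

definition C1 :: ennreal where "C1 = (\<integral>\<^sup>+x. ennreal (\<bar>W (Suc 0) x - 1\<bar> powr r) \<partial>E)"

lemma C1_finite: "C1 < \<infinity>"
proof -
  let ?T = "\<lambda>x. tsum (Suc 0) (\<lambda>p. p powr (1 - (1 - \<theta>) * r)) x"
  have [measurable]: "?T \<in> borel_measurable E" by (rule tsum_measurable) auto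
  have "C1 \<le> (\<integral>\<^sup>+x. ennreal (?T x) + 1 \<partial>E)"
    unfolding C1_def
  proof (rule nn_integral_mono_AE)
    show "AE x in E. ennreal (\<bar>W (Suc 0) x - 1\<bar> powr r) \<le> ennreal (?T x) + 1"
      using AE_good
    proof eventually_elim
      case (elim x)
      let ?t = "tsum (Suc 0) (\<lambda>p. p powr \<theta>) x"
      have t0: "0 \<le> ?t" by (rule tsum_nonneg) simp
      have w: "W (Suc 0) x \<le> ?t" using Mom_\<theta>(2) t0 by (simp add: W_def divide_le_eq mult_left_mono[of 1 m\<theta> ?t, simplified])
      have "\<bar>W (Suc 0) x - 1\<bar> \<le> max ?t 1" using w W_nonneg[of "Suc 0" x] by linarith
      then have "\<bar>W (Suc 0) x - 1\<bar> powr r \<le> max ?t 1 powr r" using r by (intro powr_mono2) auto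
      also have "\<dots> \<le> ?t powr r + 1" by (auto simp: max_def)
      also have "\<dots> \<le> ?T x + 1" using tsum_1_powr_le[OF elim] by simp
      finally have "ennreal (\<bar>W (Suc 0) x - 1\<bar> powr r) \<le> ennreal (?T x + 1)" by (rule ennreal_leI)
      also have "\<dots> = ennreal (?T x) + 1" by (subst ennreal_plus) (auto intro!: tsum_nonneg)
      finally show ?case .
    qed
  qed
  also have "\<dots> = Mom (1 - (1 - \<theta>) * r) + 1"
    by (subst nn_integral_add) (auto simp: nn_integral_tsum expect_powr E.emeasure_space_1[simplified])
  also have "\<dots> < \<infinity>" using Mom_finite by (simp add: less_top[symmetric])
  finally show ?thesis .
qed

text \<open>The factor per generation by which the mean of the sum of the r-th powers
  \<open>(p powr \<theta> / m\<theta> ^ k) powr r\<close> decays.\<close>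

definition \<beta> :: real where "\<beta> = enn2real (Mom (r * \<theta>)) / m\<theta> powr r"

lemma \<beta>: "0 < \<beta>" "\<beta> < 1"
proof -
  have f: "Mom (r * \<theta>) < \<infinity>" using r\<theta>_le by (intro Mom_fin) auto
  have "1 < Mom (r * \<theta>)" using r \<theta>_neg by (intro Mom_ge) (auto simp: mult_nonneg_nonpos)
  then have "0 < Mom (r * \<theta>)" using zero_less_one less_trans by blast
  then have "0 < enn2real (Mom (r * \<theta>))" using f by (simp add: enn2real_positive_iff)
  then show "0 < \<beta>" "\<beta> < 1" using Mom_r Mom_\<theta>(2) by (auto simp: \<beta>_def m\<theta>_def)
qed

lemma \<beta>_power: "ennreal (1 / (m\<theta> powr r) ^ k) * Mom (r * \<theta>) ^ k = ennreal (\<beta> ^ k)"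
proof -
  have f: "Mom (r * \<theta>) < \<infinity>" using r\<theta>_le by (intro Mom_fin) auto
  then have "Mom (r * \<theta>) = ennreal (enn2real (Mom (r * \<theta>)))" by simp
  then have "ennreal (1 / (m\<theta> powr r) ^ k) * Mom (r * \<theta>) ^ k = ennreal (1 / (m\<theta> powr r) ^ k * enn2real (Mom (r * \<theta>)) ^ k)"
    by (metis ennreal_mult ennreal_power enn2real_nonneg powr_ge_zero zero_le_divide_1_iff zero_le_power)
  then show ?thesis by (simp add: \<beta>_def power_divide)
qed

text \<open>A von Bahr--Esseen bound for sums over generation \<open>k\<close> whose terms are controlled by \<open>p powr \<theta>\<close>.\<close>

lemma vbe_power:
  fixes Y :: "env \<Rightarrow> real" and F :: "real \<Rightarrow> env \<Rightarrow> real"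
  assumes Y [measurable]: "Y \<in> borel_measurable E"
    and F [measurable]: "case_prod F \<in> borel_measurable (borel \<Otimes>\<^sub>M E)"
    and inv: "\<And>v x' x. length v = k \<Longrightarrow> Y (graft v x' x) = Y x"
    and int: "\<And>q. 0 < q \<Longrightarrow> integrable E (F q)" and cent: "\<And>q. 0 < q \<Longrightarrow> E.expectation (F q) = 0"
    and c: "0 \<le> c"
    and bd: "\<And>q. 0 < q \<Longrightarrow> (\<integral>\<^sup>+x. ennreal (\<bar>F q x\<bar> powr r) \<partial>E) \<le> ennreal ((c * q powr \<theta> / m\<theta> ^ k) powr r) * C"
  shows "(\<integral>\<^sup>+x. ennreal (\<bar>Y x + (\<Sum>v\<in>alive k x. F (pw x v) (subenv v x))\<bar> powr r) \<partial>E)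
    \<le> (\<integral>\<^sup>+x. ennreal (\<bar>Y x\<bar> powr r) \<partial>E) + 2 * C * ennreal (c powr r * \<beta> ^ k)"
proof -
  define K where "K = C * ennreal (c powr r / (m\<theta> powr r) ^ k)"
  define B where "B q = K * ennreal (q powr (r * \<theta>))" for q
  have [measurable]: "B \<in> borel_measurable borel" unfolding B_def by measurable
  have bd': "(\<integral>\<^sup>+x. ennreal (\<bar>F q x\<bar> powr r) \<partial>E) \<le> B q" if q: "0 < q" for q
  proof -
    have eq: "(c * q powr \<theta> / m\<theta> ^ k) powr r = c powr r / (m\<theta> powr r) ^ k * q powr (r * \<theta>)"
      using q c Mom_\<theta>(2) by (simp add: powr_mult powr_divide powr_powr mult.commute powr_power powr_realpow[symmetric] powr_powr)
    have "ennreal (c powr r / (m\<theta> powr r) ^ k * q powr (r * \<theta>)) = ennreal (c powr r / (m\<theta> powr r) ^ k) * ennreal (q powr (r * \<theta>))"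
      by (rule ennreal_mult) auto
    then show ?thesis using bd[OF q] unfolding eq B_def K_def by (simp only: mult_ac)
  qed
  have "(\<integral>\<^sup>+x. tsum_nn k B x \<partial>E) = (\<integral>\<^sup>+x. K * tsum_nn k (\<lambda>p. ennreal (p powr (r * \<theta>))) x \<partial>E)"
    unfolding tsum_nn_def B_def by (intro nn_integral_cong, subst nn_integral_cmult[symmetric]) (auto intro!: nn_integral_cong)
  also have "\<dots> = K * Mom (r * \<theta>) ^ k"
    by (subst nn_integral_cmult) (auto simp: expect_powr)
  also have "K = C * (ennreal (c powr r) * ennreal (1 / (m\<theta> powr r) ^ k))"
    unfolding K_def by (subst ennreal_mult[symmetric]) auto
  finally have "(\<integral>\<^sup>+x. tsum_nn k B x \<partial>E) = C * (ennreal (c powr r) * ennreal (\<beta> ^ k))"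
    using \<beta>_power[of k] by (simp add: mult.assoc)
  moreover have "(\<integral>\<^sup>+x. ennreal (\<bar>Y x + (\<Sum>v\<in>alive k x. F (pw x v) (subenv v x))\<bar> powr r) \<partial>E)
    \<le> (\<integral>\<^sup>+x. ennreal (\<bar>Y x\<bar> powr r) \<partial>E) + 2 * (\<integral>\<^sup>+x. tsum_nn k B x \<partial>E)"
    by (rule vbe[OF r Y _ F inv int cent bd']) auto
  ultimately show ?thesis using \<beta> by (simp add: ennreal_mult mult.assoc)
qed

lemma W_Suc_eq:
  assumes "good x"
  shows "W (k + m) x = (\<Sum>v\<in>alive k x. pw x v powr \<theta> / m\<theta> ^ k * W m (subenv v x))"
  unfolding W_def tsum_split[OF assms] sum_divide_distrib
proof (rule sum.cong[OF refl])
  fix v assume v: "v \<in> alive k x"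
  have "tsum m (\<lambda>p. (pw x v * p) powr \<theta>) (subenv v x) = pw x v powr \<theta> * tsum m (\<lambda>p. p powr \<theta>) (subenv v x)"
    using v unfolding tsum_def sum_distrib_left by (intro sum.cong) (auto simp: alive_def powr_mult)
  then show "tsum m (\<lambda>p. (pw x v * p) powr \<theta>) (subenv v x) / m\<theta> ^ (k + m)
    = pw x v powr \<theta> / m\<theta> ^ k * (tsum m (\<lambda>p. p powr \<theta>) (subenv v x) / m\<theta> ^ m)"
    by (simp add: power_add)
qed

lemma W_0: "W k x = (\<Sum>v\<in>alive k x. pw x v powr \<theta> / m\<theta> ^ k)"
  by (simp add: W_def tsum_def sum_divide_distrib)

lemma alive_graft: "length v = k \<Longrightarrow> alive k (graft v x' x) = alive k x"
  by (auto simp: alive_def pw_graft)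

lemma W_graft: "length v = k \<Longrightarrow> W k (graft v x' x) = W k x"
  unfolding W_0 alive_graft by (intro sum.cong) (auto simp: alive_def pw_graft)

text \<open>Y may be any function of the first k generations: Y = 0 bounds the increments
  themselves, and Y = \<open>W k\<close> carries the r-th moment from one generation to the
  next.\<close>

lemma W_increment:
  assumes Y [measurable]: "Y \<in> borel_measurable E" and inv: "\<And>v x' x. length v = k \<Longrightarrow> Y (graft v x' x) = Y x"
  shows "(\<integral>\<^sup>+x. ennreal (\<bar>Y x + (W (Suc k) x - W k x)\<bar> powr r) \<partial>E)
    \<le> (\<integral>\<^sup>+x. ennreal (\<bar>Y x\<bar> powr r) \<partial>E) + 2 * C1 * ennreal (\<beta> ^ k)"
proof -
  define F where "F q x = q powr \<theta> / m\<theta> ^ k * (W (Suc 0) x - 1)" for q x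
  have F [measurable]: "case_prod F \<in> borel_measurable (borel \<Otimes>\<^sub>M E)" unfolding F_def by measurable
  have "(\<integral>\<^sup>+x. ennreal (\<bar>Y x + (W (Suc k) x - W k x)\<bar> powr r) \<partial>E)
     = (\<integral>\<^sup>+x. ennreal (\<bar>Y x + (\<Sum>v\<in>alive k x. F (pw x v) (subenv v x))\<bar> powr r) \<partial>E)"
  proof (rule nn_integral_cong_AE)
    show "AE x in E. ennreal (\<bar>Y x + (W (Suc k) x - W k x)\<bar> powr r) = ennreal (\<bar>Y x + (\<Sum>v\<in>alive k x. F (pw x v) (subenv v x))\<bar> powr r)"
      using AE_good
    proof eventually_elim
      case (elim x)
      have "W (Suc k) x - W k x = (\<Sum>v\<in>alive k x. F (pw x v) (subenv v x))"
        using W_Suc_eq[OF elim, of k "Suc 0"] unfolding W_0[of k] F_def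
        by (simp add: sum_subtractf[symmetric] right_diff_distrib)
      then show ?case by simp
    qed
  qed
  also have "\<dots> \<le> (\<integral>\<^sup>+x. ennreal (\<bar>Y x\<bar> powr r) \<partial>E) + 2 * C1 * ennreal (1 powr r * \<beta> ^ k)"
  proof (rule vbe_power[OF Y F inv])
    fix q :: real assume q: "0 < q"
    show "integrable E (F q)" unfolding F_def
      by (intro integrable_mult_right Bochner_Integration.integrable_diff integrable_W) simp
    show "E.expectation (F q) = 0" unfolding F_def
      by (simp add: integral_W integrable_W E.prob_space[simplified])
    have m: "0 < m\<theta> ^ k" using Mom_\<theta>(2) by simp
    have "\<bar>F q x\<bar> powr r = (q powr \<theta> / m\<theta> ^ k) powr r * \<bar>W (Suc 0) x - 1\<bar> powr r" for x
    proof -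
      have "\<bar>F q x\<bar> = (q powr \<theta> / m\<theta> ^ k) * \<bar>W (Suc 0) x - 1\<bar>"
        unfolding F_def using m by (simp add: abs_mult)
      then show ?thesis by (simp only: powr_mult)
    qed
    then show "(\<integral>\<^sup>+x. ennreal (\<bar>F q x\<bar> powr r) \<partial>E) \<le> ennreal ((1 * q powr \<theta> / m\<theta> ^ k) powr r) * C1"
      by (simp add: C1_def ennreal_mult nn_integral_cmult)
  qed auto
  finally show ?thesis by simp
qed

lemma W_moment_bounded:
  obtains C where "0 \<le> C" "\<And>k. (\<integral>\<^sup>+x. ennreal (W k x powr r) \<partial>E) \<le> ennreal C"
proof -
  define c where "c = enn2real C1"
  have c: "C1 = ennreal c" "0 \<le> c" using C1_finite by (auto simp: c_def)
  have step: "(\<integral>\<^sup>+x. ennreal (W k x powr r) \<partial>E) \<le> ennreal (1 + (\<Sum>i<k. 2 * c * \<beta> ^ i))" for k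
  proof (induction k)
    case 0
    have "AE x in E. W 0 x = 1" using AE_good
    proof eventually_elim
      case (elim x)
      have "alive 0 x = {[]}" by (auto simp: alive_def)
      then show ?case by (simp add: W_0)
    qed
    then have "(\<integral>\<^sup>+x. ennreal (W 0 x powr r) \<partial>E) = (\<integral>\<^sup>+x. 1 \<partial>E)"
    proof (intro nn_integral_cong_AE)
      show "AE x in E. ennreal (W 0 x powr r) = 1" if "AE x in E. W 0 x = 1"
        using that by eventually_elim simp
    qed
    then show ?case by (simp add: E.emeasure_space_1[simplified])
  next
    case (Suc k)
    have "(\<integral>\<^sup>+x. ennreal (W (Suc k) x powr r) \<partial>E) = (\<integral>\<^sup>+x. ennreal (\<bar>W k x + (W (Suc k) x - W k x)\<bar> powr r) \<partial>E)"
      by (simp add: W_nonneg)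
    also have "\<dots> \<le> (\<integral>\<^sup>+x. ennreal (\<bar>W k x\<bar> powr r) \<partial>E) + 2 * C1 * ennreal (\<beta> ^ k)"
      by (rule W_increment) (auto simp: W_graft)
    also have "(\<integral>\<^sup>+x. ennreal (\<bar>W k x\<bar> powr r) \<partial>E) = (\<integral>\<^sup>+x. ennreal (W k x powr r) \<partial>E)" by (simp add: W_nonneg)
    also have "2 * C1 * ennreal (\<beta> ^ k) = ennreal (2 * c * \<beta> ^ k)"
      using c \<beta> by (simp add: ennreal_mult)
    also have "(\<integral>\<^sup>+x. ennreal (W k x powr r) \<partial>E) + ennreal (2 * c * \<beta> ^ k) \<le> ennreal (1 + (\<Sum>i<k. 2 * c * \<beta> ^ i)) + ennreal (2 * c * \<beta> ^ k)"
      using Suc by (rule add_right_mono)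
    also have "\<dots> = ennreal (1 + (\<Sum>i<Suc k. 2 * c * \<beta> ^ i))"
      using c \<beta> by (subst ennreal_plus[symmetric]) (auto intro!: sum_nonneg add_nonneg_nonneg simp: add.assoc)
    finally show ?case .
  qed
  have s: "summable (\<lambda>i. 2 * c * \<beta> ^ i)" using \<beta> by (intro summable_mult summable_geometric) auto
  show thesis
  proof
    show "0 \<le> 1 + (\<Sum>i. 2 * c * \<beta> ^ i)" using c \<beta> s by (intro add_nonneg_nonneg suminf_nonneg) auto
    fix k
    have "(\<Sum>i<k. 2 * c * \<beta> ^ i) \<le> (\<Sum>i. 2 * c * \<beta> ^ i)" using c \<beta> s by (intro sum_le_suminf) auto
    then show "(\<integral>\<^sup>+x. ennreal (W k x powr r) \<partial>E) \<le> ennreal (1 + (\<Sum>i. 2 * c * \<beta> ^ i))"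
      using order_trans[OF step[of k] ennreal_leI] by auto
  qed
qed

definition Winf :: "env \<Rightarrow> real" where "Winf x = lim (\<lambda>k. W k x)"

lemma Winf_measurable [measurable]: "Winf \<in> borel_measurable E"
  unfolding Winf_def[abs_def] by measurable

text \<open>The increments are bounded in mean by a geometric sequence, so they are absolutely
  summable almost surely. The sum of their absolute values is integrable and, up to the constant 1,
  dominates the martingale; hence the limit keeps the mean 1.\<close>

lemma W_convergence:
  shows AE_W_tendsto: "AE x in E. (\<lambda>k. W k x) \<longlonglongrightarrow> Winf x"
    and integral_Winf: "E.expectation Winf = 1"
proof -
  define \<Delta> where "\<Delta> k x = W (Suc k) x - W k x" for k x
  have [measurable]: "\<Delta> k \<in> borel_measurable E" for k unfolding \<Delta>_def by measurable
  define c where "c = enn2real C1"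
  have c: "C1 = ennreal c" "0 \<le> c" using C1_finite by (auto simp: c_def)
  define g where "g = \<beta> powr (1 / r)"
  have g: "0 < g" "g < 1" using \<beta> r powr_less_mono2[of "1 / r" \<beta> 1] by (auto simp: g_def)
  have \<Delta>i: "integrable E (\<Delta> k)" for k
    unfolding \<Delta>_def by (intro Bochner_Integration.integrable_diff integrable_W)
  have \<Delta>r: "(\<integral>\<^sup>+x. ennreal (\<bar>\<Delta> k x\<bar> powr r) \<partial>E) \<le> ennreal (2 * c * \<beta> ^ k)" for k
    using W_increment[of "\<lambda>_. 0" k] c \<beta> r by (simp add: \<Delta>_def ennreal_mult)
  have \<Delta>1: "(\<integral>\<^sup>+x. ennreal \<bar>\<Delta> k x\<bar> \<partial>E) \<le> ennreal ((1 + 2 * c) * g ^ k)" for k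
  proof -
    let ?e = "g ^ k"
    have e: "0 < ?e" using g by simp
    \<comment> \<open>Split at g^k: either |z| is at most g^k, or it is at most (g^k)^(1 - r) |z|^r.
      The choice g = \<beta>^(1/r) makes both contributions of order g^k.\<close>
    have le: "\<bar>z\<bar> \<le> ?e + ?e powr (1 - r) * \<bar>z\<bar> powr r" for z
    proof (cases "\<bar>z\<bar> \<le> ?e")
      case True then show ?thesis by (simp add: add_increasing2)
    next
      case False
      then have z: "0 < \<bar>z\<bar>" using e by linarith
      have "\<bar>z\<bar> = \<bar>z\<bar> powr (1 - r) * \<bar>z\<bar> powr r" using z by (simp flip: powr_add)
      also have "\<dots> \<le> ?e powr (1 - r) * \<bar>z\<bar> powr r"
        using False e r by (intro mult_right_mono powr_mono2') auto
      finally show ?thesis using e by linarith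
    qed
    have "(\<integral>\<^sup>+x. ennreal \<bar>\<Delta> k x\<bar> \<partial>E) \<le> (\<integral>\<^sup>+x. ennreal ?e + ennreal (?e powr (1 - r)) * ennreal (\<bar>\<Delta> k x\<bar> powr r) \<partial>E)"
      using e le by (intro nn_integral_mono) (auto simp flip: ennreal_mult ennreal_plus intro!: ennreal_leI)
    also have "\<dots> = ennreal ?e + ennreal (?e powr (1 - r)) * (\<integral>\<^sup>+x. ennreal (\<bar>\<Delta> k x\<bar> powr r) \<partial>E)"
      by (simp add: nn_integral_add nn_integral_cmult E.emeasure_space_1[simplified])
    also have "\<dots> \<le> ennreal ?e + ennreal (?e powr (1 - r)) * ennreal (2 * c * \<beta> ^ k)"
      by (intro add_left_mono mult_left_mono \<Delta>r) auto
    also have "\<dots> = ennreal (?e + ?e powr (1 - r) * (2 * c * \<beta> ^ k))"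
      using e c \<beta> by (simp add: ennreal_plus ennreal_mult)
    also have "?e powr (1 - r) * \<beta> ^ k = ?e"
    proof -
      have "\<beta> = g powr r" using \<beta> r by (simp add: g_def powr_powr)
      then have "\<beta> ^ k = g powr (r * real k)" using \<beta>(1) powr_realpow[OF \<beta>(1), of k] powr_powr[of g r "real k"] \<open>\<beta> = g powr r\<close> by simp
      also have "\<dots> = ?e powr r" using powr_realpow[OF g(1), of k] powr_powr[of g "real k" r] by (simp add: mult.commute)
      finally have "\<beta> ^ k = ?e powr r" .
      then show ?thesis using e by (simp flip: powr_add)
    qed
    then have "?e + ?e powr (1 - r) * (2 * c * \<beta> ^ k) = (1 + 2 * c) * ?e" by (simp add: algebra_simps)
    finally show ?thesis .
  qed
  have sg: "summable (\<lambda>k. (1 + 2 * c) * g ^ k)" using g by (intro summable_mult summable_geometric) auto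
  have "(\<integral>\<^sup>+x. (\<Sum>k. ennreal \<bar>\<Delta> k x\<bar>) \<partial>E) = (\<Sum>k. \<integral>\<^sup>+x. ennreal \<bar>\<Delta> k x\<bar> \<partial>E)"
    by (rule nn_integral_suminf) measurable
  also have "\<dots> \<le> (\<Sum>k. ennreal ((1 + 2 * c) * g ^ k))" by (intro suminf_le \<Delta>1) auto
  also have "\<dots> = ennreal (\<Sum>k. (1 + 2 * c) * g ^ k)" using c g sg by (intro suminf_ennreal_eq) (auto simp: summable_sums)
  finally have "(\<integral>\<^sup>+x. (\<Sum>k. ennreal \<bar>\<Delta> k x\<bar>) \<partial>E) \<le> ennreal (\<Sum>k. (1 + 2 * c) * g ^ k)" .
  from le_less_trans[OF this ennreal_less_top]
  have "(\<integral>\<^sup>+x. (\<Sum>k. ennreal \<bar>\<Delta> k x\<bar>) \<partial>E) \<noteq> \<infinity>" by simp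
  then have "AE x in E. (\<Sum>k. ennreal \<bar>\<Delta> k x\<bar>) \<noteq> \<infinity>" by (intro nn_integral_PInf_AE) auto
  then have AEs: "AE x in E. summable (\<lambda>k. \<bar>\<Delta> k x\<bar>)"
    by eventually_elim (auto intro!: summable_suminf_not_top)
  have sI: "summable (\<lambda>k. E.expectation (\<lambda>x. norm (\<Delta> k x)))"
  proof (rule summable_comparison_test'[OF sg])
    fix k :: nat
    have "E.expectation (\<lambda>x. \<bar>\<Delta> k x\<bar>) = enn2real (\<integral>\<^sup>+x. ennreal \<bar>\<Delta> k x\<bar> \<partial>E)"
      by (rule integral_eq_nn_integral) auto
    also have "\<dots> \<le> (1 + 2 * c) * g ^ k" using \<Delta>1[of k] c g by (intro enn2real_leI) auto
    finally show "norm (E.expectation (\<lambda>x. norm (\<Delta> k x))) \<le> (1 + 2 * c) * g ^ k" by simp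
  qed
  let ?D = "\<lambda>x. \<Sum>k. norm (\<Delta> k x)"
  have Di: "integrable E ?D"
    by (rule integrable_suminf) (use \<Delta>i AEs sI in auto)
  have W0: "AE x in E. W 0 x = 1" using AE_good
  proof eventually_elim
    case (elim x)
    have "alive 0 x = {[]}" by (auto simp: alive_def)
    then show ?case by (simp add: W_0)
  qed
  have tel: "W n x = W 0 x + (\<Sum>k<n. \<Delta> k x)" for n x
    by (induction n) (auto simp: \<Delta>_def)
  show AEt: "AE x in E. (\<lambda>k. W k x) \<longlonglongrightarrow> Winf x"
    using AEs
  proof eventually_elim
    case (elim x)
    then have "summable (\<lambda>k. \<Delta> k x)" by (rule summable_rabs_cancel)
    then have "(\<lambda>n. W 0 x + (\<Sum>k<n. \<Delta> k x)) \<longlonglongrightarrow> W 0 x + (\<Sum>k. \<Delta> k x)"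
      by (intro tendsto_intros summable_LIMSEQ)
    moreover have "(\<lambda>n. W n x) = (\<lambda>n. W 0 x + (\<Sum>k<n. \<Delta> k x))" by (rule ext) (rule tel)
    ultimately have "convergent (\<lambda>n. W n x)" unfolding convergent_def by metis
    then show ?case by (simp add: Winf_def convergent_LIMSEQ_iff)
  qed
  have bd: "AE x in E. norm (W n x) \<le> 1 + ?D x" for n
    using AEs W0
  proof eventually_elim
    case (elim x)
    have "norm (\<Sum>k<n. \<Delta> k x) \<le> (\<Sum>k<n. norm (\<Delta> k x))" by (rule norm_sum)
    also have "\<dots> \<le> ?D x" using elim by (intro sum_le_suminf) auto
    finally show ?case using elim unfolding tel[of n x] by simp
  qed
  have wi: "integrable E (\<lambda>x. 1 + ?D x)" using Di by simp
  have lim: "(\<lambda>n. E.expectation (W n)) \<longlonglongrightarrow> E.expectation Winf"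
    by (rule integral_dominated_convergence[OF _ _ wi AEt bd]) auto
  then show "E.expectation Winf = 1" by (simp add: integral_W LIMSEQ_const_iff)
qed

end

section \<open>The tilted random walk\<close>

lemma power_le_exp:
  fixes v \<delta> :: real
  assumes "0 \<le> v" "0 < \<delta>"
  shows "v ^ n \<le> fact n / \<delta> ^ n * exp (\<delta> * v)"
proof -
  have s: "(\<lambda>k. (\<delta> * v) ^ k /\<^sub>R fact k) sums exp (\<delta> * v)" by (rule exp_converges)
  have "(\<Sum>k\<in>{n}. (\<delta> * v) ^ k /\<^sub>R fact k) \<le> (\<Sum>k. (\<delta> * v) ^ k /\<^sub>R fact k)"
    using assms s by (intro sum_le_suminf) (auto simp: sums_iff)
  then have "(\<delta> * v) ^ n / fact n \<le> exp (\<delta> * v)" using s by (simp add: sums_iff divide_inverse mult.commute)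
  then show ?thesis using assms by (simp add: power_mult_distrib field_simps)
qed

section \<open>Positivity of the limit and the tilted random walk\<close>

context tilted_tree
begin

lemma AE_subenv_all: "AE x in E. P x \<Longrightarrow> AE x in E. \<forall>v. P (subenv v x)"
  by (subst AE_all_countable) (intro allI AE_subenv)

text \<open>The zero-one argument of branching processes, with q the probability of a zero limit. A
  zero limit is passed on to every child of positive weight. With some probability \<pi>' > 0 two
  fixed children are both alive, so q <= \<pi>' q^2 + (1 - \<pi>') q, which forces q to be 0 or 1;
  the mean 1 of the limit rules out q = 1.\<close>

lemma AE_Winf_pos: "AE x in E. 0 < Winf x"
proof -
  define Z :: "env \<Rightarrow> ennreal" where "Z x = (if Winf x = 0 then 1 else 0)" for x
  have [measurable]: "Z \<in> borel_measurable E" unfolding Z_def by measurable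
  define q where "q = E.prob {x. Winf x = 0}"
  have q01: "0 \<le> q" "q \<le> 1" by (auto simp: q_def)
  have mset: "{x. Winf x = 0} \<in> sets E" using measurable_sets[OF Winf_measurable, of "{0}"] by (simp add: vimage_def)
  have Zq: "(\<integral>\<^sup>+x. Z x \<partial>E) = ennreal q"
  proof -
    have "(\<integral>\<^sup>+x. Z x \<partial>E) = (\<integral>\<^sup>+x. indicator {x. Winf x = 0} x \<partial>E)"
      by (intro nn_integral_cong) (auto simp: Z_def)
    also have "\<dots> = ennreal q" using mset by (simp add: q_def E.emeasure_eq_measure)
    finally show ?thesis .
  qed
  have inherit: "AE x in E. good x \<and> 0 \<le> Winf x \<and> (\<forall>k. 0 < x [] k \<longrightarrow> Z x \<le> Z (subenv [k] x))"
    using AE_good AE_subenv_all[OF AE_W_tendsto]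
  proof eventually_elim
    case (elim x)
    have wx: "(\<lambda>k. W k x) \<longlonglongrightarrow> Winf x" using elim(2)[rule_format, of "[]"] by simp
    have nn: "0 \<le> Winf (subenv v x)" for v
      by (rule LIMSEQ_le_const[OF elim(2)[rule_format, of v]]) (auto simp: W_nonneg)
    have "Z x \<le> Z (subenv [k] x)" if k: "0 < x [] k" for k
    proof -
      let ?c = "x [] k powr \<theta> / m\<theta>"
      have c: "0 < ?c" using k Mom_\<theta>(2) by simp
      have le: "?c * W m (subenv [k] x) \<le> W (Suc m) x" for m
      proof -
        have kin: "[k] \<in> alive (Suc 0) x" using k by (simp add: alive_def)
        have "pw x [k] powr \<theta> / m\<theta> ^ Suc 0 * W m (subenv [k] x) \<le> (\<Sum>v\<in>alive (Suc 0) x. pw x v powr \<theta> / m\<theta> ^ Suc 0 * W m (subenv v x))"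
          using Mom_\<theta>(2) by (intro member_le_sum kin good_finite elim) (auto intro!: divide_nonneg_nonneg mult_nonneg_nonneg W_nonneg)
        then show ?thesis using W_Suc_eq[OF elim(1), of "Suc 0" m] by simp
      qed
      have lim_le: "?c * Winf (subenv [k] x) \<le> Winf x"
        by (rule LIMSEQ_le[OF tendsto_mult[OF tendsto_const elim(2)[rule_format]] LIMSEQ_Suc[OF wx]]) (use le in auto)
      have "Winf (subenv [k] x) = 0" if "Winf x = 0"
        using mult_pos_pos[OF c, of "Winf (subenv [k] x)"] lim_le nn[of "[k]"] that by linarith
      then show ?thesis by (auto simp: Z_def)
    qed
    then show ?case using elim nn[of "[]"] by auto
  qed
  \<comment> \<open>Otherwise almost surely at most one weight would be positive, and the mean
    number of children could not exceed 1, against \<open>Q1_gt\<close>.\<close>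
  have "\<exists>k l. k < l \<and> \<not> (AE y in \<rho>. \<not> (0 < y k \<and> 0 < y l))"
  proof (rule ccontr)
    assume "\<not> ?thesis"
    then have "AE y in \<rho>. \<not> (0 < y k \<and> 0 < y l)" if "k < l" for k l using that by blast
    then have "AE y in \<rho>. \<forall>k l. k < l \<longrightarrow> \<not> (0 < y k \<and> 0 < y l)"
      by (auto simp: AE_all_countable)
    then have "AE y in \<rho>. (\<integral>\<^sup>+k. (if 0 < y k then 1 else 0) \<partial>count_space UNIV) \<le> (1::ennreal)"
    proof eventually_elim
      case (elim y)
      show ?case
      proof (cases "\<exists>k. 0 < y k")
        case True
        then obtain k where "0 < y k" by auto
        then have "(if 0 < y i then 1 else 0) = (indicator {k} i :: ennreal)" for i
          using elim by (cases i k rule: linorder_cases) auto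
        then show ?thesis by simp
      qed auto
    qed
    then have "Q (\<lambda>_. 1) \<le> (\<integral>\<^sup>+y. 1 \<partial>\<rho>)" unfolding Q_def by (rule nn_integral_mono_AE)
    then show False using Q1_gt by (simp add: emeasure_space_1[simplified])
  qed
  then obtain k l where kl: "k < l" "\<not> (AE y in \<rho>. \<not> (0 < y k \<and> 0 < y l))" by blast
  define A where "A y \<longleftrightarrow> 0 < y k \<and> 0 < y l" for y :: "nat \<Rightarrow> real"
  define fa where "fa y = (LEAST k. 0 < y k)" for y :: "nat \<Rightarrow> real"
  have [measurable]: "Measurable.pred \<rho> A" unfolding A_def by measurable
  have [measurable]: "fa \<in> measurable \<rho> (count_space UNIV)" unfolding fa_def by measurable
  define \<pi>' where "\<pi>' = E.prob {x. A (x [])}"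
  have Aset: "{x. A (x [])} \<in> sets E"
  proof -
    have "Measurable.pred E (\<lambda>x. A (x []))" by measurable
    then show ?thesis by (simp add: pred_def)
  qed
  have pi01: "0 \<le> \<pi>'" "\<pi>' \<le> 1" by (auto simp: \<pi>'_def)
  have pi0: "\<pi>' \<noteq> 0"
  proof
    assume "\<pi>' = 0"
    then have "AE x in E. \<not> A (x [])"
      using Aset by (subst AE_iff_measurable[of "{x. A (x [])}"]) (auto simp: \<pi>'_def E.emeasure_eq_measure)
    then have "AE y in distr E \<rho> (\<lambda>x. x []). \<not> A y" 
    proof (subst AE_distr_iff)
      show "{y \<in> space \<rho>. \<not> A y} \<in> sets \<rho>" by measurable
    qed auto
    moreover have "distr E \<rho> (\<lambda>x. x []) = \<rho>" unfolding E_def using P.PiM_component[of "[]"] by simp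
    ultimately have "AE y in \<rho>. \<not> A y" by (simp only:)
    then show False using kl(2) by (simp add: A_def)
  qed
  \<comment> \<open>On the event A both children k and l are followed. Off A only the first alive
    child is followed; its label is random, so the event is split according to the value i of
    \<open>fa\<close>, and grafting takes place at a fixed word each time.\<close>
  have "ennreal q \<le> (\<integral>\<^sup>+x. (if A (x []) then Z (subenv [k] x) * Z (subenv [l] x) else 0)
      + (\<integral>\<^sup>+i. (if \<not> A (x []) \<and> fa (x []) = i then Z (subenv [i] x) else 0) \<partial>count_space UNIV) \<partial>E)"
    unfolding Zq[symmetric]
  proof (rule nn_integral_mono_AE)
    show "AE x in E. Z x \<le> (if A (x []) then Z (subenv [k] x) * Z (subenv [l] x) else 0)
      + (\<integral>\<^sup>+i. (if \<not> A (x []) \<and> fa (x []) = i then Z (subenv [i] x) else 0) \<partial>count_space UNIV)"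
      using inherit
    proof eventually_elim
      case (elim x)
      show ?case
      proof (cases "A (x [])")
        case True
        then have "Z x \<le> Z (subenv [k] x)" "Z x \<le> Z (subenv [l] x)" using elim by (auto simp: A_def)
        then show ?thesis using True by (auto simp: Z_def split: if_splits)
      next
        case False
        obtain i where "0 < x [] i" using alive_1_sum(2)[of x] elim by (auto simp: alive_def length_Suc_conv)
        then have "0 < x [] (fa (x []))" unfolding fa_def by (rule LeastI)
        then have "Z x \<le> Z (subenv [fa (x [])] x)" using elim by auto
        also have "\<dots> = (\<integral>\<^sup>+i. Z (subenv [i] x) * indicator {fa (x [])} i \<partial>count_space UNIV)"
          by (simp add: nn_integral_indicator_singleton)
        also have "\<dots> = (\<integral>\<^sup>+i. (if \<not> A (x []) \<and> fa (x []) = i then Z (subenv [i] x) else 0) \<partial>count_space UNIV)"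
          using False by (intro nn_integral_cong) (auto simp: indicator_def)
        finally show ?thesis using False by simp
      qed
    qed
  qed
  also have "\<dots> = (\<integral>\<^sup>+x. (if A (x []) then Z (subenv [k] x) * Z (subenv [l] x) else 0) \<partial>E)
      + (\<integral>\<^sup>+x. \<integral>\<^sup>+i. (if \<not> A (x []) \<and> fa (x []) = i then Z (subenv [i] x) else 0) \<partial>count_space UNIV \<partial>E)"
    by (intro nn_integral_add borel_measurable_nn_integral_count_space) measurable
  also have "(\<integral>\<^sup>+x. (if A (x []) then Z (subenv [k] x) * Z (subenv [l] x) else 0) \<partial>E) = ennreal (\<pi>' * q\<^sup>2)"
  proof -
    have root: "graft [i] x' x [] = x []" for i x' x by (simp add: graft_def)
    have lk: "subenv [l] (graft [k] x' x) = subenv [l] x" for x' x using kl by (intro subenv_graft_other) auto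
    have "(\<integral>\<^sup>+x. (if A (x []) then Z (subenv [k] x) * Z (subenv [l] x) else 0) \<partial>E)
      = (\<integral>\<^sup>+x. \<integral>\<^sup>+x'. Z x' * (if A (x []) then Z (subenv [l] x) else 0) \<partial>E \<partial>E)"
      by (subst nn_integral_graft[where v = "[k]"]) (auto simp: root lk intro!: nn_integral_cong)
    also have "\<dots> = (\<integral>\<^sup>+x. ennreal q * (if A (x []) then Z (subenv [l] x) else 0) \<partial>E)"
      by (simp add: nn_integral_multc Zq)
    also have "\<dots> = ennreal q * (\<integral>\<^sup>+x. \<integral>\<^sup>+x'. Z x' * (if A (x []) then 1 else 0) \<partial>E \<partial>E)"
      by (subst nn_integral_cmult, measurable, subst nn_integral_graft[where v = "[l]"]) (auto simp: root intro!: nn_integral_cong arg_cong2[where f = times])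
    also have "\<dots> = ennreal q * (\<integral>\<^sup>+x. ennreal q * indicator {x. A (x [])} x \<partial>E)"
      by (intro arg_cong2[where f = times] refl nn_integral_cong) (auto simp: nn_integral_multc Zq)
    also have "\<dots> = ennreal (\<pi>' * q\<^sup>2)"
      using Aset q01 pi01 by (simp add: nn_integral_cmult_indicator E.emeasure_eq_measure \<pi>'_def power2_eq_square mult_ac flip: ennreal_mult)
    finally show ?thesis .
  qed
  also have "(\<integral>\<^sup>+x. \<integral>\<^sup>+i. (if \<not> A (x []) \<and> fa (x []) = i then Z (subenv [i] x) else 0) \<partial>count_space UNIV \<partial>E) = ennreal ((1 - \<pi>') * q)"
  proof -
    have root: "graft [i] x' x [] = x []" for i x' x by (simp add: graft_def)
    have "(\<integral>\<^sup>+x. \<integral>\<^sup>+i. (if \<not> A (x []) \<and> fa (x []) = i then Z (subenv [i] x) else 0) \<partial>count_space UNIV \<partial>E)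
      = (\<integral>\<^sup>+i. \<integral>\<^sup>+x. (if \<not> A (x []) \<and> fa (x []) = i then Z (subenv [i] x) else 0) \<partial>E \<partial>count_space UNIV)"
      by (rule nn_integral_count_space_nn_integral) auto
    also have "\<dots> = (\<integral>\<^sup>+i. \<integral>\<^sup>+x. ennreal q * (if \<not> A (x []) \<and> fa (x []) = i then 1 else 0) \<partial>E \<partial>count_space UNIV)"
    proof (rule nn_integral_cong)
      fix i
      have "(\<integral>\<^sup>+x. (if \<not> A (x []) \<and> fa (x []) = i then Z (subenv [i] x) else 0) \<partial>E)
        = (\<integral>\<^sup>+x. \<integral>\<^sup>+x'. Z x' * (if \<not> A (x []) \<and> fa (x []) = i then 1 else 0) \<partial>E \<partial>E)"
        by (subst nn_integral_graft[where v = "[i]"]) (auto simp: root intro!: nn_integral_cong)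
      also have "\<dots> = (\<integral>\<^sup>+x. ennreal q * (if \<not> A (x []) \<and> fa (x []) = i then 1 else 0) \<partial>E)"
        by (simp add: nn_integral_multc Zq)
      finally show "(\<integral>\<^sup>+x. (if \<not> A (x []) \<and> fa (x []) = i then Z (subenv [i] x) else 0) \<partial>E) = \<dots>" .
    qed
    also have "\<dots> = (\<integral>\<^sup>+x. \<integral>\<^sup>+i. ennreal q * (if \<not> A (x []) \<and> fa (x []) = i then 1 else 0) \<partial>count_space UNIV \<partial>E)"
      by (rule nn_integral_count_space_nn_integral[symmetric]) auto
    also have "\<dots> = (\<integral>\<^sup>+x. ennreal q * indicator (UNIV - {x. A (x [])}) x \<partial>E)"
    proof (rule nn_integral_cong)
      fix x
      have "(\<integral>\<^sup>+i. ennreal q * (if \<not> A (x []) \<and> fa (x []) = i then 1 else 0) \<partial>count_space UNIV)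
        = (\<integral>\<^sup>+i. (ennreal q * indicator (UNIV - {x. A (x [])}) x) * indicator {fa (x [])} i \<partial>count_space UNIV)"
        by (intro nn_integral_cong) (auto simp: indicator_def)
      then show "(\<integral>\<^sup>+i. ennreal q * (if \<not> A (x []) \<and> fa (x []) = i then 1 else 0) \<partial>count_space UNIV) = ennreal q * indicator (UNIV - {x. A (x [])}) x"
        by (simp add: nn_integral_indicator_singleton)
    qed
    also have "\<dots> = ennreal q * emeasure E (UNIV - {x. A (x [])})"
      using Aset sets.compl_sets[OF Aset] by (intro nn_integral_cmult_indicator) auto
    also have "emeasure E (UNIV - {x. A (x [])}) = ennreal (1 - \<pi>')"
      using E.prob_compl[OF Aset] by (simp add: E.emeasure_eq_measure \<pi>'_def)
    finally show ?thesis using q01 pi01 by (simp add: mult.commute flip: ennreal_mult)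
  qed
  also have "ennreal (\<pi>' * q\<^sup>2) + ennreal ((1 - \<pi>') * q) = ennreal (\<pi>' * q\<^sup>2 + (1 - \<pi>') * q)"
    using q01 pi01 by (intro ennreal_plus[symmetric]) auto
  finally have "q \<le> \<pi>' * q\<^sup>2 + (1 - \<pi>') * q"
    using q01 pi01 by (subst (asm) ennreal_le_iff) auto
  then have "\<pi>' * (q * (1 - q)) \<le> 0" by (simp add: power2_eq_square algebra_simps)
  then have "q * (1 - q) \<le> 0" using pi0 pi01 by (simp add: mult_le_0_iff)
  then have "q = 0 \<or> q = 1" using q01 by (auto simp: mult_le_0_iff)
  moreover have "q \<noteq> 1"
  proof
    assume "q = 1"
    then have "AE x in E. x \<in> {x. Winf x = 0}"
      using E.prob_eq_1[OF mset] by (simp add: q_def)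
    then have "E.expectation Winf = E.expectation (\<lambda>_. 0)"
      by (intro integral_cong_AE) auto
    then show False by (simp add: integral_Winf)
  qed
  ultimately have "q = 0" by simp
  then have "AE x in E. Winf x \<noteq> 0"
    using mset by (subst AE_iff_measurable[of "{x. Winf x = 0}"]) (auto simp: q_def E.emeasure_eq_measure)
  then show ?thesis using inherit by eventually_elim auto
qed

text \<open>The step law of the random walk in the many-to-one formula: an exponential tilt of the
  displacement intensity, normalised to mass 1 by \<open>m\<theta>\<close>.\<close>

definition \<nu> :: "real measure" where
  "\<nu> = distr (density (\<rho> \<Otimes>\<^sub>M count_space UNIV) (\<lambda>z. ennreal (if 0 < fst z (snd z) then fst z (snd z) powr \<theta> / m\<theta> else 0)))
     borel (\<lambda>z. - ln (fst z (snd z)))"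

lemma nn_integral_\<nu>:
  assumes [measurable]: "f \<in> borel_measurable borel"
  shows "(\<integral>\<^sup>+v. f v \<partial>\<nu>) = Q (\<lambda>p. ennreal (p powr \<theta> / m\<theta>) * f (- ln p))"
proof -
  interpret c: sigma_finite_measure "count_space (UNIV :: nat set)" by (rule sigma_finite_measure_count_space)
  have "(\<integral>\<^sup>+v. f v \<partial>\<nu>) = (\<integral>\<^sup>+z. ennreal (if 0 < fst z (snd z) then fst z (snd z) powr \<theta> / m\<theta> else 0) * f (- ln (fst z (snd z))) \<partial>(\<rho> \<Otimes>\<^sub>M count_space UNIV))"
    unfolding \<nu>_def by (simp add: nn_integral_distr nn_integral_density)
  also have "\<dots> = (\<integral>\<^sup>+y. \<integral>\<^sup>+k. ennreal (if 0 < y k then y k powr \<theta> / m\<theta> else 0) * f (- ln (y k)) \<partial>count_space UNIV \<partial>\<rho>)"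
    by (subst c.nn_integral_fst[symmetric]) (auto cong: if_cong)
  also have "\<dots> = Q (\<lambda>p. ennreal (p powr \<theta> / m\<theta>) * f (- ln p))"
    unfolding Q_def by (intro nn_integral_cong) auto
  finally show ?thesis .
qed

lemma Q_powr_div: "Q (\<lambda>p. ennreal (p powr s / m\<theta>)) = ennreal (1 / m\<theta>) * Mom s"
proof -
  have "Q (\<lambda>p. ennreal (p powr s / m\<theta>)) = Q (\<lambda>p. ennreal (1 / m\<theta>) * ennreal (p powr s))"
    using Mom_\<theta>(2) by (intro Q_cong) (simp flip: ennreal_mult)
  also have "\<dots> = ennreal (1 / m\<theta>) * Mom s" unfolding Mom_def by (rule Q_cmult) measurable
  finally show ?thesis .
qed

lemma real_distribution_\<nu>: "real_distribution \<nu>"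
proof -
  have "emeasure \<nu> (space \<nu>) = (\<integral>\<^sup>+v. 1 \<partial>\<nu>)" by simp
  also have "\<dots> = ennreal (1 / m\<theta>) * Mom \<theta>"
    by (subst nn_integral_\<nu>) (auto simp: Q_powr_div)
  also have "\<dots> = 1" using Mom_\<theta> by (simp flip: ennreal_mult)
  finally have "prob_space \<nu>" by (rule prob_spaceI)
  then show ?thesis
    by (auto simp: real_distribution_def real_distribution_axioms_def \<nu>_def)
qed

sublocale \<nu>: real_distribution \<nu> by (rule real_distribution_\<nu>)

lemma sets_\<nu> [measurable_cong, simp]: "sets \<nu> = sets borel" by simp

text \<open>The tilting density is strictly positive at every positive weight, so an exceptional set
  of the tilted law is almost surely avoided by all children at once. The nonlattice property passes
  to \<nu> in this way.\<close>

lemma AE_\<nu>_imp_AE_\<rho>: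
  assumes [measurable]: "Measurable.pred borel P" and "AE v in \<nu>. P v"
  shows "AE y in \<rho>. \<forall>k. 0 < y k \<longrightarrow> P (- ln (y k))"
proof -
  have "0 = (\<integral>\<^sup>+v. (if P v then 0 else 1) \<partial>\<nu>)"
    using assms(2) by (subst nn_integral_0_iff_AE[THEN iffD2]) auto
  also have "\<dots> = Q (\<lambda>p. ennreal (p powr \<theta> / m\<theta>) * (if P (- ln p) then 0 else 1))"
    by (rule nn_integral_\<nu>) measurable
  finally have "(\<integral>\<^sup>+ y. \<integral>\<^sup>+ k. (if 0 < y k then ennreal (y k powr \<theta> / m\<theta>) * (if P (- ln (y k)) then 0 else 1) else 0) \<partial>count_space UNIV \<partial>\<rho>) = 0"
    by (simp add: Q_def)
  moreover have "(\<lambda>y. \<integral>\<^sup>+ k. (if 0 < y k then ennreal (y k powr \<theta> / m\<theta>) * (if P (- ln (y k)) then 0 else 1) else 0) \<partial>count_space UNIV) \<in> borel_measurable \<rho>"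
    by (rule borel_measurable_nn_integral_count_space) auto
  ultimately have "AE y in \<rho>. (\<integral>\<^sup>+ k. (if 0 < y k then ennreal (y k powr \<theta> / m\<theta>) * (if P (- ln (y k)) then 0 else 1) else 0) \<partial>count_space UNIV) = 0"
    by (subst (asm) nn_integral_0_iff_AE) auto
  then show ?thesis
  proof eventually_elim
    case (elim y)
    then have "(if 0 < y k then ennreal (y k powr \<theta> / m\<theta>) * (if P (- ln (y k)) then 0 else 1) else 0) = 0" for k
      by (subst (asm) nn_integral_0_iff_AE) (auto simp: AE_count_space)
    then show ?case using Mom_\<theta>(2) by (force split: if_splits)
  qed
qed

lemma AE_\<nu>_nonneg: "AE v in \<nu>. 0 \<le> v"
proof -
  have "(\<integral>\<^sup>+v. (if 0 \<le> v then 0 else 1) \<partial>\<nu>) = Q (\<lambda>p. ennreal (p powr \<theta> / m\<theta>) * (if 0 \<le> - ln p then 0 else 1))"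
    by (rule nn_integral_\<nu>) measurable
  also have "\<dots> \<le> Q (\<lambda>p. 0)" by (rule Q_mono) auto
  also have "\<dots> = 0" by (simp add: Q_def)
  finally have "(\<integral>\<^sup>+v. (if 0 \<le> v then 0 else 1) \<partial>\<nu>) = (0::ennreal)" by simp
  then have "AE v in \<nu>. (if 0 \<le> v then 0 else 1) = (0::ennreal)"
    by (subst (asm) nn_integral_0_iff_AE) auto
  then show ?thesis by eventually_elim (auto split: if_splits)
qed

text \<open>Chosen so that \<open>\<theta> - \<eta>\<close> is the exponent of
  \<open>Mom_finite\<close>. The tilted step thus has an exponential moment of order \<eta>, hence
  all power moments; \<eta> also controls large displacements in \<open>tail\<close>.\<close>

definition \<eta> :: real where "\<eta> = (r - 1) * (1 - \<theta>)"

lemma \<eta>: "0 < \<eta>" "\<theta> - \<eta> = 1 - (1 - \<theta>) * r"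
proof -
  show "0 < \<eta>" using r \<theta>_neg unfolding \<eta>_def by (intro mult_pos_pos) auto
  show "\<theta> - \<eta> = 1 - (1 - \<theta>) * r" by (simp add: \<eta>_def algebra_simps)
qed

lemma \<nu>_exp_moment: "integrable \<nu> (\<lambda>v. exp (\<eta> * v))"
proof (rule integrableI_nonneg)
  have "(\<integral>\<^sup>+v. ennreal (exp (\<eta> * v)) \<partial>\<nu>) = Q (\<lambda>p. ennreal (p powr \<theta> / m\<theta>) * ennreal (exp (\<eta> * - ln p)))"
    by (rule nn_integral_\<nu>) measurable
  also have "\<dots> = Q (\<lambda>p. ennreal (p powr (\<theta> - \<eta>) / m\<theta>))"
    using Mom_\<theta>(2) by (intro Q_cong) (simp add: powr_def exp_diff algebra_simps exp_minus field_simps flip: ennreal_mult)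
  also have "\<dots> < \<infinity>" using Mom_finite Mom_\<theta>(2) by (simp add: Q_powr_div \<eta> ennreal_mult_less_top)
  finally show "(\<integral>\<^sup>+v. ennreal (exp (\<eta> * v)) \<partial>\<nu>) < \<infinity>" .
qed auto

lemma \<nu>_moments: "integrable \<nu> (\<lambda>v. v ^ n)"
proof (rule Bochner_Integration.integrable_bound[OF integrable_mult_right[OF \<nu>_exp_moment, of "fact n / \<eta> ^ n"]])
  show "AE v in \<nu>. norm (v ^ n) \<le> norm (fact n / \<eta> ^ n * exp (\<eta> * v))"
    using AE_\<nu>_nonneg
  proof eventually_elim
    case (elim v)
    then show ?case using power_le_exp[of v \<eta> n] \<eta> by simp
  qed
qed auto

definition \<nu>m :: "nat \<Rightarrow> real measure" where
  "\<nu>m = rec_nat (return borel 0) (\<lambda>_ \<mu>. distr (\<nu> \<Otimes>\<^sub>M \<mu>) borel (\<lambda>(x, y). x + y))"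

lemma \<nu>m_0: "\<nu>m 0 = return borel 0" and \<nu>m_Suc: "\<nu>m (Suc m) = distr (\<nu> \<Otimes>\<^sub>M \<nu>m m) borel (\<lambda>(x, y). x + y)"
  by (simp_all add: \<nu>m_def)

lemma real_distribution_\<nu>m: "real_distribution (\<nu>m m)"
proof (induction m)
  case 0
  have "prob_space (return borel (0::real))" by (rule prob_space_return) simp
  then show ?case by (simp add: \<nu>m_0 real_distribution_def real_distribution_axioms_def)
next
  case (Suc m)
  interpret m: real_distribution "\<nu>m m" by fact
  interpret p: pair_prob_space \<nu> "\<nu>m m" ..
  have "prob_space (\<nu>m (Suc m))" unfolding \<nu>m_Suc by (rule p.prob_space_distr) measurable
  then show ?case by (simp add: \<nu>m_Suc real_distribution_def real_distribution_axioms_def)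
qed

lemma char_\<nu>m: "char (\<nu>m m) t = char \<nu> t ^ m"
proof (induction m)
  case 0 then show ?case by (simp add: \<nu>m_0 char_def integral_return)
next
  case (Suc m)
  interpret m: real_distribution "\<nu>m m" by (rule real_distribution_\<nu>m)
  interpret p: pair_prob_space \<nu> "\<nu>m m" ..
  have "char (\<nu>m (Suc m)) t = (CLINT z|(\<nu> \<Otimes>\<^sub>M \<nu>m m). iexp (t * (fst z + snd z)))"
    unfolding \<nu>m_Suc char_def by (subst integral_distr) (auto simp: split_beta')
  also have "\<dots> = (CLINT x|\<nu>. CLINT y|\<nu>m m. iexp (t * (x + y)))"
    by (subst p.integral_fst'[symmetric]) (auto intro!: p.integrable_const_bound[of _ 1])
  also have "\<dots> = (CLINT x|\<nu>. iexp (t * x) * char (\<nu>m m) t)"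
  proof (rule Bochner_Integration.integral_cong[OF refl])
    fix x
    have "(CLINT y|\<nu>m m. iexp (t * (x + y))) = (CLINT y|\<nu>m m. iexp (t * x) * iexp (t * y))"
      by (simp add: algebra_simps flip: exp_add)
    then show "(CLINT y|\<nu>m m. iexp (t * (x + y))) = iexp (t * x) * char (\<nu>m m) t"
      unfolding char_def by (simp only: integral_mult_right_zero)
  qed
  also have "\<dots> = char \<nu> t * char (\<nu>m m) t" unfolding char_def[of \<nu>] by (rule integral_mult_left_zero)
  finally show ?case using Suc by simp
qed

text \<open>Induction on the generation with a decomposition at the first step: the tilt factorises
  along the path, while the displacements add up.\<close>

lemma many_to_one:
  assumes [measurable]: "f \<in> borel_measurable borel"
  shows "(\<integral>\<^sup>+x. tsum_nn m (\<lambda>p. ennreal (p powr \<theta> / m\<theta> ^ m) * f (- ln p)) x \<partial>E) = (\<integral>\<^sup>+v. f v \<partial>\<nu>m m)"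
  using assms
proof (induction m arbitrary: f)
  case 0
  note [measurable] = 0
  show ?case by (simp add: tsum_nn_0 \<nu>m_0 nn_integral_return E.emeasure_space_1[simplified])
next
  case (Suc m)
  note [measurable] = Suc.prems
  interpret m: real_distribution "\<nu>m m" by (rule real_distribution_\<nu>m)
  interpret p: pair_prob_space \<nu> "\<nu>m m" ..
  have 1: "(\<integral>\<^sup>+x. tsum_nn m (\<lambda>p. ennreal ((q * p) powr \<theta> / m\<theta> ^ Suc m) * f (- ln (q * p))) x \<partial>E)
     = ennreal (q powr \<theta> / m\<theta>) * (\<integral>\<^sup>+y. f (- ln q + y) \<partial>\<nu>m m)" if q: "0 < q" for q
  proof -
    have "(\<integral>\<^sup>+x. tsum_nn m (\<lambda>p. ennreal ((q * p) powr \<theta> / m\<theta> ^ Suc m) * f (- ln (q * p))) x \<partial>E)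
      = (\<integral>\<^sup>+x. ennreal (q powr \<theta> / m\<theta>) * tsum_nn m (\<lambda>p. ennreal (p powr \<theta> / m\<theta> ^ m) * f (- ln q + - ln p)) x \<partial>E)"
    proof (rule nn_integral_cong)
      fix x
      have e: "ennreal ((q * p) powr \<theta> / m\<theta> ^ Suc m) * f (- ln (q * p)) = ennreal (q powr \<theta> / m\<theta>) * (ennreal (p powr \<theta> / m\<theta> ^ m) * f (- ln q + - ln p))" if "0 < p" for p
      proof -
        have "(q * p) powr \<theta> / m\<theta> ^ Suc m = q powr \<theta> / m\<theta> * (p powr \<theta> / m\<theta> ^ m)" using q that by (simp add: powr_mult)
        moreover have "- ln (q * p) = - ln q + - ln p" using q that by (simp add: ln_mult)
        ultimately show ?thesis using Mom_\<theta>(2) by (simp only: ennreal_mult mult.assoc divide_nonneg_nonneg powr_ge_zero zero_le_power less_imp_le order_trans[OF zero_le_one])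
      qed
      show "tsum_nn m (\<lambda>p. ennreal ((q * p) powr \<theta> / m\<theta> ^ Suc m) * f (- ln (q * p))) x
        = ennreal (q powr \<theta> / m\<theta>) * tsum_nn m (\<lambda>p. ennreal (p powr \<theta> / m\<theta> ^ m) * f (- ln q + - ln p)) x"
        unfolding tsum_nn_def
        by (subst nn_integral_cmult[symmetric]) (auto intro!: nn_integral_cong simp: e simp del: power_Suc)
    qed
    also have "\<dots> = ennreal (q powr \<theta> / m\<theta>) * (\<integral>\<^sup>+x. tsum_nn m (\<lambda>p. ennreal (p powr \<theta> / m\<theta> ^ m) * f (- ln q + - ln p)) x \<partial>E)"
      by (rule nn_integral_cmult) measurable
    also have "(\<integral>\<^sup>+x. tsum_nn m (\<lambda>p. ennreal (p powr \<theta> / m\<theta> ^ m) * f (- ln q + - ln p)) x \<partial>E) = (\<integral>\<^sup>+y. f (- ln q + y) \<partial>\<nu>m m)"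
      by (rule Suc.IH) measurable
    finally show ?thesis .
  qed
  have "(\<integral>\<^sup>+x. tsum_nn (Suc m) (\<lambda>p. ennreal (p powr \<theta> / m\<theta> ^ Suc m) * f (- ln p)) x \<partial>E)
     = Q (\<lambda>q. \<integral>\<^sup>+x. tsum_nn m (\<lambda>p. ennreal ((q * p) powr \<theta> / m\<theta> ^ Suc m) * f (- ln (q * p))) x \<partial>E)"
    by (rule expect_tsum_nn_Suc) measurable
  also have "\<dots> = Q (\<lambda>q. ennreal (q powr \<theta> / m\<theta>) * (\<integral>\<^sup>+y. f (- ln q + y) \<partial>\<nu>m m))"
    by (intro Q_cong 1)
  also have "\<dots> = (\<integral>\<^sup>+v. \<integral>\<^sup>+y. f (v + y) \<partial>\<nu>m m \<partial>\<nu>)"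
    by (subst nn_integral_\<nu>) auto
  also have "\<dots> = (\<integral>\<^sup>+v. f v \<partial>\<nu>m (Suc m))"
    unfolding \<nu>m_Suc by (subst nn_integral_distr) (auto simp: split_beta' m.nn_integral_fst[symmetric])
  finally show ?case .
qed

end

section \<open>The sum of exp (- n P(u))\<close>

locale nonlattice_tilted_tree = tilted_tree +
  assumes nonlattice_\<rho>: "\<And>c d. 0 < c \<Longrightarrow> \<not> (AE y in \<rho>. \<forall>k. 0 < y k \<longrightarrow> (\<exists>z::int. - ln (y k) = c * of_int z + d))"
begin

definition a\<nu> :: real where "a\<nu> = \<nu>.expectation (\<lambda>v. v)"

definition \<sigma>\<nu> :: real where "\<sigma>\<nu> = sqrt (\<nu>.expectation (\<lambda>v. (v - a\<nu>)\<^sup>2))"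

lemma nonlattice_\<nu>:
  assumes "0 < c" shows "\<not> (AE v in \<nu>. \<exists>z::int. v = c * of_int z + d)"
proof
  assume "AE v in \<nu>. \<exists>z::int. v = c * of_int z + d"
  then have "AE y in \<rho>. \<forall>k. 0 < y k \<longrightarrow> (\<exists>z::int. - ln (y k) = c * of_int z + d)"
    by (intro AE_\<nu>_imp_AE_\<rho>) measurable
  then show False using nonlattice_\<rho>[OF assms, of d] by simp
qed

lemma integrable_\<nu>_id: "integrable \<nu> (\<lambda>v. v)"
  using \<nu>_moments[of 1] by simp

lemma integrable_\<nu>_sq: "integrable \<nu> (\<lambda>v. (v - c)\<^sup>2)"
  unfolding power2_diff using \<nu>_moments[of 2] integrable_\<nu>_id by simp

lemma \<sigma>\<nu>_pos: "0 < \<sigma>\<nu>" "\<nu>.expectation (\<lambda>v. (v - a\<nu>)\<^sup>2) = \<sigma>\<nu>\<^sup>2"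
proof -
  let ?e = "\<nu>.expectation (\<lambda>v. (v - a\<nu>)\<^sup>2)"
  have e0: "0 \<le> ?e" by simp
  have "?e \<noteq> 0"
  proof
    assume "?e = 0"
    then have "AE v in \<nu>. (v - a\<nu>)\<^sup>2 = 0"
      by (subst (asm) integral_nonneg_eq_0_iff_AE) (use integrable_\<nu>_sq in auto)
    then have "AE v in \<nu>. \<exists>z::int. v = 1 * of_int z + a\<nu>"
      by eventually_elim (auto intro!: exI[of _ 0])
    then show False using nonlattice_\<nu>[of 1 a\<nu>] by simp
  qed
  with e0 have "0 < ?e" by (metis order_le_less)
  then show "0 < \<sigma>\<nu>" unfolding \<sigma>\<nu>_def by (rule real_sqrt_gt_zero)
  show "?e = \<sigma>\<nu>\<^sup>2" unfolding \<sigma>\<nu>_def by (rule real_sqrt_pow2[OF e0, symmetric])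
qed

lemma a\<nu>_pos: "0 < a\<nu>"
proof -
  have e0: "0 \<le> a\<nu>" unfolding a\<nu>_def by (intro integral_nonneg_AE AE_\<nu>_nonneg)
  have "a\<nu> \<noteq> 0"
  proof
    assume "a\<nu> = 0"
    then have "AE v in \<nu>. v = 0"
      unfolding a\<nu>_def by (subst (asm) integral_nonneg_eq_0_iff_AE) (use integrable_\<nu>_id AE_\<nu>_nonneg in auto)
    then have "AE v in \<nu>. \<exists>z::int. v = 1 * of_int z + 0"
      by eventually_elim (auto intro!: exI[of _ 0])
    then show False using nonlattice_\<nu>[of 1 0] by simp
  qed
  then show ?thesis using e0 by simp
qed

text \<open>If the modulus were 1, removing the phase \<alpha> would make the mean of cos (t v -
  \<alpha>) equal to 1. The cosine would then be 1 almost surely and v would lie in a lattice of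
  span 2 pi / |t|.\<close>

lemma char_\<nu>_less_1:
  assumes "t \<noteq> 0" shows "cmod (char \<nu> t) < 1"
proof (rule ccontr)
  assume "\<not> cmod (char \<nu> t) < 1"
  then have c1: "cmod (char \<nu> t) = 1" using \<nu>.cmod_char_le_1[of t] by linarith
  then obtain \<alpha> where \<alpha>: "char \<nu> t = cis \<alpha>" using rcis_cmod_Arg[of "char \<nu> t"] by (metis mult_1 of_real_1 rcis_def)
  have ii: "integrable \<nu> (\<lambda>v. iexp (t * v))" by (rule \<nu>.integrable_iexp) auto
  have "char \<nu> t * cis (- \<alpha>) = 1" unfolding \<alpha> by (simp add: cis_mult)
  then have "(CLINT v|\<nu>. iexp (t * v) * cis (- \<alpha>)) = 1"
    unfolding char_def by simp
  moreover have "Re (CLINT v|\<nu>. iexp (t * v) * cis (- \<alpha>)) = (LINT v|\<nu>. Re (iexp (t * v) * cis (- \<alpha>)))"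
    using ii by (intro integral_Re[symmetric]) simp
  moreover have "Re (iexp (t * v) * cis (- \<alpha>)) = cos (t * v - \<alpha>)" for v
    by (simp add: cis_conv_exp[symmetric] cis_mult flip: of_real_mult)
  ultimately have I: "(LINT v|\<nu>. cos (t * v - \<alpha>)) = 1" by simp
  have ci: "integrable \<nu> (\<lambda>v. cos (t * v - \<alpha>))"
    by (rule \<nu>.integrable_const_bound[of _ 1]) auto
  have "(LINT v|\<nu>. 1 - cos (t * v - \<alpha>)) = 0" using I ci \<nu>.prob_space by simp
  then have "AE v in \<nu>. 1 - cos (t * v - \<alpha>) = 0"
    by (subst (asm) integral_nonneg_eq_0_iff_AE) (use ci in auto)
  then have "AE v in \<nu>. \<exists>z::int. v = (2 * pi / \<bar>t\<bar>) * of_int z + \<alpha> / t"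
  proof eventually_elim
    case (elim v)
    then obtain z :: int where z: "t * v - \<alpha> = of_int z * 2 * pi" by (auto simp: cos_one_2pi_int)
    then have v: "v = (2 * pi / t) * of_int z + \<alpha> / t" using assms by (simp add: field_simps)
    show ?case
    proof (cases "t > 0")
      case True then show ?thesis using v by (intro exI[of _ z]) simp
    next
      case False then show ?thesis using v assms by (intro exI[of _ "- z"]) simp
    qed
  qed
  then show False using nonlattice_\<nu>[of "2 * pi / \<bar>t\<bar>" "\<alpha> / t"] assms by simp
qed

sublocale L: llt \<nu> \<nu>m "- \<theta>" a\<nu> \<sigma>\<nu>
proof (intro llt.intro llt_axioms.intro)
  show "real_distribution \<nu>" by (rule real_distribution_\<nu>)
next
  show "integrable \<nu> (\<lambda>x. \<bar>x - a\<nu>\<bar> ^ 3)"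
  proof -
    have "integrable \<nu> (\<lambda>x. x ^ 3 - 3 * a\<nu> * x ^ 2 + 3 * a\<nu>\<^sup>2 * x - a\<nu> ^ 3)"
      using \<nu>_moments[of 3] \<nu>_moments[of 2] integrable_\<nu>_id by simp
    also have "(\<lambda>x. x ^ 3 - 3 * a\<nu> * x ^ 2 + 3 * a\<nu>\<^sup>2 * x - a\<nu> ^ 3) = (\<lambda>x. (x - a\<nu>) ^ 3)"
      by (auto simp: fun_eq_iff power3_eq_cube power2_eq_square algebra_simps)
    finally have "integrable \<nu> (\<lambda>x. norm ((x - a\<nu>) ^ 3))" by (rule integrable_norm)
    then show ?thesis by (simp add: power_abs)
  qed
next
  show "0 < - \<theta>" using \<theta>_neg by simp
  show "0 < \<sigma>\<nu>" by (rule \<sigma>\<nu>_pos)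
  show "real_distribution (\<nu>m m)" for m by (rule real_distribution_\<nu>m)
  show "char (\<nu>m m) t = char \<nu> t ^ m" for m t by (rule char_\<nu>m)
  show "integrable \<nu> (\<lambda>x. (x - a\<nu>)\<^sup>2)" by (rule integrable_\<nu>_sq)
  show "integrable \<nu> (\<lambda>x. x)" by (rule integrable_\<nu>_id)
  show "\<nu>.expectation (\<lambda>x. x) = a\<nu>" by (rule a\<nu>_def[symmetric])
  show "\<nu>.expectation (\<lambda>x. (x - a\<nu>)\<^sup>2) = \<sigma>\<nu>\<^sup>2" by (rule \<sigma>\<nu>_pos)
  show "cmod (char \<nu> t) < 1" if "t \<noteq> 0" for t using that by (rule char_\<nu>_less_1)
qed

section \<open>The exponential sum and its conditional fluctuations\<close>

definition A :: "nat \<Rightarrow> real \<Rightarrow> env \<Rightarrow> real" where "A j t x = tsum j (\<lambda>p. exp (- (t * p))) x"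

text \<open>The mean of \<open>A j t\<close> for t > 0 (\<open>nn_integral_A\<close>), written so
  that the local limit theorem applies at the point ln t.\<close>

definition EA :: "nat \<Rightarrow> real \<Rightarrow> real" where "EA j t = t powr \<theta> * m\<theta> ^ j * L.G j (ln t)"

lemma A_nonneg: "0 \<le> A j t x" unfolding A_def by (rule tsum_nonneg) simp

lemma EA_nonneg: "0 \<le> EA j t"
  unfolding EA_def using L.G_nonneg Mom_\<theta>(2) by simp

lemma A_joint_measurable [measurable]: "(\<lambda>z. A j (fst z) (snd z)) \<in> borel_measurable (borel \<Otimes>\<^sub>M E)"
proof -
  have "A j t x = (if tsum_nn j (\<lambda>_. 1) x < \<infinity> then enn2real (tsum_nn j (\<lambda>p. ennreal (exp (- (t * p)))) x) else 0)" for t x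
  proof (cases "finite (alive j x)")
    case True
    then show ?thesis unfolding A_def using tsum_nn_eq_tsum[OF True, of "\<lambda>p. exp (- (t * p))"] tsum_nonneg[of "\<lambda>p. exp (- (t * p))" j x]
      by (simp add: finite_alive_iff)
  next
    case False then show ?thesis using finite_alive_iff[of j x] by (simp add: A_def tsum_def)
  qed
  then have "(\<lambda>z. A j (fst z) (snd z)) = (\<lambda>z. if tsum_nn j (\<lambda>_. 1) (snd z) < \<infinity> then enn2real (tsum_nn j (\<lambda>p. ennreal (exp (- (fst z * p)))) (snd z)) else 0)"
    by (simp add: fun_eq_iff)
  moreover have [measurable]: "(\<lambda>z. tsum_nn j (\<lambda>p. ennreal (exp (- (fst z * p)))) (snd z)) \<in> borel_measurable (borel \<Otimes>\<^sub>M E)"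
    unfolding tsum_nn_def by (rule borel_measurable_nn_integral_count_space) auto
  ultimately show ?thesis by simp
qed

lemma A_measurable [measurable]: "A j t \<in> borel_measurable E"
  unfolding A_def[abs_def] by (rule tsum_measurable) auto

lemma EA_measurable [measurable]: "EA j \<in> borel_measurable borel"
  unfolding EA_def[abs_def] by measurable

text \<open>Pulling out the power \<theta> < 0 supplies the tilt of the many-to-one formula and
  leaves a kernel that decays on both sides. This is the origin of \<open>gum\<close> and of the
  constant \<open>Gamma (- \<theta>)\<close>.\<close>

lemma exp_eq_gum:
  assumes "0 < t" "0 < p"
  shows "exp (- (t * p)) = (t * p) powr \<theta> * gum (- \<theta>) (- ln p - ln t)"
proof -
  have "exp (- (- ln p - ln t)) = t * p" using assms by (simp add: exp_add mult.commute)
  then have 1: "gum (- \<theta>) (- ln p - ln t) = exp (\<theta> * (- ln p - ln t) - t * p)" unfolding gum_def by simp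
  have 2: "(t * p) powr \<theta> = exp (\<theta> * (ln t + ln p))" using assms by (simp add: powr_def ln_mult)
  show ?thesis unfolding 1 2 exp_add[symmetric] by (simp add: algebra_simps)
qed

lemma nn_integral_A:
  assumes t: "0 < t" shows "(\<integral>\<^sup>+x. ennreal (A j t x) \<partial>E) = ennreal (EA j t)"
proof -
  let ?c = "t powr \<theta> * m\<theta> ^ j"
  have c: "0 < ?c" using t Mom_\<theta>(2) by simp
  have "(\<integral>\<^sup>+x. ennreal (A j t x) \<partial>E) = (\<integral>\<^sup>+x. tsum_nn j (\<lambda>p. ennreal (exp (- (t * p)))) x \<partial>E)"
    unfolding A_def by (rule nn_integral_tsum) auto
  also have "\<dots> = (\<integral>\<^sup>+x. tsum_nn j (\<lambda>p. ennreal (p powr \<theta> / m\<theta> ^ j) * ennreal (?c * gum (- \<theta>) (- ln p - ln t))) x \<partial>E)"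
    unfolding tsum_nn_def
  proof (intro nn_integral_cong, goal_cases)
    case (1 x u)
    show ?case
      using t Mom_\<theta>(2) gum_pos[of "- \<theta>"] exp_eq_gum[OF t, of "pw x u"]
      by (auto simp: powr_mult less_imp_le mult_ac simp flip: ennreal_mult)
  qed
  also have "\<dots> = (\<integral>\<^sup>+v. ennreal (?c * gum (- \<theta>) (v - ln t)) \<partial>\<nu>m j)"
    by (rule many_to_one) measurable
  also have "\<dots> = ennreal (LINT v|\<nu>m j. ?c * gum (- \<theta>) (v - ln t))"
    using c gum_pos[of "- \<theta>"] by (intro nn_integral_eq_integral integrable_mult_right L.G_int) (auto simp: less_imp_le)
  also have "(LINT v|\<nu>m j. ?c * gum (- \<theta>) (v - ln t)) = EA j t"
    by (simp add: EA_def L.G_def)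
  finally show ?thesis .
qed

text \<open>Boundedness of the kernel means exp (- t p) <= C (t p) powr \<theta>, which compares the
  sum with the martingale itself.\<close>

lemma A_bound: obtains C where "0 < C" "\<And>j t x. 0 < t \<Longrightarrow> A j t x \<le> C * (t powr \<theta> * m\<theta> ^ j) * W j x"
    "\<And>j t. 0 < t \<Longrightarrow> EA j t \<le> C * (t powr \<theta> * m\<theta> ^ j)"
proof -
  obtain C1 where C1: "0 < C1" "\<And>y. gum (- \<theta>) y \<le> C1" using gum_bounded[of "- \<theta>"] \<theta>_neg by auto
  obtain C2 where C2: "0 < C2" "\<And>m x. L.G m x \<le> C2" by (rule L.G_bounded) blast
  have m: "0 < m\<theta>" using Mom_\<theta>(2) by simp
  show thesis
  proof (rule that[of "max C1 C2"])
    show "0 < max C1 C2" using C1 by simp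
    fix j t assume t: "0 < (t::real)"
    show "EA j t \<le> max C1 C2 * (t powr \<theta> * m\<theta> ^ j)"
    proof -
      have "L.G j (ln t) \<le> max C1 C2" using C2(2)[of j "ln t"] by simp
      then have "t powr \<theta> * m\<theta> ^ j * L.G j (ln t) \<le> t powr \<theta> * m\<theta> ^ j * max C1 C2"
        using m by (intro mult_left_mono) auto
      then show ?thesis by (simp add: EA_def mult_ac)
    qed
    fix x
    have "A j t x \<le> tsum j (\<lambda>p. (max C1 C2 * t powr \<theta>) * p powr \<theta>) x"
      unfolding A_def
    proof (rule tsum_mono)
      fix p :: real assume p: "0 < p"
      have "exp (- (t * p)) = (t * p) powr \<theta> * gum (- \<theta>) (- ln p - ln t)" by (rule exp_eq_gum[OF t p])
      also have "\<dots> \<le> (t * p) powr \<theta> * max C1 C2"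
        using C1(2)[of "- ln p - ln t"] by (intro mult_left_mono) auto
      finally show "exp (- (t * p)) \<le> (max C1 C2 * t powr \<theta>) * p powr \<theta>" by (simp add: powr_mult mult_ac)
    qed
    also have "\<dots> = (max C1 C2 * t powr \<theta>) * tsum j (\<lambda>p. p powr \<theta>) x" unfolding tsum_def by (simp add: sum_distrib_left)
    also have "tsum j (\<lambda>p. p powr \<theta>) x = m\<theta> ^ j * W j x" using m by (simp add: W_def)
    finally show "A j t x \<le> max C1 C2 * (t powr \<theta> * m\<theta> ^ j) * W j x" by (simp add: mult_ac)
  qed
qed

definition D :: "nat \<Rightarrow> nat \<Rightarrow> real \<Rightarrow> env \<Rightarrow> real" where
  "D k m t x = A (k + m) t x - (\<Sum>v\<in>alive k x. EA m (t * pw x v))"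

lemma D_measurable [measurable]: "D k m t \<in> borel_measurable E"
proof -
  have "(\<lambda>x. \<Sum>v\<in>alive k x. EA m (t * pw x v)) = tsum k (\<lambda>p. EA m (t * p))" by (simp add: tsum_def fun_eq_iff)
  moreover have "tsum k (\<lambda>p. EA m (t * p)) \<in> borel_measurable E"
    by (rule tsum_measurable) (auto simp: EA_nonneg)
  ultimately have [measurable]: "(\<lambda>x. \<Sum>v\<in>alive k x. EA m (t * pw x v)) \<in> borel_measurable E" by simp
  show ?thesis unfolding D_def[abs_def] by measurable
qed

text \<open>D is the deviation from the conditional mean given the first k generations, a sum of
  conditionally independent centred terms. Each is at most a constant times its tilted weight times
  max (W m) 1, so the uniform r-th moment of the martingale and \<open>vbe_power\<close> give a
  factor \<beta> for each of the k generations.\<close>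

lemma fluctuation:
  obtains K where "0 \<le> K" "\<And>k m t. 0 < t \<Longrightarrow>
    (\<integral>\<^sup>+x. ennreal (\<bar>D k m t x\<bar> powr r) \<partial>E) \<le> ennreal (K * (t powr \<theta> * m\<theta> ^ (k + m)) powr r * \<beta> ^ k)"
proof -
  obtain C where C: "0 < C" "\<And>j t x. 0 < t \<Longrightarrow> A j t x \<le> C * (t powr \<theta> * m\<theta> ^ j) * W j x"
    "\<And>j t. 0 < t \<Longrightarrow> EA j t \<le> C * (t powr \<theta> * m\<theta> ^ j)" by (rule A_bound) blast
  obtain Cw where Cw: "0 \<le> Cw" "\<And>k. (\<integral>\<^sup>+x. ennreal (W k x powr r) \<partial>E) \<le> ennreal Cw" by (rule W_moment_bounded) blast
  have m0: "0 < m\<theta>" using Mom_\<theta>(2) by simp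
  define C' where "C' = Cw + 1"
  have C'0: "0 \<le> C'" using Cw by (simp add: C'_def)
  show thesis
  proof
    show "0 \<le> 2 * C' * C powr r" using C'0 by simp
    fix k m t assume t: "0 < (t::real)"
    define c where "c = C * (t powr \<theta> * m\<theta> ^ (k + m))"
    have c0: "0 \<le> c" using C m0 by (simp add: c_def)
    define F where "F q x = A m (t * q) x - EA m (t * q)" for q x
    have F [measurable]: "case_prod F \<in> borel_measurable (borel \<Otimes>\<^sub>M E)"
    proof -
      have "(\<lambda>z. A m (fst (t * fst z, snd z)) (snd (t * fst z, snd z))) \<in> borel_measurable (borel \<Otimes>\<^sub>M E)"
        by (rule measurable_compose[OF _ A_joint_measurable]) measurable
      then show ?thesis unfolding F_def by (simp add: split_beta')
    qed
    have Ai: "integrable E (A m (t * q))" if "0 < q" for q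
      by (rule integrableI_nonneg) (use t that in \<open>auto simp: A_nonneg nn_integral_A\<close>)
    have Ae: "E.expectation (A m (t * q)) = EA m (t * q)" if "0 < q" for q
      by (subst integral_eq_nn_integral) (use t that in \<open>auto simp: A_nonneg nn_integral_A EA_nonneg\<close>)
    have eqA: "AE x in E. D k m t x = 0 + (\<Sum>v\<in>alive k x. F (pw x v) (subenv v x))"
      using AE_good
    proof eventually_elim
      case (elim x)
      show ?case unfolding D_def F_def A_def tsum_split[OF elim, of k m]
        by (simp add: sum_subtractf mult.assoc)
    qed
    have "(\<integral>\<^sup>+x. ennreal (\<bar>D k m t x\<bar> powr r) \<partial>E)
       = (\<integral>\<^sup>+x. ennreal (\<bar>0 + (\<Sum>v\<in>alive k x. F (pw x v) (subenv v x))\<bar> powr r) \<partial>E)"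
    proof (rule nn_integral_cong_AE)
      show "AE x in E. ennreal (\<bar>D k m t x\<bar> powr r) = ennreal (\<bar>0 + (\<Sum>v\<in>alive k x. F (pw x v) (subenv v x))\<bar> powr r)"
        using eqA by eventually_elim simp
    qed
    also have "\<dots> \<le> (\<integral>\<^sup>+x. ennreal (\<bar>0\<bar> powr r) \<partial>E) + 2 * ennreal C' * ennreal (c powr r * \<beta> ^ k)"
    proof (rule vbe_power[where Y = "\<lambda>_. 0", OF _ F _ _ _ c0])
      fix q :: real assume q: "0 < q"
      show "integrable E (F q)" unfolding F_def by (intro Bochner_Integration.integrable_diff Ai q) simp
      show "E.expectation (F q) = 0" unfolding F_def using Ai[OF q] Ae[OF q] E.prob_space by simp
      let ?d = "c * q powr \<theta> / m\<theta> ^ k"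
      have d: "?d = C * ((t * q) powr \<theta> * m\<theta> ^ m)" using m0 by (simp add: c_def powr_mult power_add)
      have d0: "0 \<le> ?d" using c0 m0 by simp
      have le: "\<bar>F q x\<bar> powr r \<le> ?d powr r * (W m x powr r + 1)" for x
      proof -
        have "A m (t * q) x \<le> ?d * W m x" "EA m (t * q) \<le> ?d"
          unfolding d using C(2)[of "t * q" m x] C(3)[of "t * q" m] t q by (auto simp: mult_ac)
        moreover have "?d * W m x \<le> ?d * max (W m x) 1" "?d * 1 \<le> ?d * max (W m x) 1"
          using d0 by (intro mult_left_mono; simp)+
        ultimately have "\<bar>F q x\<bar> \<le> ?d * max (W m x) 1"
          using A_nonneg[of m "t * q" x] EA_nonneg[of m "t * q"] unfolding F_def by linarith
        then have "\<bar>F q x\<bar> powr r \<le> (?d * max (W m x) 1) powr r" using r by (intro powr_mono2) auto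
        also have "\<dots> = ?d powr r * max (W m x) 1 powr r" by (rule powr_mult)
        also have "\<dots> \<le> ?d powr r * (W m x powr r + 1)" by (intro mult_left_mono) (auto simp: max_def)
        finally show ?thesis .
      qed
      have "(\<integral>\<^sup>+x. ennreal (\<bar>F q x\<bar> powr r) \<partial>E) \<le> (\<integral>\<^sup>+x. ennreal (?d powr r) * (ennreal (W m x powr r) + 1) \<partial>E)"
      proof (rule nn_integral_mono)
        fix x
        have "ennreal (\<bar>F q x\<bar> powr r) \<le> ennreal (?d powr r * (W m x powr r + 1))" using le by (rule ennreal_leI)
        also have "\<dots> = ennreal (?d powr r) * (ennreal (W m x powr r) + 1)" by (simp add: ennreal_mult ennreal_plus)
        finally show "ennreal (\<bar>F q x\<bar> powr r) \<le> ennreal (?d powr r) * (ennreal (W m x powr r) + 1)" .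
      qed
      also have "\<dots> = ennreal (?d powr r) * ((\<integral>\<^sup>+x. ennreal (W m x powr r) \<partial>E) + 1)"
        by (subst nn_integral_cmult, measurable, subst nn_integral_add) (auto simp: E.emeasure_space_1[simplified])
      also have "\<dots> \<le> ennreal (?d powr r) * (ennreal Cw + 1)"
        by (intro mult_left_mono add_right_mono Cw) auto
      also have "ennreal Cw + 1 = ennreal C'" using Cw by (simp add: C'_def ennreal_plus)
      finally show "(\<integral>\<^sup>+x. ennreal (\<bar>F q x\<bar> powr r) \<partial>E) \<le> ennreal (?d powr r) * ennreal C'" .
    qed auto
    also have "(\<integral>\<^sup>+x. ennreal (\<bar>0\<bar> powr r) \<partial>E) + 2 * ennreal C' * ennreal (c powr r * \<beta> ^ k) = ennreal (2 * C' * (c powr r * \<beta> ^ k))"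
      using C'0 \<beta> by (simp add: ennreal_mult)
    also have "2 * C' * (c powr r * \<beta> ^ k) = 2 * C' * C powr r * (t powr \<theta> * m\<theta> ^ (k + m)) powr r * \<beta> ^ k"
      unfolding c_def powr_mult[of C] by simp
    finally show "(\<integral>\<^sup>+x. ennreal (\<bar>D k m t x\<bar> powr r) \<partial>E) \<le> ennreal (2 * C' * C powr r * (t powr \<theta> * m\<theta> ^ (k + m)) powr r * \<beta> ^ k)" .
  qed
qed

end

section \<open>Almost sure limits along a grid of times\<close>

lemma AE_tendsto_0_if_summable:
  fixes T :: "nat \<Rightarrow> 'a \<Rightarrow> real"
  assumes [measurable]: "\<And>j. T j \<in> borel_measurable M" and nn: "\<And>j x. 0 \<le> T j x"
    and le: "\<And>j. 0 < j \<Longrightarrow> (\<integral>\<^sup>+x. ennreal (T j x) \<partial>M) \<le> ennreal (s j)"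
    and s: "summable s" "\<And>j. 0 \<le> s j"
  shows "AE x in M. (\<lambda>j. T j x) \<longlonglongrightarrow> 0"
proof -
  have s': "summable (\<lambda>j. s (Suc j))" using s by (simp add: summable_Suc_iff)
  have "(\<integral>\<^sup>+x. (\<Sum>j. ennreal (T (Suc j) x)) \<partial>M) = (\<Sum>j. \<integral>\<^sup>+x. ennreal (T (Suc j) x) \<partial>M)"
    by (rule nn_integral_suminf) measurable
  also have "\<dots> \<le> (\<Sum>j. ennreal (s (Suc j)))" by (intro suminf_le le) auto
  also have "\<dots> = ennreal (\<Sum>j. s (Suc j))" using s s' by (intro suminf_ennreal_eq) (auto simp: summable_sums)
  finally have "(\<integral>\<^sup>+x. (\<Sum>j. ennreal (T (Suc j) x)) \<partial>M) \<le> ennreal (\<Sum>j. s (Suc j))" .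
  from le_less_trans[OF this ennreal_less_top]
  have "(\<integral>\<^sup>+x. (\<Sum>j. ennreal (T (Suc j) x)) \<partial>M) \<noteq> \<infinity>" by simp
  then have "AE x in M. (\<Sum>j. ennreal (T (Suc j) x)) \<noteq> \<infinity>" by (intro nn_integral_PInf_AE) auto
  then show ?thesis
  proof eventually_elim
    case (elim x)
    then have "summable (\<lambda>j. T (Suc j) x)" by (intro summable_suminf_not_top) (auto simp: nn)
    then have "(\<lambda>j. T (Suc j) x) \<longlonglongrightarrow> 0" by (rule summable_LIMSEQ_zero)
    then show ?case by (rule LIMSEQ_imp_Suc)
  qed
qed

text \<open>The exponents are ordered as 1/8 < 1/4 < 1/2. The power j powr (1/8) is large enough for
  \<beta> raised to it to beat every polynomial in j. It is small compared with j powr (1/4), so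
  displacements beyond that threshold in the first generations carry negligible weight. The
  threshold in turn is o(sqrt j), invisible to the Gaussian factor.\<close>

definition split_level :: "nat \<Rightarrow> nat" where "split_level j = nat \<lfloor>real j powr (1/8)\<rfloor>"

lemma split_level_le: "real (split_level j) \<le> real j powr (1/8)"
  unfolding split_level_def by simp

lemma split_level_ge: "real j powr (1/8) - 1 \<le> real (split_level j)"
proof -
  have "0 \<le> \<lfloor>real j powr (1/8)\<rfloor>" by simp
  then have "real (split_level j) = of_int \<lfloor>real j powr (1/8)\<rfloor>" by (simp add: split_level_def)
  then show ?thesis by linarith
qed

lemma split_level_le_self: "split_level j \<le> j"
proof (cases "j = 0")
  case False
  then have "real j powr (1/8) \<le> real j powr 1" by (intro powr_mono) auto
  then have "real (split_level j) \<le> real j" using split_level_le[of j] False by simp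
  then show ?thesis by simp
qed (simp add: split_level_def)

lemma split_level_at_top: "filterlim split_level at_top sequentially"
proof -
  have "filterlim (\<lambda>j. real j powr (1/8) - 1) at_top sequentially" by real_asymp
  then have "filterlim (\<lambda>j. real (split_level j)) at_top sequentially"
    by (rule filterlim_at_top_mono) (auto intro!: always_eventually split_level_ge)
  then show ?thesis by (simp add: filterlim_sequentially_iff_filterlim_real)
qed

lemma split_rest_ge: "real j - real j powr (1/8) \<le> real (j - split_level j)"
  using split_level_le[of j] split_level_le_self[of j] by simp

lemma split_rest_at_top: "filterlim (\<lambda>j. j - split_level j) at_top sequentially"
proof -
  have "filterlim (\<lambda>j. real j - real j powr (1/8)) at_top sequentially" by real_asymp
  then have "filterlim (\<lambda>j. real (j - split_level j)) at_top sequentially"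
    by (rule filterlim_at_top_mono) (auto intro!: always_eventually split_rest_ge)
  then show ?thesis by (simp add: filterlim_sequentially_iff_filterlim_real)
qed

lemma split_rest_ratio: "(\<lambda>j. real j / real (j - split_level j)) \<longlonglongrightarrow> 1"
proof (rule tendsto_sandwich[of "\<lambda>_. 1" _ _ "\<lambda>j. real j / (real j - real j powr (1/8))"])
  have ev: "\<forall>\<^sub>F j in sequentially. 0 < real j - real j powr (1/8)" by real_asymp
  show "\<forall>\<^sub>F j in sequentially. 1 \<le> real j / real (j - split_level j)"
    using ev
  proof eventually_elim
    case (elim j)
    then have "0 < real (j - split_level j)" using split_rest_ge[of j] by linarith
    then show ?case by simp
  qed
  show "\<forall>\<^sub>F j in sequentially. real j / real (j - split_level j) \<le> real j / (real j - real j powr (1/8))"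
    using ev
  proof eventually_elim
    case (elim j)
    then show ?case using split_rest_ge[of j] by (intro frac_le) auto
  qed
  show "(\<lambda>j. real j / (real j - real j powr (1/8))) \<longlonglongrightarrow> 1" by real_asymp
qed simp

lemma summable_if_bigo_inverse_square:
  fixes f g :: "nat \<Rightarrow> real"
  assumes "\<And>j. 0 \<le> f j" "\<And>j. 0 < j \<Longrightarrow> f j \<le> g j" "g \<in> O(\<lambda>j. 1 / real j ^ 2)"
  shows "summable f"
proof -
  have "f \<in> O(g)"
    by (rule bigoI[of _ 1]) (use assms in \<open>auto intro!: eventually_mono[OF eventually_gt_at_top[of 0]] intro: order_trans[OF _ abs_ge_self]\<close>)
  then have "f \<in> O(\<lambda>j. 1 / real j ^ 2)" using assms(3) by (rule landau_o.big_trans)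
  moreover have "summable (\<lambda>j. norm (1 / real j ^ 2))"
    using inverse_power_summable[of 2, where 'a = real] by (simp add: inverse_eq_divide)
  ultimately show ?thesis by (rule summable_comparison_test_bigo[rotated])
qed

text \<open>Taking the supremum over x as the error turns the eventual bound into a null sequence,
  which can be composed with \<open>j - split_level j\<close>.\<close>

lemma (in llt) local_limit_error:
  obtains e where "e \<longlonglongrightarrow> 0" "\<And>m x. \<bar>sqrt (real m) * G m x - N m x\<bar> \<le> e m"
proof -
  obtain C where C: "0 < C" "\<And>m x. G m x \<le> C" by (rule G_bounded) blast
  define f where "f m x = \<bar>sqrt (real m) * G m x - N m x\<bar>" for m x
  have bdd: "bdd_above (range (f m))" for m
  proof (rule bdd_aboveI2)
    fix x
    have "sqrt (real m) * G m x \<le> sqrt (real m) * C" using C by (intro mult_left_mono) auto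
    moreover have "0 \<le> sqrt (real m) * G m x" by (simp add: G_nonneg)
    ultimately show "f m x \<le> sqrt (real m) * C + Gamma s / (\<sigma> * sqrt (2 * pi))"
      using N_nonneg[of m x] N_le[of m x] unfolding f_def by linarith
  qed
  show thesis
  proof
    show "\<bar>sqrt (real m) * G m x - N m x\<bar> \<le> (SUP x. f m x)" for m x
      using cSUP_upper[OF _ bdd[of m], of x] by (simp add: f_def)
    show "(\<lambda>m. SUP x. f m x) \<longlonglongrightarrow> 0"
    proof (rule LIMSEQ_I)
      fix \<epsilon> :: real assume e: "0 < \<epsilon>"
      have "\<forall>\<^sub>F m in sequentially. \<forall>x. f m x \<le> \<epsilon> / 2" unfolding f_def using e by (intro local_limit) auto
      then have "\<forall>\<^sub>F m in sequentially. norm ((SUP x. f m x) - 0) < \<epsilon>"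
      proof eventually_elim
        case (elim m)
        have "(SUP x. f m x) \<le> \<epsilon> / 2" using elim by (intro cSUP_least) auto
        moreover have "0 \<le> f m 0" by (simp add: f_def)
        then have "0 \<le> (SUP x. f m x)" using cSUP_upper[OF _ bdd[of m], of 0] by simp
        ultimately show ?case using e by simp
      qed
      then show "\<exists>no. \<forall>n\<ge>no. norm ((SUP x. f n x) - 0) < \<epsilon>" by (simp add: eventually_sequentially)
    qed
  qed
qed

context nonlattice_tilted_tree
begin

definition density0 :: real where "density0 = Gamma (- \<theta>) / (\<sigma>\<nu> * sqrt (2 * pi))"

lemma N_eq: "L.N m x = density0 * exp (- (x - a\<nu> * real m)\<^sup>2 / (2 * \<sigma>\<nu>\<^sup>2 * real m))"
  by (simp add: L.N_def density0_def)

lemma density0_pos: "0 < density0"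
  using L.Gamma_s_pos \<sigma>\<nu>_pos by (simp add: density0_def)

text \<open>At each level the normalised r-th powers are summed over all j^2 + 1 times. The
  polynomial factors, from the number of times and from the demanded precision 1 / j, are beaten by
  \<beta> to the power j powr (1/8), so the means are summable over j.\<close>

lemma AE_grid_fluctuation:
  assumes \<tau>: "\<And>i. 0 < \<tau> i"
  shows "AE x in E. \<forall>\<^sub>F j in sequentially. \<forall>i\<le>j\<^sup>2.
     \<bar>D (split_level j) (j - split_level j) (\<tau> i) x\<bar> \<le> \<tau> i powr \<theta> * m\<theta> ^ j / real j"
proof -
  have m0: "0 < m\<theta>" using Mom_\<theta>(2) by simp
  obtain K where K: "0 \<le> K" "\<And>k m t. 0 < t \<Longrightarrow>
    (\<integral>\<^sup>+x. ennreal (\<bar>D k m t x\<bar> powr r) \<partial>E) \<le> ennreal (K * (t powr \<theta> * m\<theta> ^ (k + m)) powr r * \<beta> ^ k)"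
    by (rule fluctuation) blast
  define u where "u j i x = real j / (\<tau> i powr \<theta> * m\<theta> ^ j) * \<bar>D (split_level j) (j - split_level j) (\<tau> i) x\<bar>" for j i x
  have [measurable]: "u j i \<in> borel_measurable E" for j i unfolding u_def by measurable
  have u0: "0 \<le> u j i x" for j i x unfolding u_def using m0 by simp
  define T where "T j x = (\<Sum>i\<le>j\<^sup>2. u j i x powr r)" for j x
  define s where "s j = (real j ^ 2 + 1) * (real j powr r * (K * \<beta> ^ split_level j))" for j
  have Tle: "(\<integral>\<^sup>+x. ennreal (T j x) \<partial>E) \<le> ennreal (s j)" for j
  proof -
    have "(\<integral>\<^sup>+x. ennreal (T j x) \<partial>E) = (\<Sum>i\<le>j\<^sup>2. \<integral>\<^sup>+x. ennreal (u j i x powr r) \<partial>E)"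
      unfolding T_def by (subst nn_integral_sum[symmetric]) auto
    also have "\<dots> \<le> (\<Sum>i\<le>j\<^sup>2. ennreal (real j powr r * (K * \<beta> ^ split_level j)))"
    proof (rule sum_mono)
      fix i
      let ?c = "\<tau> i powr \<theta> * m\<theta> ^ j"
      have c: "0 < ?c" using \<tau>[of i] m0 by simp
      have "(\<integral>\<^sup>+x. ennreal (u j i x powr r) \<partial>E) = ennreal ((real j / ?c) powr r) * (\<integral>\<^sup>+x. ennreal (\<bar>D (split_level j) (j - split_level j) (\<tau> i) x\<bar> powr r) \<partial>E)"
        unfolding u_def powr_mult by (subst ennreal_mult) (simp_all add: nn_integral_cmult)
      also have "\<dots> \<le> ennreal ((real j / ?c) powr r) * ennreal (K * ?c powr r * \<beta> ^ split_level j)"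
        using K(2)[OF \<tau>, of "split_level j" "j - split_level j" i] split_level_le_self[of j]
        by (intro mult_left_mono) auto
      also have "\<dots> = ennreal ((real j / ?c) powr r * (K * ?c powr r * \<beta> ^ split_level j))"
        using K \<beta> by (intro ennreal_mult[symmetric]) auto
      also have "(real j / ?c) powr r * (K * ?c powr r * \<beta> ^ split_level j) = real j powr r * (K * \<beta> ^ split_level j)"
      proof -
        have "(real j / b) powr r * b powr r = real j powr r" if "0 < b" for b
          using that by (simp add: powr_mult[symmetric])
        from this[OF c] have "(real j / ?c) powr r * ?c powr r = real j powr r" .
        then show ?thesis by (simp add: mult_ac) 
      qed
      finally show "(\<integral>\<^sup>+x. ennreal (u j i x powr r) \<partial>E) \<le> ennreal (real j powr r * (K * \<beta> ^ split_level j))" .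
    qed
    also have "\<dots> = ennreal (s j)"
      using K \<beta> by (simp add: s_def ennreal_mult ennreal_of_nat_eq_real_of_nat add.commute)
    finally show ?thesis .
  qed
  have s0: "0 \<le> s j" for j unfolding s_def using K \<beta> by simp
  define c where "c = - ln \<beta>"
  have c: "0 < c" using \<beta> by (simp add: c_def)
  have "summable s"
  proof (rule summable_if_bigo_inverse_square[OF s0])
    fix j :: nat assume j: "0 < j"
    have "\<beta> ^ split_level j = exp (- c * real (split_level j))"
      using \<beta> by (simp add: c_def mult.commute exp_of_nat_mult)
    also have "\<dots> \<le> exp (- c * (real j powr (1/8) - 1))"
      using c split_level_ge[of j] by simp
    finally have "\<beta> ^ split_level j \<le> exp (- c * (real j powr (1/8) - 1))" .
    moreover have "real j powr r \<le> real j powr 2" using j r by (intro powr_mono) auto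
    ultimately show "s j \<le> (real j ^ 2 + 1) * (real j powr 2 * (K * exp (- c * (real j powr (1/8) - 1))))"
      unfolding s_def using K \<beta> by (intro mult_left_mono mult_mono) auto
  next
    show "(\<lambda>j. (real j ^ 2 + 1) * (real j powr 2 * (K * exp (- c * (real j powr (1/8) - 1))))) \<in> O(\<lambda>j. 1 / real j ^ 2)"
    proof -
      have "(\<lambda>j. (real j ^ 2 + 1) * (real j powr 2 * exp (- c * (real j powr (1/8) - 1)))) \<in> O(\<lambda>j. 1 / real j ^ 2)"
        using c by real_asymp
      then have "(\<lambda>j. K * ((real j ^ 2 + 1) * (real j powr 2 * exp (- c * (real j powr (1/8) - 1))))) \<in> O(\<lambda>j. 1 / real j ^ 2)"
        by (cases "K = 0") auto
      then show ?thesis by (simp add: mult_ac)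
    qed
  qed
  then have "AE x in E. (\<lambda>j. T j x) \<longlonglongrightarrow> 0"
    by (intro AE_tendsto_0_if_summable[OF _ _ Tle _ s0]) (auto simp: T_def intro!: sum_nonneg)
  then show ?thesis
  proof eventually_elim
    case (elim x)
    have "\<forall>\<^sub>F j in sequentially. T j x < 1" using elim by (rule order_tendstoD) simp
    then show ?case using eventually_gt_at_top[of 0]
    proof eventually_elim
      case (elim j)
      show ?case
      proof (intro allI impI)
        fix i assume i: "i \<le> j\<^sup>2"
        have "u j i x powr r \<le> T j x" unfolding T_def using i by (intro member_le_sum) auto
        then have "u j i x powr r < 1" using elim by simp
        then have "u j i x \<le> 1" using r u0[of j i x] by (metis ge_one_powr_ge_zero less_eq_real_def not_less zero_less_one less_trans)
        moreover have "0 < \<tau> i powr \<theta> * m\<theta> ^ j" using \<tau>[of i] m0 by simp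
        ultimately show "\<bar>D (split_level j) (j - split_level j) (\<tau> i) x\<bar> \<le> \<tau> i powr \<theta> * m\<theta> ^ j / real j"
          using elim by (simp add: u_def field_simps)
      qed
    qed
  qed
qed

text \<open>An exponential Markov bound for the tilted weight of the words in the splitting
  generation whose displacement exceeds j powr (1/4).\<close>

definition tail :: "nat \<Rightarrow> env \<Rightarrow> real" where
  "tail j x = tsum (split_level j) (\<lambda>p. p powr (\<theta> - \<eta>)) x / m\<theta> ^ split_level j * exp (- (\<eta> * real j powr (1/4)))"

lemma AE_tail: "AE x in E. (\<lambda>j. tail j x) \<longlonglongrightarrow> 0"
proof -
  have m0: "0 < m\<theta>" using Mom_\<theta>(2) by simp
  have [measurable]: "tsum k (\<lambda>p. p powr (\<theta> - \<eta>)) \<in> borel_measurable E" for k by (rule tsum_measurable) auto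
  define M where "M = enn2real (Mom (\<theta> - \<eta>)) / m\<theta>"
  have M: "Mom (\<theta> - \<eta>) = ennreal (M * m\<theta>)" "0 \<le> M"
    using Mom_finite m0 by (auto simp: M_def \<eta>)
  define s where "s j = M ^ split_level j * exp (- (\<eta> * real j powr (1/4)))" for j
  have le: "(\<integral>\<^sup>+x. ennreal (tail j x) \<partial>E) \<le> ennreal (s j)" for j
  proof -
    let ?k = "split_level j"
    let ?c = "exp (- (\<eta> * real j powr (1/4))) / m\<theta> ^ ?k"
    have "(\<integral>\<^sup>+x. ennreal (tail j x) \<partial>E) = (\<integral>\<^sup>+x. ennreal ?c * ennreal (tsum ?k (\<lambda>p. p powr (\<theta> - \<eta>)) x) \<partial>E)"
      unfolding tail_def using m0
      by (intro nn_integral_cong) (subst ennreal_mult[symmetric], auto intro!: tsum_nonneg simp: mult_ac)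
    also have "\<dots> = ennreal ?c * Mom (\<theta> - \<eta>) ^ ?k"
      by (subst nn_integral_cmult) (auto simp: nn_integral_tsum expect_powr)
    also have "\<dots> = ennreal (?c * (M * m\<theta>) ^ ?k)"
      using M m0 by (subst M(1), subst ennreal_power, simp, subst ennreal_mult[symmetric]) auto
    also have "?c * (M * m\<theta>) ^ ?k = s j" using m0 by (simp add: s_def power_mult_distrib)
    finally show ?thesis by simp
  qed
  have s0: "0 \<le> s j" for j using M by (simp add: s_def)
  \<comment> \<open>All that matters is 0 < c and M <= exp c; the offset inside the logarithm covers
    M = 0.\<close>
  define c where "c = \<bar>ln (M + 1)\<bar> + 1"
  have c: "0 < c" by (simp add: c_def)
  have "summable s"
  proof (rule summable_if_bigo_inverse_square[OF s0])
    fix j :: nat assume "0 < j"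
    have "M \<le> exp c"
    proof -
      have "M + 1 = exp (ln (M + 1))" using M by simp
      also have "\<dots> \<le> exp c" unfolding exp_le_cancel_iff c_def by linarith
      finally show ?thesis by simp
    qed
    then have "M ^ split_level j \<le> exp c ^ split_level j" using M by (intro power_mono)
    also have "\<dots> = exp (c * real (split_level j))" by (rule exp_of_nat2_mult[symmetric])
    also have "\<dots> \<le> exp (c * real j powr (1/8))" using c split_level_le[of j] by simp
    finally show "s j \<le> exp (c * real j powr (1/8)) * exp (- (\<eta> * real j powr (1/4)))"
      unfolding s_def by (intro mult_right_mono) auto
  next
    show "(\<lambda>j. exp (c * real j powr (1/8)) * exp (- (\<eta> * real j powr (1/4)))) \<in> O(\<lambda>j. 1 / real j ^ 2)"
      using c \<eta>(1) by real_asymp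
  qed
  then show ?thesis
    by (intro AE_tendsto_0_if_summable[OF _ _ le _ s0])
       (use m0 in \<open>auto simp: tail_def intro!: divide_nonneg_nonneg mult_nonneg_nonneg tsum_nonneg\<close>)
qed

lemma env_uniform:
  assumes \<tau>: "\<And>i. 0 < \<tau> i"
  shows "AE x in E. \<exists>R. R \<longlonglongrightarrow> 0 \<and> (\<forall>\<^sub>F j in sequentially. \<forall>i\<le>j\<^sup>2.
     \<bar>sqrt (real (j - split_level j)) * (\<tau> i powr (- \<theta>) / m\<theta> ^ j * A j (\<tau> i) x)
       - W (split_level j) x * L.N (j - split_level j) (ln (\<tau> i) - a\<nu> * real (split_level j))\<bar> \<le> R j)"
proof -
  have m0: "0 < m\<theta>" using Mom_\<theta>(2) by simp
  obtain e where e: "e \<longlonglongrightarrow> 0" "\<And>m x. \<bar>sqrt (real m) * L.G m x - L.N m x\<bar> \<le> e m"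
    by (rule L.local_limit_error) blast
  obtain Li where Li: "0 \<le> Li" "\<And>m x y. m > 0 \<Longrightarrow> \<bar>L.N m x - L.N m y\<bar> \<le> Li * \<bar>x - y\<bar> / sqrt (real m)"
    by (rule L.N_lipschitz) blast
  show ?thesis
    using AE_good AE_W_tendsto AE_tail AE_grid_fluctuation[of \<tau>, OF \<tau>]
  proof eventually_elim
    case (elim x)
    let ?k = split_level
    let ?m = "\<lambda>j. j - split_level j"
    let ?h = "\<lambda>j. Li * (real j powr (1/4) + a\<nu> * real (?k j)) / sqrt (real (?m j))"
    \<comment> \<open>The summands belong, in this order, to the fluctuation D, to the local limit
      error \<open>e\<close> together with the Lipschitz cost \<open>?h\<close> of recentring, and
      to words with an excessive displacement.\<close>
    define R where "R j = sqrt (real j) / real j + W (?k j) x * (e (?m j) + ?h j) + density0 * tail j x" for j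
    have Wl: "(\<lambda>j. W (?k j) x) \<longlonglongrightarrow> Winf x"
      by (rule filterlim_compose[OF elim(2) split_level_at_top])
    have hl: "?h \<longlonglongrightarrow> 0"
    proof (rule Lim_null_comparison)
      show "(\<lambda>j. Li * ((real j powr (1/4) + a\<nu> * real j powr (1/8)) / sqrt (real j - real j powr (1/8)))) \<longlonglongrightarrow> 0"
      proof -
        have "(\<lambda>j. (real j powr (1/4) + a\<nu> * real j powr (1/8)) / sqrt (real j - real j powr (1/8))) \<longlonglongrightarrow> 0"
          using a\<nu>_pos by real_asymp
        then show ?thesis using tendsto_mult_right_zero by blast
      qed
      have ev: "\<forall>\<^sub>F j in sequentially. 0 < real j - real j powr (1/8)" by real_asymp
      show "\<forall>\<^sub>F j in sequentially. norm (?h j) \<le> Li * ((real j powr (1/4) + a\<nu> * real j powr (1/8)) / sqrt (real j - real j powr (1/8)))"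
        using ev
      proof eventually_elim
        case (elim j)
        have "(real j powr (1/4) + a\<nu> * real (?k j)) / sqrt (real (?m j)) \<le> (real j powr (1/4) + a\<nu> * real j powr (1/8)) / sqrt (real j - real j powr (1/8))"
          using elim a\<nu>_pos split_rest_ge[of j] split_level_le[of j]
          by (intro frac_le add_left_mono mult_left_mono add_nonneg_nonneg) auto
        then have "Li * ((real j powr (1/4) + a\<nu> * real (?k j)) / sqrt (real (?m j))) \<le> Li * ((real j powr (1/4) + a\<nu> * real j powr (1/8)) / sqrt (real j - real j powr (1/8)))"
          using Li(1) by (rule mult_left_mono)
        moreover have "0 \<le> ?h j" using Li(1) a\<nu>_pos by simp
        ultimately show ?case by simp
      qed
    qed
    have el: "(\<lambda>j. e (?m j)) \<longlonglongrightarrow> 0" by (rule filterlim_compose[OF e(1) split_rest_at_top])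
    have "(\<lambda>j. sqrt (real j) / real j + W (?k j) x * (e (?m j) + ?h j) + density0 * tail j x) \<longlonglongrightarrow> 0 + Winf x * (0 + 0) + density0 * 0"
      by (intro tendsto_intros Wl el hl elim) real_asymp
    then have Rl: "R \<longlonglongrightarrow> 0" by (simp add: R_def[abs_def])
    have ev: "\<forall>\<^sub>F j in sequentially. 0 < ?m j"
      using split_rest_at_top[unfolded filterlim_at_top, rule_format, of 1] by eventually_elim linarith
    have "\<forall>\<^sub>F j in sequentially. \<forall>i\<le>j\<^sup>2.
     \<bar>sqrt (real (?m j)) * (\<tau> i powr (- \<theta>) / m\<theta> ^ j * A j (\<tau> i) x) - W (?k j) x * L.N (?m j) (ln (\<tau> i) - a\<nu> * real (?k j))\<bar> \<le> R j"
      using elim(4) ev eventually_gt_at_top[of 0]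
    proof eventually_elim
      case (elim j)
      note good = \<open>good x\<close>
      let ?r = "sqrt (real (?m j))"
      show ?case
      proof (intro allI impI)
        fix i assume i: "i \<le> j\<^sup>2"
        define y where "y = ln (\<tau> i)"
        have km: "?k j + ?m j = j" using split_level_le_self[of j] by simp
        define c where "c v = pw x v powr \<theta> / m\<theta> ^ ?k j" for v
        have c0: "0 \<le> c v" for v using m0 by (simp add: c_def)
        have Wc: "W (?k j) x = (\<Sum>v\<in>alive (?k j) x. c v)" by (simp add: c_def W_0)
        have S: "\<tau> i powr (- \<theta>) / m\<theta> ^ j * A j (\<tau> i) x
           = \<tau> i powr (- \<theta>) / m\<theta> ^ j * D (?k j) (?m j) (\<tau> i) x + (\<Sum>v\<in>alive (?k j) x. c v * L.G (?m j) (y + ln (pw x v)))"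
        proof -
          have "\<tau> i powr (- \<theta>) / m\<theta> ^ j * EA (?m j) (\<tau> i * pw x v) = c v * L.G (?m j) (y + ln (pw x v))" if "v \<in> alive (?k j) x" for v
          proof -
            have p: "0 < pw x v" using that by (simp add: alive_def)
            have "m\<theta> ^ j = m\<theta> ^ ?k j * m\<theta> ^ ?m j" using km by (metis power_add)
            then show ?thesis using \<tau>[of i] p m0
              by (simp add: EA_def c_def y_def ln_mult powr_mult powr_minus field_simps)
          qed
          then have "(\<Sum>v\<in>alive (?k j) x. c v * L.G (?m j) (y + ln (pw x v))) = \<tau> i powr (- \<theta>) / m\<theta> ^ j * (\<Sum>v\<in>alive (?k j) x. EA (?m j) (\<tau> i * pw x v))"
            by (simp add: sum_distrib_left)
          moreover have "A j (\<tau> i) x = D (?k j) (?m j) (\<tau> i) x + (\<Sum>v\<in>alive (?k j) x. EA (?m j) (\<tau> i * pw x v))"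
            by (simp add: D_def km)
          ultimately show ?thesis by (simp add: distrib_left)
        qed
        have 1: "\<bar>?r * (\<tau> i powr (- \<theta>) / m\<theta> ^ j * D (?k j) (?m j) (\<tau> i) x)\<bar> \<le> sqrt (real j) / real j"
        proof -
          have t: "0 < \<tau> i powr (- \<theta>) / m\<theta> ^ j" using \<tau>[of i] m0 by simp
          have "\<tau> i powr (- \<theta>) / m\<theta> ^ j * \<bar>D (?k j) (?m j) (\<tau> i) x\<bar> \<le> \<tau> i powr (- \<theta>) / m\<theta> ^ j * (\<tau> i powr \<theta> * m\<theta> ^ j / real j)"
            using elim i t by (intro mult_left_mono) auto
          also have "\<dots> = 1 / real j" using \<tau>[of i] m0 by (simp add: powr_minus field_simps)
          finally have "?r * (\<tau> i powr (- \<theta>) / m\<theta> ^ j * \<bar>D (?k j) (?m j) (\<tau> i) x\<bar>) \<le> sqrt (real j) * (1 / real j)"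
            using t by (intro mult_mono mult_nonneg_nonneg less_imp_le[OF t]) auto
          then show ?thesis using t m0 by (simp add: abs_mult)
        qed
        \<comment> \<open>A displacement V of at most j powr (1/4) shifts the argument of N by
          o(sqrt j), which the Lipschitz bound absorbs. For larger V the two values of N differ by
          at most \<open>density0\<close>, and the exponential factor exceeds 1.\<close>
        have 2: "\<bar>?r * L.G (?m j) (y + ln (pw x v)) - L.N (?m j) (y - a\<nu> * real (?k j))\<bar>
            \<le> e (?m j) + ?h j + density0 * (pw x v powr (- \<eta>) * exp (- (\<eta> * real j powr (1/4))))" if v: "v \<in> alive (?k j) x" for v
        proof -
          have p: "0 < pw x v" "pw x v \<le> 1" using v good_pw_le_1[OF good] by (auto simp: alive_def)
          define V where "V = - ln (pw x v)"
          have V0: "0 \<le> V" using p by (simp add: V_def)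
          have pw': "pw x v powr (- \<eta>) * exp (- (\<eta> * real j powr (1/4))) = exp (\<eta> * (V - real j powr (1/4)))"
            using p by (simp add: V_def powr_def algebra_simps flip: exp_add)
          have h0: "0 \<le> ?h j" using Li(1) a\<nu>_pos by simp
          have "\<bar>L.N (?m j) (y + ln (pw x v)) - L.N (?m j) (y - a\<nu> * real (?k j))\<bar> \<le> ?h j + density0 * exp (\<eta> * (V - real j powr (1/4)))"
          proof (cases "V \<le> real j powr (1/4)")
            case True
            have "\<bar>L.N (?m j) (y + ln (pw x v)) - L.N (?m j) (y - a\<nu> * real (?k j))\<bar> \<le> Li * \<bar>(y + ln (pw x v)) - (y - a\<nu> * real (?k j))\<bar> / ?r"
              using elim by (intro Li) auto
            also have "\<dots> \<le> ?h j"
            proof -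
              have "\<bar>(y + ln (pw x v)) - (y - a\<nu> * real (?k j))\<bar> \<le> real j powr (1/4) + a\<nu> * real (?k j)"
                using True V0 mult_nonneg_nonneg[OF less_imp_le[OF a\<nu>_pos], of "real (?k j)"] unfolding V_def by simp
              then show ?thesis using Li(1) by (intro divide_right_mono mult_left_mono) auto
            qed
            finally show ?thesis using density0_pos by (simp add: add_increasing2)
          next
            case False
            have "1 \<le> exp (\<eta> * (V - real j powr (1/4)))" using False \<eta>(1) by simp
            then have "density0 * 1 \<le> density0 * exp (\<eta> * (V - real j powr (1/4)))"
              using density0_pos by (intro mult_left_mono) auto
            moreover have "\<bar>L.N (?m j) (y + ln (pw x v)) - L.N (?m j) (y - a\<nu> * real (?k j))\<bar> \<le> density0"
              using L.N_nonneg[of "?m j" "y + ln (pw x v)"] L.N_le[of "?m j" "y + ln (pw x v)"]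
                L.N_nonneg[of "?m j" "y - a\<nu> * real (?k j)"] L.N_le[of "?m j" "y - a\<nu> * real (?k j)"]
              unfolding density0_def[symmetric] by linarith
            ultimately show ?thesis using h0 by linarith
          qed
          then show ?thesis using e(2)[of "?m j" "y + ln (pw x v)"] unfolding pw' by linarith
        qed
        have "\<bar>?r * (\<Sum>v\<in>alive (?k j) x. c v * L.G (?m j) (y + ln (pw x v))) - W (?k j) x * L.N (?m j) (y - a\<nu> * real (?k j))\<bar>
          = \<bar>\<Sum>v\<in>alive (?k j) x. c v * (?r * L.G (?m j) (y + ln (pw x v)) - L.N (?m j) (y - a\<nu> * real (?k j)))\<bar>"
          unfolding Wc by (simp add: sum_distrib_left sum_distrib_right sum_subtractf right_diff_distrib mult_ac)
        also have "\<dots> \<le> (\<Sum>v\<in>alive (?k j) x. \<bar>c v * (?r * L.G (?m j) (y + ln (pw x v)) - L.N (?m j) (y - a\<nu> * real (?k j)))\<bar>)"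
          by (rule sum_abs)
        also have "\<dots> \<le> (\<Sum>v\<in>alive (?k j) x. c v * (e (?m j) + ?h j + density0 * (pw x v powr (- \<eta>) * exp (- (\<eta> * real j powr (1/4))))))"
          unfolding abs_mult abs_of_nonneg[OF c0] by (intro sum_mono mult_left_mono 2 c0)
        also have "\<dots> = (\<Sum>v\<in>alive (?k j) x. c v * (e (?m j) + ?h j)) + (\<Sum>v\<in>alive (?k j) x. density0 * (c v * pw x v powr (- \<eta>) * exp (- (\<eta> * real j powr (1/4)))))"
          by (simp add: distrib_left sum.distrib mult_ac)
        also have "(\<Sum>v\<in>alive (?k j) x. c v * (e (?m j) + ?h j)) = W (?k j) x * (e (?m j) + ?h j)"
          unfolding Wc by (simp add: sum_distrib_right)
        also have "(\<Sum>v\<in>alive (?k j) x. density0 * (c v * pw x v powr (- \<eta>) * exp (- (\<eta> * real j powr (1/4))))) = density0 * tail j x"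
        proof -
          have "c v * pw x v powr (- \<eta>) = pw x v powr (\<theta> - \<eta>) / m\<theta> ^ ?k j" for v
            by (simp add: c_def powr_add[symmetric])
          then show ?thesis unfolding tail_def tsum_def
            by (simp add: sum_distrib_left sum_distrib_right sum_divide_distrib mult_ac)
        qed
        finally have 3: "\<bar>?r * (\<Sum>v\<in>alive (?k j) x. c v * L.G (?m j) (y + ln (pw x v))) - W (?k j) x * L.N (?m j) (y - a\<nu> * real (?k j))\<bar>
           \<le> W (?k j) x * (e (?m j) + ?h j) + density0 * tail j x" .
        show "\<bar>?r * (\<tau> i powr (- \<theta>) / m\<theta> ^ j * A j (\<tau> i) x) - W (?k j) x * L.N (?m j) (ln (\<tau> i) - a\<nu> * real (?k j))\<bar> \<le> R j"
          using 1 3 unfolding S R_def y_def[symmetric] distrib_left[of ?r] by linarith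
      qed
    qed
    then show ?case using Rl by blast
  qed
qed

text \<open>The sequences i and j and the limit \<beta>' are quantified inside the almost sure
  statement, so that they may be chosen after the null set is fixed; \<open>empty_limit\<close>
  inserts grid indices that depend on n.\<close>

theorem env_limit:
  assumes \<tau>: "\<And>i. 0 < \<tau> i"
  shows "AE x in E. \<forall>i j \<beta>'. filterlim j at_top sequentially \<longrightarrow> (\<forall>\<^sub>F n in sequentially. i n \<le> (j n)\<^sup>2) \<longrightarrow>
     (\<lambda>n. (ln (\<tau> (i n)) - a\<nu> * real (j n)) / sqrt (real (j n))) \<longlonglongrightarrow> \<beta>' \<longrightarrow>
     (\<lambda>n. sqrt (real (j n)) * (\<tau> (i n) powr (- \<theta>) / m\<theta> ^ j n * A (j n) (\<tau> (i n)) x))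
        \<longlonglongrightarrow> Winf x * (density0 * exp (- \<beta>'\<^sup>2 / (2 * \<sigma>\<nu>\<^sup>2)))"
  using env_uniform[of \<tau>, OF \<tau>] AE_W_tendsto
proof eventually_elim
  case (elim x)
  then obtain R where R: "R \<longlonglongrightarrow> 0" and ev: "\<forall>\<^sub>F j in sequentially. \<forall>i\<le>j\<^sup>2.
     \<bar>sqrt (real (j - split_level j)) * (\<tau> i powr (- \<theta>) / m\<theta> ^ j * A j (\<tau> i) x)
       - W (split_level j) x * L.N (j - split_level j) (ln (\<tau> i) - a\<nu> * real (split_level j))\<bar> \<le> R j" by blast
  have Wl: "(\<lambda>j. W (split_level j) x) \<longlonglongrightarrow> Winf x"
    by (rule filterlim_compose[OF elim(2) split_level_at_top])
  show ?case
  proof (intro allI impI)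
    fix i j :: "nat \<Rightarrow> nat" and \<beta>' :: real
    assume j: "filterlim j at_top sequentially" and i: "\<forall>\<^sub>F n in sequentially. i n \<le> (j n)\<^sup>2"
      and b: "(\<lambda>n. (ln (\<tau> (i n)) - a\<nu> * real (j n)) / sqrt (real (j n))) \<longlonglongrightarrow> \<beta>'"
    define m where "m n = j n - split_level (j n)" for n
    define Y where "Y n = \<tau> (i n) powr (- \<theta>) / m\<theta> ^ j n * A (j n) (\<tau> (i n)) x" for n
    define q where "q n = real (j n) / real (m n)" for n
    have q: "q \<longlonglongrightarrow> 1" unfolding q_def m_def by (rule filterlim_compose[OF split_rest_ratio j])
    have mpos: "\<forall>\<^sub>F n in sequentially. 0 < m n"
      using filterlim_compose[OF split_rest_at_top j, unfolded filterlim_at_top, rule_format, of 1]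
      unfolding m_def by eventually_elim linarith
    have jpos: "\<forall>\<^sub>F n in sequentially. 0 < j n"
      using j[unfolded filterlim_at_top, rule_format, of 1] by eventually_elim linarith
    have Nl: "(\<lambda>n. L.N (m n) (ln (\<tau> (i n)) - a\<nu> * real (split_level (j n)))) \<longlonglongrightarrow> density0 * exp (- \<beta>'\<^sup>2 / (2 * \<sigma>\<nu>\<^sup>2))"
    proof -
      have "(\<lambda>n. density0 * exp (- (((ln (\<tau> (i n)) - a\<nu> * real (j n)) / sqrt (real (j n)))\<^sup>2 * q n) / (2 * \<sigma>\<nu>\<^sup>2)))
         \<longlonglongrightarrow> density0 * exp (- (\<beta>'\<^sup>2 * 1) / (2 * \<sigma>\<nu>\<^sup>2))"
        using \<sigma>\<nu>_pos by (intro tendsto_intros b q) auto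
      moreover have "\<forall>\<^sub>F n in sequentially. density0 * exp (- (((ln (\<tau> (i n)) - a\<nu> * real (j n)) / sqrt (real (j n)))\<^sup>2 * q n) / (2 * \<sigma>\<nu>\<^sup>2))
         = L.N (m n) (ln (\<tau> (i n)) - a\<nu> * real (split_level (j n)))"
        using mpos jpos
      proof eventually_elim
        case (elim n)
        \<comment> \<open>The recentring by the splitting generation and the drift of the remaining
          m steps recombine to the drift of j steps, so only the ratio j / m, which tends to 1,
          separates the two Gaussian exponents.\<close>
        have e: "ln (\<tau> (i n)) - a\<nu> * real (split_level (j n)) - a\<nu> * real (m n) = ln (\<tau> (i n)) - a\<nu> * real (j n)"
          using split_level_le_self[of "j n"] by (simp add: m_def right_diff_distrib)
        have "((ln (\<tau> (i n)) - a\<nu> * real (j n)) / sqrt (real (j n)))\<^sup>2 * q n = (ln (\<tau> (i n)) - a\<nu> * real (j n))\<^sup>2 / real (m n)"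
          using elim by (simp add: power_divide q_def)
        then show ?case unfolding N_eq e by (simp add: mult.commute)
      qed
      ultimately show ?thesis by (simp add: tendsto_cong)
    qed
    have "(\<lambda>n. W (split_level (j n)) x * L.N (m n) (ln (\<tau> (i n)) - a\<nu> * real (split_level (j n)))) \<longlonglongrightarrow> Winf x * (density0 * exp (- \<beta>'\<^sup>2 / (2 * \<sigma>\<nu>\<^sup>2)))"
      by (intro tendsto_mult Nl filterlim_compose[OF Wl j])
    moreover have "(\<lambda>n. sqrt (real (m n)) * Y n - W (split_level (j n)) x * L.N (m n) (ln (\<tau> (i n)) - a\<nu> * real (split_level (j n)))) \<longlonglongrightarrow> 0"
    proof (rule Lim_null_comparison)
      show "(\<lambda>n. R (j n)) \<longlonglongrightarrow> 0" by (rule filterlim_compose[OF R j])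
      show "\<forall>\<^sub>F n in sequentially. norm (sqrt (real (m n)) * Y n - W (split_level (j n)) x * L.N (m n) (ln (\<tau> (i n)) - a\<nu> * real (split_level (j n)))) \<le> R (j n)"
        using i eventually_compose_filterlim[OF ev j]
        by eventually_elim (simp add: m_def Y_def)
    qed
    ultimately have "(\<lambda>n. sqrt (real (m n)) * Y n) \<longlonglongrightarrow> Winf x * (density0 * exp (- \<beta>'\<^sup>2 / (2 * \<sigma>\<nu>\<^sup>2)))"
      using tendsto_add by fastforce
    from tendsto_mult[OF tendsto_real_sqrt[OF q] this]
    have "(\<lambda>n. sqrt (q n) * (sqrt (real (m n)) * Y n)) \<longlonglongrightarrow> sqrt 1 * (Winf x * (density0 * exp (- \<beta>'\<^sup>2 / (2 * \<sigma>\<nu>\<^sup>2))))" .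
    moreover have "\<forall>\<^sub>F n in sequentially. sqrt (q n) * (sqrt (real (m n)) * Y n) = sqrt (real (j n)) * Y n"
      using mpos by eventually_elim (simp add: q_def real_sqrt_divide)
    ultimately have "(\<lambda>n. sqrt (real (j n)) * Y n) \<longlonglongrightarrow> sqrt 1 * (Winf x * (density0 * exp (- \<beta>'\<^sup>2 / (2 * \<sigma>\<nu>\<^sup>2))))"
      by (rule Lim_transform_eventually)
    then show "(\<lambda>n. sqrt (real (j n)) * (\<tau> (i n) powr (- \<theta>) / m\<theta> ^ j n * A (j n) (\<tau> (i n)) x))
        \<longlonglongrightarrow> Winf x * (density0 * exp (- \<beta>'\<^sup>2 / (2 * \<sigma>\<nu>\<^sup>2)))"
      unfolding Y_def by simp
  qed
qed

end

section \<open>The logarithmic moment function\<close>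

lemma abs_exp_diff_le: "\<bar>exp a - exp b\<bar> \<le> \<bar>a - b\<bar> * exp (max a b)" for a b :: real
proof -
  have *: "\<bar>exp a - exp b\<bar> \<le> \<bar>a - b\<bar> * exp (max a b)" if "b \<le> a" for a b :: real
  proof -
    have "exp a * (1 + (b - a)) \<le> exp a * exp (b - a)" using exp_ge_add_one_self by (intro mult_left_mono) auto
    then have "exp a - exp b \<le> (a - b) * exp a" by (simp add: exp_diff algebra_simps)
    moreover have "exp b \<le> exp a" using that by simp
    ultimately show ?thesis using that by (simp add: max_def abs_if)
  qed
  show ?thesis using *[of b a] *[of a b] by (cases "b \<le> a") (auto simp: abs_minus_commute max.commute)
qed

context
  fixes \<mu> :: "real measure" and \<tau> :: real
  assumes sets_\<mu> [measurable_cong]: "sets \<mu> = sets borel" and nn: "AE v in \<mu>. 0 \<le> v"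
    and int: "integrable \<mu> (\<lambda>v. exp (- (\<tau> * v)))"
begin

lemma laplace_integrable:
  assumes "\<tau> < t" shows "integrable \<mu> (\<lambda>v. v ^ n * exp (- (t * v)))"
proof (rule Bochner_Integration.integrable_bound[OF integrable_mult_right[OF int, of "fact n / (t - \<tau>) ^ n"]])
  show "AE v in \<mu>. norm (v ^ n * exp (- (t * v))) \<le> norm (fact n / (t - \<tau>) ^ n * exp (- (\<tau> * v)))"
    using nn
  proof eventually_elim
    case (elim v)
    have "v ^ n * exp (- (t * v)) \<le> fact n / (t - \<tau>) ^ n * exp ((t - \<tau>) * v) * exp (- (t * v))"
      using elim assms by (intro mult_right_mono power_le_exp) auto
    also have "\<dots> = fact n / (t - \<tau>) ^ n * exp (- (\<tau> * v))" by (simp add: algebra_simps flip: exp_add)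
    finally show ?case using elim assms by (simp add: abs_mult)
  qed
qed measurable

text \<open>Differentiation under the integral, along sequences. The interval of radius \<delta>
  around t stays to the right of \<tau>, and the bound \<open>abs_exp_diff_le\<close> supplies the
  integrable majorant v^(n+1) exp (- (t - \<delta>) v).\<close>

lemma laplace_deriv:
  assumes t: "\<tau> < t"
  shows "((\<lambda>t. LINT v|\<mu>. v ^ n * exp (- (t * v))) has_real_derivative - (LINT v|\<mu>. v ^ Suc n * exp (- (t * v)))) (at t)"
proof -
  let ?F = "\<lambda>t. LINT v|\<mu>. v ^ n * exp (- (t * v))"
  define \<delta> where "\<delta> = (t - \<tau>) / 2"
  have d: "0 < \<delta>" "\<tau> < t - \<delta>" using t by (auto simp: \<delta>_def field_simps)
  have main: "(\<lambda>k. (?F (t + X k) - ?F t) / X k) \<longlonglongrightarrow> - (LINT v|\<mu>. v ^ Suc n * exp (- (t * v)))"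
    if X0: "\<And>k. X k \<noteq> 0" and Xl: "X \<longlonglongrightarrow> 0" and Xd: "\<And>k. \<bar>X k\<bar> \<le> \<delta>" for X :: "nat \<Rightarrow> real"
  proof -
    have eq: "(?F (t + X k) - ?F t) / X k = (LINT v|\<mu>. (v ^ n * exp (- ((t + X k) * v)) - v ^ n * exp (- (t * v))) / X k)" for k
    proof -
      have "\<tau> < t + X k" using Xd[of k] d by linarith
      then show ?thesis using laplace_integrable[of "t + X k" n] laplace_integrable[OF t, of n]
        by simp
    qed
    have "(\<lambda>k. LINT v|\<mu>. (v ^ n * exp (- ((t + X k) * v)) - v ^ n * exp (- (t * v))) / X k) \<longlonglongrightarrow> (LINT v|\<mu>. - (v ^ Suc n * exp (- (t * v))))"
    proof (rule integral_dominated_convergence[where w = "\<lambda>v. v ^ Suc n * exp (- ((t - \<delta>) * v))"])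
      show "integrable \<mu> (\<lambda>v. v ^ Suc n * exp (- ((t - \<delta>) * v)))" by (rule laplace_integrable[OF d(2)])
      show "AE v in \<mu>. (\<lambda>k. (v ^ n * exp (- ((t + X k) * v)) - v ^ n * exp (- (t * v))) / X k) \<longlonglongrightarrow> - (v ^ Suc n * exp (- (t * v)))"
      proof (rule AE_I2)
        fix v
        have "((\<lambda>s. v ^ n * exp (- (s * v))) has_real_derivative - (v ^ Suc n * exp (- (t * v)))) (at t)"
          by (auto intro!: derivative_eq_intros)
        then have "((\<lambda>h. (v ^ n * exp (- ((t + h) * v)) - v ^ n * exp (- (t * v))) / h) \<longlongrightarrow> - (v ^ Suc n * exp (- (t * v)))) (at 0)"
          by (simp add: DERIV_def)
        then show "(\<lambda>k. (v ^ n * exp (- ((t + X k) * v)) - v ^ n * exp (- (t * v))) / X k) \<longlonglongrightarrow> - (v ^ Suc n * exp (- (t * v)))"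
          by (rule filterlim_compose) (use X0 Xl in \<open>auto simp: filterlim_at\<close>)
      qed
      show "AE v in \<mu>. norm ((v ^ n * exp (- ((t + X k) * v)) - v ^ n * exp (- (t * v))) / X k) \<le> v ^ Suc n * exp (- ((t - \<delta>) * v))" for k
        using nn
      proof eventually_elim
        case (elim v)
        have "\<bar>exp (- ((t + X k) * v)) - exp (- (t * v))\<bar> \<le> \<bar>- ((t + X k) * v) - - (t * v)\<bar> * exp (max (- ((t + X k) * v)) (- (t * v)))"
          by (rule abs_exp_diff_le)
        also have "\<bar>- ((t + X k) * v) - - (t * v)\<bar> = \<bar>X k\<bar> * v" using elim by (simp add: algebra_simps abs_mult)
        also have "max (- ((t + X k) * v)) (- (t * v)) \<le> - ((t - \<delta>) * v)"
        proof -
          have "(t - \<delta>) * v \<le> (t + X k) * v" "(t - \<delta>) * v \<le> t * v"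
            using elim Xd[of k] d by (auto intro!: mult_right_mono)
          then show ?thesis by simp
        qed
        then have "\<bar>X k\<bar> * v * exp (max (- ((t + X k) * v)) (- (t * v))) \<le> \<bar>X k\<bar> * v * exp (- ((t - \<delta>) * v))"
          using elim by (intro mult_left_mono) auto
        finally have "\<bar>exp (- ((t + X k) * v)) - exp (- (t * v))\<bar> \<le> \<bar>X k\<bar> * v * exp (- ((t - \<delta>) * v))" .
        then have "v ^ n * \<bar>exp (- ((t + X k) * v)) - exp (- (t * v))\<bar> \<le> v ^ n * (\<bar>X k\<bar> * v * exp (- ((t - \<delta>) * v)))"
          using elim by (intro mult_left_mono) auto
        moreover have "norm ((v ^ n * exp (- ((t + X k) * v)) - v ^ n * exp (- (t * v))) / X k)
          = v ^ n * \<bar>exp (- ((t + X k) * v)) - exp (- (t * v))\<bar> / \<bar>X k\<bar>"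
          using elim by (simp add: abs_mult flip: right_diff_distrib)
        ultimately show ?case using X0[of k] by (simp add: divide_le_eq mult_ac)
      qed
    qed measurable
    then show ?thesis by (simp add: eq)
  qed
  show ?thesis
    unfolding DERIV_def tendsto_at_iff_sequentially
  proof (intro allI impI)
    fix X :: "nat \<Rightarrow> real" assume X: "\<forall>i. X i \<in> UNIV - {0}" "X \<longlonglongrightarrow> 0"
    have "\<forall>\<^sub>F k in sequentially. \<bar>X k\<bar> < \<delta>"
      using tendsto_rabs[OF X(2)] d by (intro order_tendstoD(2)) auto
    then obtain K where K: "\<And>k. k \<ge> K \<Longrightarrow> \<bar>X k\<bar> < \<delta>" by (auto simp: eventually_sequentially)
    have "(\<lambda>k. (?F (t + X (k + K)) - ?F t) / X (k + K)) \<longlonglongrightarrow> - (LINT v|\<mu>. v ^ Suc n * exp (- (t * v)))"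
    proof (rule main)
      show "(\<lambda>k. X (k + K)) \<longlonglongrightarrow> 0" using X(2) by (rule LIMSEQ_ignore_initial_segment)
      show "\<bar>X (k + K)\<bar> \<le> \<delta>" for k using K[of "k + K"] by simp
    qed (use X in auto)
    then have "(\<lambda>k. (?F (t + X k) - ?F t) / X k) \<longlonglongrightarrow> - (LINT v|\<mu>. v ^ Suc n * exp (- (t * v)))"
      by (rule LIMSEQ_offset)
    then show "((\<lambda>h. (?F (t + h) - ?F t) / h) \<circ> X) \<longlonglongrightarrow> - (LINT v|\<mu>. v ^ Suc n * exp (- (t * v)))"
      by (simp add: o_def)
  qed
qed

end

section \<open>The moment function as a Laplace transform\<close>

context tree_pos
begin

text \<open>The untilted intensity measure of the displacements. Its Laplace transform is
  \<open>Mom\<close>, and the step law \<nu> is an exponential tilt of it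
  (\<open>\<nu>_eq_density\<close>).\<close>

definition \<kappa> :: "real measure" where
  "\<kappa> = distr (density (\<rho> \<Otimes>\<^sub>M count_space UNIV) (\<lambda>z. ennreal (if 0 < fst z (snd z) then 1 else 0)))
     borel (\<lambda>z. - ln (fst z (snd z)))"

lemma sets_\<kappa> [measurable_cong, simp]: "sets \<kappa> = sets borel" by (simp add: \<kappa>_def)

lemma borel_measurable_\<kappa>: "f \<in> borel_measurable borel \<Longrightarrow> f \<in> borel_measurable \<kappa>"
  using measurable_cong_sets[OF sets_\<kappa> refl] by blast

lemma nn_integral_\<kappa>:
  assumes [measurable]: "f \<in> borel_measurable borel"
  shows "(\<integral>\<^sup>+v. f v \<partial>\<kappa>) = Q (\<lambda>p. f (- ln p))"
proof -
  interpret c: sigma_finite_measure "count_space (UNIV :: nat set)" by (rule sigma_finite_measure_count_space)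
  have "(\<integral>\<^sup>+v. f v \<partial>\<kappa>) = (\<integral>\<^sup>+z. ennreal (if 0 < fst z (snd z) then 1 else 0) * f (- ln (fst z (snd z))) \<partial>(\<rho> \<Otimes>\<^sub>M count_space UNIV))"
    unfolding \<kappa>_def by (simp add: nn_integral_distr nn_integral_density)
  also have "\<dots> = (\<integral>\<^sup>+y. \<integral>\<^sup>+k. ennreal (if 0 < y k then 1 else 0) * f (- ln (y k)) \<partial>count_space UNIV \<partial>\<rho>)"
    by (subst c.nn_integral_fst[symmetric]) (auto cong: if_cong)
  also have "\<dots> = Q (\<lambda>p. f (- ln p))"
    unfolding Q_def by (intro nn_integral_cong) auto
  finally show ?thesis .
qed

lemma AE_\<kappa>_nonneg: "AE v in \<kappa>. 0 \<le> v"
proof -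
  have "(\<integral>\<^sup>+v. (if 0 \<le> v then 0 else 1) \<partial>\<kappa>) = Q (\<lambda>p. (if 0 \<le> - ln p then 0 else 1))"
    by (rule nn_integral_\<kappa>) measurable
  also have "\<dots> \<le> Q (\<lambda>p. 0)" by (rule Q_mono) auto
  also have "\<dots> = 0" by (simp add: Q_def)
  finally have "(\<integral>\<^sup>+v. (if 0 \<le> v then 0 else 1) \<partial>\<kappa>) = (0::ennreal)" by simp
  then have "AE v in \<kappa>. (if 0 \<le> v then 0 else 1) = (0::ennreal)"
    by (subst (asm) nn_integral_0_iff_AE) auto
  then show ?thesis by eventually_elim (auto split: if_splits)
qed

lemma Mom_\<kappa>: "Mom t = (\<integral>\<^sup>+v. ennreal (exp (- (t * v))) \<partial>\<kappa>)"
  unfolding Mom_def by (subst nn_integral_\<kappa>) (auto intro!: Q_cong simp: powr_def)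

text \<open>Up to the sign (-1)^n the n-th derivative of the moment function, to the right of a
  point where that function is finite (\<open>F_deriv\<close>).\<close>

definition F :: "nat \<Rightarrow> real \<Rightarrow> real" where "F n t = (LINT v|\<kappa>. v ^ n * exp (- (t * v)))"

definition lamT :: "real \<Rightarrow> real" where "lamT t = ln (enn2real (Mom t))"

lemma integrable_\<kappa>: "Mom t < \<infinity> \<Longrightarrow> integrable \<kappa> (\<lambda>v. exp (- (t * v)))"
  by (rule integrableI_nonneg[OF borel_measurable_\<kappa>]) (auto simp: Mom_\<kappa>)

lemma F_0: "enn2real (Mom t) = F 0 t"
  unfolding Mom_\<kappa> F_def by (subst integral_eq_nn_integral) (auto intro!: borel_measurable_\<kappa>)

lemma lamT_eq: "lamT = (\<lambda>t. ln (F 0 t))" by (simp add: fun_eq_iff lamT_def F_0)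

lemma F_integrable: "Mom \<tau> < \<infinity> \<Longrightarrow> \<tau> < t \<Longrightarrow> integrable \<kappa> (\<lambda>v. v ^ n * exp (- (t * v)))"
  by (rule laplace_integrable[OF sets_\<kappa> AE_\<kappa>_nonneg integrable_\<kappa>])

lemma F_deriv: "Mom \<tau> < \<infinity> \<Longrightarrow> \<tau> < t \<Longrightarrow> (F n has_real_derivative - F (Suc n) t) (at t)"
  unfolding F_def[abs_def] by (rule laplace_deriv[OF sets_\<kappa> AE_\<kappa>_nonneg integrable_\<kappa>])

context
  fixes \<tau> :: real
  assumes \<tau>: "Mom \<tau> < \<infinity>" and pos: "\<And>t. 0 < Mom t"
begin

lemma F0_pos: "\<tau> < t \<Longrightarrow> 0 < F 0 t"
proof -
  assume "\<tau> < t"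
  then have "Mom t < \<infinity>" using Mom_antimono[of \<tau> t] \<tau> le_less_trans by auto
  then show ?thesis using pos[of t] by (simp add: F_0[symmetric] enn2real_positive_iff)
qed

lemma lamT_deriv: "\<tau> < t \<Longrightarrow> (lamT has_real_derivative - F 1 t / F 0 t) (at t)"
  unfolding lamT_eq using F0_pos[of t] F_deriv[OF \<tau>, of t 0]
  by (auto intro!: derivative_eq_intros)

lemma deriv_lamT: "\<tau> < t \<Longrightarrow> deriv lamT t = - F 1 t / F 0 t"
  using lamT_deriv by (rule DERIV_imp_deriv)

lemma deriv_lamT_deriv:
  assumes t: "\<tau> < t"
  shows "(deriv lamT has_real_derivative F 2 t / F 0 t - (F 1 t / F 0 t)\<^sup>2) (at t)"
proof -
  have d: "((\<lambda>t. - F 1 t / F 0 t) has_real_derivative F 2 t / F 0 t - (F 1 t / F 0 t)\<^sup>2) (at t)"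
    using F_deriv[OF \<tau> t, of 0] F_deriv[OF \<tau> t, of 1] F0_pos[OF t]
    by (auto intro!: derivative_eq_intros simp: numeral_2_eq_2 power2_eq_square field_simps)
  have ev: "\<forall>\<^sub>F s in nhds t. deriv lamT s = - F 1 s / F 0 s"
    using eventually_nhds_in_open[of "{\<tau><..}" t] t by (auto elim!: eventually_mono simp: deriv_lamT)
  show ?thesis using DERIV_cong_ev[OF refl ev refl] d by simp
qed

text \<open>The expression is the variance of the law with density proportional to exp (- t v) with
  respect to \<kappa>; the proof expands the square around its mean \<open>?c\<close>.\<close>

lemma variance_nonneg:
  assumes t: "\<tau> < t" shows "0 \<le> F 2 t / F 0 t - (F 1 t / F 0 t)\<^sup>2"
proof -
  let ?c = "F 1 t / F 0 t"
  have p: "0 < F 0 t" by (rule F0_pos[OF t])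
  have i: "integrable \<kappa> (\<lambda>v. exp (- (t * v)))" "integrable \<kappa> (\<lambda>v. v * exp (- (t * v)))" "integrable \<kappa> (\<lambda>v. v\<^sup>2 * exp (- (t * v)))"
    using F_integrable[OF \<tau> t, of 0] F_integrable[OF \<tau> t, of 1] F_integrable[OF \<tau> t, of 2] by simp_all
  have "0 \<le> (LINT v|\<kappa>. (v - ?c)\<^sup>2 * exp (- (t * v)))" by (intro integral_nonneg_AE AE_I2) simp
  also have "\<dots> = (LINT v|\<kappa>. v\<^sup>2 * exp (- (t * v)) - 2 * ?c * (v * exp (- (t * v))) + ?c\<^sup>2 * exp (- (t * v)))"
    by (intro Bochner_Integration.integral_cong) (auto simp: power2_eq_square algebra_simps)
  also have "\<dots> = F 2 t - 2 * ?c * F 1 t + ?c\<^sup>2 * F 0 t"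
    using i unfolding F_def by simp
  also have "\<dots> = F 0 t * (F 2 t / F 0 t - ?c\<^sup>2)"
    using p by (simp add: power2_eq_square field_simps)
  finally show ?thesis using p by (simp add: zero_le_mult_iff)
qed

text \<open>The tangent to \<open>lamT\<close> has intercept \<open>lamT t - t * deriv lamT t\<close>, whose derivative is
  \<open>- t * deriv (deriv lamT) t \<ge> 0\<close> for negative \<open>t\<close>.\<close>

lemma intercept_mono:
  assumes "\<tau> < t" "t \<le> t'" "t' \<le> 0"
  shows "t' * deriv lamT t' - lamT t' \<le> t * deriv lamT t - lamT t"
proof (rule DERIV_nonpos_imp_nonincreasing[OF assms(2)])
  fix s assume s: "t \<le> s" "s \<le> t'"
  then have ts: "\<tau> < s" "s \<le> 0" using assms by auto
  let ?V = "F 2 s / F 0 s - (F 1 s / F 0 s)\<^sup>2"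
  have "((\<lambda>t. t * deriv lamT t - lamT t) has_real_derivative 1 * deriv lamT s + ?V * s - (- F 1 s / F 0 s)) (at s)"
    by (intro DERIV_diff DERIV_mult DERIV_ident deriv_lamT_deriv lamT_deriv ts)
  moreover have "1 * deriv lamT s + ?V * s - (- F 1 s / F 0 s) \<le> 0"
    using variance_nonneg[OF ts(1)] ts(2) by (simp add: deriv_lamT[OF ts(1)] mult_nonneg_nonpos)
  ultimately show "\<exists>y. ((\<lambda>t. t * deriv lamT t - lamT t) has_real_derivative y) (at s) \<and> y \<le> 0" by blast
qed

text \<open>The function \<open>lamT (r * \<theta>) - r * lamT \<theta>\<close> of r vanishes at r =
  1, and its derivative there is the quantity assumed to be negative, so every r slightly above 1
  gives the strict inequality.\<close>

lemma exists_exponent: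
  assumes t: "\<tau> < \<theta>" "\<theta> < 0" and neg: "\<theta> * deriv lamT \<theta> - lamT \<theta> < 0"
  obtains r where "1 < r" "r \<le> 2" "\<tau> < 1 - (1 - \<theta>) * r" "enn2real (Mom (r * \<theta>)) < enn2real (Mom \<theta>) powr r"
proof -
  have "((\<lambda>r. lamT (r * \<theta>) - r * lamT \<theta>) has_real_derivative (- F 1 (1 * \<theta>) / F 0 (1 * \<theta>)) * \<theta> - lamT \<theta>) (at 1)"
  proof (rule DERIV_diff)
    show "((\<lambda>r. lamT (r * \<theta>)) has_real_derivative (- F 1 (1 * \<theta>) / F 0 (1 * \<theta>)) * \<theta>) (at 1)"
      by (rule DERIV_chain2[where f = lamT and g = "\<lambda>r. r * \<theta>"], rule lamT_deriv)
         (use t in \<open>auto intro!: derivative_eq_intros\<close>)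
    show "((\<lambda>r. r * lamT \<theta>) has_real_derivative lamT \<theta>) (at 1)" by (auto intro!: derivative_eq_intros)
  qed
  moreover have "(- F 1 (1 * \<theta>) / F 0 (1 * \<theta>)) * \<theta> - lamT \<theta> < 0"
    using neg by (simp add: deriv_lamT[OF t(1)] mult.commute)
  ultimately obtain d where d: "0 < d" "\<And>h. 0 < h \<Longrightarrow> h < d \<Longrightarrow> lamT ((1 + h) * \<theta>) - (1 + h) * lamT \<theta> < lamT (1 * \<theta>) - 1 * lamT \<theta>"
    using DERIV_neg_dec_right[of "\<lambda>r. lamT (r * \<theta>) - r * lamT \<theta>" _ 1] by blast
  \<comment> \<open>The three bounds give h < d, then r = 1 + h <= 2, and finally \<open>1 - (1 -
    \<theta>) * r = \<theta> - h * (1 - \<theta>) > \<tau>\<close>.\<close>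
  define h where "h = min (min (d / 2) 1) ((\<theta> - \<tau>) / (2 * (1 - \<theta>)))"
  have h: "0 < h" "h < d" "h \<le> 1" using d t by (auto simp: h_def)
  have "h * (1 - \<theta>) \<le> (\<theta> - \<tau>) / (2 * (1 - \<theta>)) * (1 - \<theta>)" using t by (intro mult_right_mono) (auto simp: h_def)
  also have "\<dots> = (\<theta> - \<tau>) / 2" using t by (simp add: field_simps)
  also have "\<dots> < \<theta> - \<tau>" using t by simp
  finally have hb: "h * (1 - \<theta>) < \<theta> - \<tau>" .
  have lt: "lamT ((1 + h) * \<theta>) < (1 + h) * lamT \<theta>" using d(2)[OF h(1,2)] by simp
  have b: "\<tau> < 1 - (1 - \<theta>) * (1 + h)" using hb by (simp add: algebra_simps)
  have b2: "\<tau> < (1 + h) * \<theta>"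
    using b h by (simp add: algebra_simps)
  have "enn2real (Mom ((1 + h) * \<theta>)) = exp (lamT ((1 + h) * \<theta>))"
    using F0_pos[OF b2] by (simp add: lamT_eq F_0)
  also have "\<dots> < exp ((1 + h) * lamT \<theta>)" using lt by simp
  also have "\<dots> = enn2real (Mom \<theta>) powr (1 + h)"
    using F0_pos[OF t(1)] by (simp add: lamT_eq F_0 powr_def)
  finally show thesis using h b by (intro that[of "1 + h"]) auto
qed

end

end

context nonlattice_tilted_tree
begin

lemma \<nu>_eq_density: "\<nu> = density \<kappa> (\<lambda>v. ennreal (exp (- (\<theta> * v)) / m\<theta>))"
proof (rule measure_eqI)
  fix A assume "A \<in> sets \<nu>"
  then have [measurable]: "A \<in> sets borel" by simp
  have "emeasure \<nu> A = (\<integral>\<^sup>+v. indicator A v \<partial>\<nu>)" by simp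
  also have "\<dots> = Q (\<lambda>p. ennreal (p powr \<theta> / m\<theta>) * indicator A (- ln p))" by (rule nn_integral_\<nu>) measurable
  also have "\<dots> = (\<integral>\<^sup>+v. ennreal (exp (- (\<theta> * v)) / m\<theta>) * indicator A v \<partial>\<kappa>)"
    by (subst nn_integral_\<kappa>) (auto intro!: Q_cong simp: powr_def)
  also have "\<dots> = emeasure (density \<kappa> (\<lambda>v. ennreal (exp (- (\<theta> * v)) / m\<theta>))) A"
    by (subst emeasure_density) (auto intro!: borel_measurable_\<kappa>)
  finally show "emeasure \<nu> A = emeasure (density \<kappa> (\<lambda>v. ennreal (exp (- (\<theta> * v)) / m\<theta>))) A" .
qed simp

lemma m\<theta>_eq_F: "m\<theta> = F 0 \<theta>" by (simp add: m\<theta>_def F_0)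

lemma integral_\<nu>:
  fixes f :: "real \<Rightarrow> real"
  assumes [measurable]: "f \<in> borel_measurable borel"
  shows "\<nu>.expectation f = (LINT v|\<kappa>. f v * exp (- (\<theta> * v))) / F 0 \<theta>"
proof -
  have fm: "f \<in> borel_measurable \<kappa>" by (rule borel_measurable_\<kappa>) measurable
  have gm: "(\<lambda>v. exp (- (\<theta> * v)) / m\<theta>) \<in> borel_measurable \<kappa>" by (rule borel_measurable_\<kappa>) measurable
  have "\<nu>.expectation f = (LINT v|\<kappa>. (exp (- (\<theta> * v)) / m\<theta>) *\<^sub>R f v)"
    unfolding \<nu>_eq_density by (rule integral_density[OF fm gm]) (use Mom_\<theta>(2) in auto)
  also have "\<dots> = (LINT v|\<kappa>. (f v * exp (- (\<theta> * v))) / m\<theta>)"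
    by (rule Bochner_Integration.integral_cong) auto
  also have "\<dots> = (LINT v|\<kappa>. f v * exp (- (\<theta> * v))) / F 0 \<theta>"
    unfolding m\<theta>_eq_F by (rule integral_divide_zero)
  finally show ?thesis .
qed

text \<open>Together with \<open>deriv_lamT\<close> and \<open>deriv_lamT_deriv\<close> this
  identifies the mean and variance of the tilted step with the derivatives of the logarithmic moment
  function that occur in the theorem.\<close>

lemma moments_eq:
  assumes \<tau>: "Mom \<tau> < \<infinity>" "\<tau> < \<theta>"
  shows "a\<nu> = F 1 \<theta> / F 0 \<theta>" "\<sigma>\<nu>\<^sup>2 = F 2 \<theta> / F 0 \<theta> - (F 1 \<theta> / F 0 \<theta>)\<^sup>2"
proof -
  have e: "\<nu>.expectation (\<lambda>v. v ^ n) = F n \<theta> / F 0 \<theta>" for n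
    unfolding F_def[of n] by (rule integral_\<nu>) measurable
  show a: "a\<nu> = F 1 \<theta> / F 0 \<theta>" unfolding a\<nu>_def using e[of 1] by simp
  have "\<sigma>\<nu>\<^sup>2 = \<nu>.expectation (\<lambda>v. v\<^sup>2) - a\<nu>\<^sup>2"
    unfolding \<sigma>\<nu>_pos(2)[symmetric] unfolding a\<nu>_def
    by (rule \<nu>.variance_eq) (use integrable_\<nu>_id integrable_\<nu>_sq[of 0] in auto)
  then show "\<sigma>\<nu>\<^sup>2 = F 2 \<theta> / F 0 \<theta> - (F 1 \<theta> / F 0 \<theta>)\<^sup>2" by (simp add: a e)
qed

end

section \<open>Empty boxes\<close>

text \<open>The box end points as functions of a deterministic environment, so that the argument can
  run on the product of \<open>E\<close> and \<open>balls\<close> and be transferred to the given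
  probability space at the end.\<close>

definition elo :: "env \<Rightarrow> nat list \<Rightarrow> real" where
  "elo x u = (\<Sum>\<^sub>\<infinity> v \<in> {v. length v = length u \<and> (v, u) \<in> lex less_than}. pw x v)"

definition ehi :: "env \<Rightarrow> nat list \<Rightarrow> real" where
  "ehi x u = (\<Sum>\<^sub>\<infinity> v \<in> {v. length v = length u \<and> ((v, u) \<in> lex less_than \<or> v = u)}. pw x v)"

definition ebox :: "env \<Rightarrow> nat list \<Rightarrow> real set" where "ebox x u = {elo x u ..< ehi x u}"

definition empty_count :: "nat \<Rightarrow> nat \<Rightarrow> env \<Rightarrow> (nat \<Rightarrow> real) \<Rightarrow> real" where
  "empty_count n j x U = real (card (alive j x)) - real (card {u. length u = j \<and> 1 \<le> card {i. i < n \<and> U i \<in> ebox x u}})"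

lemma lex_irrefl: "(u, u) \<notin> lex less_than"
  using wf_not_refl[OF wf_lex[OF wf_less_than]] by blast

lemma lex_total: "length u = length v \<Longrightarrow> u \<noteq> v \<Longrightarrow> (u, v) \<in> lex less_than \<or> (v, u) \<in> lex less_than"
proof -
  have "total less_than" by (auto simp: total_on_def)
  from total_lexord[OF this] show "length u = length v \<Longrightarrow> u \<noteq> v \<Longrightarrow> (u, v) \<in> lex less_than \<or> (v, u) \<in> lex less_than"
    by (auto simp: lexord_lex total_on_def)
qed

lemma lex_transitive: "(u, v) \<in> lex less_than \<Longrightarrow> (v, w) \<in> lex less_than \<Longrightarrow> (u, w) \<in> lex less_than"
  using lexord_trans[of u v less_than w] by (auto simp: lexord_lex trans_less_than)

lemma good_infsum:
  assumes "good x" "B \<subseteq> lev j"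
  shows "infsum (pw x) B = (\<Sum>v\<in>alive j x \<inter> B. pw x v)"
proof -
  have "infsum (pw x) B = infsum (pw x) (alive j x \<inter> B)"
    by (rule infsum_cong_neutral)
       (use assms good_pw_nonneg[OF assms(1)] in \<open>auto simp: alive_def lev_def less_le\<close>)
  then show ?thesis using good_finite[OF assms(1), of j] by simp
qed

lemma elo_good: "good x \<Longrightarrow> elo x u = (\<Sum>v\<in>alive (length u) x \<inter> {v. (v, u) \<in> lex less_than}. pw x v)"
  unfolding elo_def by (subst good_infsum[of x _ "length u"]) (auto simp: lev_def alive_def intro!: sum.cong)

lemma ehi_good: "good x \<Longrightarrow> ehi x u = elo x u + pw x u"
proof -
  assume g: "good x"
  let ?S = "alive (length u) x \<inter> {v. (v, u) \<in> lex less_than}"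
  have f: "finite ?S" using good_finite[OF g] by auto
  have "ehi x u = (\<Sum>v\<in>alive (length u) x \<inter> {v. (v, u) \<in> lex less_than \<or> v = u}. pw x v)"
    unfolding ehi_def using g by (subst good_infsum[of x _ "length u"]) (auto simp: lev_def alive_def intro!: sum.cong)
  also have "\<dots> = elo x u + pw x u"
  proof (cases "0 < pw x u")
    case True
    then have "alive (length u) x \<inter> {v. (v, u) \<in> lex less_than \<or> v = u} = insert u ?S" by (auto simp: alive_def)
    then show ?thesis using f lex_irrefl[of u] by (simp add: elo_good[OF g] add.commute)
  next
    case False
    then have "pw x u = 0" using good_pw_nonneg[OF g, of u] by simp
    moreover from False have "alive (length u) x \<inter> {v. (v, u) \<in> lex less_than \<or> v = u} = ?S" by (auto simp: alive_def)
    ultimately show ?thesis by (simp add: elo_good[OF g])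
  qed
  finally show ?thesis .
qed

lemma good_tsum_id: "good x \<Longrightarrow> (\<Sum>u\<in>alive j x. pw x u) = 1"
proof (induction j arbitrary: x)
  case 0
  have "alive 0 x = {[]}" by (auto simp: alive_def)
  then show ?case by simp
next
  case (Suc j)
  have one: "(\<Sum>u\<in>alive (Suc 0) x. pw x u) = 1" by (rule alive_1_sum(1)[OF Suc.prems])
  have "(\<Sum>u\<in>alive (Suc 0 + j) x. pw x u) = tsum (Suc 0 + j) (\<lambda>p. p) x" by (simp add: tsum_def)
  also have "\<dots> = (\<Sum>v\<in>alive (Suc 0) x. tsum j (\<lambda>p. pw x v * p) (subenv v x))"
    by (rule tsum_split[OF Suc.prems])
  also have "\<dots> = (\<Sum>v\<in>alive (Suc 0) x. pw x v * (\<Sum>u\<in>alive j (subenv v x). pw (subenv v x) u))"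
    by (simp add: tsum_def sum_distrib_left)
  also have "\<dots> = 1" using one by (simp add: Suc.IH[OF good_subenv[OF Suc.prems]])
  finally show ?case by simp
qed

lemma ebox_subset: "good x \<Longrightarrow> ebox x u \<subseteq> {0..<1}"
proof -
  assume g: "good x"
  have "0 \<le> elo x u" unfolding elo_good[OF g] by (intro sum_nonneg) (auto simp: alive_def)
  moreover have "ehi x u \<le> 1"
  proof -
    have "ehi x u = (\<Sum>v\<in>alive (length u) x \<inter> {v. (v, u) \<in> lex less_than \<or> v = u}. pw x v)"
      unfolding ehi_def using g by (subst good_infsum[of x _ "length u"]) (auto simp: lev_def alive_def intro!: sum.cong)
    also have "\<dots> \<le> (\<Sum>v\<in>alive (length u) x. pw x v)"
      using good_finite[OF g] by (intro sum_mono2) (auto simp: alive_def)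
    finally show ?thesis using good_tsum_id[OF g] by simp
  qed
  ultimately show ?thesis by (auto simp: ebox_def)
qed

lemma ehi_le_elo:
  assumes g: "good x" and "length u = length v" "(u, v) \<in> lex less_than"
  shows "ehi x u \<le> elo x v"
proof -
  have "ehi x u = (\<Sum>w\<in>alive (length u) x \<inter> {w. (w, u) \<in> lex less_than \<or> w = u}. pw x w)"
    unfolding ehi_def using g by (subst good_infsum[of x _ "length u"]) (auto simp: lev_def alive_def intro!: sum.cong)
  also have "\<dots> \<le> elo x v"
    unfolding elo_good[OF g] using good_finite[OF g] assms(2,3)
    by (intro sum_mono2) (auto simp: alive_def intro: lex_transitive)
  finally show ?thesis .
qed

lemma ebox_disjoint:
  assumes g: "good x" and "length u = length v" "u \<noteq> v"
  shows "ebox x u \<inter> ebox x v = {}"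
  using lex_total[OF assms(2,3)] ehi_le_elo[OF g, of u v] ehi_le_elo[OF g, of v u] assms(2)
  by (fastforce simp: ebox_def)

lemma ebox_empty: "good x \<Longrightarrow> \<not> 0 < pw x u \<Longrightarrow> ebox x u = {}"
  using good_pw_nonneg[of x u] by (auto simp: ebox_def ehi_good)

text \<open>A box of weight 0 is the empty interval and never receives a ball, so subtracting the
  occupied boxes from the alive ones counts alive boxes without a ball.\<close>

lemma empty_count_good:
  assumes g: "good x"
  shows "empty_count n j x U = (\<Sum>u\<in>alive j x. indicator {U. \<forall>i<n. U i \<notin> ebox x u} U)"
proof -
  let ?O = "{u. length u = j \<and> 1 \<le> card {i. i < n \<and> U i \<in> ebox x u}}"
  have O: "?O = {u\<in>alive j x. \<exists>i<n. U i \<in> ebox x u}"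
  proof -
    have "1 \<le> card {i. i < n \<and> U i \<in> ebox x u} \<longleftrightarrow> (\<exists>i<n. U i \<in> ebox x u)" for u
    proof -
      have "finite {i. i < n \<and> U i \<in> ebox x u}" by simp
      then have "1 \<le> card {i. i < n \<and> U i \<in> ebox x u} \<longleftrightarrow> {i. i < n \<and> U i \<in> ebox x u} \<noteq> {}"
        by (simp add: Suc_le_eq card_gt_0_iff)
      then show ?thesis by blast
    qed
    then show ?thesis using ebox_empty[OF g] by (auto simp: alive_def)
  qed
  have fin: "finite (alive j x)" by (rule good_finite[OF g])
  have "real (card (alive j x)) - real (card ?O) = real (card (alive j x - ?O))"
    unfolding O using fin by (subst card_Diff_subset) (auto simp: card_mono of_nat_diff)
  also have "alive j x - ?O = {u\<in>alive j x. U \<in> {U. \<forall>i<n. U i \<notin> ebox x u}}" unfolding O by auto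
  also have "real (card \<dots>) = (\<Sum>u\<in>alive j x. indicator {U. \<forall>i<n. U i \<notin> ebox x u} U)"
    using fin by (simp add: indicator_def sum.If_cases Int_def)
  finally show ?thesis unfolding empty_count_def .
qed

lemma empty_count_antimono: "good x \<Longrightarrow> m \<le> n \<Longrightarrow> empty_count n j x U \<le> empty_count m j x U"
  unfolding empty_count_good by (intro sum_mono) (auto simp: indicator_def)

section \<open>Uniform balls and negative correlation\<close>

abbreviation unif :: "real measure" where "unif \<equiv> uniform_measure lborel {0..1}"

definition balls :: "(nat \<Rightarrow> real) measure" where "balls = Pi\<^sub>M UNIV (\<lambda>_. unif)"

lemma prob_space_unif: "prob_space unif"
  by (rule prob_space_uniform_measure) auto

lemma prob_space_balls: "prob_space balls"
  unfolding balls_def by (rule prob_space_PiM) (rule prob_space_unif)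

lemma space_balls [simp]: "space balls = UNIV"
  by (simp add: balls_def space_PiM)

lemma ball_measurable [measurable]: "(\<lambda>U. U i) \<in> borel_measurable balls"
proof -
  have "(\<lambda>U. U i) \<in> measurable balls unif" unfolding balls_def by (rule measurable_component_singleton) simp
  moreover have "measurable balls unif = measurable balls borel" by (rule measurable_cong_sets) auto
  ultimately show ?thesis by simp
qed

lemma prob_avoid:
  assumes [measurable]: "B \<in> sets borel" and B: "B \<subseteq> {0..1}"
  shows "measure balls {U. \<forall>i<n. U i \<notin> B} = (1 - measure lborel B) ^ n"
proof -
  interpret U: prob_space unif by (rule prob_space_unif)
  interpret P: product_prob_space "\<lambda>_::nat. unif" UNIV ..
  have fin: "emeasure lborel B < \<infinity>" by (rule le_less_trans[OF emeasure_mono[OF B]]) auto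
  have mU: "measure unif (- B) = 1 - measure lborel B"
  proof -
    have "measure unif B = measure lborel B"
      using B by (subst measure_uniform_measure) (auto simp: Int_absorb1)
    moreover have "measure unif (space unif - B) = 1 - measure unif B"
      by (rule U.prob_compl) simp
    ultimately show ?thesis by (simp add: Compl_eq_Diff_UNIV)
  qed
  have nn: "0 \<le> 1 - measure lborel B" using measure_nonneg[of unif "- B"] mU by simp
  have "emeasure balls {x \<in> space balls. \<forall>i\<in>{..<n}. x i \<in> - B} = (\<Prod>i<n. emeasure unif (- B))"
    unfolding balls_def by (rule P.emeasure_PiM_Collect) auto
  also have "\<dots> = ennreal ((1 - measure lborel B) ^ n)"
    using nn by (simp add: U.emeasure_eq_measure mU ennreal_power)
  finally have "emeasure balls {U. \<forall>i<n. U i \<notin> B} = ennreal ((1 - measure lborel B) ^ n)" by (simp add: Ball_def)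
  then show ?thesis unfolding measure_def[of balls] using nn by simp
qed

text \<open>Nonpositive covariances leave only the diagonal, and an indicator has variance at most
  its mean.\<close>

lemma (in prob_space) indicator_sum_chebyshev:
  fixes B :: "'i \<Rightarrow> 'a set"
  assumes S: "finite S" and B: "\<And>u. u \<in> S \<Longrightarrow> B u \<in> sets M"
    and neg: "\<And>u v. u \<in> S \<Longrightarrow> v \<in> S \<Longrightarrow> u \<noteq> v \<Longrightarrow> prob (B u \<inter> B v) \<le> prob (B u) * prob (B v)"
  shows "(\<integral>\<^sup>+x. ennreal (((\<Sum>u\<in>S. indicator (B u) x) - (\<Sum>u\<in>S. prob (B u)))\<^sup>2) \<partial>M) \<le> ennreal (\<Sum>u\<in>S. prob (B u))"
proof -
  let ?f = "\<lambda>u x. indicator (B u) x - prob (B u)"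
  have sq: "((\<Sum>u\<in>S. indicator (B u) x) - (\<Sum>u\<in>S. prob (B u)))\<^sup>2 = (\<Sum>u\<in>S. \<Sum>v\<in>S. ?f u x * ?f v x)" for x
    by (simp add: power2_eq_square sum_subtractf[symmetric] sum_product)
  have ii: "integrable M (indicator (B u) :: 'a \<Rightarrow> real)" if "u \<in> S" for u
    using B[OF that] by (simp add: integrable_indicator_iff less_top[symmetric])
  have e: "?f u x * ?f v x = indicator (B u \<inter> B v) x - prob (B v) * indicator (B u) x - prob (B u) * indicator (B v) x + prob (B u) * prob (B v)" for u v x
    by (simp add: algebra_simps indicator_inter_arith)
  have iuv: "integrable M (\<lambda>x. ?f u x * ?f v x)" if "u \<in> S" "v \<in> S" for u v
    unfolding e using ii that B by (intro Bochner_Integration.integrable_add Bochner_Integration.integrable_diff integrable_mult_right) (auto simp: integrable_indicator_iff less_top[symmetric])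
  have cov: "expectation (\<lambda>x. ?f u x * ?f v x) = prob (B u \<inter> B v) - prob (B u) * prob (B v)" if "u \<in> S" "v \<in> S" for u v
  proof -
    have i3: "integrable M (indicator (B u \<inter> B v) :: 'a \<Rightarrow> real)"
      using B that by (auto simp: integrable_indicator_iff less_top[symmetric])
    show ?thesis unfolding e using ii[OF that(1)] ii[OF that(2)] B[OF that(1)] B[OF that(2)] i3
      by (simp add: prob_space)
  qed
  have "(\<integral>\<^sup>+x. ennreal (((\<Sum>u\<in>S. indicator (B u) x) - (\<Sum>u\<in>S. prob (B u)))\<^sup>2) \<partial>M)
     = ennreal (expectation (\<lambda>x. ((\<Sum>u\<in>S. indicator (B u) x) - (\<Sum>u\<in>S. prob (B u)))\<^sup>2))"
    unfolding sq using iuv by (intro nn_integral_eq_integral Bochner_Integration.integrable_sum) (auto simp: sq[symmetric])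
  also have "expectation (\<lambda>x. ((\<Sum>u\<in>S. indicator (B u) x) - (\<Sum>u\<in>S. prob (B u)))\<^sup>2) = (\<Sum>u\<in>S. \<Sum>v\<in>S. prob (B u \<inter> B v) - prob (B u) * prob (B v))"
    unfolding sq using iuv cov by (simp add: Bochner_Integration.integral_sum Bochner_Integration.integrable_sum)
  also have "\<dots> \<le> (\<Sum>u\<in>S. \<Sum>v\<in>S. if v = u then prob (B u) else 0)"
    using neg by (intro sum_mono) (auto simp: measure_nonneg)
  also have "\<dots> = (\<Sum>u\<in>S. prob (B u))" using S by simp
  finally show ?thesis by (simp add: ennreal_leI)
qed

text \<open>Two disjoint boxes of sizes p and q are both avoided with probability (1 - p - q)^n,
  which is at most (1 - p)^n (1 - q)^n: this is the negative correlation. The absolute value in |1 -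
  p|^n has no effect for p <= 1 and keeps the summand nonnegative for all p > 0, as the lemmas on
  \<open>tsum\<close> require.\<close>

lemma empty_count_chebyshev:
  assumes g: "good x"
  shows "(\<integral>\<^sup>+U. ennreal ((empty_count n j x U - tsum j (\<lambda>p. \<bar>1 - p\<bar> ^ n) x)\<^sup>2) \<partial>balls) \<le> ennreal (tsum j (\<lambda>p. \<bar>1 - p\<bar> ^ n) x)"
proof -
  interpret B: prob_space balls by (rule prob_space_balls)
  define B where "B u = {U. \<forall>i<n. U i \<notin> ebox x u}" for u
  have bm [measurable]: "ebox x u \<in> sets borel" for u by (simp add: ebox_def)
  have Bs: "B u \<in> sets balls" for u
  proof -
    have "{U \<in> space balls. \<forall>i<n. U i \<notin> ebox x u} \<in> sets balls" by measurable
    then show ?thesis by (simp add: B_def)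
  qed
  have mb: "measure lborel (ebox x u) = pw x u" for u
    using good_pw_nonneg[OF g, of u] by (simp add: ebox_def ehi_good[OF g])
  have sub: "ebox x u \<subseteq> {0..1}" for u using ebox_subset[OF g, of u] by auto
  have pB: "B.prob (B u) = \<bar>1 - pw x u\<bar> ^ n" for u
    unfolding B_def by (subst prob_avoid[OF bm sub]) (simp add: mb good_pw_le_1[OF g])
  have neg: "B.prob (B u \<inter> B v) \<le> B.prob (B u) * B.prob (B v)" if "u \<in> alive j x" "v \<in> alive j x" "u \<noteq> v" for u v
  proof -
    have uv: "length u = length v" using that by (auto simp: alive_def)
    have "B u \<inter> B v = {U. \<forall>i<n. U i \<notin> ebox x u \<union> ebox x v}" by (auto simp: B_def)
    then have "B.prob (B u \<inter> B v) = (1 - measure lborel (ebox x u \<union> ebox x v)) ^ n"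
      using sub[of u] sub[of v] by (subst prob_avoid[symmetric]) auto
    also have m: "measure lborel (ebox x u \<union> ebox x v) = pw x u + pw x v"
    proof -
      have f: "emeasure lborel (ebox x w) \<noteq> \<infinity>" for w
      proof -
        have "emeasure lborel (ebox x w) \<le> emeasure lborel {0..1::real}" by (rule emeasure_mono[OF sub]) simp
        then show ?thesis by (auto simp: top_unique)
      qed
      show ?thesis using ebox_disjoint[OF g uv that(3)] mb f
        by (subst measure_Union) (auto simp: fmeasurable_def less_top)
    qed
    also have "(1 - (pw x u + pw x v)) ^ n \<le> ((1 - pw x u) * (1 - pw x v)) ^ n"
    proof (rule power_mono)
      have p: "0 \<le> pw x u" "0 \<le> pw x v" using good_pw_nonneg[OF g] by auto
      show "1 - (pw x u + pw x v) \<le> (1 - pw x u) * (1 - pw x v)" using mult_nonneg_nonneg[OF p] by (simp add: algebra_simps)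
      have "(\<Sum>w\<in>{u, v}. pw x w) \<le> (\<Sum>w\<in>alive j x. pw x w)"
        using that good_finite[OF g] by (intro sum_mono2) (auto simp: alive_def)
      then show "0 \<le> 1 - (pw x u + pw x v)" using good_tsum_id[OF g, of j] that(3) by simp
    qed
    also have "\<dots> = B.prob (B u) * B.prob (B v)"
      using good_pw_le_1[OF g] by (simp add: pB power_mult_distrib)
    finally show ?thesis .
  qed
  have "tsum j (\<lambda>p. \<bar>1 - p\<bar> ^ n) x = (\<Sum>u\<in>alive j x. B.prob (B u))"
    by (simp add: tsum_def pB)
  then show ?thesis
    unfolding empty_count_good[OF g] B_def[symmetric]
    using B.indicator_sum_chebyshev[of "alive j x" B] good_finite[OF g] Bs neg by simp
qed

text \<open>The error is put in the form exp (- (n / 2) p), so that summed over boxes it is 8 / n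
  times the exponential sum at time n / 2, to which the same limit theorem applies.\<close>

lemma one_minus_power_approx:
  fixes p :: real
  assumes "0 \<le> p" "p \<le> 1" "0 < n"
  shows "(1 - p) ^ n \<le> exp (- (real n * p))"
    and "exp (- (real n * p)) - (1 - p) ^ n \<le> 8 / real n * exp (- (real n / 2 * p))"
proof -
  have "1 - p \<le> exp (- p)" using exp_ge_add_one_self[of "- p"] by simp
  then have "(1 - p) ^ n \<le> exp (- p) ^ n" using assms by (intro power_mono) auto
  then show "(1 - p) ^ n \<le> exp (- (real n * p))" by (simp flip: exp_of_nat_mult)
  \<comment> \<open>From exp (- p) (1 - p^2) <= 1 - p and Bernoulli's inequality for the n-th power
    of 1 - p^2 the relative error is at most n p^2.\<close>
  have "(1 + p) * exp (- p) \<le> exp p * exp (- p)" using exp_ge_add_one_self[of p] by (intro mult_right_mono) auto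
  then have "(1 + p) * exp (- p) \<le> 1" by (simp flip: exp_add)
  then have "(1 - p) * ((1 + p) * exp (- p)) \<le> (1 - p) * 1" using assms by (intro mult_left_mono) auto
  then have "exp (- p) * (1 - p\<^sup>2) \<le> 1 - p" by (simp add: algebra_simps power2_eq_square)
  then have "(exp (- p) * (1 - p\<^sup>2)) ^ n \<le> (1 - p) ^ n"
    using assms by (intro power_mono) (auto simp: power_le_one)
  then have 1: "exp (- (real n * p)) * (1 - p\<^sup>2) ^ n \<le> (1 - p) ^ n"
    by (simp add: power_mult_distrib flip: exp_of_nat_mult)
  have "1 + real n * (- p\<^sup>2) \<le> (1 + (- p\<^sup>2)) ^ n"
    using assms by (intro Bernoulli_inequality) (auto simp: power_le_one)
  then have "exp (- (real n * p)) * (1 - real n * p\<^sup>2) \<le> exp (- (real n * p)) * (1 - p\<^sup>2) ^ n"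
    by (intro mult_left_mono) auto
  with 1 have 2: "exp (- (real n * p)) - (1 - p) ^ n \<le> exp (- (real n * p)) * (real n * p\<^sup>2)"
    by (simp add: algebra_simps)
  \<comment> \<open>Half of the decay exp (- z) is spent on the factor z^2; the quadratic Taylor
    bound for exp (z / 2) gives the constant 8.\<close>
  define z where "z = real n * p"
  have z: "0 \<le> z" using assms by (simp add: z_def)
  have "z\<^sup>2 / 8 \<le> exp (z / 2)"
  proof -
    have "(1 + z/4) \<le> exp (z/4)" by (rule exp_ge_add_one_self)
    then have "(1 + z/4)\<^sup>2 \<le> exp (z/4) ^ 2" using z by (intro power_mono) auto
    also have "\<dots> = exp (z/2)" by (simp flip: exp_of_nat_mult)
    finally have "(1 + z/4)\<^sup>2 \<le> exp (z/2)" .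
    have e: "exp (z/2) \<ge> 1 + z/2 + (z/2)\<^sup>2/2" using exp_lower_Taylor_quadratic[of "z/2"] z by simp
    have "(z/2)\<^sup>2/2 = z\<^sup>2/8" by (simp add: power2_eq_square)
    then show ?thesis using e z by linarith
  qed
  then have "z\<^sup>2 * exp (- z) \<le> 8 * exp (z / 2) * exp (- z)" by (intro mult_right_mono) auto
  also have "\<dots> = 8 * exp (- z / 2)" by (simp add: mult.assoc flip: exp_add)
  finally have "z\<^sup>2 * exp (- z) \<le> 8 * exp (- z / 2)" .
  then have "exp (- z) * (real n * p\<^sup>2) \<le> 8 / real n * exp (- z / 2)"
    using assms(3) by (simp add: z_def field_simps power2_eq_square)
  with 2 show "exp (- (real n * p)) - (1 - p) ^ n \<le> 8 / real n * exp (- (real n / 2 * p))"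
    by (simp add: z_def)
qed

lemma AE_pair_fst:
  assumes "sigma_finite_measure M2" "AE x in M1. P x"
  shows "AE z in M1 \<Otimes>\<^sub>M M2. P (fst z)"
proof -
  interpret sigma_finite_measure M2 by fact
  obtain N where N: "{x \<in> space M1. \<not> P x} \<subseteq> N" "N \<in> sets M1" "emeasure M1 N = 0"
    using assms(2) by (rule AE_E)
  have "emeasure (M1 \<Otimes>\<^sub>M M2) (N \<times> space M2) = 0"
    using N by (subst emeasure_pair_measure_Times) auto
  then show ?thesis
    using N by (intro AE_I[of _ _ "N \<times> space M2"]) (auto simp: space_pair_measure)
qed

section \<open>Concentration of the number of empty boxes\<close>

context nonlattice_tilted_tree
begin

sublocale B: prob_space balls by (rule prob_space_balls)

sublocale EB: pair_prob_space E balls ..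

text \<open>A version of \<open>elo\<close> written as a nonnegative integral, whose measurability
  in the environment is immediate. It agrees with \<open>elo\<close> for good environments;
  \<open>empties_m\<close> does the same for the count, jointly in weights and balls.\<close>

definition elo_m :: "env \<Rightarrow> nat list \<Rightarrow> real" where
  "elo_m x u = enn2real (\<integral>\<^sup>+v. ennreal (pw x v) \<partial>count_space {v. length v = length u \<and> (v, u) \<in> lex less_than})"

lemma elo_m_measurable [measurable]: "(\<lambda>x. elo_m x u) \<in> borel_measurable E"
  unfolding elo_m_def
  by (intro measurable_compose[OF borel_measurable_nn_integral_count_space borel_measurable_enn2real] countableI_type) measurable

lemma elo_m_good: "good x \<Longrightarrow> elo_m x u = elo x u"
proof -
  assume g: "good x"
  let ?B = "{v. length v = length u \<and> (v, u) \<in> lex less_than}"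
  let ?S = "alive (length u) x \<inter> {v. (v, u) \<in> lex less_than}"
  have "(\<integral>\<^sup>+v. ennreal (pw x v) \<partial>count_space ?B) = (\<Sum>v\<in>?S. ennreal (pw x v))"
    using good_finite[OF g] good_pw_nonneg[OF g]
    by (intro nn_integral_count_space') (auto simp: alive_def less_le)
  also have "\<dots> = ennreal (\<Sum>v\<in>?S. pw x v)" using good_pw_nonneg[OF g] by (intro sum_ennreal)
  finally show ?thesis unfolding elo_m_def elo_good[OF g] using good_pw_nonneg[OF g] by (simp add: sum_nonneg)
qed

definition empties_m :: "nat \<Rightarrow> nat \<Rightarrow> env \<Rightarrow> (nat \<Rightarrow> real) \<Rightarrow> real" where
  "empties_m n j x U = enn2real (\<integral>\<^sup>+u. (if 0 < pw x u \<and> (\<forall>i<n. \<not> (elo_m x u \<le> U i \<and> U i < elo_m x u + pw x u)) then 1 else 0) \<partial>count_space (lev j))"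

lemma empties_m_measurable [measurable]:
  "(\<lambda>z. empties_m n j (fst z) (snd z)) \<in> borel_measurable (E \<Otimes>\<^sub>M balls)"
  unfolding empties_m_def
  by (intro measurable_compose[OF borel_measurable_nn_integral_count_space borel_measurable_enn2real] lev_countable) measurable

lemma empties_m_good: "good x \<Longrightarrow> empties_m n j x U = empty_count n j x U"
proof -
  assume g: "good x"
  let ?P = "\<lambda>u. \<forall>i<n. \<not> (elo_m x u \<le> U i \<and> U i < elo_m x u + pw x u)"
  have P: "?P u \<longleftrightarrow> (\<forall>i<n. U i \<notin> ebox x u)" for u
    by (simp add: ebox_def ehi_good[OF g] elo_m_good[OF g])
  have "(\<integral>\<^sup>+u. (if 0 < pw x u \<and> ?P u then 1 else 0) \<partial>count_space (lev j)) = (\<Sum>u\<in>alive j x. (if 0 < pw x u \<and> ?P u then 1 else 0))"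
    using good_finite[OF g] by (intro nn_integral_count_space') (auto simp: alive_def lev_def)
  also have "\<dots> = (\<Sum>u\<in>alive j x. ennreal (indicator {U. \<forall>i<n. U i \<notin> ebox x u} U))"
    unfolding P by (intro sum.cong) (auto simp: alive_def indicator_def)
  also have "\<dots> = ennreal (empty_count n j x U)"
    unfolding empty_count_good[OF g] by (intro sum_ennreal) auto
  finally show ?thesis unfolding empties_m_def empty_count_good[OF g] by (simp add: sum_nonneg)
qed

text \<open>For good weights, the mean number of empty boxes given these weights.\<close>

definition A' :: "nat \<Rightarrow> nat \<Rightarrow> env \<Rightarrow> real" where "A' n j x = tsum j (\<lambda>p. \<bar>1 - p\<bar> ^ n) x"

lemma A'_measurable [measurable]: "A' n j \<in> borel_measurable E"
  unfolding A'_def[abs_def] by (rule tsum_measurable) auto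

lemma A'_approx:
  assumes g: "good x" and n: "0 < n"
  shows "A' n j x \<le> A j (real n) x" "A j (real n) x - A' n j x \<le> 8 / real n * A j (real n / 2) x"
proof -
  have p: "0 \<le> pw x u" "pw x u \<le> 1" "\<bar>1 - pw x u\<bar> = 1 - pw x u" for u
    using good_pw_nonneg[OF g, of u] good_pw_le_1[OF g, of u] by auto
  show "A' n j x \<le> A j (real n) x"
    unfolding A'_def A_def tsum_def using one_minus_power_approx(1)[OF p(1,2) n] by (intro sum_mono) (simp add: p)
  show "A j (real n) x - A' n j x \<le> 8 / real n * A j (real n / 2) x"
    unfolding A'_def A_def tsum_def sum_subtractf[symmetric] sum_distrib_left
    using one_minus_power_approx(2)[OF p(1,2) n] by (intro sum_mono) (simp add: p)
qed

text \<open>The exponential growth rate in j of n powr \<theta> * m\<theta> ^ j when ln n is close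
  to a\<nu> j. The margin \<open>slack\<close> for ln n / j is the one that costs half of this
  rate.\<close>

definition gap :: real where "gap = ln m\<theta> + \<theta> * a\<nu>"

definition slack :: real where "slack = gap / (2 * (- \<theta>))"

text \<open>Since the conditional variance is at most the conditional mean, the rescaled deviation
  has second moment of order j^2 n powr (- \<theta>) / m\<theta> ^ j. For ln n <= (a\<nu> + slack) j
  this is exponentially small in j, so it survives the sum over j^2 + 1 grid times and over
  j.\<close>

lemma AE_empty_concentration:
  fixes N :: "nat \<Rightarrow> nat"
  assumes gap: "0 < gap" and N: "\<And>i. 0 < N i"
  shows "AE z in E \<Otimes>\<^sub>M balls. \<forall>\<^sub>F j in sequentially. \<forall>i\<le>j\<^sup>2. real (N i) \<le> exp ((a\<nu> + slack) * real j) \<longrightarrow>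
     \<bar>empty_count (N i) j (fst z) (snd z) - A' (N i) j (fst z)\<bar> \<le> real (N i) powr \<theta> * m\<theta> ^ j / real j"
proof -
  have m0: "0 < m\<theta>" using Mom_\<theta>(2) by simp
  obtain C where C: "0 < C" "\<And>j t x. 0 < t \<Longrightarrow> A j t x \<le> C * (t powr \<theta> * m\<theta> ^ j) * W j x"
    "\<And>j t. 0 < t \<Longrightarrow> EA j t \<le> C * (t powr \<theta> * m\<theta> ^ j)" by (rule A_bound) blast
  define c where "c j i = real j / (real (N i) powr \<theta> * m\<theta> ^ j)" for i j
  define ok where "ok j i \<longleftrightarrow> real (N i) \<le> exp ((a\<nu> + slack) * real j)" for j i
  define u where "u j i z = (if ok j i then (c j i * (empties_m (N i) j (fst z) (snd z) - A' (N i) j (fst z)))\<^sup>2 else 0)" for j i and z :: "env \<times> (nat \<Rightarrow> real)"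
  have [measurable]: "u j i \<in> borel_measurable (E \<Otimes>\<^sub>M balls)" for j i unfolding u_def by measurable
  define T where "T j z = (\<Sum>i\<le>j\<^sup>2. u j i z)" for j z
  define s where "s j = (real j ^ 2 + 1) * (C * real j ^ 2 * exp (- (gap / 2) * real j))" for j
  have ule: "(\<integral>\<^sup>+z. ennreal (u j i z) \<partial>(E \<Otimes>\<^sub>M balls)) \<le> ennreal (C * real j ^ 2 * exp (- (gap / 2) * real j))" for i j
  proof (cases "ok j i")
    case True
    have c0: "0 \<le> c j i" unfolding c_def using m0 by simp
    have n0: "0 < real (N i)" using N by simp
    have "(\<integral>\<^sup>+z. ennreal (u j i z) \<partial>(E \<Otimes>\<^sub>M balls)) = (\<integral>\<^sup>+x. \<integral>\<^sup>+U. ennreal (u j i (x, U)) \<partial>balls \<partial>E)"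
      by (rule B.nn_integral_fst[symmetric]) measurable
    also have "\<dots> \<le> (\<integral>\<^sup>+x. ennreal ((c j i)\<^sup>2) * ennreal (A j (real (N i)) x) \<partial>E)"
    proof (rule nn_integral_mono_AE)
      show "AE x in E. (\<integral>\<^sup>+U. ennreal (u j i (x, U)) \<partial>balls) \<le> ennreal ((c j i)\<^sup>2) * ennreal (A j (real (N i)) x)"
        using AE_good
      proof eventually_elim
        case (elim x)
        have meas: "(\<lambda>U. ennreal ((empty_count (N i) j x U - A' (N i) j x)\<^sup>2)) \<in> borel_measurable balls"
        proof -
          have "(\<lambda>U. empties_m (N i) j (fst (x, U)) (snd (x, U))) \<in> borel_measurable balls"
            by (rule measurable_compose[OF _ empties_m_measurable]) simp
          then show ?thesis by (simp add: empties_m_good[OF elim])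
        qed
        have "(\<integral>\<^sup>+U. ennreal (u j i (x, U)) \<partial>balls) = (\<integral>\<^sup>+U. ennreal ((c j i)\<^sup>2) * ennreal ((empty_count (N i) j x U - A' (N i) j x)\<^sup>2) \<partial>balls)"
          using True by (simp add: u_def empties_m_good[OF elim] power_mult_distrib ennreal_mult)
        also have "\<dots> = ennreal ((c j i)\<^sup>2) * (\<integral>\<^sup>+U. ennreal ((empty_count (N i) j x U - A' (N i) j x)\<^sup>2) \<partial>balls)"
          by (rule nn_integral_cmult[OF meas])
        also have "\<dots> \<le> ennreal ((c j i)\<^sup>2) * ennreal (A' (N i) j x)"
          unfolding A'_def by (intro mult_left_mono empty_count_chebyshev[OF elim]) auto
        also have "\<dots> \<le> ennreal ((c j i)\<^sup>2) * ennreal (A j (real (N i)) x)"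
          by (intro mult_left_mono ennreal_leI A'_approx[OF elim N]) auto
        finally show ?case .
      qed
    qed
    also have "\<dots> = ennreal ((c j i)\<^sup>2) * ennreal (EA j (real (N i)))"
      by (subst nn_integral_cmult) (auto simp: nn_integral_A[OF n0])
    also have "\<dots> \<le> ennreal ((c j i)\<^sup>2) * ennreal (C * (real (N i) powr \<theta> * m\<theta> ^ j))"
      by (intro mult_left_mono ennreal_leI C(3) n0) auto
    also have "\<dots> = ennreal ((c j i)\<^sup>2 * (C * (real (N i) powr \<theta> * m\<theta> ^ j)))"
      using C(1) m0 by (intro ennreal_mult[symmetric]) auto
    also have "(c j i)\<^sup>2 * (C * (real (N i) powr \<theta> * m\<theta> ^ j)) = C * real j ^ 2 * (real (N i) powr (- \<theta>) / m\<theta> ^ j)"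
      using m0 n0 by (simp add: c_def power2_eq_square powr_minus field_simps)
    also have "real (N i) powr (- \<theta>) / m\<theta> ^ j \<le> exp (- (gap / 2) * real j)"
    proof -
      have "real (N i) powr (- \<theta>) \<le> exp ((a\<nu> + slack) * real j) powr (- \<theta>)"
        using True n0 \<theta>_neg by (intro powr_mono2) (auto simp: ok_def)
      also have "\<dots> = exp (- \<theta> * ((a\<nu> + slack) * real j))" by (simp add: powr_def)
      finally have 1: "real (N i) powr (- \<theta>) \<le> exp (- \<theta> * ((a\<nu> + slack) * real j))" .
      have 2: "m\<theta> ^ j = exp (ln m\<theta> * real j)" using m0 by (simp add: exp_of_nat2_mult)
      have "real (N i) powr (- \<theta>) / m\<theta> ^ j \<le> exp (- \<theta> * ((a\<nu> + slack) * real j)) / exp (ln m\<theta> * real j)"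
        unfolding 2 by (intro divide_right_mono 1) auto
      also have "\<dots> = exp ((- \<theta> * (a\<nu> + slack) - ln m\<theta>) * real j)" by (simp add: exp_diff[symmetric] algebra_simps)
      also have "- \<theta> * (a\<nu> + slack) - ln m\<theta> = - (gap / 2)"
        using \<theta>_neg by (simp add: slack_def gap_def field_simps)
      finally show ?thesis .
    qed
    then have "C * real j ^ 2 * (real (N i) powr (- \<theta>) / m\<theta> ^ j) \<le> C * real j ^ 2 * exp (- (gap / 2) * real j)"
      using C(1) by (intro mult_left_mono) auto
    finally show ?thesis by (simp add: ennreal_leI)
  next
    case False then show ?thesis by (simp add: u_def)
  qed
  have Tle: "(\<integral>\<^sup>+z. ennreal (T j z) \<partial>(E \<Otimes>\<^sub>M balls)) \<le> ennreal (s j)" for j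
  proof -
    have "(\<integral>\<^sup>+z. ennreal (T j z) \<partial>(E \<Otimes>\<^sub>M balls)) = (\<integral>\<^sup>+z. (\<Sum>i\<le>j\<^sup>2. ennreal (u j i z)) \<partial>(E \<Otimes>\<^sub>M balls))"
      unfolding T_def by (intro nn_integral_cong sum_ennreal[symmetric]) (simp add: u_def)
    also have "\<dots> = (\<Sum>i\<le>j\<^sup>2. \<integral>\<^sup>+z. ennreal (u j i z) \<partial>(E \<Otimes>\<^sub>M balls))" by (rule nn_integral_sum) measurable
    also have "\<dots> \<le> (\<Sum>i\<le>j\<^sup>2. ennreal (C * real j ^ 2 * exp (- (gap / 2) * real j)))" by (intro sum_mono ule)
    also have "\<dots> = ennreal (s j)"
      using C(1) by (simp add: s_def ennreal_mult ennreal_of_nat_eq_real_of_nat add.commute)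
    finally show ?thesis .
  qed
  have s0: "0 \<le> s j" for j unfolding s_def using C(1) by simp
  have "summable s"
  proof (rule summable_if_bigo_inverse_square[OF s0])
    show "s j \<le> s j" for j by simp
    have "(\<lambda>j. (real j ^ 2 + 1) * (real j ^ 2 * exp (- (gap / 2) * real j))) \<in> O(\<lambda>j. 1 / real j ^ 2)"
      using gap by real_asymp
    then have "(\<lambda>j. C * ((real j ^ 2 + 1) * (real j ^ 2 * exp (- (gap / 2) * real j)))) \<in> O(\<lambda>j. 1 / real j ^ 2)"
      using C(1) by simp
    then show "s \<in> O(\<lambda>j. 1 / real j ^ 2)" by (simp add: s_def[abs_def] mult_ac)
  qed
  then have "AE z in E \<Otimes>\<^sub>M balls. (\<lambda>j. T j z) \<longlonglongrightarrow> 0"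
    by (intro AE_tendsto_0_if_summable[OF _ _ Tle _ s0]) (auto simp: T_def u_def intro!: sum_nonneg)
  moreover have "AE z in E \<Otimes>\<^sub>M balls. good (fst z)"
    using B.sigma_finite_measure_axioms AE_good by (rule AE_pair_fst)
  ultimately show ?thesis
  proof eventually_elim
    case (elim z)
    have "\<forall>\<^sub>F j in sequentially. T j z < 1" using elim(1) by (rule order_tendstoD) simp
    then show ?case using eventually_gt_at_top[of 0]
    proof eventually_elim
      case (elim j)
      show ?case
      proof (intro allI impI)
        fix i assume i: "i \<le> j\<^sup>2" and "real (N i) \<le> exp ((a\<nu> + slack) * real j)"
        then have ok: "ok j i" by (simp add: ok_def)
        have cp: "0 < real (N i) powr \<theta> * m\<theta> ^ j" using N[of i] m0 by simp
        let ?d = "empty_count (N i) j (fst z) (snd z) - A' (N i) j (fst z)"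
        have "u j i z \<le> T j z" unfolding T_def using i by (intro member_le_sum) (auto simp: u_def)
        then have "u j i z \<le> 1" using elim by simp
        then have "(c j i * ?d)\<^sup>2 \<le> 1\<^sup>2" using ok by (simp add: u_def empties_m_good[OF \<open>good (fst z)\<close>])
        then have "\<bar>c j i * ?d\<bar> \<le> 1" using abs_le_square_iff[of "c j i * ?d" 1] by simp
        moreover have "0 \<le> c j i" using cp by (simp add: c_def)
        ultimately have "c j i * \<bar>?d\<bar> \<le> 1" by (simp add: abs_mult)
        then show "\<bar>?d\<bar> \<le> real (N i) powr \<theta> * m\<theta> ^ j / real j"
          using cp elim by (simp add: c_def field_simps)
      qed
    qed
  qed
qed

text \<open>The limit theorem for the exponential sum is used along two families of times:
  \<open>N i\<close> for the main term and \<open>N i / 2\<close> for the error in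
  \<open>A'_approx\<close>. The latter has a finite limit after normalisation and still carries the
  factor 8 / n.\<close>

lemma empty_grid_limit:
  fixes N :: "nat \<Rightarrow> nat"
  assumes gap: "0 < gap" and N: "\<And>i. 0 < N i"
  shows "AE z in E \<Otimes>\<^sub>M balls. \<forall>i j \<beta>'. filterlim j at_top sequentially \<longrightarrow> (\<forall>\<^sub>F n in sequentially. i n \<le> (j n)\<^sup>2) \<longrightarrow>
     (\<lambda>n. (ln (real (N (i n))) - a\<nu> * real (j n)) / sqrt (real (j n))) \<longlonglongrightarrow> \<beta>' \<longrightarrow>
     (\<lambda>n. sqrt (real (j n)) * (real (N (i n)) powr (- \<theta>) / m\<theta> ^ j n * empty_count (N (i n)) (j n) (fst z) (snd z)))
        \<longlonglongrightarrow> Winf (fst z) * (density0 * exp (- \<beta>'\<^sup>2 / (2 * \<sigma>\<nu>\<^sup>2)))"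
proof -
  have m0: "0 < m\<theta>" using Mom_\<theta>(2) by simp
  have slack: "0 < slack" unfolding slack_def using gap \<theta>_neg by (intro divide_pos_pos) auto
  have sf: "sigma_finite_measure balls" by (rule B.sigma_finite_measure_axioms)
  have p1: "0 < real (N i)" and p2: "0 < real (N i) / 2" for i using N[of i] by auto
  show ?thesis
    using AE_empty_concentration[of N, OF gap N] AE_pair_fst[OF sf AE_good]
      AE_pair_fst[OF sf env_limit[of "\<lambda>i. real (N i)", OF p1]] AE_pair_fst[OF sf env_limit[of "\<lambda>i. real (N i) / 2", OF p2]]
  proof eventually_elim
    case (elim z)
    note g = \<open>good (fst z)\<close>
    show ?case
    proof (intro allI impI)
      fix i j :: "nat \<Rightarrow> nat" and \<beta>' :: real
      assume j: "filterlim j at_top sequentially" and i: "\<forall>\<^sub>F n in sequentially. i n \<le> (j n)\<^sup>2"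
        and b: "(\<lambda>n. (ln (real (N (i n))) - a\<nu> * real (j n)) / sqrt (real (j n))) \<longlonglongrightarrow> \<beta>'"
      let ?l = "Winf (fst z) * (density0 * exp (- \<beta>'\<^sup>2 / (2 * \<sigma>\<nu>\<^sup>2)))"
      define M where "M n = real (N (i n))" for n
      define J where "J n = real (j n)" for n
      define f where "f n = sqrt (J n) * (M n powr (- \<theta>) / m\<theta> ^ j n)" for n
      have M0: "0 < M n" for n using N by (simp add: M_def)
      have f0: "0 \<le> f n" for n using m0 by (simp add: f_def J_def)
      have Jlim: "filterlim J at_top sequentially"
        unfolding J_def using filterlim_compose[OF filterlim_real_sequentially j] .
      have Jpos: "\<forall>\<^sub>F n in sequentially. 0 < J n" using Jlim by (auto simp: filterlim_at_top_dense)
      have sJ: "(\<lambda>n. 1 / sqrt (J n)) \<longlonglongrightarrow> 0"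
        by (rule filterlim_compose[OF _ Jlim, of "\<lambda>t. 1 / sqrt t"]) real_asymp
      have b': "(\<lambda>n. (ln (M n) - a\<nu> * J n) / sqrt (J n)) \<longlonglongrightarrow> \<beta>'" using b by (simp add: M_def J_def)
      have "(\<lambda>n. (ln (M n) - a\<nu> * J n) / sqrt (J n) * (1 / sqrt (J n))) \<longlonglongrightarrow> \<beta>' * 0"
        by (intro tendsto_mult b' sJ)
      then have ratio: "(\<lambda>n. (ln (M n) - a\<nu> * J n) / J n) \<longlonglongrightarrow> 0"
        by (rule Lim_transform_eventually[THEN tendsto_eq_rhs]) (use Jpos in \<open>auto elim!: eventually_mono\<close>)
      have A1: "(\<lambda>n. f n * A (j n) (M n) (fst z)) \<longlonglongrightarrow> ?l"
        using elim(3)[rule_format, OF j i b] by (simp add: f_def M_def J_def mult.assoc)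
      have A2: "(\<lambda>n. f n * A (j n) (M n / 2) (fst z)) \<longlonglongrightarrow> 2 powr (- \<theta>) * ?l"
      proof -
        have "(\<lambda>n. (ln (M n) - a\<nu> * J n) / sqrt (J n) - ln 2 * (1 / sqrt (J n))) \<longlonglongrightarrow> \<beta>' - ln 2 * 0"
          by (intro tendsto_intros b' sJ)
        moreover have "(ln (M n) - a\<nu> * J n) / sqrt (J n) - ln 2 * (1 / sqrt (J n)) = (ln (M n / 2) - a\<nu> * J n) / sqrt (J n)" for n
          using M0[of n] by (simp add: ln_div diff_divide_distrib)
        ultimately have "(\<lambda>n. (ln (M n / 2) - a\<nu> * J n) / sqrt (J n)) \<longlonglongrightarrow> \<beta>'" by simp
        from elim(4)[rule_format, OF j i this[unfolded M_def J_def]]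
        have "(\<lambda>n. 2 powr (- \<theta>) * (sqrt (J n) * ((M n / 2) powr (- \<theta>) / m\<theta> ^ j n * A (j n) (M n / 2) (fst z)))) \<longlonglongrightarrow> 2 powr (- \<theta>) * ?l"
          unfolding M_def J_def by (rule tendsto_mult[OF tendsto_const])
        then show ?thesis using M0 by (simp add: f_def powr_divide mult_ac)
      qed
      have Minf: "(\<lambda>n. 8 / M n) \<longlonglongrightarrow> 0"
      proof -
        have "\<forall>\<^sub>F n in sequentially. - (a\<nu> / 2) < (ln (M n) - a\<nu> * J n) / J n"
          using a\<nu>_pos by (intro order_tendstoD(1)[OF ratio]) simp
        then have "\<forall>\<^sub>F n in sequentially. a\<nu> / 2 * J n \<le> ln (M n)"
          using Jpos by eventually_elim (simp add: field_simps)
        moreover have "filterlim (\<lambda>n. a\<nu> / 2 * J n) at_top sequentially"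
          using a\<nu>_pos by (intro filterlim_tendsto_pos_mult_at_top[OF tendsto_const _ Jlim]) simp
        ultimately have "filterlim (\<lambda>n. ln (M n)) at_top sequentially"
          by (rule filterlim_at_top_mono[rotated])
        then have "(\<lambda>n. 8 * exp (- ln (M n))) \<longlonglongrightarrow> 0"
          by (rule filterlim_compose[rotated]) real_asymp
        then show ?thesis using M0 by (simp add: exp_minus divide_inverse)
      qed
      have A3: "(\<lambda>n. f n * (A (j n) (M n) (fst z) - A' (N (i n)) (j n) (fst z))) \<longlonglongrightarrow> 0"
      proof (rule tendsto_sandwich[of "\<lambda>_. 0" _ _ "\<lambda>n. 8 / M n * (f n * A (j n) (M n / 2) (fst z))"])
        show "\<forall>\<^sub>F n in sequentially. 0 \<le> f n * (A (j n) (M n) (fst z) - A' (N (i n)) (j n) (fst z))"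
          using f0 A'_approx(1)[OF g N] by (intro always_eventually allI mult_nonneg_nonneg) (auto simp: M_def)
        show "\<forall>\<^sub>F n in sequentially. f n * (A (j n) (M n) (fst z) - A' (N (i n)) (j n) (fst z)) \<le> 8 / M n * (f n * A (j n) (M n / 2) (fst z))"
          using mult_left_mono[OF A'_approx(2)[OF g N] f0]
          by (intro always_eventually allI) (auto simp: M_def mult_ac)
        show "(\<lambda>n. 8 / M n * (f n * A (j n) (M n / 2) (fst z))) \<longlonglongrightarrow> 0"
          using tendsto_mult[OF Minf A2] by simp
      qed simp
      have A4: "(\<lambda>n. f n * (empty_count (N (i n)) (j n) (fst z) (snd z) - A' (N (i n)) (j n) (fst z))) \<longlonglongrightarrow> 0"
      proof (rule Lim_null_comparison[OF _ sJ])
        \<comment> \<open>Since ln n / j tends to a\<nu>, the restriction on n in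
          \<open>AE_empty_concentration\<close> holds eventually.\<close>
        have "\<forall>\<^sub>F n in sequentially. (ln (M n) - a\<nu> * J n) / J n < slack"
          using slack by (intro order_tendstoD(2)[OF ratio])
        then have small: "\<forall>\<^sub>F n in sequentially. M n \<le> exp ((a\<nu> + slack) * J n)"
          using Jpos
        proof eventually_elim
          case (elim n)
          then have "ln (M n) \<le> (a\<nu> + slack) * J n" by (simp add: field_simps)
          then have "exp (ln (M n)) \<le> exp ((a\<nu> + slack) * J n)" by simp
          then show ?case using M0[of n] by simp
        qed
        show "\<forall>\<^sub>F n in sequentially. norm (f n * (empty_count (N (i n)) (j n) (fst z) (snd z) - A' (N (i n)) (j n) (fst z))) \<le> 1 / sqrt (J n)"
          using small Jpos i eventually_compose_filterlim[OF elim(1) j]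
        proof eventually_elim
          case (elim n)
          let ?d = "empty_count (N (i n)) (j n) (fst z) (snd z) - A' (N (i n)) (j n) (fst z)"
          have "\<bar>?d\<bar> \<le> M n powr \<theta> * m\<theta> ^ j n / J n" using elim by (simp add: M_def J_def)
          then have "f n * \<bar>?d\<bar> \<le> f n * (M n powr \<theta> * m\<theta> ^ j n / J n)" using f0 by (rule mult_left_mono)
          also have "\<dots> = 1 / sqrt (J n)"
          proof -
            have "sqrt (J n) / J n = 1 / sqrt (J n)" using elim(2) by (subst frac_eq_eq) auto
            then show ?thesis using M0[of n] m0 by (simp add: f_def powr_minus field_simps)
          qed
          finally show ?case using f0[of n] by (simp add: abs_mult)
        qed
      qed
      have "(\<lambda>n. f n * A (j n) (M n) (fst z) - f n * (A (j n) (M n) (fst z) - A' (N (i n)) (j n) (fst z))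
          + f n * (empty_count (N (i n)) (j n) (fst z) (snd z) - A' (N (i n)) (j n) (fst z))) \<longlonglongrightarrow> ?l - 0 + 0"
        by (intro tendsto_add tendsto_diff A1 A3 A4)
      moreover have "f n * A (j n) (M n) (fst z) - f n * (A (j n) (M n) (fst z) - A' (N (i n)) (j n) (fst z))
          + f n * (empty_count (N (i n)) (j n) (fst z) (snd z) - A' (N (i n)) (j n) (fst z)) = f n * empty_count (N (i n)) (j n) (fst z) (snd z)" for n
        by (simp only: right_diff_distrib)
      ultimately have "(\<lambda>n. f n * empty_count (N (i n)) (j n) (fst z) (snd z)) \<longlonglongrightarrow> ?l" by simp
      then show "(\<lambda>n. sqrt (real (j n)) * (real (N (i n)) powr (- \<theta>) / m\<theta> ^ j n * empty_count (N (i n)) (j n) (fst z) (snd z))) \<longlonglongrightarrow> ?l"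
        by (simp add: f_def M_def J_def mult.assoc)
    qed
  qed
qed

end

section \<open>From a geometric grid to all n\<close>

lemma grid_bounds:
  fixes h :: real
  assumes h: "0 < h" and n: "1 \<le> n" and i: "i = nat \<lfloor>ln (real n) / h\<rfloor>"
  shows "real i \<le> ln (real n) / h" "nat \<lfloor>exp (h * real i)\<rfloor> \<le> n" "n \<le> nat \<lfloor>exp (h * real (i + 1))\<rfloor>"
    "real (nat \<lfloor>exp (h * real (i + 1))\<rfloor>) \<le> exp h * real n"
    "1 \<le> real n * (exp (- h) - exp (- 2 * h)) \<Longrightarrow> real n \<le> exp (2 * h) * real (nat \<lfloor>exp (h * real i)\<rfloor>)"
proof -
  have l0: "0 \<le> ln (real n) / h" using n h by simp
  then have ri: "real i = of_int \<lfloor>ln (real n) / h\<rfloor>" by (simp add: i)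
  then show 1: "real i \<le> ln (real n) / h" by simp
  have 2: "ln (real n) / h < real i + 1" unfolding ri by linarith
  have e1: "exp (h * real i) \<le> real n"
  proof -
    have "h * real i \<le> ln (real n)" using 1 h by (simp add: field_simps)
    then have "exp (h * real i) \<le> exp (ln (real n))" by simp
    then show ?thesis using n by simp
  qed
  have e2: "real n \<le> exp (h * real (i + 1))"
  proof -
    have "ln (real n) \<le> h * real (i + 1)" using 2 h by (simp add: field_simps)
    then have "exp (ln (real n)) \<le> exp (h * real (i + 1))" by simp
    then show ?thesis using n by simp
  qed
  show "nat \<lfloor>exp (h * real i)\<rfloor> \<le> n" using e1 by linarith
  show "n \<le> nat \<lfloor>exp (h * real (i + 1))\<rfloor>" using e2 by linarith
  have s: "exp (h * real (i + 1)) = exp h * exp (h * real i)" by (simp add: exp_add[symmetric] algebra_simps)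
  have "real (nat \<lfloor>exp (h * real (i + 1))\<rfloor>) \<le> exp (h * real (i + 1))" by simp
  also have "\<dots> \<le> exp h * real n" unfolding s using e1 by (intro mult_left_mono) auto
  finally show "real (nat \<lfloor>exp (h * real (i + 1))\<rfloor>) \<le> exp h * real n" .
  \<comment> \<open>For large n the difference between n exp (- h) and n exp (- 2 h) absorbs the
    loss of at most 1 from rounding the grid point down.\<close>
  assume big: "1 \<le> real n * (exp (- h) - exp (- 2 * h))"
  have "exp (h * real i) - 1 \<le> real (nat \<lfloor>exp (h * real i)\<rfloor>)"
  proof -
    have "0 \<le> \<lfloor>exp (h * real i)\<rfloor>" by simp
    then have "real (nat \<lfloor>exp (h * real i)\<rfloor>) = of_int \<lfloor>exp (h * real i)\<rfloor>" by simp
    then show ?thesis by linarith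
  qed
  moreover have "real n * exp (- h) \<le> exp (h * real i)"
    using e2 unfolding s by (simp add: exp_minus field_simps)
  ultimately have "real n * exp (- 2 * h) \<le> real (nat \<lfloor>exp (h * real i)\<rfloor>)"
    using big unfolding right_diff_distrib by linarith
  then have "exp (2 * h) * (real n * exp (- 2 * h)) \<le> exp (2 * h) * real (nat \<lfloor>exp (h * real i)\<rfloor>)"
    by (rule mult_left_mono) simp
  moreover have "exp (2 * h) * exp (- 2 * h) = 1" by (simp flip: exp_add)
  then have "exp (2 * h) * (real n * exp (- 2 * h)) = real n" by (metis mult.left_commute mult.right_neutral)
  ultimately show "real n \<le> exp (2 * h) * real (nat \<lfloor>exp (h * real i)\<rfloor>)" by linarith
qed

context nonlattice_tilted_tree
begin

text \<open>The count decreases in n, while between n and a neighbouring grid point the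
  normalisation n powr (- \<theta>) changes by a factor of at most exp (2 h) powr (- \<theta>). The
  normalised count is thus squeezed between grid values up to this factor, which tends to 1 with the
  mesh h.\<close>

theorem empty_limit:
  assumes gap: "0 < gap"
  shows "AE z in E \<Otimes>\<^sub>M balls. \<forall>j \<beta>'. filterlim j at_top sequentially \<longrightarrow>
     (\<lambda>n. (ln (real n) - a\<nu> * real (j n)) / sqrt (real (j n))) \<longlonglongrightarrow> \<beta>' \<longrightarrow>
     (\<lambda>n. sqrt (real (j n)) * (real n powr (- \<theta>) / m\<theta> ^ j n * empty_count n (j n) (fst z) (snd z)))
        \<longlonglongrightarrow> Winf (fst z) * (density0 * exp (- \<beta>'\<^sup>2 / (2 * \<sigma>\<nu>\<^sup>2)))"
proof -
  have m0: "0 < m\<theta>" using Mom_\<theta>(2) by simp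
  \<comment> \<open>Countably many meshes tending to 0, so that one null set serves them
    all.\<close>
  define h where "h q = 1 / real (Suc q)" for q
  have h0: "0 < h q" for q by (simp add: h_def)
  define N where "N q i = nat \<lfloor>exp (h q * real i)\<rfloor>" for q i
  have N0: "0 < N q i" for q i
  proof -
    have "1 \<le> exp (h q * real i)" using h0[of q] by simp
    then show ?thesis unfolding N_def by linarith
  qed
  have "AE z in E \<Otimes>\<^sub>M balls. \<forall>q. \<forall>i j \<beta>'. filterlim j at_top sequentially \<longrightarrow> (\<forall>\<^sub>F n in sequentially. i n \<le> (j n)\<^sup>2) \<longrightarrow>
     (\<lambda>n. (ln (real (N q (i n))) - a\<nu> * real (j n)) / sqrt (real (j n))) \<longlonglongrightarrow> \<beta>' \<longrightarrow>
     (\<lambda>n. sqrt (real (j n)) * (real (N q (i n)) powr (- \<theta>) / m\<theta> ^ j n * empty_count (N q (i n)) (j n) (fst z) (snd z)))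
        \<longlonglongrightarrow> Winf (fst z) * (density0 * exp (- \<beta>'\<^sup>2 / (2 * \<sigma>\<nu>\<^sup>2)))"
    by (subst AE_all_countable, intro allI, rule empty_grid_limit[OF gap, OF N0])
  moreover have "AE z in E \<Otimes>\<^sub>M balls. good (fst z)"
    using B.sigma_finite_measure_axioms AE_good by (rule AE_pair_fst)
  ultimately show ?thesis
  proof eventually_elim
    case (elim z)
    note g = \<open>good (fst z)\<close>
    show ?case
    proof (intro allI impI)
      fix j :: "nat \<Rightarrow> nat" and \<beta>' :: real
      assume j: "filterlim j at_top sequentially"
        and b: "(\<lambda>n. (ln (real n) - a\<nu> * real (j n)) / sqrt (real (j n))) \<longlonglongrightarrow> \<beta>'"
      define l where "l = Winf (fst z) * (density0 * exp (- \<beta>'\<^sup>2 / (2 * \<sigma>\<nu>\<^sup>2)))"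
      define Lc where "Lc m n = empty_count m (j n) (fst z) (snd z)" for m n
      have Lc0: "0 \<le> Lc m n" for m n unfolding Lc_def empty_count_good[OF g] by (intro sum_nonneg) auto
      define Y where "Y m n = sqrt (real (j n)) * (real m powr (- \<theta>) / m\<theta> ^ j n * Lc m n)" for m n
      have Jlim: "filterlim (\<lambda>n. real (j n)) at_top sequentially"
        using filterlim_compose[OF filterlim_real_sequentially j] .
      have Jpos: "\<forall>\<^sub>F n in sequentially. 0 < real (j n)"
        using Jlim[unfolded filterlim_at_top_dense, rule_format, of 0] .
      have sJ: "(\<lambda>n. 1 / sqrt (real (j n))) \<longlonglongrightarrow> 0"
        by (rule filterlim_compose[OF _ Jlim, of "\<lambda>t. 1 / sqrt t"]) real_asymp
      have "(\<lambda>n. (ln (real n) - a\<nu> * real (j n)) / sqrt (real (j n)) * (1 / sqrt (real (j n)))) \<longlonglongrightarrow> \<beta>' * 0"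
        by (intro tendsto_mult b sJ)
      then have ratio: "(\<lambda>n. (ln (real n) - a\<nu> * real (j n)) / real (j n)) \<longlonglongrightarrow> 0"
        by (rule Lim_transform_eventually[THEN tendsto_eq_rhs]) (use Jpos in \<open>auto elim!: eventually_mono\<close>)
      have lnle: "\<forall>\<^sub>F n in sequentially. ln (real n) \<le> (a\<nu> + 1) * real (j n)"
        using order_tendstoD(2)[OF ratio zero_less_one] Jpos by eventually_elim (simp add: field_simps)
      have grid: "(\<lambda>n. Y (N q (i n)) n) \<longlonglongrightarrow> l"
        if i: "\<forall>\<^sub>F n in sequentially. i n \<le> (j n)\<^sup>2"
          and near: "\<forall>\<^sub>F n in sequentially. \<bar>ln (real (N q (i n))) - ln (real n)\<bar> \<le> 2 * h q" for q i
      proof -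
        have "(\<lambda>n. (ln (real (N q (i n))) - a\<nu> * real (j n)) / sqrt (real (j n)) - (ln (real n) - a\<nu> * real (j n)) / sqrt (real (j n))) \<longlonglongrightarrow> 0"
        proof (rule Lim_null_comparison)
          show "(\<lambda>n. 2 * h q * (1 / sqrt (real (j n)))) \<longlonglongrightarrow> 0" using tendsto_mult[OF tendsto_const sJ, of "2 * h q"] by simp
          show "\<forall>\<^sub>F n in sequentially. norm ((ln (real (N q (i n))) - a\<nu> * real (j n)) / sqrt (real (j n)) - (ln (real n) - a\<nu> * real (j n)) / sqrt (real (j n))) \<le> 2 * h q * (1 / sqrt (real (j n)))"
            using near
          proof eventually_elim
            case (elim n)
            have "(ln (real (N q (i n))) - a\<nu> * real (j n)) / sqrt (real (j n)) - (ln (real n) - a\<nu> * real (j n)) / sqrt (real (j n))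
              = (ln (real (N q (i n))) - ln (real n)) / sqrt (real (j n))" by (simp add: diff_divide_distrib)
            then show ?case using divide_right_mono[OF elim, of "sqrt (real (j n))"] by simp
          qed
        qed
        from tendsto_add[OF this b]
        have "(\<lambda>n. (ln (real (N q (i n))) - a\<nu> * real (j n)) / sqrt (real (j n))) \<longlonglongrightarrow> \<beta>'" by simp
        from elim(1)[rule_format, OF j i this] show ?thesis by (simp add: Y_def l_def Lc_def)
      qed
      have two: "(\<lambda>n. Y (N q (nat \<lfloor>ln (real n) / h q\<rfloor>)) n) \<longlonglongrightarrow> l \<and> (\<lambda>n. Y (N q (nat \<lfloor>ln (real n) / h q\<rfloor> + 1)) n) \<longlonglongrightarrow> l
         \<and> (\<forall>\<^sub>F n in sequentially. Y n n \<le> exp (2 * h q) powr (- \<theta>) * Y (N q (nat \<lfloor>ln (real n) / h q\<rfloor>)) n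
              \<and> Y (N q (nat \<lfloor>ln (real n) / h q\<rfloor> + 1)) n \<le> exp (2 * h q) powr (- \<theta>) * Y n n)" for q
      proof -
        define i where "i n = nat \<lfloor>ln (real n) / h q\<rfloor>" for n
        have "\<forall>\<^sub>F n in sequentially. 1 \<le> real n * (exp (- h q) - exp (- 2 * h q))"
        proof -
          have "0 < exp (- h q) - exp (- 2 * h q)" using h0[of q] by simp
          then show ?thesis by real_asymp
        qed
        then have ev: "\<forall>\<^sub>F n in sequentially. 1 \<le> n \<and> real (i n) \<le> ln (real n) / h q \<and> N q (i n) \<le> n \<and> n \<le> N q (i n + 1)
            \<and> real (N q (i n + 1)) \<le> exp (h q) * real n \<and> real n \<le> exp (2 * h q) * real (N q (i n))"
          using eventually_ge_at_top[of 1]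
        proof eventually_elim
          case (elim n)
          then show ?case using grid_bounds[OF h0 elim(2) i_def] by (simp add: N_def)
        qed
        \<comment> \<open>For a fixed mesh the grid index is at most ln n / h, which is linear in j
          and hence eventually within the j^2 indices covered by the uniform statement, even after
          adding 1.\<close>
        have poly: "\<forall>\<^sub>F n in sequentially. (a\<nu> + 1) * real (j n) / h q + 1 \<le> (real (j n))\<^sup>2"
        proof -
          have "\<forall>\<^sub>F t in at_top. (a\<nu> + 1) * t / h q + 1 \<le> t\<^sup>2"
            using h0[of q] a\<nu>_pos by real_asymp
          then show ?thesis using Jlim by (rule eventually_compose_filterlim)
        qed
        have il: "\<forall>\<^sub>F n in sequentially. i n + 1 \<le> (j n)\<^sup>2"
          using ev lnle poly
        proof eventually_elim
          case (elim n)
          have "ln (real n) / h q \<le> (a\<nu> + 1) * real (j n) / h q" using elim(2) h0[of q] by (intro divide_right_mono) auto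
          then have "real (i n) + 1 \<le> (real (j n))\<^sup>2" using elim by linarith
          then have "real (i n + 1) \<le> real ((j n)\<^sup>2)" by simp
          then show ?case by (simp only: of_nat_le_iff)
        qed
        have near: "\<forall>\<^sub>F n in sequentially. \<bar>ln (real (N q (i n))) - ln (real n)\<bar> \<le> 2 * h q \<and> \<bar>ln (real (N q (i n + 1))) - ln (real n)\<bar> \<le> 2 * h q"
          using ev
        proof eventually_elim
          case (elim n)
          have p: "0 < real n" "0 < real (N q (i n))" "0 < real (N q (i n + 1))" using elim N0 by auto
          have "ln (real (N q (i n))) \<le> ln (real n)" using elim p by simp
          moreover have "ln (real n) \<le> ln (exp (2 * h q) * real (N q (i n)))" using elim p by (subst ln_le_cancel_iff) auto
          then have "ln (real n) \<le> 2 * h q + ln (real (N q (i n)))" using p by (simp add: ln_mult)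
          moreover have "ln (real n) \<le> ln (real (N q (i n + 1)))" using elim p by simp
          moreover have "ln (real (N q (i n + 1))) \<le> ln (exp (h q) * real n)" using elim p by (subst ln_le_cancel_iff) auto
          then have "ln (real (N q (i n + 1))) \<le> h q + ln (real n)" using p by (simp add: ln_mult)
          ultimately show ?case using h0[of q] by linarith
        qed
        have "(\<lambda>n. Y (N q (i n)) n) \<longlonglongrightarrow> l"
        proof (rule grid)
          show "\<forall>\<^sub>F n in sequentially. i n \<le> (j n)\<^sup>2" using il by eventually_elim simp
          show "\<forall>\<^sub>F n in sequentially. \<bar>ln (real (N q (i n))) - ln (real n)\<bar> \<le> 2 * h q" using near by eventually_elim simp
        qed
        moreover have "(\<lambda>n. Y (N q (i n + 1)) n) \<longlonglongrightarrow> l"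
        proof (rule grid)
          show "\<forall>\<^sub>F n in sequentially. \<bar>ln (real (N q (i n + 1))) - ln (real n)\<bar> \<le> 2 * h q" using near by eventually_elim simp
        qed (rule il)
        moreover have "\<forall>\<^sub>F n in sequentially. Y n n \<le> exp (2 * h q) powr (- \<theta>) * Y (N q (i n)) n \<and> Y (N q (i n + 1)) n \<le> exp (2 * h q) powr (- \<theta>) * Y n n"
          using ev
        proof eventually_elim
          case (elim n)
          have cmp: "Y m' n \<le> exp (2 * h q) powr (- \<theta>) * Y m n" if "m \<le> m'" "real m' \<le> exp (2 * h q) * real m" for m m'
          proof -
            have "Lc m' n \<le> Lc m n" unfolding Lc_def using g that(1) by (rule empty_count_antimono)
            moreover have "real m' powr (- \<theta>) \<le> (exp (2 * h q) * real m) powr (- \<theta>)"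
              using that \<theta>_neg by (intro powr_mono2) auto
            ultimately have "sqrt (real (j n)) * (real m' powr (- \<theta>) / m\<theta> ^ j n * Lc m' n) \<le> sqrt (real (j n)) * ((exp (2 * h q) * real m) powr (- \<theta>) / m\<theta> ^ j n * Lc m n)"
              using m0 Lc0 by (intro mult_left_mono mult_mono divide_right_mono) auto
            then show ?thesis by (simp add: Y_def powr_mult mult_ac)
          qed
          have "exp (h q) * real n \<le> exp (2 * h q) * real n" using h0[of q] by (intro mult_right_mono) auto
          then have "real (N q (i n + 1)) \<le> exp (2 * h q) * real n" using elim by linarith
          then show ?case using elim by (intro conjI cmp) auto
        qed
        ultimately show ?thesis unfolding i_def by blast
      qed
      have hh: "h \<longlonglongrightarrow> 0" unfolding h_def by real_asymp
      have "(\<lambda>n. Y n n) \<longlonglongrightarrow> l"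
      proof (rule order_tendstoI)
        have hl: "(\<lambda>q. exp (2 * h q) powr (- \<theta>)) \<longlonglongrightarrow> 1"
        proof -
          have "(\<lambda>q. exp (2 * h q) powr (- \<theta>)) \<longlonglongrightarrow> exp (2 * 0) powr (- \<theta>)"
            by (intro tendsto_intros hh) auto
          then show ?thesis by simp
        qed
        fix y assume "l < y"
        then have "\<forall>\<^sub>F q in sequentially. exp (2 * h q) powr (- \<theta>) * l < y"
          using tendsto_mult[OF hl tendsto_const[of l]] by (intro order_tendstoD(2)) auto
        then obtain q where q: "exp (2 * h q) powr (- \<theta>) * l < y" by (auto simp: eventually_sequentially)
        have "(\<lambda>n. exp (2 * h q) powr (- \<theta>) * Y (N q (nat \<lfloor>ln (real n) / h q\<rfloor>)) n) \<longlonglongrightarrow> exp (2 * h q) powr (- \<theta>) * l"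
          using two[of q] by (intro tendsto_mult tendsto_const) auto
        from order_tendstoD(2)[OF this q] two[of q] show "\<forall>\<^sub>F n in sequentially. Y n n < y"
          by (auto elim: eventually_elim2)
      next
        have hl: "(\<lambda>q. 1 / exp (2 * h q) powr (- \<theta>)) \<longlonglongrightarrow> 1"
        proof -
          have "(\<lambda>q. 1 / exp (2 * h q) powr (- \<theta>)) \<longlonglongrightarrow> 1 / exp (2 * 0) powr (- \<theta>)"
            by (intro tendsto_intros hh) auto
          then show ?thesis by simp
        qed
        fix y assume "y < l"
        then have "\<forall>\<^sub>F q in sequentially. y < 1 / exp (2 * h q) powr (- \<theta>) * l"
          using tendsto_mult[OF hl tendsto_const[of l]] by (intro order_tendstoD(1)) auto
        then obtain q where q: "y < 1 / exp (2 * h q) powr (- \<theta>) * l" by (auto simp: eventually_sequentially)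
        have "(\<lambda>n. 1 / exp (2 * h q) powr (- \<theta>) * Y (N q (nat \<lfloor>ln (real n) / h q\<rfloor> + 1)) n) \<longlonglongrightarrow> 1 / exp (2 * h q) powr (- \<theta>) * l"
          using two[of q] by (intro tendsto_mult tendsto_const) auto
        from order_tendstoD(1)[OF this q] two[of q, THEN conjunct2, THEN conjunct2] show "\<forall>\<^sub>F n in sequentially. y < Y n n"
        proof eventually_elim
          case (elim n)
          have "0 < exp (2 * h q) powr (- \<theta>)" by simp
          then have "1 / exp (2 * h q) powr (- \<theta>) * Y (N q (nat \<lfloor>ln (real n) / h q\<rfloor> + 1)) n \<le> Y n n"
            using elim(2) by (simp add: divide_le_eq mult.commute)
          then show ?case using elim(1) by linarith
        qed
      qed
      then show "(\<lambda>n. sqrt (real (j n)) * (real n powr (- \<theta>) / m\<theta> ^ j n * empty_count n (j n) (fst z) (snd z)))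
        \<longlonglongrightarrow> Winf (fst z) * (density0 * exp (- \<beta>'\<^sup>2 / (2 * \<sigma>\<nu>\<^sup>2)))"
        by (simp add: Y_def l_def Lc_def)
    qed
  qed
qed

end

section \<open>Transfer to the given probability space\<close>

declare ball_measurable [measurable del]

lemma wt_eq_pw: "wt X u w = pw (\<lambda>u. X u w) u"
  by (simp add: wt_def pw_def)

lemma box_eq_ebox: "box X u w = ebox (\<lambda>u. X u w) u"
  by (simp add: box_def ebox_def box_lo_def box_hi_def elo_def ehi_def wt_eq_pw)

lemma Lempty_eq:
  assumes "good (\<lambda>u. X u w)"
  shows "Lempty X U n j w = empty_count n j (\<lambda>u. X u w) (\<lambda>i. U i w)"
proof -
  have "{u. length u = j \<and> wt X u w \<noteq> 0} = alive j (\<lambda>u. X u w)"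
    using good_pw_nonneg[OF assms] by (auto simp: alive_def wt_eq_pw less_le)
  then show ?thesis by (simp add: Lempty_def Zcount_def Kcount_def empty_count_def box_eq_ebox)
qed

lemma mgf_inner:
  "(\<integral>\<^sup>+ u. ennreal (exp (- t * brw X u w)) \<partial>count_space {u. length u = 1 \<and> wt X u w > 0})
    = (\<integral>\<^sup>+k. (if 0 < X [] w k then ennreal (X [] w k powr t) else 0) \<partial>count_space UNIV)"
proof -
  have "(\<integral>\<^sup>+ u. ennreal (exp (- t * brw X u w)) \<partial>count_space {u. length u = 1 \<and> wt X u w > 0})
    = (\<integral>\<^sup>+ u. ennreal (exp (- t * brw X u w)) * indicator {u. length u = 1 \<and> wt X u w > 0} u \<partial>count_space UNIV)"
    by (rule nn_integral_count_space_indicator) simp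
  also have "\<dots> = (\<integral>\<^sup>+ u. (if 0 < pw (\<lambda>u. X u w) u then ennreal (pw (\<lambda>u. X u w) u powr t) else 0) * indicator (lev (Suc 0)) u \<partial>count_space UNIV)"
    by (intro nn_integral_cong) (auto simp: indicator_def lev_def wt_eq_pw brw_def powr_def)
  also have "\<dots> = tsum_nn (Suc 0) (\<lambda>p. ennreal (p powr t)) (\<lambda>u. X u w)"
    unfolding tsum_nn_def by (rule nn_integral_count_space_indicator[symmetric]) simp
  finally show ?thesis unfolding tsum_nn_1st .
qed

text \<open>The extended nonnegative series is measurable in y, which lets the event be transferred
  to the law of the weights through \<open>AE_distr_iff\<close>.\<close>

lemma sums_1_iff_ennreal:
  fixes y :: "nat \<Rightarrow> real"
  assumes "\<And>k. 0 \<le> y k"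
  shows "y sums 1 \<longleftrightarrow> (\<Sum>k. ennreal (y k)) = 1"
proof
  assume "y sums 1"
  then have "(\<Sum>k. ennreal (y k)) = ennreal 1" using assms by (intro suminf_ennreal_eq) auto
  then show "(\<Sum>k. ennreal (y k)) = 1" by simp
next
  assume e: "(\<Sum>k. ennreal (y k)) = 1"
  then have s: "summable y" using assms by (intro summable_suminf_not_top) auto
  then have "(\<Sum>k. ennreal (y k)) = ennreal (suminf y)" using assms by (intro suminf_ennreal2) auto
  then have "suminf y = 1" using e by simp
  then show "y sums 1" using s by (simp add: sums_iff)
qed

lemma (in prob_space) distr_indep_pair:
  assumes "random_variable S A" "random_variable T B"
    and "indep_set (sets (vimage_algebra (space M) A S)) (sets (vimage_algebra (space M) B T))"
  shows "distr M (S \<Otimes>\<^sub>M T) (\<lambda>w. (A w, B w)) = distr M S A \<Otimes>\<^sub>M distr M T B"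
proof (rule pair_measure_eqI[symmetric])
  show "sigma_finite_measure (distr M S A)" "sigma_finite_measure (distr M T B)"
    using assms by (auto intro!: prob_space_imp_sigma_finite prob_space_distr)
  show "sets (distr M S A \<Otimes>\<^sub>M distr M T B) = sets (distr M (S \<Otimes>\<^sub>M T) (\<lambda>w. (A w, B w)))"
    by (simp cong: sets_pair_measure_cong)
  fix C D assume "C \<in> sets (distr M S A)" "D \<in> sets (distr M T B)"
  then have CD [measurable]: "C \<in> sets S" "D \<in> sets T" by auto
  have m: "A -` C \<inter> space M \<in> sets (vimage_algebra (space M) A S)" "B -` D \<inter> space M \<in> sets (vimage_algebra (space M) B T)"
    using CD by (auto intro: in_vimage_algebra)
  have "prob ((A -` C \<inter> space M) \<inter> (B -` D \<inter> space M)) = prob (A -` C \<inter> space M) * prob (B -` D \<inter> space M)"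
    by (rule indep_setD[OF assms(3) m])
  moreover have "(\<lambda>w. (A w, B w)) -` (C \<times> D) \<inter> space M = (A -` C \<inter> space M) \<inter> (B -` D \<inter> space M)" by auto
  ultimately show "emeasure (distr M S A) C * emeasure (distr M T B) D = emeasure (distr M (S \<Otimes>\<^sub>M T) (\<lambda>w. (A w, B w))) (C \<times> D)"
    using assms(1,2) CD by (simp add: emeasure_distr emeasure_eq_measure ennreal_mult'[symmetric])
qed

lemma (in prob_space) distr_iid_sequence:
  assumes "indep_vars (\<lambda>_. N) X UNIV" and "\<And>i. distr M N (X i) = D"
  shows "distr M (Pi\<^sub>M UNIV (\<lambda>_. N)) (\<lambda>w i. X i w) = Pi\<^sub>M UNIV (\<lambda>_. D)"
proof -
  have "\<And>i. random_variable N (X i)" using assms(1) by (simp add: indep_vars_def2)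
  then have "distr M (Pi\<^sub>M UNIV (\<lambda>_. N)) (\<lambda>w. \<lambda>i\<in>UNIV. X i w) = Pi\<^sub>M UNIV (\<lambda>i. distr M N (X i))"
    using assms(1) by (subst (asm) indep_vars_iff_distr_eq_PiM) auto
  then show ?thesis by (simp add: assms(2) restrict_def)
qed

text \<open>The hypothesis implies j / ln n -> 1 / a, so exchanging sqrt (ln n) for sqrt j
  multiplies the limit by sqrt a. The square a b^2 of the new limit is what appears in the Gaussian
  exponent.\<close>

lemma level_time_limits:
  fixes a b :: real and j :: "nat \<Rightarrow> nat"
  assumes a: "0 < a" and lim: "(\<lambda>n. (ln (real n) - a * real (j n)) / sqrt (ln (real n))) \<longlonglongrightarrow> b"
  shows "filterlim j at_top sequentially"
    and "(\<lambda>n. (ln (real n) - a * real (j n)) / sqrt (real (j n))) \<longlonglongrightarrow> b * sqrt a"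
proof -
  define c where "c n = ln (real n)" for n :: nat
  have cl: "filterlim c at_top sequentially" unfolding c_def by real_asymp
  have cp: "\<forall>\<^sub>F n in sequentially. 0 < c n" using cl[unfolded filterlim_at_top_dense, rule_format, of 0] .
  have sc: "(\<lambda>n. 1 / sqrt (c n)) \<longlonglongrightarrow> 0"
    by (rule filterlim_compose[OF _ cl, of "\<lambda>t. 1 / sqrt t"]) real_asymp
  have lim': "(\<lambda>n. (c n - a * real (j n)) / sqrt (c n)) \<longlonglongrightarrow> b" using lim by (simp add: c_def)
  have "(\<lambda>n. (1 - (c n - a * real (j n)) / sqrt (c n) * (1 / sqrt (c n))) / a) \<longlonglongrightarrow> (1 - b * 0) / a"
    using a by (intro tendsto_intros lim' sc) auto
  moreover have "\<forall>\<^sub>F n in sequentially. (1 - (c n - a * real (j n)) / sqrt (c n) * (1 / sqrt (c n))) / a = real (j n) / c n"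
    using cp
  proof eventually_elim
    case (elim n)
    then show ?case using a by (simp add: field_simps)
  qed
  ultimately have ratio: "(\<lambda>n. real (j n) / c n) \<longlonglongrightarrow> 1 / a"
    using Lim_transform_eventually by fastforce
  have "filterlim (\<lambda>n. real (j n) / c n * c n) at_top sequentially"
    using a by (intro filterlim_tendsto_pos_mult_at_top[OF ratio _ cl]) simp
  then have "filterlim (\<lambda>n. real (j n)) at_top sequentially"
    by (rule filterlim_cong[THEN iffD1, rotated 3]) (use cp in \<open>auto elim!: eventually_mono\<close>)
  then show jl: "filterlim j at_top sequentially"
    by (simp add: filterlim_sequentially_iff_filterlim_real)
  have "(\<lambda>n. (c n - a * real (j n)) / sqrt (c n) * sqrt (1 / (real (j n) / c n))) \<longlonglongrightarrow> b * sqrt (1 / (1 / a))"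
    using a by (intro tendsto_intros lim' ratio) auto
  moreover have "\<forall>\<^sub>F n in sequentially. (c n - a * real (j n)) / sqrt (c n) * sqrt (1 / (real (j n) / c n)) = (c n - a * real (j n)) / sqrt (real (j n))"
    using cp by eventually_elim (simp add: real_sqrt_divide)
  ultimately have "(\<lambda>n. (c n - a * real (j n)) / sqrt (real (j n))) \<longlonglongrightarrow> b * sqrt (1 / (1 / a))"
    by (rule Lim_transform_eventually)
  then show "(\<lambda>n. (ln (real n) - a * real (j n)) / sqrt (real (j n))) \<longlonglongrightarrow> b * sqrt a" by (simp add: c_def)
qed

text \<open>Count and limit depend on the sample point only through the weights and the balls, whose
  joint law is the product of \<open>T.E\<close> and \<open>balls\<close>. What remains is to
  extract from the hypotheses an exponent r for \<open>nonlattice_tilted_tree\<close> and to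
  translate the constants.\<close>

theorem theorem3:
  fixes M :: "'a measure"
    and X :: "nat list \<Rightarrow> 'a \<Rightarrow> nat \<Rightarrow> real"
    and U :: "nat \<Rightarrow> 'a \<Rightarrow> real"
    and a b \<theta> :: real
    and j :: "nat \<Rightarrow> nat"
  assumes "prob_space M"
    and "prob_space.indep_vars M (\<lambda>_. Pi\<^sub>M UNIV (\<lambda>_. borel)) X UNIV"
    and "\<forall>u. distr M (Pi\<^sub>M UNIV (\<lambda>_. borel)) (X u) = distr M (Pi\<^sub>M UNIV (\<lambda>_. borel)) (X [])"
    and "AE w in M. (\<forall>k. 0 \<le> X [] w k) \<and> (\<lambda>k. X [] w k) sums 1"
    and "(\<integral>\<^sup>+ w. emeasure (count_space UNIV) {k. 0 < X [] w k} \<partial>M) > 1"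
    and "prob_space.indep_vars M (\<lambda>_. borel) U UNIV"
    and "\<forall>i. distr M lborel (U i) = uniform_measure lborel {0..1}"
    and "prob_space.indep_set M
           (sets (vimage_algebra (space M) (\<lambda>w u. X u w) (Pi\<^sub>M UNIV (\<lambda>_. Pi\<^sub>M UNIV (\<lambda>_. borel)))))
           (sets (vimage_algebra (space M) (\<lambda>w i. U i w) (Pi\<^sub>M UNIV (\<lambda>_. borel))))"
    and "\<forall>c>0. \<forall>d. measure M {w \<in> space M. \<forall>u. length u = 1 \<and> wt X u w > 0 \<longrightarrow>
                                 (\<exists>z::int. brw X u w = c * of_int z + d)} < 1"
    and "\<exists>t. theta_low M X < ereal t \<and> t * deriv (lam M X) t - lam M X t = 0"
    and "theta_low M X < 0"
    and "- deriv (lam M X) 0 < a" and "ereal a < abar M X"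
    and "theta_star M X < ereal \<theta>" and "\<theta> < 0" and "a = - deriv (lam M X) \<theta>"
    and "\<forall>n. 0 < j n"
    and "(\<lambda>n. (ln (real n) - a * real (j n)) / sqrt (ln (real n))) \<longlonglongrightarrow> b"
  shows "AE w in M. (\<lambda>n. Lempty X U n (j n) w) \<sim>[sequentially]
           (\<lambda>n. Gamma (- \<theta>) / sqrt (2 * pi * deriv (deriv (lam M X)) \<theta>)
                * exp (- a * b\<^sup>2 / (2 * deriv (deriv (lam M X)) \<theta>))
                * Wlim M X \<theta> w
                * (real n powr \<theta> * exp (lam M X \<theta> * real (j n)) / sqrt (real (j n))))"
proof -
  let ?PB = "Pi\<^sub>M UNIV (\<lambda>_::nat. borel) :: (nat \<Rightarrow> real) measure"
  let ?env = "\<lambda>w u. X u w"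
  interpret M: prob_space M by fact
  define \<rho> where "\<rho> = distr M ?PB (X [])"
  have XM [measurable]: "X u \<in> measurable M ?PB" for u
    using assms(2) by (simp add: M.indep_vars_def2)
  have UM [measurable]: "U i \<in> borel_measurable M" for i
    using assms(6) by (simp add: M.indep_vars_def2)
  have prob\<rho>: "prob_space \<rho>" unfolding \<rho>_def by (rule M.prob_space_distr) measurable
  have sets\<rho>: "sets \<rho> = sets ?PB" by (simp add: \<rho>_def)
  have tree: "tree \<rho>" using prob\<rho> sets\<rho> by (simp add: tree_def tree_axioms_def)
  interpret T: tree \<rho> by (rule tree)
  have AE\<rho>: "AE y in \<rho>. (\<forall>k. 0 \<le> y k) \<and> y sums 1"
  proof -
    have "AE y in \<rho>. (\<forall>k. 0 \<le> y k) \<and> (\<Sum>k. ennreal (y k)) = 1"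
      unfolding \<rho>_def
    proof (subst AE_distr_iff)
      show "{y \<in> space ?PB. (\<forall>k. 0 \<le> y k) \<and> (\<Sum>k. ennreal (y k)) = 1} \<in> sets ?PB" by measurable
      show "AE w in M. (\<forall>k. 0 \<le> X [] w k) \<and> (\<Sum>k. ennreal (X [] w k)) = 1"
        using assms(4) by eventually_elim (use sums_1_iff_ennreal in blast)
    qed measurable
    then show ?thesis by eventually_elim (simp add: sums_1_iff_ennreal)
  qed
  interpret TP: tree_pos \<rho> by unfold_locales (rule AE\<rho>)
  have Q_eq: "T.Q f = (\<integral>\<^sup>+w. \<integral>\<^sup>+k. (if 0 < X [] w k then f (X [] w k) else 0) \<partial>count_space UNIV \<partial>M)"
    if [measurable]: "f \<in> borel_measurable borel" for f
  proof -
    have m: "(\<lambda>y. \<integral>\<^sup>+k. (if 0 < y k then f (y k) else 0) \<partial>count_space UNIV) \<in> borel_measurable ?PB"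
      by (rule borel_measurable_nn_integral_count_space) auto
    show ?thesis unfolding T.Q_def unfolding \<rho>_def by (rule nn_integral_distr[OF XM]) (use m in simp)
  qed
  have mgf: "mgf M X t = TP.Mom t" for t
    unfolding mgf_def mgf_inner TP.Mom_def by (subst Q_eq) auto
  have lam: "lam M X = TP.lamT" by (simp add: fun_eq_iff lam_def TP.lamT_def mgf)
  have Q1_gt: "1 < T.Q (\<lambda>_. 1)"
  proof -
    have "(\<integral>\<^sup>+k. (if 0 < X [] w k then 1 else 0) \<partial>count_space UNIV) = emeasure (count_space UNIV) {k. 0 < X [] w k}" for w
    proof -
      have "(\<lambda>k. if 0 < X [] w k then 1 else 0 :: ennreal) = indicator {k. 0 < X [] w k}"
        by (simp add: fun_eq_iff indicator_def)
      then show ?thesis by simp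
    qed
    then have "T.Q (\<lambda>_. 1) = (\<integral>\<^sup>+w. emeasure (count_space UNIV) {k. 0 < X [] w k} \<partial>M)"
      by (subst Q_eq) simp_all
    then show ?thesis using assms(5) by simp
  qed
  have Mom0: "TP.Mom 0 = T.Q (\<lambda>_. 1)" unfolding TP.Mom_def by (intro TP.Q_cong) simp
  \<comment> \<open>If the Laplace transform of \<kappa> vanished at one point, \<kappa> would be
    null and \<open>Mom 0\<close> would be 0 instead of exceeding 1.\<close>
  have pos: "0 < TP.Mom t" for t
  proof (rule ccontr)
    assume "\<not> 0 < TP.Mom t"
    then have "(\<integral>\<^sup>+v. ennreal (exp (- (t * v))) \<partial>TP.\<kappa>) = 0" by (simp add: TP.Mom_\<kappa>)
    then have "AE v in TP.\<kappa>. ennreal (exp (- (t * v))) = 0"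
      by (subst (asm) nn_integral_0_iff_AE) (auto intro!: TP.borel_measurable_\<kappa>)
    then have "AE v in TP.\<kappa>. ennreal (exp (- (0 * v))) = 0" by eventually_elim auto
    then have "TP.Mom 0 = 0"
      unfolding TP.Mom_\<kappa> by (subst nn_integral_0_iff_AE) (auto intro!: TP.borel_measurable_\<kappa>)
    then show False using Q1_gt Mom0 by simp
  qed
  have low: "\<exists>\<tau><t. TP.Mom \<tau> < \<infinity>" if "theta_low M X < ereal t" for t
    using that unfolding theta_low_def mgf by (auto simp: Inf_less_iff)
  obtain \<tau>0 where \<tau>0: "\<tau>0 < 0" "TP.Mom \<tau>0 < \<infinity>" using low[of 0] assms(11) by (auto simp: zero_ereal_def)
  have Q1: "T.Q (\<lambda>_. 1) < \<infinity>"
    using TP.Mom_antimono[of \<tau>0 0] \<tau>0 le_less_trans unfolding Mom0 by auto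
  have "theta_star M X = Inf {ereal t | t. theta_low M X < ereal t \<and> t < 0 \<and> t * deriv TP.lamT t - TP.lamT t < 0}"
    unfolding theta_star_def mgf lam using Q1 Mom0 by auto
  \<comment> \<open>As an infimum, \<open>theta_star\<close> lies below \<theta> only if the
    defining inequality holds at some t < \<theta>; convexity, in the form of
    \<open>intercept_mono\<close>, carries it to \<theta>. A finite moment at some \<tau> < t leaves
    room for derivatives at \<theta> and for the exponent of \<open>Mom_finite\<close>.\<close>
  then obtain t where t: "theta_low M X < ereal t" "t < 0" "t * deriv TP.lamT t - TP.lamT t < 0" "t < \<theta>"
    using assms(14) by (auto simp: Inf_less_iff)
  obtain \<tau> where \<tau>: "\<tau> < t" "TP.Mom \<tau> < \<infinity>" using low[OF t(1)] by blast
  have \<tau>\<theta>: "\<tau> < \<theta>" using \<tau> t by simp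
  have neg: "\<theta> * deriv TP.lamT \<theta> - TP.lamT \<theta> < 0"
    using TP.intercept_mono[OF \<tau>(2) pos \<tau>(1), of \<theta>] t assms(15) by simp
  obtain r where r: "1 < r" "r \<le> 2" "\<tau> < 1 - (1 - \<theta>) * r" "enn2real (TP.Mom (r * \<theta>)) < enn2real (TP.Mom \<theta>) powr r"
    using TP.exists_exponent[OF \<tau>(2) pos \<tau>\<theta> assms(15) neg] by blast
  have Momr: "TP.Mom (1 - (1 - \<theta>) * r) < \<infinity>"
    using TP.Mom_antimono[of \<tau> "1 - (1 - \<theta>) * r"] r \<tau> le_less_trans by auto
  have nonlat: "\<not> (AE y in \<rho>. \<forall>k. 0 < y k \<longrightarrow> (\<exists>z::int. - ln (y k) = c * of_int z + d))" if c: "0 < c" for c d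
  proof
    let ?B = "{y \<in> space ?PB. \<forall>k. 0 < y k \<longrightarrow> (\<exists>z::int. - ln (y k) = c * of_int z + d)}"
    let ?A = "{w \<in> space M. \<forall>u. length u = 1 \<and> wt X u w > 0 \<longrightarrow> (\<exists>z::int. brw X u w = c * of_int z + d)}"
    have B: "?B \<in> sets ?PB" by measurable
    have A: "?A = X [] -` ?B \<inter> space M"
    proof -
      have "(\<forall>u. length u = 1 \<and> wt X u w > 0 \<longrightarrow> (\<exists>z::int. brw X u w = c * of_int z + d))
        \<longleftrightarrow> (\<forall>k. 0 < X [] w k \<longrightarrow> (\<exists>z::int. - ln (X [] w k) = c * of_int z + d))" for w
        by (auto simp: length_Suc_conv brw_def wt_eq_pw)
      then show ?thesis by (auto simp: space_PiM)
    qed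
    have Aev: "?A \<in> sets M" unfolding A by (rule measurable_sets[OF XM B])
    assume "AE y in \<rho>. \<forall>k. 0 < y k \<longrightarrow> (\<exists>z::int. - ln (y k) = c * of_int z + d)"
    then have "AE w in M. \<forall>k. 0 < X [] w k \<longrightarrow> (\<exists>z::int. - ln (X [] w k) = c * of_int z + d)"
      unfolding \<rho>_def by (rule AE_distrD[OF XM])
    then have "AE w in M. w \<in> ?A"
      using AE_space unfolding A by eventually_elim (auto simp: space_PiM)
    then have "M.prob ?A = 1" using M.prob_eq_1[OF Aev] by simp
    then show False using assms(9)[rule_format, OF c, of d] by simp
  qed
  interpret N: nonlattice_tilted_tree \<rho> \<theta> r
    by unfold_locales (use Q1 assms(15) r Q1_gt Momr nonlat in auto)
  have lnm: "lam M X \<theta> = ln N.m\<theta>" by (simp add: lam TP.lamT_def N.m\<theta>_def)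
  have a_eq: "a = N.a\<nu>"
    using N.moments_eq(1)[OF \<tau>(2) \<tau>\<theta>] TP.deriv_lamT[OF \<tau>(2) pos \<tau>\<theta>] assms(16) by (simp add: lam)
  have sg_eq: "deriv (deriv (lam M X)) \<theta> = N.\<sigma>\<nu>\<^sup>2"
    unfolding lam using DERIV_imp_deriv[OF TP.deriv_lamT_deriv[OF \<tau>(2) pos \<tau>\<theta>]] N.moments_eq(2)[OF \<tau>(2) \<tau>\<theta>] by simp
  \<comment> \<open>\<open>N.gap\<close> is the negative of the left-hand side of
    \<open>neg\<close>, because the drift \<open>N.a\<nu>\<close> equals
    \<open>a = - deriv (lam M X) \<theta>\<close>.\<close>
  have gap: "0 < N.gap"
    using neg lnm assms(16) unfolding N.gap_def a_eq[symmetric] lam by simp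
  have a0: "0 < a" unfolding a_eq by (rule N.a\<nu>_pos)
  let ?ENV = "Pi\<^sub>M UNIV (\<lambda>_::nat list. ?PB)"
  let ?UU = "Pi\<^sub>M UNIV (\<lambda>_::nat. borel) :: (nat \<Rightarrow> real) measure"
  have envM: "?env \<in> measurable M ?ENV" by (rule measurable_abs_UNIV) simp
  have UUM: "(\<lambda>w i. U i w) \<in> measurable M ?UU" by (rule measurable_abs_UNIV) simp
  have dX: "distr M ?ENV ?env = T.E"
    unfolding T.E_def by (rule M.distr_iid_sequence[OF assms(2)]) (use assms(3) in \<open>simp add: \<rho>_def\<close>)
  have dU: "distr M ?UU (\<lambda>w i. U i w) = balls"
    unfolding balls_def
  proof (rule M.distr_iid_sequence[OF assms(6)])
    fix i
    have "distr M borel (U i) = distr M lborel (U i)" by (rule distr_cong) auto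
    then show "distr M borel (U i) = unif" using assms(7) by simp
  qed
  have joint: "distr M (?ENV \<Otimes>\<^sub>M ?UU) (\<lambda>w. (?env w, \<lambda>i. U i w)) = T.E \<Otimes>\<^sub>M balls"
    unfolding M.distr_indep_pair[OF envM UUM assms(8)] dX dU ..
  have jM: "(\<lambda>w. (?env w, \<lambda>i. U i w)) \<in> measurable M (?ENV \<Otimes>\<^sub>M ?UU)" using envM UUM by measurable
  note jl = level_time_limits[OF a0 assms(18)]
  have E1: "AE w in M. good (?env w) \<and> (\<lambda>k. N.W k (?env w)) \<longlonglongrightarrow> N.Winf (?env w) \<and> 0 < N.Winf (?env w)"
  proof (rule AE_distrD[OF envM])
    show "AE x in distr M ?ENV ?env. good x \<and> (\<lambda>k. N.W k x) \<longlonglongrightarrow> N.Winf x \<and> 0 < N.Winf x"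
      unfolding dX using N.AE_good N.AE_W_tendsto N.AE_Winf_pos by eventually_elim simp
  qed
  have E2: "AE w in M. (\<lambda>n. sqrt (real (j n)) * (real n powr (- \<theta>) / N.m\<theta> ^ j n * empty_count n (j n) (?env w) (\<lambda>i. U i w)))
        \<longlonglongrightarrow> N.Winf (?env w) * (N.density0 * exp (- (b * sqrt a)\<^sup>2 / (2 * N.\<sigma>\<nu>\<^sup>2)))"
  proof -
    have "AE z in distr M (?ENV \<Otimes>\<^sub>M ?UU) (\<lambda>w. (?env w, \<lambda>i. U i w)).
       (\<lambda>n. sqrt (real (j n)) * (real n powr (- \<theta>) / N.m\<theta> ^ j n * empty_count n (j n) (fst z) (snd z)))
        \<longlonglongrightarrow> N.Winf (fst z) * (N.density0 * exp (- (b * sqrt a)\<^sup>2 / (2 * N.\<sigma>\<nu>\<^sup>2)))"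
      unfolding joint using N.empty_limit[OF gap]
    proof eventually_elim
      case (elim z)
      show ?case using elim jl unfolding a_eq[symmetric] by blast
    qed
    from AE_distrD[OF jM this] show ?thesis by simp
  qed
  show ?thesis
    using E1 E2
  proof eventually_elim
    case (elim w)
    let ?x = "?env w"
    have g: "good ?x" and W0: "0 < N.Winf ?x" and Wl: "(\<lambda>k. N.W k ?x) \<longlonglongrightarrow> N.Winf ?x" using elim by auto
    have m0: "0 < N.m\<theta>" using N.Mom_\<theta>(2) by simp
    have Wj: "Wj M X \<theta> k w = N.W k ?x" for k
    proof -
      have s: "{u. length u = k \<and> wt X u w > 0} = alive k ?x" by (auto simp: alive_def wt_eq_pw)
      have "Wj M X \<theta> k w = (\<Sum>u\<in>alive k ?x. exp (- \<theta> * brw X u w - lam M X \<theta> * real k))"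
        unfolding Wj_def s using good_finite[OF g] by simp
      also have "\<dots> = N.W k ?x"
        unfolding N.W_0
      proof (rule sum.cong[OF refl])
        fix u assume "u \<in> alive k ?x"
        then have p: "0 < pw ?x u" by (simp add: alive_def)
        have "exp (lam M X \<theta> * real k) = N.m\<theta> ^ k" using m0 by (simp add: lnm exp_of_nat2_mult)
        moreover have "exp (- \<theta> * brw X u w) = pw ?x u powr \<theta>" using p by (simp add: brw_def wt_eq_pw powr_def)
        ultimately show "exp (- \<theta> * brw X u w - lam M X \<theta> * real k) = pw ?x u powr \<theta> / N.m\<theta> ^ k"
          by (simp add: exp_diff)
      qed
      finally show ?thesis .
    qed
    have Wlim: "Wlim M X \<theta> w = N.Winf ?x" unfolding Wlim_def Wj using Wl by (rule limI)
    define l where "l = N.Winf ?x * (N.density0 * exp (- (b * sqrt a)\<^sup>2 / (2 * N.\<sigma>\<nu>\<^sup>2)))"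
    \<comment> \<open>Positivity of the martingale limit matters here: asymptotic equivalence will
      be shown by dividing by l.\<close>
    have l0: "0 < l" using W0 N.density0_pos by (simp add: l_def)
    \<comment> \<open>Here \<beta>' = b sqrt a, so the exponent of the local limit theorem takes the
      form with a b^2, and \<sigma> sqrt (2 pi) becomes the root in the statement.\<close>
    have const: "Gamma (- \<theta>) / sqrt (2 * pi * deriv (deriv (lam M X)) \<theta>) * exp (- a * b\<^sup>2 / (2 * deriv (deriv (lam M X)) \<theta>)) * Wlim M X \<theta> w = l"
    proof -
      have "sqrt (2 * pi * N.\<sigma>\<nu>\<^sup>2) = N.\<sigma>\<nu> * sqrt (2 * pi)" using N.\<sigma>\<nu>_pos by (simp add: real_sqrt_mult)
      moreover have "(b * sqrt a)\<^sup>2 = a * b\<^sup>2" using a0 by (simp add: power_mult_distrib mult.commute)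
      ultimately show ?thesis unfolding l_def Wlim sg_eq N.density0_def by (simp add: mult_ac)
    qed
    have expm: "exp (lam M X \<theta> * real k) = N.m\<theta> ^ k" for k using m0 by (simp add: lnm exp_of_nat2_mult)
    show ?case
      unfolding const expm Lempty_eq[where X = X and w = w, OF g]
    proof (rule asymp_equivI')
      have "(\<lambda>n. sqrt (real (j n)) * (real n powr (- \<theta>) / N.m\<theta> ^ j n * empty_count n (j n) ?x (\<lambda>i. U i w)) / l) \<longlonglongrightarrow> l / l"
        using elim l0 unfolding l_def by (intro tendsto_divide tendsto_const) auto
      moreover have "\<forall>\<^sub>F n in sequentially. sqrt (real (j n)) * (real n powr (- \<theta>) / N.m\<theta> ^ j n * empty_count n (j n) ?x (\<lambda>i. U i w)) / l
        = empty_count n (j n) ?x (\<lambda>i. U i w) / (l * (real n powr \<theta> * N.m\<theta> ^ j n / sqrt (real (j n))))"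
        using eventually_gt_at_top[of 0]
      proof eventually_elim
        case (elim n)
        then show ?case using m0 l0 assms(17) by (simp add: powr_minus divide_simps)
      qed
      ultimately have "(\<lambda>n. empty_count n (j n) ?x (\<lambda>i. U i w) / (l * (real n powr \<theta> * N.m\<theta> ^ j n / sqrt (real (j n))))) \<longlonglongrightarrow> l / l"
        by (rule Lim_transform_eventually)
      then show "(\<lambda>n. empty_count n (j n) ?x (\<lambda>i. U i w) / (l * (real n powr \<theta> * N.m\<theta> ^ j n / sqrt (real (j n))))) \<longlonglongrightarrow> 1"
        using l0 by simp
    qed
  qed
qed

end
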